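(* Let $d\ge 1$ and $1<p<\infty$. (a) For every $s\in\mathbb{R}$ there is a constant $C\ge 1$, independent of $h\in(0,1]$, such that for all $h\in(0,1]$ and all $f:\mathbb{Z}_h^d\to\mathbb{C}$ for which $|\nabla_h|^sf$ and $(-\Delta_h)^{s/2}f$ are defined, $$C^{-1}\|(-\Delta_h)^{\frac s2}f\|_{L_h^p}\le \|f\|_{\dot W_h^{s,p}}\le C\|(-\Delta_h)^{\frac s2}f\|_{L_h^p}.$$ (b) There is a constant $C\ge 1$, independent of $h\in(0,1]$, such that for all $h\in(0,1]$ and all $f\in L_h^p$, $$C^{-1}\sum_{j=1}^d\|D_{j;h}^+f\|_{L_h^p}\le \|f\|_{\dot W_h^{1,p}}\le C\sum_{j=1}^d\|D_{j;h}^+f\|_{L_h^p}.$$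
   Context: For $h>0$, $\mathbb{Z}_h^d=h\mathbb{Z}^d$. For $f:\mathbb{Z}_h^d\to\mathbb{C}$, $\|f\|_{L_h^p}=\big(h^d\sum_{x\in\mathbb{Z}_h^d}|f(x)|^p\big)^{1/p}$ for $1\le p<\infty$ and $\|f\|_{L_h^\infty}=\sup_{x\in\mathbb{Z}_h^d}|f(x)|$; $L_h^p$ is the space of functions with finite norm. The lattice Fourier transform is $\hat f(\xi)=h^d\sum_{x\in\mathbb{Z}_h^d}f(x)e^{-ix\cdot\xi}$, $\xi\in\mathbb{T}_h^d=[-\frac{\pi}{h},\frac{\pi}{h}]^d$, with inverse $\check g(x)=\frac{1}{(2\pi)^d}\int_{\mathbb{T}_h^d}g(\xi)e^{ix\cdot\xi}d\xi$, $x\in\mathbb{Z}_h^d$ (both extended by duality). The Fourier multiplier of symbol $m$ on $\mathbb{T}_h^d$ maps $f$ to $(m\hat f)^\vee$, equivalently to the lattice convolution $h^d\sum_y\check m(x-y)f(y)$. $|\nabla_h|^s$ is the Fourier multiplier of symbol $|\xi|^s$ on $\mathbb{T}_h^d$, and $\|f\|_{\dot W_h^{s,p}}=\||\nabla_h|^sf\|_{L_h^p}$. The discrete Laplacian is $\Delta_hf(x)=\sum_{j=1}^d\frac{f(x+he_j)+f(x-he_j)-2f(x)}{h^2}$ with $e_j$ the standard basis of $\mathbb{R}^d$, and $(-\Delta_h)^{s/2}$ is the Fourier multiplier of symbol $\big(\frac{4}{h^2}\sum_{j=1}^d\sin^2\frac{h\xi_j}{2}\big)^{s/2}$. Also $D_{j;h}^+f(x)=\frac{f(x+he_j)-f(x)}{h}$.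 Convention on the class of $f$: for $s\ge 0$ the operators are considered on $f\in L_h^p$; for $s<0$ they are considered on $f\in L_h^p\cap L_h^2$ such that $|\xi|^s\hat f\in L^1(\mathbb{T}_h^d)$, the $L_h^p$ norms being allowed to equal $+\infty$. *)

theory Defs
  imports "HOL-Analysis.Analysis"
begin

text \<open>
  The dimension is \<open>d = CARD('n)\<close>. A function on \<open>h \<int>\<^sup>d\<close> is represented by a function on
  \<open>real ^ 'n\<close>, of which only the values on \<open>grid h\<close> are ever used.
\<close>

definition grid :: "real \<Rightarrow> (real ^ 'n) set" where
  "grid h = {x. \<forall>i. \<exists>k::int. x $ i = h * of_int k}"

definition torus :: "real \<Rightarrow> (real ^ 'n) set" where
  "torus h = cbox (\<chi> i. - (pi / h)) (\<chi> i. pi / h)"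

text \<open>The norm takes the value \<open>\<infinity>\<close> exactly when the series diverges.\<close>

definition Lp_norm :: "real \<Rightarrow> real \<Rightarrow> (real ^ 'n \<Rightarrow> complex) \<Rightarrow> ennreal" where
  "Lp_norm h p f =
     (if (\<lambda>x. norm (f x) powr p) summable_on grid h
      then ennreal ((h ^ CARD('n) * (\<Sum>\<^sub>\<infinity>x\<in>grid h. norm (f x) powr p)) powr (1 / p))
      else \<infinity>)"

definition Lp_space :: "real \<Rightarrow> real \<Rightarrow> (real ^ 'n \<Rightarrow> complex) set" where
  "Lp_space h p = {f. Lp_norm h p f < \<infinity>}"

definition is_L2_fourier :: "real \<Rightarrow> (real ^ 'n \<Rightarrow> complex) \<Rightarrow> (real ^ 'n \<Rightarrow> complex) \<Rightarrow> bool" where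
  "is_L2_fourier h f g \<longleftrightarrow>
     set_borel_measurable lborel (torus h) g \<and>
     set_integrable lborel (torus h) (\<lambda>\<xi>. (norm (g \<xi>))\<^sup>2) \<and>
     ((\<lambda>F. LINT \<xi>:torus h|lborel.
         (norm (g \<xi> - of_real (h ^ CARD('n)) * (\<Sum>x\<in>F. f x * exp (- (\<i> * of_real (x \<bullet> \<xi>))))))\<^sup>2)
       \<longlongrightarrow> 0) (finite_subsets_at_top (grid h))"

text \<open>
  On \<open>L\<^sup>1\<close> the transform is given by the absolutely convergent series; on the rest of \<open>L\<^sup>2\<close> it is
  the limit of the partial sums in \<open>L\<^sup>2\<close> of the torus. That limit is determined only almost
  everywhere, and the transform is used only under integrals over the torus, so the choice
  of representative is irrelevant. Outside \<open>L\<^sup>1 \<union> L\<^sup>2\<close> the value is unspecified and is not used.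
\<close>

definition lattice_fourier :: "real \<Rightarrow> (real ^ 'n \<Rightarrow> complex) \<Rightarrow> real ^ 'n \<Rightarrow> complex" where
  "lattice_fourier h f =
     (if f \<in> Lp_space h 1
      then (\<lambda>\<xi>. of_real (h ^ CARD('n)) * (\<Sum>\<^sub>\<infinity>x\<in>grid h. f x * exp (- (\<i> * of_real (x \<bullet> \<xi>)))))
      else (SOME g. is_L2_fourier h f g))"

definition inv_lattice_fourier :: "real \<Rightarrow> (real ^ 'n \<Rightarrow> complex) \<Rightarrow> real ^ 'n \<Rightarrow> complex" where
  "inv_lattice_fourier h g x =
     of_real (1 / (2 * pi) ^ CARD('n)) *
     (LINT \<xi>:torus h|lborel. g \<xi> * exp (\<i> * of_real (x \<bullet> \<xi>)))"

text \<open>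
  The multiplier is the inverse transform of \<open>m\<close> times the transform of \<open>f\<close> whenever \<open>f \<in> L\<^sup>2\<close>
  and this product is integrable. The remaining case of interest is \<open>f \<in> L\<^sup>p\<close> with \<open>2 < p < \<infinity>\<close>,
  where the transform of \<open>f\<close> need not be a function; there the multiplier is the lattice
  convolution with the inverse transform of \<open>m\<close>. For the two symbols below with \<open>s \<ge> 0\<close>,
  integration by parts in each variable bounds that kernel by a multiple of the product of the
  \<open>1 / (1 + \<bar>x\<^sub>j\<bar>)\<close>, so it lies in every \<open>L\<^sup>q\<close> with \<open>q > 1\<close> and the convolution series
  converges absolutely.
\<close>

definition fourier_multiplier ::
    "real \<Rightarrow> (real ^ 'n \<Rightarrow> complex) \<Rightarrow> (real ^ 'n \<Rightarrow> complex) \<Rightarrow> real ^ 'n \<Rightarrow> complex" where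
  "fourier_multiplier h m f =
     (if f \<in> Lp_space h 2 \<and> set_integrable lborel (torus h) (\<lambda>\<xi>. m \<xi> * lattice_fourier h f \<xi>)
      then inv_lattice_fourier h (\<lambda>\<xi>. m \<xi> * lattice_fourier h f \<xi>)
      else (\<lambda>x. of_real (h ^ CARD('n)) *
                (\<Sum>\<^sub>\<infinity>y\<in>grid h. inv_lattice_fourier h m (x - y) * f y)))"

text \<open>
  In both symbols the base of the power vanishes on the torus only at the origin, a null set, so
  the convention \<open>0 powr s = 0\<close> plays no role.
\<close>

definition nabla_pow :: "real \<Rightarrow> real \<Rightarrow> (real ^ 'n \<Rightarrow> complex) \<Rightarrow> real ^ 'n \<Rightarrow> complex" where
  "nabla_pow h s = fourier_multiplier h (\<lambda>\<xi>. of_real (norm \<xi> powr s))"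

definition neg_laplacian_pow ::
    "real \<Rightarrow> real \<Rightarrow> (real ^ 'n \<Rightarrow> complex) \<Rightarrow> real ^ 'n \<Rightarrow> complex" where
  "neg_laplacian_pow h r =
     fourier_multiplier h
       (\<lambda>\<xi>. of_real ((4 / h\<^sup>2 * (\<Sum>j\<in>UNIV. (sin (h * \<xi> $ j / 2))\<^sup>2)) powr r))"

definition sobolev_norm :: "real \<Rightarrow> real \<Rightarrow> real \<Rightarrow> (real ^ 'n \<Rightarrow> complex) \<Rightarrow> ennreal" where
  "sobolev_norm h s p f = Lp_norm h p (nabla_pow h s f)"

definition fwd_diff :: "real \<Rightarrow> 'n \<Rightarrow> (real ^ 'n \<Rightarrow> complex) \<Rightarrow> real ^ 'n \<Rightarrow> complex" where
  "fwd_diff h j f x = (f (x + h *\<^sub>R axis j 1) - f x) / of_real h"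

text \<open>The functions to which the operators of order \<open>s\<close> are applied.\<close>

definition admissible :: "real \<Rightarrow> real \<Rightarrow> real \<Rightarrow> (real ^ 'n \<Rightarrow> complex) set" where
  "admissible h s p =
     (if s \<ge> 0 then Lp_space h p
      else {f \<in> Lp_space h p \<inter> Lp_space h 2.
              set_integrable lborel (torus h)
                (\<lambda>\<xi>. of_real (norm \<xi> powr s) * lattice_fourier h f \<xi>)})"

end

theory Submission imports Defs "HOL-Real_Asymp.Real_Asymp" begin

text \<open>
  After rescaling the lattice to \<open>\<int>\<^sup>d\<close> both powers of \<open>h\<close> factor out, which is why the constants do not
  depend on \<open>h\<close>: only operators on the unit lattice remain. Write \<open>\<sigma>(\<xi>) = 4 \<Sum>\<^sub>j sin\<^sup>2 (\<xi>\<^sub>j / 2)\<close> for the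
  symbol of the Laplacian on the cube \<open>[- \<pi>, \<pi>]\<^sup>d\<close>.

  For part (a) the quotient of the two symbols is \<open>(\<bar>\<xi>\<bar>\<^sup>2 / \<sigma>(\<xi>)) powr (s / 2)\<close>. It is bounded above and
  below, but its periodic extension has corners on the faces of the cube and it is singular at the
  origin, so that the usual multiplier theorems on the whole space do not apply directly. It has
  nevertheless an absolutely summable Fourier series. Indeed Frullani's integral expresses the logarithm
  of the quotient as \<open>\<integral> (exp (- u \<sigma>) - exp (- u \<bar>\<xi>\<bar>\<^sup>2)) / u du\<close>; both exponentials are products over the
  coordinates, and in one coordinate their difference has summable coefficients of total size
  \<open>min u (1 / u)\<close>, up to a constant (\<open>gauss_minus_heat\<close>). So the logarithm lies in the Wiener algebra of
  absolutely convergent Fourier series, and so does its exponential times any real number (\<open>W_ratio\<close>).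
  Convolution with a summable kernel is bounded on every \<open>L\<^sup>p\<close> (\<open>young_l1\<close>), and applying this to the
  quotient and to its inverse gives (a) for all real \<open>s\<close>.

  For part (b) it is then enough to compare the differences with \<open>\<sigma> powr (1 / 2)\<close>. The discrete Riesz
  transforms, with symbol \<open>(exp (\<i> \<xi>\<^sub>j) - 1) / sqrt (e + \<sigma>)\<close>, are bounded by 1 on \<open>L\<^sup>2\<close>, and estimates for
  the heat kernel, which in each coordinate is the law of a difference of two independent Poisson
  variables, show Hoermander's condition uniformly in \<open>e > 0\<close> (\<open>rz_hoermander\<close>). A Calderon-Zygmund
  decomposition, interpolation and duality make them bounded on \<open>L\<^sup>p\<close> (\<open>singular_multiplier_lp\<close>). The
  differences are Riesz transforms of the root, and the root is the sum of the adjoint Riesz transforms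
  of the differences (\<open>gradient_vs_root\<close>).

  What remains is the passage between the multiplier as it is defined on the grid and convolution on the
  unit lattice. In part (a) only the integrability of the product of symbol and transform is used. In
  part (b) the transform of a square summable function has to be constructed (\<open>riesz_fischer\<close>).
\<close>

section \<open>Absolutely convergent Fourier series on the lattice\<close>

abbreviation "cs \<equiv> count_space UNIV"

lemma cs_nn_swap:
 fixes f :: "'a::countable => 'b => ennreal"
 assumes "!!n. f n : borel_measurable M"
 shows "(\<integral>\<^sup>+n. \<integral>\<^sup>+u. f n u \<partial>M \<partial>cs) = (\<integral>\<^sup>+u. \<integral>\<^sup>+n. f n u \<partial>cs \<partial>M)"
 by (rule nn_integral_count_space_nn_integral[symmetric]) (use assms in auto)

lemma cs_integral_swap:
 fixes f :: "'a::countable => 'b => complex"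
 assumes sf: "sigma_finite_measure M" and [measurable]: "!!n. f n : borel_measurable M"
  and fin: "(\<integral>\<^sup>+n. \<integral>\<^sup>+u. ennreal (norm (f n u)) \<partial>M \<partial>cs) < \<infinity>"
 shows "(\<integral>n. \<integral>u. f n u \<partial>M \<partial>cs) = (\<integral>u. \<integral>n. f n u \<partial>cs \<partial>M)"
  and "integrable cs (%n. \<integral>u. f n u \<partial>M)"
  and "integrable M (%u. \<integral>n. f n u \<partial>cs)"
proof -
 interpret M: sigma_finite_measure M by fact
 interpret C: sigma_finite_measure "cs :: 'a measure" by (rule sigma_finite_measure_count_space)
 interpret P: pair_sigma_finite "cs :: 'a measure" M ..
 have [measurable]: "case_prod f : borel_measurable (cs \<Otimes>\<^sub>M M)"
  by (rule measurable_pair_measure_countable1) auto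
 have i: "integrable (cs \<Otimes>\<^sub>M M) (case_prod f)"
  unfolding integrable_iff_bounded using fin by (simp add: M.nn_integral_fst[symmetric])
 show "(\<integral>n. \<integral>u. f n u \<partial>M \<partial>cs) = (\<integral>u. \<integral>n. f n u \<partial>cs \<partial>M)"
  using P.Fubini_integral[OF i] by simp
 show "integrable cs (%n. \<integral>u. f n u \<partial>M)" using P.integrable_fst[OF i] by simp
 show "integrable M (%u. \<integral>n. f n u \<partial>cs)" using P.integrable_snd[OF i] by simp
qed

lemma nn_norm_integral_le:
 "ennreal (norm (\<integral>x. f x \<partial>M)) <= (\<integral>\<^sup>+x. ennreal (norm (f x)) \<partial>M)"
 for f :: "'a => complex"
 by (cases "integrable M f") (auto intro: integral_norm_bound_ennreal simp: not_integrable_integral_eq)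

lemma integrable_cs_iff:
 fixes f :: "'a => complex"
 shows "integrable cs f \<longleftrightarrow> (\<integral>\<^sup>+n. ennreal (norm (f n)) \<partial>cs) < \<infinity>"
 by (simp add: integrable_iff_bounded)

lemma nn_shift:
 fixes f :: "int^'n => ennreal"
 shows "(\<integral>\<^sup>+n. f (n + a) \<partial>cs) = (\<integral>\<^sup>+n. f n \<partial>cs)" "(\<integral>\<^sup>+n. f (n - a) \<partial>cs) = (\<integral>\<^sup>+n. f n \<partial>cs)"
  "(\<integral>\<^sup>+n. f (a - n) \<partial>cs) = (\<integral>\<^sup>+n. f n \<partial>cs)" "(\<integral>\<^sup>+n. f (- n) \<partial>cs) = (\<integral>\<^sup>+n. f n \<partial>cs)"
proof -
 show "(\<integral>\<^sup>+n. f (n + a) \<partial>cs) = (\<integral>\<^sup>+n. f n \<partial>cs)"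
  by (rule nn_integral_bij_count_space) (rule bij_betw_byWitness[where f'="%n. n - a"], auto)
 show "(\<integral>\<^sup>+n. f (n - a) \<partial>cs) = (\<integral>\<^sup>+n. f n \<partial>cs)"
  by (rule nn_integral_bij_count_space) (rule bij_betw_byWitness[where f'="%n. n + a"], auto)
 show "(\<integral>\<^sup>+n. f (a - n) \<partial>cs) = (\<integral>\<^sup>+n. f n \<partial>cs)"
  by (rule nn_integral_bij_count_space) (rule bij_betw_byWitness[where f'="%n. a - n"], auto)
 show "(\<integral>\<^sup>+n. f (- n) \<partial>cs) = (\<integral>\<^sup>+n. f n \<partial>cs)"
  by (rule nn_integral_bij_count_space) (rule bij_betw_byWitness[where f'="%n. - n"], auto)
qed

lemma integral_shift:
 fixes f :: "int^'n => complex"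
 shows "(\<integral>n. f (n + a) \<partial>cs) = (\<integral>n. f n \<partial>cs)" "(\<integral>n. f (n - a) \<partial>cs) = (\<integral>n. f n \<partial>cs)"
  "(\<integral>n. f (a - n) \<partial>cs) = (\<integral>n. f n \<partial>cs)" "(\<integral>n. f (- n) \<partial>cs) = (\<integral>n. f n \<partial>cs)"
proof -
 show "(\<integral>n. f (n + a) \<partial>cs) = (\<integral>n. f n \<partial>cs)"
  by (rule integral_bij_count_space) (rule bij_betw_byWitness[where f'="%n. n - a"], auto)
 show "(\<integral>n. f (n - a) \<partial>cs) = (\<integral>n. f n \<partial>cs)"
  by (rule integral_bij_count_space) (rule bij_betw_byWitness[where f'="%n. n + a"], auto)
 show "(\<integral>n. f (a - n) \<partial>cs) = (\<integral>n. f n \<partial>cs)"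
  by (rule integral_bij_count_space) (rule bij_betw_byWitness[where f'="%n. a - n"], auto)
 show "(\<integral>n. f (- n) \<partial>cs) = (\<integral>n. f n \<partial>cs)"
  by (rule integral_bij_count_space) (rule bij_betw_byWitness[where f'="%n. - n"], auto)
qed

lemma nn_cs_single:
 fixes c :: ennreal
 shows "(\<integral>\<^sup>+n. (if n = m then c else 0) \<partial>cs) = c"
proof -
 have "(\<integral>\<^sup>+n. (if n = m then c else 0) \<partial>cs) = (\<integral>\<^sup>+n. c * indicator {m} n \<partial>cs)"
  by (intro nn_integral_cong) (auto split: split_indicator)
 also have "... = c" by (simp add: nn_integral_cmult)
 finally show ?thesis .
qed

lemma integral_cs_single:
 fixes c :: complex
 shows "(\<integral>n. (if n = m then c else 0) \<partial>cs) = c" "integrable cs (%n. if n = m then c else 0)"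
proof -
 have *: "{a : UNIV. (if a = m then c else 0) ~= 0} = (if c = 0 then {} else {m})" by auto
 show "(\<integral>n. (if n = m then c else 0) \<partial>cs) = c"
  by (subst lebesgue_integral_count_space_finite_support) (use * in auto)
 show "integrable cs (%n. if n = m then c else 0)"
  by (auto simp: integrable_iff_bounded if_distrib[of norm] if_distrib[of ennreal] nn_cs_single cong: if_cong)
qed

subsection \<open>Convolution\<close>

definition conv :: "(int^'n => complex) => (int^'n => complex) => int^'n => complex" where
 "conv K f n = (\<integral>y. K (n - y) * f y \<partial>cs)"

lemma nn_conv_le:
 fixes K L :: "int^'n => complex"
 shows "(\<integral>\<^sup>+n. w n * ennreal (norm (conv K L n)) \<partial>cs)
   <= (\<integral>\<^sup>+y. ennreal (norm (L y)) * (\<integral>\<^sup>+n. w (n + y) * ennreal (norm (K n)) \<partial>cs) \<partial>cs)"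
proof -
 have "(\<integral>\<^sup>+n. w n * ennreal (norm (conv K L n)) \<partial>cs)
   <= (\<integral>\<^sup>+n. w n * (\<integral>\<^sup>+y. ennreal (norm (K (n - y) * L y)) \<partial>cs) \<partial>cs)"
  unfolding conv_def by (intro nn_integral_mono mult_left_mono nn_norm_integral_le) auto
 also have "... = (\<integral>\<^sup>+n. (\<integral>\<^sup>+y. ennreal (norm (L y)) * (w n * ennreal (norm (K (n - y)))) \<partial>cs) \<partial>cs)"
  by (simp add: nn_integral_cmult[symmetric] norm_mult ennreal_mult mult_ac)
 also have "... = (\<integral>\<^sup>+y. (\<integral>\<^sup>+n. ennreal (norm (L y)) * (w n * ennreal (norm (K (n - y)))) \<partial>cs) \<partial>cs)"
  by (rule cs_nn_swap) auto
 also have "... = (\<integral>\<^sup>+y. ennreal (norm (L y)) * (\<integral>\<^sup>+n. w n * ennreal (norm (K (n - y))) \<partial>cs) \<partial>cs)"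
  by (simp add: nn_integral_cmult)
 also have "... = (\<integral>\<^sup>+y. ennreal (norm (L y)) * (\<integral>\<^sup>+n. w (n + y) * ennreal (norm (K n)) \<partial>cs) \<partial>cs)"
 proof (rule nn_integral_cong, rule arg_cong2[where f="(*)"], rule refl)
  fix y
  show "(\<integral>\<^sup>+n. w n * ennreal (norm (K (n - y))) \<partial>cs) = (\<integral>\<^sup>+n. w (n + y) * ennreal (norm (K n)) \<partial>cs)"
   using nn_shift(1)[of "%n. w n * ennreal (norm (K (n - y)))" y] by simp
 qed
 finally show ?thesis .
qed

lemma nn_conv_le_mult:
 fixes K L :: "int^'n => complex"
 shows "(\<integral>\<^sup>+n. ennreal (norm (conv K L n)) \<partial>cs)
   <= (\<integral>\<^sup>+n. ennreal (norm (K n)) \<partial>cs) * (\<integral>\<^sup>+n. ennreal (norm (L n)) \<partial>cs)"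
 using nn_conv_le[of "%_. 1" K L] by (simp add: nn_integral_multc mult.commute)

lemma conv_integrable:
 fixes K L :: "int^'n => complex"
 assumes "integrable cs K" "integrable cs L"
 shows "integrable cs (conv K L)"
 using assms le_less_trans[OF nn_conv_le_mult[of K L]]
 by (auto simp: integrable_cs_iff ennreal_mult_less_top)

subsection \<open>Characters and the frequency cube\<close>

definition emb :: "int^'n => real^'n" where "emb n = (\<chi> i. of_int (n $ i))"

definition chr :: "int^'n => real^'n => complex" where
 "chr n \<xi> = cis (- (emb n \<bullet> \<xi>))"

definition pbox :: "(real^'n) set" where
 "pbox = box (\<chi> i. - pi) (\<chi> i. pi) - {0}"

definition TM :: "(real^'n) measure" where "TM = restrict_space lborel pbox"

definition ker :: "(real^'n => complex) => int^'n => complex" where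
 "ker F n = (\<integral>\<xi>. F \<xi> * chr (- n) \<xi> \<partial>TM) / of_real ((2 * pi) ^ CARD('n))"

lemma emb_simps [simp]: "emb (m + n) = emb m + emb n" "emb (m - n) = emb m - emb n"
 "emb (- n) = - emb n" "emb 0 = 0" "emb n $ i = of_int (n $ i)"
 by (auto simp: emb_def vec_eq_iff)

lemma emb_eq_iff [simp]: "emb m = emb n \<longleftrightarrow> m = n"
 by (auto simp: emb_def vec_eq_iff)

lemma chr_simps [simp]: "chr 0 \<xi> = 1" "norm (chr n \<xi>) = 1" "cnj (chr n \<xi>) = chr (- n) \<xi>"
 by (auto simp: chr_def cis_cnj)

lemma chr_add: "chr (m + n) \<xi> = chr m \<xi> * chr n \<xi>"
 by (simp add: chr_def inner_add_left cis_mult add.commute)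

lemma chr_minus_arg: "chr n (- \<xi>) = chr (- n) \<xi>"
 by (simp add: chr_def)

lemma chr_measurable [measurable]: "chr n : borel_measurable borel"
 unfolding chr_def cis_conv_exp by measurable

lemma pbox_sets [measurable]: "pbox : sets borel"
 by (simp add: pbox_def)

lemma space_TM [simp]: "space TM = pbox"
 by (simp add: TM_def space_restrict_space)

lemma TM_borel: "f : borel_measurable borel ==> f : borel_measurable TM"
 by (simp add: TM_def measurable_restrict_space1)

lemma chr_measurable_TM [measurable]: "chr n : borel_measurable TM"
 by (rule TM_borel) simp

lemma emeasure_TM: "emeasure TM (pbox :: (real^'n) set) < \<infinity>"
proof -
 have "emeasure TM (pbox :: (real^'n) set) <= emeasure lborel (cbox (\<chi> i. - pi) (\<chi> i. pi) :: (real^'n) set)"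
  unfolding TM_def by (subst emeasure_restrict_space) (auto simp: pbox_def mem_box less_imp_le intro!: emeasure_mono)
 also have "... < \<infinity>" by (rule emeasure_lborel_cbox_finite)
 finally show ?thesis by simp
qed

interpretation TM: finite_measure TM
 using emeasure_TM by (intro finite_measureI) (auto simp: less_top)

lemma integral_cis_int:
 fixes k :: int
 shows "(\<integral>t. indicator {-pi<..<pi} t *\<^sub>R cis (of_int k * t) \<partial>lborel) = (if k = 0 then of_real (2 * pi) else 0)"
  and "integrable lborel (%t. indicator {-pi<..<pi} t *\<^sub>R cis (of_int k * t))"
proof -
 have ae: "AE t in lborel. indicator {-pi<..<pi} t *\<^sub>R cis (of_int k * t) = indicator {-pi..pi} t *\<^sub>R cis (of_int k * t)"
 proof (rule AE_I')
  show "{-pi, pi} : null_sets lborel" by (intro finite_imp_null_set_lborel) auto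
 qed (auto split: split_indicator)
 have c: "continuous_on {-pi..pi} (%t. cis (of_int k * t))" by (intro continuous_intros)
 have I: "set_integrable lborel {-pi..pi} (%t. cis (of_int k * t))"
  by (rule borel_integrable_atLeastAtMost') (rule c)
 then show "integrable lborel (%t. indicator {-pi<..<pi} t *\<^sub>R cis (of_int k * t))"
  unfolding set_integrable_def
  by (subst integrable_cong_AE[OF _ _ ae]) (auto simp: cis_conv_exp)
 have "(\<integral>t. indicator {-pi<..<pi} t *\<^sub>R cis (of_int k * t) \<partial>lborel) = (\<integral>t. indicator {-pi..pi} t *\<^sub>R cis (of_int k * t) \<partial>lborel)"
  by (rule integral_cong_AE[OF _ _ ae]) (auto simp: cis_conv_exp)
 also have "... = (if k = 0 then of_real (2 * pi) else 0)"
 proof (cases "k = 0")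
  case True
  then show ?thesis by (simp add: scaleR_conv_of_real measure_def)
 next
  case False
  have "(\<integral>t. indicator {-pi..pi} t *\<^sub>R cis (of_int k * t) \<partial>lborel) =
    cis (of_int k * pi) / (\<i> * of_int k) - cis (of_int k * (-pi)) / (\<i> * of_int k)"
  proof (rule integral_FTC_atLeastAtMost)
   fix x :: real
   have "((%t. exp (\<i> * (of_int k * of_real t)) / (\<i> * of_int k)) has_vector_derivative exp (\<i> * of_real (of_int k * x))) (at x within {-pi..pi})"
   proof (rule has_vector_derivative_real_field)
    define c :: complex where "c = \<i> * of_int k"
    have "c ~= 0" using False by (simp add: c_def)
    then have "((%z. exp (c * z) / c) has_field_derivative exp (c * z)) (at z)" for z
     by (auto intro!: derivative_eq_intros)
    then show "((%z. exp (\<i> * (of_int k * z)) / (\<i> * of_int k)) has_field_derivative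
      exp (\<i> * of_real (of_int k * x))) (at (of_real x))"
     by (simp add: c_def mult.assoc)
   qed
   then show "((%t. cis (of_int k * t) / (\<i> * of_int k)) has_vector_derivative cis (of_int k * x)) (at x within {-pi..pi})"
    by (simp add: cis_conv_exp)
  qed (use c in auto)
  also have "cis (of_int k * pi) = cis (of_int k * (-pi))"
  proof -
   have "cis (of_int k * pi) = cis (of_int k * (-pi)) * cis (2 * pi * of_int k)"
    by (simp only: cis_mult) (simp add: algebra_simps)
   then show ?thesis by (simp add: cis_multiple_2pi)
  qed
  finally show ?thesis using False by simp
 qed
 finally show "(\<integral>t. indicator {-pi<..<pi} t *\<^sub>R cis (of_int k * t) \<partial>lborel) = (if k = 0 then of_real (2 * pi) else 0)" .
qed

lemma integral_lborel_prod:
 fixes f :: "'a::euclidean_space => real => complex"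
 assumes "!!b. b : Basis ==> integrable lborel (f b)"
 shows "(\<integral>x. (\<Prod>b\<in>Basis. f b (x \<bullet> b)) \<partial>lborel) = (\<Prod>b\<in>Basis. \<integral>t. f b t \<partial>lborel)"
proof -
 interpret product_sigma_finite "%_::'a. lborel :: real measure" ..
 have [measurable]: "!!b. b : Basis ==> f b : borel_measurable borel"
  using assms borel_measurable_integrable by fastforce
 show ?thesis
  by (subst lborel_eq, subst integral_distr)
   (auto simp: product_integral_prod assms inner_sum_left inner_Basis if_distrib sum.delta cong: if_cong)
qed

text \<open>Orthogonality of the characters is the product of the one-dimensional integrals.\<close>

lemma integral_chr: "(\<integral>\<xi>. chr n \<xi> \<partial>TM) = (if n = 0 then of_real ((2 * pi) ^ CARD('n)) else 0)"
 for n :: "int^'n"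
proof -
 let ?k = "%b::real^'n. - \<lfloor>emb n \<bullet> b\<rfloor>"
 have kb: "of_int (?k b) = - (emb n \<bullet> b)" if "b : Basis" for b
  using that by (auto simp: Basis_vec_def inner_axis)
 have "(\<integral>\<xi>. chr n \<xi> \<partial>TM) = (\<integral>\<xi>. indicator pbox \<xi> *\<^sub>R chr n \<xi> \<partial>lborel)"
  unfolding TM_def by (subst integral_restrict_space) auto
 also have "... = (\<integral>\<xi>. (\<Prod>b\<in>Basis. indicator {-pi<..<pi} (\<xi> \<bullet> b) *\<^sub>R cis (of_int (?k b) * (\<xi> \<bullet> b))) \<partial>lborel)"
 proof (rule integral_cong_AE)
  show "AE \<xi> in lborel. indicator pbox \<xi> *\<^sub>R chr n \<xi> = (\<Prod>b\<in>Basis. indicator {-pi<..<pi} (\<xi> \<bullet> b) *\<^sub>R cis (of_int (?k b) * (\<xi> \<bullet> b)))"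
  proof (rule AE_I')
   show "{0::real^'n} : null_sets lborel" by auto
   have "indicator pbox \<xi> *\<^sub>R chr n \<xi> = (\<Prod>b\<in>Basis. indicator {-pi<..<pi} (\<xi> \<bullet> b) *\<^sub>R cis (of_int (?k b) * (\<xi> \<bullet> b)))"
    if nz: "\<xi> ~= 0" for \<xi> :: "real^'n"
   proof -
    have "(\<Prod>b\<in>Basis. indicator {-pi<..<pi} (\<xi> \<bullet> b)) = (indicator pbox \<xi> :: real)"
    proof (cases "\<xi> : pbox")
     case True
     then show ?thesis by (auto simp: pbox_def box_def inner_axis Basis_vec_def intro!: prod.neutral)
    next
     case False
     then obtain i where i: "~ (-pi < \<xi> $ i & \<xi> $ i < pi)"
      using nz by (auto simp: pbox_def mem_box_cart)
     define b :: "real^'n" where "b = axis i 1"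
     have "b : Basis" "~ (-pi < \<xi> \<bullet> b & \<xi> \<bullet> b < pi)"
      using i by (auto simp: b_def inner_axis Basis_vec_def)
     then show ?thesis using False by (auto intro!: prod_zero bexI[of _ b])
    qed
    moreover have "(\<Prod>b\<in>Basis. cis (of_int (?k b) * (\<xi> \<bullet> b))) = chr n \<xi>"
    proof -
     have "(\<Prod>b\<in>B. cis (g b)) = cis (\<Sum>b\<in>B. g b)" for B and g :: "real^'n => real"
      by (induction B rule: infinite_finite_induct) (auto simp: cis_mult)
     moreover have s: "(\<Sum>b\<in>Basis. of_int (?k b) * (\<xi> \<bullet> b)) = - (emb n \<bullet> \<xi>)"
     proof -
      have "(\<Sum>b\<in>Basis. of_int (?k b) * (\<xi> \<bullet> b)) = (\<Sum>b\<in>Basis. - (emb n \<bullet> b) * (\<xi> \<bullet> b))"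
       by (rule sum.cong) (auto simp only: kb)
      then show ?thesis by (simp add: euclidean_inner[of "emb n" \<xi>] sum_negf)
     qed
     ultimately show ?thesis
      unfolding chr_def using s by simp
    qed
    ultimately show ?thesis by (simp add: scaleR_conv_of_real prod.distrib flip: of_real_prod)
   qed
   then show "{\<xi> : space lborel. indicator pbox \<xi> *\<^sub>R chr n \<xi> ~= (\<Prod>b\<in>Basis. indicator {-pi<..<pi} (\<xi> \<bullet> b) *\<^sub>R cis (of_int (?k b) * (\<xi> \<bullet> b)))} <= {0}"
    by auto
  qed
 qed (auto simp: cis_conv_exp)
 also have "... = (\<Prod>b\<in>(Basis::(real^'n) set). (if ?k b = 0 then of_real (2 * pi) else 0))"
  by (subst integral_lborel_prod, rule integral_cis_int(2), simp only: integral_cis_int(1))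
 also have "... = (if n = 0 then of_real ((2 * pi) ^ CARD('n)) else 0)"
 proof (cases "n = 0")
  case True
  then show ?thesis by simp
 next
  case False
  then obtain i where i: "n $ i ~= 0" by (auto simp: vec_eq_iff)
  have "?k (axis i 1) ~= 0" using i by (simp add: inner_axis)
  moreover have "axis i (1::real) : Basis" by (auto simp: Basis_vec_def)
  ultimately show ?thesis using False by (auto intro!: prod_zero bexI[of _ "axis i 1"])
 qed
 finally show ?thesis .
qed

subsection \<open>The Wiener algebra\<close>

text \<open>
  A function on the frequency cube together with its absolutely summable coefficients. Carrying the
  coefficients along makes products of symbols into convolutions of kernels without any discussion of
  uniqueness until it is needed.
\<close>

definition wien :: "(real^'n => complex) => (int^'n => complex) => bool" where
 "wien F K \<longleftrightarrow> integrable cs K & (\<forall>\<xi>\<in>pbox. (\<integral>n. K n * chr n \<xi> \<partial>cs) = F \<xi>)"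

abbreviation W :: "(real^'n => complex) => bool" where "W F \<equiv> wien F (ker F)"

text \<open>
  The weighted norm of the coefficients. Weight 1 gives the Wiener norm, which bounds the operator on
  every \<open>L\<^sup>p\<close>; the weight \<open>\<bar>n\<bar>\<^sup>2\<close> measures decay of the kernel away from the origin.
\<close>

definition an :: "(int^'n => ennreal) => (real^'n => complex) => ennreal" where
 "an w F = (\<integral>\<^sup>+n. w n * ennreal (norm (ker F n)) \<partial>cs)"

abbreviation an1 :: "(real^'n => complex) => ennreal" where "an1 \<equiv> an (%_. 1)"

lemma integrable_times_chr [simp]: "integrable cs (%n. K n * chr n \<xi>) \<longleftrightarrow> integrable cs K"
 by (simp add: integrable_cs_iff norm_mult)

lemma chr_integrable_TM: "integrable TM (chr n)"
 by (rule TM.integrable_const_bound[where B=1]) auto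

lemma wien_coeff:
 fixes F :: "real^'n => complex"
 assumes "wien F K" shows "ker F = K"
proof
 fix n :: "int^'n"
 have K: "integrable cs K" and F: "!!\<xi>. \<xi> : pbox ==> (\<integral>m. K m * chr m \<xi> \<partial>cs) = F \<xi>"
  using assms by (auto simp: wien_def)
 have "(\<integral>\<xi>. F \<xi> * chr (- n) \<xi> \<partial>TM) = (\<integral>\<xi>. (\<integral>m. K m * chr (m - n) \<xi> \<partial>cs) \<partial>TM)"
 proof (rule Bochner_Integration.integral_cong)
  fix \<xi> assume "\<xi> : space (TM :: (real^'n) measure)"
  then have "F \<xi> * chr (- n) \<xi> = (\<integral>m. K m * chr m \<xi> * chr (- n) \<xi> \<partial>cs)"
   by (simp add: F)
  also have "... = (\<integral>m. K m * chr (m - n) \<xi> \<partial>cs)"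
   using chr_add[of _ "- n"] by (simp add: mult.assoc)
  finally show "F \<xi> * chr (- n) \<xi> = (\<integral>m. K m * chr (m - n) \<xi> \<partial>cs)" .
 qed simp
 also have "... = (\<integral>m. (\<integral>\<xi>. K m * chr (m - n) \<xi> \<partial>TM) \<partial>cs)"
 proof (rule cs_integral_swap(1)[symmetric])
  have "(\<integral>\<^sup>+ m. \<integral>\<^sup>+ \<xi>. ennreal (cmod (K m * chr (m - n) \<xi>)) \<partial>TM \<partial>cs)
    = (\<integral>\<^sup>+ m. ennreal (norm (K m)) * emeasure TM (pbox :: (real^'n) set) \<partial>cs)"
   by (simp add: norm_mult)
  also have "... < \<infinity>"
   using K emeasure_TM[where 'n='n] by (simp add: nn_integral_multc integrable_cs_iff ennreal_mult_less_top)
  finally show "(\<integral>\<^sup>+ m. \<integral>\<^sup>+ \<xi>. ennreal (cmod (K m * chr (m - n) \<xi>)) \<partial>TM \<partial>cs) < \<infinity>" .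
 qed (auto intro: TM.sigma_finite_measure_axioms)
 also have "... = (\<integral>m. (if m = n then K n * of_real ((2 * pi) ^ CARD('n)) else 0) \<partial>cs)"
  by (intro Bochner_Integration.integral_cong) (auto simp: integral_chr chr_integrable_TM)
 also have "... = K n * of_real ((2 * pi) ^ CARD('n))" by (rule integral_cs_single)
 finally show "ker F n = K n" by (simp add: ker_def)
qed

lemma wienD: "wien F K ==> integrable cs K" "wien F K ==> \<xi> : pbox ==> (\<integral>n. K n * chr n \<xi> \<partial>cs) = F \<xi>"
 by (auto simp: wien_def)

lemma wien_imp_W: "wien F K ==> W F"
 using wien_coeff[of F K] by simp

lemma wien_an: "wien F K ==> an w F = (\<integral>\<^sup>+n. w n * ennreal (norm (K n)) \<partial>cs)"
 using wien_coeff[of F K] by (simp add: an_def)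

lemma ker_cong: "(!!\<xi>. \<xi> : pbox ==> F \<xi> = G \<xi>) ==> ker F = ker G"
 unfolding ker_def by (intro ext arg_cong2[where f="(/)"] Bochner_Integration.integral_cong) auto

lemma an_cong: "(!!\<xi>. \<xi> : pbox ==> F \<xi> = G \<xi>) ==> an w F = an w G"
 unfolding an_def by (subst ker_cong[of F G]) auto

lemma W_cong: assumes "!!\<xi>. \<xi> : pbox ==> F \<xi> = G \<xi>" shows "W F \<longleftrightarrow> W G"
proof -
 have "ker F = ker G" by (rule ker_cong) (rule assms)
 then show ?thesis using assms by (simp add: wien_def)
qed

lemma W_an1: "W F ==> an1 F < \<infinity>"
 by (auto simp: wien_def an_def integrable_cs_iff)

lemma W_norm_le: "W F ==> \<xi> : pbox ==> ennreal (norm (F \<xi>)) <= an1 F"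
 using nn_norm_integral_le[of cs "%n. ker F n * chr n \<xi>"] by (simp add: wienD(2) an_def norm_mult)

lemma W_measurable: assumes "W F" shows "F : borel_measurable TM"
proof -
 have "case_prod (%n \<xi>. ker F n * chr n \<xi>) : borel_measurable (cs \<Otimes>\<^sub>M TM)"
  by (rule measurable_pair_measure_countable1) auto
 then have "case_prod (%\<xi> n. ker F n * chr n \<xi>) : borel_measurable (TM \<Otimes>\<^sub>M cs)"
  by (rule measurable_pair_swap_iff[THEN iffD1, of "%(n, \<xi>). ker F n * chr n \<xi>", simplified case_prod_beta, simplified] ) 
 then have "(%\<xi>. \<integral>n. ker F n * chr n \<xi> \<partial>cs) : borel_measurable TM"
  by (rule sigma_finite_measure.borel_measurable_lebesgue_integral[OF sigma_finite_measure_count_space])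
 then show ?thesis
  by (rule measurable_cong[THEN iffD1, rotated]) (simp add: wienD(2)[OF assms])
qed

lemma wien_add: "wien F K ==> wien G L ==> wien (%\<xi>. F \<xi> + G \<xi>) (%n. K n + L n)"
 by (auto simp: wien_def ring_distribs)

lemma wien_cmult: "wien F K ==> wien (%\<xi>. c * F \<xi>) (%n. c * K n)"
 by (auto simp: wien_def mult.assoc)

lemma wien_mult:
 fixes F :: "real^'n => complex"
 assumes "wien F K" "wien G L" shows "wien (%\<xi>. F \<xi> * G \<xi>) (conv K L)"
 unfolding wien_def
proof (intro conjI ballI)
 have K: "integrable cs K" and L: "integrable cs L" using assms by (auto simp: wien_def)
 show "integrable cs (conv K L)" by (rule conv_integrable[OF K L])
 fix \<xi> :: "real^'n" assume \<xi>: "\<xi> : pbox"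
 have "(\<integral>n. conv K L n * chr n \<xi> \<partial>cs) = (\<integral>n. \<integral>y. K (n - y) * L y * chr n \<xi> \<partial>cs \<partial>cs)"
  unfolding conv_def by (subst integral_mult_left_zero) simp
 also have "... = (\<integral>y. \<integral>n. K (n - y) * L y * chr n \<xi> \<partial>cs \<partial>cs)"
 proof (rule cs_integral_swap(1))
  have "(\<integral>\<^sup>+ n. \<integral>\<^sup>+ y. ennreal (cmod (K (n - y) * L y * chr n \<xi>)) \<partial>cs \<partial>cs)
    = (\<integral>\<^sup>+ y. \<integral>\<^sup>+ n. ennreal (cmod (L y)) * ennreal (cmod (K (n - y))) \<partial>cs \<partial>cs)"
   by (subst cs_nn_swap) (auto simp: norm_mult ennreal_mult mult_ac)
  also have "... < \<infinity>"
   using K L nn_shift(2)[of "%n. ennreal (cmod (K n))"]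
   by (simp add: nn_integral_cmult nn_integral_multc integrable_cs_iff ennreal_mult_less_top)
  finally show "(\<integral>\<^sup>+ n. \<integral>\<^sup>+ y. ennreal (cmod (K (n - y) * L y * chr n \<xi>)) \<partial>cs \<partial>cs) < \<infinity>" .
 qed (auto intro: sigma_finite_measure_count_space)
 also have "... = (\<integral>y. L y * chr y \<xi> * F \<xi> \<partial>cs)"
 proof (rule Bochner_Integration.integral_cong)
  fix y
  have "(\<integral>n. K (n - y) * L y * chr n \<xi> \<partial>cs) = (\<integral>n. K n * L y * chr (n + y) \<xi> \<partial>cs)"
   using integral_shift(2)[of "%n. K n * L y * chr (n + y) \<xi>" y] by simp
  also have "... = (\<integral>n. (L y * chr y \<xi>) * (K n * chr n \<xi>) \<partial>cs)"
   by (simp add: chr_add mult_ac)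
  also have "... = L y * chr y \<xi> * F \<xi>"
   by (simp only: integral_mult_right_zero wienD(2)[OF assms(1) \<xi>])
  finally show "(\<integral>n. K (n - y) * L y * chr n \<xi> \<partial>cs) = L y * chr y \<xi> * F \<xi>" .
 qed simp
 also have "... = G \<xi> * F \<xi>"
  by (simp only: integral_mult_left_zero wienD(2)[OF assms(2) \<xi>])
 also have "... = F \<xi> * G \<xi>" by (rule mult.commute)
 finally show "(\<integral>n. conv K L n * chr n \<xi> \<partial>cs) = F \<xi> * G \<xi>" .
qed

lemma wien_chr: "wien (chr m) (%n. if n = m then 1 else 0)" for m :: "int^'n"
 unfolding wien_def
proof (intro conjI ballI)
 show "integrable cs (%n. if n = m then 1 else 0::complex)" by (rule integral_cs_single)
 fix \<xi> :: "real^'n"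
 have "(\<integral>n. (if n = m then 1 else 0) * chr n \<xi> \<partial>cs) = (\<integral>n. (if n = m then chr m \<xi> else 0) \<partial>cs)"
  by (intro Bochner_Integration.integral_cong) auto
 then show "(\<integral>n. (if n = m then 1 else 0) * chr n \<xi> \<partial>cs) = chr m \<xi>"
  by (simp add: integral_cs_single)
qed

lemma W_add: "W F ==> W G ==> W (%\<xi>. F \<xi> + G \<xi>)" by (rule wien_imp_W[OF wien_add])
lemma W_cmult: "W F ==> W (%\<xi>. c * F \<xi>)" by (rule wien_imp_W[OF wien_cmult])
lemma W_mult: "W F ==> W G ==> W (%\<xi>. F \<xi> * G \<xi>)" by (rule wien_imp_W[OF wien_mult])
lemma W_chr: "W (chr m)" by (rule wien_imp_W[OF wien_chr])
lemma W_const: "W (%_. c)" using W_cmult[OF W_chr[of 0], of c] by simp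
lemma W_diff: "W F ==> W G ==> W (%\<xi>. F \<xi> - G \<xi>)" using W_add[OF _ W_cmult[of G "-1"], of F] by simp
lemma W_sum: "(!!i. i : A ==> W (F i)) ==> W (%\<xi>. \<Sum>i\<in>A. F i \<xi>)"
 by (induction A rule: infinite_finite_induct) (auto intro: W_const W_add)
lemma W_power: "W F ==> W (%\<xi>. F \<xi> ^ k)"
 by (induction k) (auto intro: W_const W_mult)

lemma an_add_le: assumes "W F" "W G" shows "an w (%\<xi>. F \<xi> + G \<xi>) <= an w F + an w G"
proof -
 have "an w (%\<xi>. F \<xi> + G \<xi>) = (\<integral>\<^sup>+n. w n * ennreal (norm (ker F n + ker G n)) \<partial>cs)"
  by (rule wien_an[OF wien_add[OF assms]])
 also have "... <= (\<integral>\<^sup>+n. w n * ennreal (norm (ker F n)) + w n * ennreal (norm (ker G n)) \<partial>cs)"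
  by (intro nn_integral_mono) (auto simp: distrib_left[symmetric] ennreal_plus[symmetric] norm_triangle_ineq simp del: ennreal_plus intro!: mult_left_mono ennreal_leI)
 also have "... = an w F + an w G" by (simp add: an_def nn_integral_add)
 finally show ?thesis .
qed

lemma an_cmult: assumes "W F" shows "an w (%\<xi>. c * F \<xi>) = ennreal (norm c) * an w F"
 by (simp add: wien_an[OF wien_cmult[OF assms]] wien_an[OF assms] norm_mult ennreal_mult nn_integral_cmult[symmetric] mult_ac)

lemma an_diff_le: assumes "W F" "W G" shows "an w (%\<xi>. F \<xi> - G \<xi>) <= an w F + an w G"
 using an_add_le[OF assms(1) W_cmult[OF assms(2), of "-1"], of w] by (simp add: an_cmult[OF assms(2), of _ "-1", simplified])

lemma an_chr: "an w (chr m) = w m"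
proof -
 have "an w (chr m) = (\<integral>\<^sup>+n. (if n = m then w m else 0) \<partial>cs)"
  unfolding wien_an[OF wien_chr] by (intro nn_integral_cong) auto
 then show ?thesis by (simp add: nn_cs_single)
qed

lemma an_zero: "an w (%_. 0) = 0" by (simp add: an_def ker_def)

lemma an1_const: "an1 (%_::real^'n. c) = ennreal (norm c)"
 using an_cmult[OF W_chr[of "0::int^'n"], of "%_. 1" c] an_chr[of "%_. 1" "0::int^'n"] by simp

lemma an_sum_le: "(!!i. i : A ==> W (F i)) ==> an w (%\<xi>. \<Sum>i\<in>A. F i \<xi>) <= (\<Sum>i\<in>A. an w (F i))"
proof (induction A rule: infinite_finite_induct)
 case (insert a A)
 then show ?case
  using an_add_le[of "F a" "%\<xi>. \<Sum>i\<in>A. F i \<xi>" w] by (auto intro: W_sum order_trans[OF _ add_left_mono])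
qed (auto simp: an_zero)

lemma an1_mult_le: "W F ==> W G ==> an1 (%\<xi>. F \<xi> * G \<xi>) <= an1 F * an1 G"
 using nn_conv_le_mult[of "ker F" "ker G"] by (simp add: an_def wien_coeff[OF wien_mult])

lemma an1_power_le: assumes "W F" shows "an1 (%\<xi>. F \<xi> ^ k) <= an1 F ^ k"
proof (induction k)
 case (Suc k)
 have "an1 (%\<xi>. F \<xi> ^ Suc k) <= an1 F * an1 (%\<xi>. F \<xi> ^ k)"
  using an1_mult_le[OF assms W_power[OF assms, of k]] by simp
 also have "... <= an1 F * an1 F ^ k" using Suc by (rule mult_left_mono) simp
 finally show ?case by simp
qed (simp add: an1_const)

definition sqw :: "int^'n => ennreal" where "sqw n = ennreal (\<Sum>i\<in>UNIV. (of_int (n $ i))\<^sup>2)"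

abbreviation an2 :: "(real^'n => complex) => ennreal" where "an2 \<equiv> an sqw"

lemma sqw_add_le: "sqw (m + n) <= 2 * sqw m + 2 * sqw n"
proof -
 have "(\<Sum>i\<in>UNIV. (of_int ((m + n) $ i))\<^sup>2 :: real) <= (\<Sum>i\<in>UNIV. 2 * (of_int (m $ i))\<^sup>2 + 2 * (of_int (n $ i))\<^sup>2)"
 proof (rule sum_mono)
  fix i
  have "0 <= (of_int (m $ i) - of_int (n $ i) :: real)\<^sup>2" by simp
  then show "(of_int ((m + n) $ i))\<^sup>2 <= 2 * (of_int (m $ i))\<^sup>2 + 2 * (of_int (n $ i) :: real)\<^sup>2"
   by (simp add: power2_eq_square algebra_simps)
 qed
 then have "sqw (m + n) <= ennreal (2 * (\<Sum>i\<in>UNIV. (of_int (m $ i))\<^sup>2) + 2 * (\<Sum>i\<in>UNIV. (of_int (n $ i))\<^sup>2))"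
  unfolding sqw_def by (intro ennreal_leI) (simp add: sum.distrib sum_distrib_left)
 also have "... = 2 * sqw m + 2 * sqw n"
  by (simp add: sqw_def ennreal_plus ennreal_mult sum_nonneg)
 finally show ?thesis .
qed

lemma an2_mult_le:
 fixes F :: "real^'n => complex"
 assumes "W F" "W G" shows "an2 (%\<xi>. F \<xi> * G \<xi>) <= 2 * (an2 F * an1 G + an1 F * an2 G)"
proof -
 have "an2 (%\<xi>. F \<xi> * G \<xi>) <= (\<integral>\<^sup>+y. ennreal (norm (ker G y)) * (\<integral>\<^sup>+n. sqw (n + y) * ennreal (norm (ker F n)) \<partial>cs) \<partial>cs)"
  unfolding wien_an[OF wien_mult[OF assms]] by (rule nn_conv_le)
 also have "... <= (\<integral>\<^sup>+y. ennreal (norm (ker G y)) * (\<integral>\<^sup>+n. 2 * (sqw n * ennreal (norm (ker F n))) + (2 * sqw y) * ennreal (norm (ker F n)) \<partial>cs) \<partial>cs)"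
 proof (intro nn_integral_mono mult_left_mono)
  fix y n :: "int^'n"
  show "sqw (n + y) * ennreal (norm (ker F n)) <= 2 * (sqw n * ennreal (norm (ker F n))) + (2 * sqw y) * ennreal (norm (ker F n))"
   using mult_right_mono[OF sqw_add_le[of n y], of "ennreal (norm (ker F n))"] by (simp add: distrib_right mult.assoc)
 qed simp
 also have "... = (\<integral>\<^sup>+y. ennreal (norm (ker G y)) * (2 * an2 F + 2 * sqw y * an1 F) \<partial>cs)"
  by (simp add: nn_integral_add nn_integral_cmult an_def)
 also have "... = (\<integral>\<^sup>+y. (2 * an2 F) * ennreal (norm (ker G y)) + (2 * an1 F) * (sqw y * ennreal (norm (ker G y))) \<partial>cs)"
  by (simp add: algebra_simps)
 also have "... = 2 * (an2 F * an1 G + an1 F * an2 G)"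
  by (subst nn_integral_add)
   (simp_all add: nn_integral_cmult an_def[of sqw G] an_def[of "%_. 1" G] distrib_left mult.assoc)
 finally show ?thesis .
qed

text \<open>
  An integral of symbols with integrable Wiener norms is again in the algebra, by Fubini. Every power
  of a symbol below is written as such an integral over heat kernels.
\<close>

lemma W_integral:
 fixes F :: "'u => real^'n => complex"
 assumes sf: "sigma_finite_measure M" and meas: "case_prod F : borel_measurable (M \<Otimes>\<^sub>M TM)"
  and WF: "!!u. u : space M ==> W (F u)" and fin: "(\<integral>\<^sup>+u. an1 (F u) \<partial>M) < \<infinity>"
 shows "W (%\<xi>. \<integral>u. F u \<xi> \<partial>M)"
  and "an w (%\<xi>. \<integral>u. F u \<xi> \<partial>M) <= (\<integral>\<^sup>+u. an w (F u) \<partial>M)"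
  and "!!n. ker (%\<xi>. \<integral>u. F u \<xi> \<partial>M) n = (\<integral>u. ker (F u) n \<partial>M)"
  and "!!\<xi>. \<xi> : pbox ==> integrable M (%u. F u \<xi>)"
proof -
 interpret M: sigma_finite_measure M by fact
 have [measurable]: "(%u. ker (F u) n) : borel_measurable M" for n
 proof -
  note meas[measurable]
  have "case_prod (%u \<xi>. F u \<xi> * chr (- n) \<xi>) : borel_measurable (M \<Otimes>\<^sub>M TM)"
   unfolding case_prod_beta
   using meas by (intro borel_measurable_times) (auto simp: case_prod_beta intro!: measurable_compose[OF measurable_snd chr_measurable_TM])
  then show ?thesis
   unfolding ker_def by (intro borel_measurable_divide TM.borel_measurable_lebesgue_integral) auto
 qed
 have fin': "(\<integral>\<^sup>+n. \<integral>\<^sup>+u. ennreal (norm (ker (F u) n * chr n \<xi>)) \<partial>M \<partial>cs) < \<infinity>" for \<xi>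
  using fin by (subst cs_nn_swap) (auto simp: an_def norm_mult)
 have "wien (%\<xi>. \<integral>u. F u \<xi> \<partial>M) (%n. \<integral>u. ker (F u) n \<partial>M)"
  unfolding wien_def
 proof (intro conjI ballI)
  show "integrable cs (%n. \<integral>u. ker (F u) n \<partial>M)"
   using fin'[of 0] by (intro cs_integral_swap(2)[OF sf]) (auto simp: norm_mult)
  fix \<xi> :: "real^'n" assume \<xi>: "\<xi> : pbox"
  have "(\<integral>n. (\<integral>u. ker (F u) n \<partial>M) * chr n \<xi> \<partial>cs) = (\<integral>n. (\<integral>u. ker (F u) n * chr n \<xi> \<partial>M) \<partial>cs)"
   by simp
  also have "... = (\<integral>u. (\<integral>n. ker (F u) n * chr n \<xi> \<partial>cs) \<partial>M)"
   by (rule cs_integral_swap(1)[OF sf _ fin']) auto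
  also have "... = (\<integral>u. F u \<xi> \<partial>M)"
   by (intro Bochner_Integration.integral_cong refl wienD(2)[OF WF \<xi>])
  finally show "(\<integral>n. (\<integral>u. ker (F u) n \<partial>M) * chr n \<xi> \<partial>cs) = (\<integral>u. F u \<xi> \<partial>M)" .
 qed
 note w = this
 show "W (%\<xi>. \<integral>u. F u \<xi> \<partial>M)" by (rule wien_imp_W[OF w])
 show "!!n. ker (%\<xi>. \<integral>u. F u \<xi> \<partial>M) n = (\<integral>u. ker (F u) n \<partial>M)"
  using wien_coeff[OF w] by simp
 have "an w (%\<xi>. \<integral>u. F u \<xi> \<partial>M) <= (\<integral>\<^sup>+n. \<integral>\<^sup>+u. w n * ennreal (norm (ker (F u) n)) \<partial>M \<partial>cs)"
  unfolding wien_an[OF w]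
  by (intro nn_integral_mono, subst nn_integral_cmult) (auto intro!: mult_left_mono nn_norm_integral_le)
 also have "... = (\<integral>\<^sup>+u. an w (F u) \<partial>M)"
  unfolding an_def by (rule cs_nn_swap) auto
 finally show "an w (%\<xi>. \<integral>u. F u \<xi> \<partial>M) <= (\<integral>\<^sup>+u. an w (F u) \<partial>M)" .
 show "integrable M (%u. F u \<xi>)" if "\<xi> : pbox" for \<xi>
 proof -
  have "integrable M (%u. \<integral>n. ker (F u) n * chr n \<xi> \<partial>cs)"
   by (rule cs_integral_swap(3)[OF sf _ fin']) auto
  then show ?thesis
   by (rule Bochner_Integration.integrable_cong[THEN iffD1, rotated 2]) (auto simp: wienD(2)[OF WF that])
 qed
qed

lemma W_series:
 fixes F :: "'i::countable => real^'n => complex"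
 assumes WF: "!!i. W (F i)" and fin: "(\<integral>\<^sup>+i. an1 (F i) \<partial>cs) < \<infinity>"
 shows "W (%\<xi>. \<integral>i. F i \<xi> \<partial>cs)" and "an w (%\<xi>. \<integral>i. F i \<xi> \<partial>cs) <= (\<integral>\<^sup>+i. an w (F i) \<partial>cs)"
proof -
 have m: "case_prod F : borel_measurable (cs \<Otimes>\<^sub>M TM)"
  by (rule measurable_pair_measure_countable1) (auto intro: W_measurable WF)
 note * = W_integral[OF sigma_finite_measure_count_space m WF fin]
 show "W (%\<xi>. \<integral>i. F i \<xi> \<partial>cs)" "an w (%\<xi>. \<integral>i. F i \<xi> \<partial>cs) <= (\<integral>\<^sup>+i. an w (F i) \<partial>cs)"
  using * by auto
qed

text \<open>
  The exponential series converges in the Wiener norm. This is how a logarithm that lies in the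
  algebra yields all real powers at once, positive and negative.
\<close>

lemma W_exp: assumes "W F" shows "W (%\<xi>. exp (F \<xi>))"
proof -
 obtain a where a: "an1 F = ennreal a" "0 <= a"
  using W_an1[OF assms] by (cases "an1 F") auto
 let ?G = "%k::nat. %\<xi>. (1 / fact k) * F \<xi> ^ k"
 have "(\<integral>\<^sup>+k. an1 (?G k) \<partial>cs) <= (\<integral>\<^sup>+k. ennreal (a ^ k / fact k) \<partial>cs)"
 proof (rule nn_integral_mono)
  fix k :: nat
  have "an1 (?G k) <= ennreal (1 / fact k) * an1 F ^ k"
   unfolding an_cmult[OF W_power[OF assms]] by (auto simp: norm_divide intro!: mult_left_mono an1_power_le assms)
  also have "... = ennreal (a ^ k / fact k)"
   using a by (simp add: ennreal_power ennreal_mult[symmetric])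
  finally show "an1 (?G k) <= ennreal (a ^ k / fact k)" .
 qed
 also have "... = ennreal (\<Sum>k. a ^ k / fact k)"
  unfolding nn_integral_count_space_nat using a(2) summable_exp[of a]
  by (intro suminf_ennreal2) (auto simp: field_simps)
 also have "... < \<infinity>" by simp
 finally have fin: "(\<integral>\<^sup>+k. an1 (?G k) \<partial>cs) < \<infinity>" .
 have "W (?G k)" for k by (rule W_cmult[OF W_power[OF assms]])
 from W_series(1)[OF this fin] have "W (%\<xi>. \<integral>k. ?G k \<xi> \<partial>cs)" .
 moreover have "(\<integral>k. (1 / fact k) * z ^ (k::nat) \<partial>cs) = exp z" for z :: complex
 proof -
  have "summable (%k. norm ((1 / fact k) * z ^ k))"
   using summable_norm_exp[of z] by (simp add: norm_mult norm_divide norm_power scaleR_conv_of_real divide_inverse)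
  then show ?thesis
   by (subst integral_count_space_nat) (auto simp: integrable_count_space_nat_iff exp_def scaleR_conv_of_real field_simps)
 qed
 ultimately show ?thesis by simp
qed

section \<open>The lattice heat kernel\<close>

definition s1 :: "real => real" where "s1 x = 4 * (sin (x / 2))\<^sup>2"

definition sg :: "real^'n => real" where "sg \<xi> = (\<Sum>j\<in>UNIV. s1 (\<xi> $ j))"

definition fd :: "'n => real^'n => complex" where "fd j \<xi> = cis (\<xi> $ j) - 1"

definition heat :: "real => real^'n => complex" where "heat t \<xi> = of_real (exp (- (t * sg \<xi>)))"

lemma chr_axis: "chr (axis j m) \<xi> = cis (- (of_int m * \<xi> $ j))"
proof -
 have "emb (axis j m) = axis j (of_int m)" by (auto simp: vec_eq_iff axis_def)
 then show ?thesis by (simp add: chr_def inner_axis')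
qed

lemma s1_alt: "s1 x = 2 - 2 * cos x"
 using cos_double_sin[of "x / 2"] by (simp add: s1_def)

lemma s1_nonneg [simp]: "0 <= s1 x" by (simp add: s1_def)
lemma sg_nonneg [simp]: "0 <= sg \<xi>" by (simp add: sg_def sum_nonneg)

lemma sqw_axis: "sqw (axis j m) = ennreal ((of_int m)\<^sup>2)"
proof -
 have "(\<Sum>i\<in>UNIV. (of_int (axis j m $ i))\<^sup>2 :: real) = (\<Sum>i\<in>UNIV. if i = j then (of_int m)\<^sup>2 else 0)"
  by (intro sum.cong) (auto simp: axis_def)
 then show ?thesis by (simp add: sqw_def)
qed

subsection \<open>Moments of the Poisson distribution\<close>

definition pq :: "real => nat => real" where "pq t m = exp (- t) * t ^ m / fact m"

lemma pq_nonneg [simp]: "0 <= t ==> 0 <= pq t m" by (simp add: pq_def)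

lemma pq_sums: "pq t sums 1"
proof -
 have "(%m. exp (- t) * (t ^ m /\<^sub>R fact m)) sums (exp (- t) * exp t)"
  by (intro sums_mult exp_converges)
 moreover have "exp (- t) * exp t = (1::real)" by (simp add: exp_minus)
 ultimately show ?thesis by (simp add: pq_def[abs_def] divide_inverse mult_ac)
qed

lemma pq_Suc: "real (Suc m) * pq t (Suc m) = t * pq t m"
proof -
 have "real (Suc m) * (exp (- t) * (t * t ^ m) / (real (Suc m) * fact m)) = exp (- t) * (t * t ^ m) / fact m"
  by (simp del: of_nat_Suc)
 then show ?thesis by (simp add: pq_def fact_Suc mult_ac del: of_nat_Suc)
qed

lemma pq_shift:
 assumes "(%m. pq t m * f (Suc m)) sums S" shows "(%m. pq t m * (real m * f m)) sums (t * S)"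
proof -
 have e: "pq t (Suc m) * (real (Suc m) * f (Suc m)) = t * (pq t m * f (Suc m))" for m
  by (metis mult.assoc mult.commute pq_Suc)
 have "(%m. pq t (Suc m) * (real (Suc m) * f (Suc m))) sums (t * S)"
  unfolding e by (rule sums_mult[OF assms])
 then show ?thesis by (subst (asm) sums_Suc_iff) simp
qed

lemma pq_moments:
 "(%m. pq t m * (real m - t)\<^sup>2) sums t"
 "(%m. pq t m * (real m - t) ^ 4) sums (3 * t\<^sup>2 + t)"
proof -
 note m0 = pq_sums[of t]
 have m1: "(%m. pq t m * real m) sums t"
  using pq_shift[of t "%_. 1" 1] m0 by simp
 have m2: "(%m. pq t m * real m ^ 2) sums (t * (t + 1))"
  using pq_shift[of t "%m. real m" "t + 1"] sums_add[OF m1 m0] by (simp add: algebra_simps power2_eq_square)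
 have m3: "(%m. pq t m * real m ^ 3) sums (t * (t * (t + 1) + 2 * t + 1))"
  using pq_shift[of t "%m. real m ^ 2" "t * (t + 1) + 2 * t + 1"]
   sums_add[OF sums_add[OF m2 sums_mult[OF m1, of 2]] m0]
  by (simp add: algebra_simps power2_eq_square power3_eq_cube)
 have m4: "(%m. pq t m * real m ^ 4) sums (t * (t * (t * (t + 1) + 2 * t + 1) + 3 * (t * (t + 1)) + 3 * t + 1))"
  using pq_shift[of t "%m. real m ^ 3" "t * (t * (t + 1) + 2 * t + 1) + 3 * (t * (t + 1)) + 3 * t + 1"]
   sums_add[OF sums_add[OF sums_add[OF m3 sums_mult[OF m2, of 3]] sums_mult[OF m1, of 3]] m0]
  by (simp add: algebra_simps power2_eq_square power3_eq_cube power4_eq_xxxx)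
 show "(%m. pq t m * (real m - t)\<^sup>2) sums t"
  using sums_add[OF sums_add[OF m2 sums_mult[OF m1, of "- 2 * t"]] sums_mult[OF m0, of "t\<^sup>2"]]
  by (simp add: algebra_simps power2_eq_square)
 show "(%m. pq t m * (real m - t) ^ 4) sums (3 * t\<^sup>2 + t)"
  using sums_add[OF sums_add[OF sums_add[OF sums_add[OF m4 sums_mult[OF m3, of "- 4 * t"]] sums_mult[OF m2, of "6 * t\<^sup>2"]]
    sums_mult[OF m1, of "- 4 * t ^ 3"]] sums_mult[OF m0, of "t ^ 4"]]
  by (simp add: algebra_simps power2_eq_square power3_eq_cube power4_eq_xxxx)
qed

lemma nn_pq:
 assumes "0 <= t" "!!m. 0 <= f m" "(%m. pq t m * f m) sums S"
 shows "(\<integral>\<^sup>+m. ennreal (pq t m * f m) \<partial>cs) = ennreal S"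
 unfolding nn_integral_count_space_nat using assms by (intro suminf_ennreal_eq) auto

lemma nn_pq2:
 assumes "0 <= t" "!!m. 0 <= f m" "(%m. pq t m * f m) sums S" "!!m. 0 <= g m" "(%m. pq t m * g m) sums R"
 shows "(\<integral>\<^sup>+p. ennreal (pq t (fst p) * pq t (snd p) * (f (fst p) * g (snd p))) \<partial>cs) = ennreal (S * R)"
proof -
 have S: "0 <= S"
  by (rule sums_le[OF _ sums_zero assms(3)]) (simp add: assms)
 have e: "ennreal (pq t m * pq t n * (f m * g n)) = ennreal (pq t m * f m) * ennreal (pq t n * g n)" for m n
 proof -
  have "pq t m * pq t n * (f m * g n) = (pq t m * f m) * (pq t n * g n)" by (simp only: mult_ac)
  moreover have "0 <= pq t m * f m" "0 <= pq t n * g n" using assms by auto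
  ultimately show ?thesis by (simp only: ennreal_mult)
 qed
 have "(\<integral>\<^sup>+p. ennreal (pq t (fst p) * pq t (snd p) * (f (fst p) * g (snd p))) \<partial>cs)
   = (\<integral>\<^sup>+m. \<integral>\<^sup>+n. ennreal (pq t m * f m) * ennreal (pq t n * g n) \<partial>cs \<partial>cs)"
  unfolding e by (subst nn_integral_fst_count_space[symmetric]) simp
 also have "... = (\<integral>\<^sup>+m. ennreal (pq t m * f m) * ennreal R \<partial>cs)"
  by (subst nn_integral_cmult) (simp_all add: nn_pq[OF assms(1,4,5)])
 also have "... = ennreal S * ennreal R"
  using nn_pq[OF assms(1,2,3)] by (subst nn_integral_multc) simp_all
 also have "... = ennreal (S * R)" using S by (simp add: ennreal_mult')
 finally show ?thesis .
qed

lemma integral_cs_prod: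
 fixes f g :: "nat => complex"
 assumes "integrable cs f" "integrable cs g"
 shows "(\<integral>p. f (fst p) * g (snd p) \<partial>cs) = (\<integral>m. f m \<partial>cs) * (\<integral>m. g m \<partial>cs)"
proof -
 interpret C: sigma_finite_measure "cs :: nat measure" by (rule sigma_finite_measure_count_space)
 interpret P: pair_sigma_finite "cs :: nat measure" "cs :: nat measure" ..
 have cs: "(cs :: nat measure) \<Otimes>\<^sub>M cs = (cs :: (nat \<times> nat) measure)"
  using pair_measure_countable[of "UNIV :: nat set" "UNIV :: nat set"] by simp
 have "(\<integral>\<^sup>+p. ennreal (norm (f (fst p) * g (snd p))) \<partial>cs)
   = (\<integral>\<^sup>+m. \<integral>\<^sup>+n. ennreal (norm (f m)) * ennreal (norm (g n)) \<partial>cs \<partial>cs)"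
  by (subst nn_integral_fst_count_space[symmetric]) (simp add: norm_mult ennreal_mult)
 also have "... = (\<integral>\<^sup>+m. ennreal (norm (f m)) * (\<integral>\<^sup>+n. ennreal (norm (g n)) \<partial>cs) \<partial>cs)"
  by (subst nn_integral_cmult) simp_all
 also have "... < \<infinity>"
  using assms by (subst nn_integral_multc) (simp_all add: integrable_cs_iff ennreal_mult_less_top)
 finally have "integrable cs (%p. f (fst p) * g (snd p))"
  by (simp add: integrable_cs_iff)
 then have "(\<integral>p. f (fst p) * g (snd p) \<partial>cs) = (\<integral>m. \<integral>n. f m * g n \<partial>cs \<partial>cs)"
  using P.integral_fst'[of "%p. f (fst p) * g (snd p)"] by (simp add: cs)
 then show ?thesis by simp
qed

lemma poisson_char:
 assumes "0 <= t"
 shows "(\<integral>m. of_real (pq t m) * cis \<theta> ^ m \<partial>cs) = exp (of_real t * (cis \<theta> - 1))"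
  and "integrable cs (%m. of_real (pq t m) * cis \<theta> ^ m)"
proof -
 have i: "summable (%m. norm (of_real (pq t m) * cis \<theta> ^ m :: complex))"
  using pq_sums[of t] assms by (simp add: norm_mult norm_power sums_iff)
 then show "integrable cs (%m. of_real (pq t m) * cis \<theta> ^ m)"
  by (simp add: integrable_count_space_nat_iff)
 have "(%m. exp (- of_real t) * ((of_real t * cis \<theta>) ^ m /\<^sub>R fact m)) sums (exp (- of_real t) * exp (of_real t * cis \<theta>))"
  by (intro sums_mult exp_converges)
 moreover have "exp (- of_real t) * ((of_real t * cis \<theta>) ^ m /\<^sub>R fact m) = of_real (pq t m) * cis \<theta> ^ m" for m
  by (simp add: pq_def scaleR_conv_of_real power_mult_distrib exp_of_real[symmetric] divide_inverse)
 ultimately show "(\<integral>m. of_real (pq t m) * cis \<theta> ^ m \<partial>cs) = exp (of_real t * (cis \<theta> - 1))"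
  using i by (subst integral_count_space_nat)
   (auto simp: integrable_count_space_nat_iff sums_iff exp_add[symmetric] algebra_simps)
qed

lemma axis_series:
 fixes b :: "nat \<times> nat => real" and j :: "'n::finite"
 defines "F \<equiv> %\<xi>. \<integral>p. of_real (b p) * chr (axis j (int (snd p) - int (fst p))) \<xi> \<partial>cs"
 assumes "(\<integral>\<^sup>+p. ennreal \<bar>b p\<bar> \<partial>cs) < \<infinity>"
 shows "W F" "an w F <= (\<integral>\<^sup>+p. ennreal \<bar>b p\<bar> * w (axis j (int (snd p) - int (fst p))) \<partial>cs)"
proof -
 let ?F = "%p \<xi>. of_real (b p) * chr (axis j (int (snd p) - int (fst p)) :: int^'n) \<xi>"
 have a: "an w (?F p) = ennreal \<bar>b p\<bar> * w (axis j (int (snd p) - int (fst p)))" for p w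
  by (simp add: an_cmult[OF W_chr] an_chr)
 have "W (?F p)" for p by (intro W_cmult W_chr)
 from W_series[of ?F, OF this] assms(2) a
 show "W F" "an w F <= (\<integral>\<^sup>+p. ennreal \<bar>b p\<bar> * w (axis j (int (snd p) - int (fst p))) \<partial>cs)"
  unfolding F_def by auto
qed

lemma chr_axis_diff: "chr (axis j (int n - int m)) \<xi> = cis (\<xi> $ j) ^ m * cis (- \<xi> $ j) ^ n"
 by (simp add: chr_axis Complex.DeMoivre cis_mult algebra_simps)

text \<open>The heat kernel in one variable is the law of the difference of two independent Poisson
  variables, so its moments are Poisson moments.\<close>

lemma heat_axis:
 fixes j :: "'n::finite"
 assumes "0 <= t" defines "F \<equiv> %\<xi>::real^'n. complex_of_real (exp (- (t * s1 (\<xi> $ j))))"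
 shows "W F" "an1 F <= 1" "an2 F <= ennreal (4 * t)"
proof -
 let ?b = "%p. pq t (fst p) * pq t (snd p)"
 have F: "F \<xi> = (\<integral>p. of_real (?b p) * chr (axis j (int (snd p) - int (fst p))) \<xi> \<partial>cs)" for \<xi>
 proof -
  have "(\<integral>p. of_real (?b p) * chr (axis j (int (snd p) - int (fst p))) \<xi> \<partial>cs)
   = (\<integral>p. (of_real (pq t (fst p)) * cis (\<xi> $ j) ^ fst p) * (of_real (pq t (snd p)) * cis (- \<xi> $ j) ^ snd p) \<partial>cs)"
   by (intro Bochner_Integration.integral_cong refl)
    (simp add: chr_axis_diff mult_ac)
  also have "... = exp (of_real t * (cis (\<xi> $ j) - 1)) * exp (of_real t * (cis (- \<xi> $ j) - 1))"
   by (subst integral_cs_prod) (simp_all add: poisson_char assms(1))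
  also have "... = exp (of_real t * (cis (\<xi> $ j) - 1) + of_real t * (cis (- \<xi> $ j) - 1))"
   by (simp add: exp_add)
  also have "of_real t * (cis (\<xi> $ j) - 1) + of_real t * (cis (- \<xi> $ j) - 1) = of_real (- (t * s1 (\<xi> $ j)))"
   by (simp add: complex_eq_iff s1_alt algebra_simps)
  also have "exp (of_real (- (t * s1 (\<xi> $ j)))) = F \<xi>"
   by (simp only: F_def exp_of_real)
  finally show ?thesis by simp
 qed
 have b: "(\<integral>\<^sup>+p. ennreal \<bar>?b p\<bar> \<partial>cs) = 1"
  using nn_pq2[of t "%_. 1" 1 "%_. 1" 1] pq_sums[of t] assms(1) by simp
 note * = axis_series[where b = ?b and j = j, unfolded F[symmetric]]
 show "W F" using *(1) b by simp
 show "an1 F <= 1" using *(2)[of "%_. 1"] b by simp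
 have "an2 F <= (\<integral>\<^sup>+p. ennreal (?b p) * ennreal ((real (snd p) - real (fst p))\<^sup>2) \<partial>cs)"
  using *(2)[of sqw] b assms(1) by (simp add: sqw_axis)
 also have "... <= (\<integral>\<^sup>+p. ennreal (?b p * (2 * (real (fst p) - t)\<^sup>2 * 1)) + ennreal (?b p * (1 * (2 * (real (snd p) - t)\<^sup>2))) \<partial>cs)"
 proof (rule nn_integral_mono)
  fix p :: "nat \<times> nat"
  obtain x y where xy: "x = real (fst p) - t" "y = real (snd p) - t" by auto
  have "(y - x)\<^sup>2 <= 2 * x\<^sup>2 + 2 * y\<^sup>2" using sum_squares_ge_zero[of "x + y" 0] by (simp add: power2_eq_square algebra_simps)
  moreover have "real (snd p) - real (fst p) = y - x" by (simp add: xy)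
  ultimately have "(real (snd p) - real (fst p))\<^sup>2 <= 2 * x\<^sup>2 + 2 * y\<^sup>2" by simp
  then have "?b p * (real (snd p) - real (fst p))\<^sup>2 <= ?b p * (2 * x\<^sup>2 + 2 * y\<^sup>2)"
   using assms(1) by (intro mult_left_mono) auto
  also have "... = ?b p * (2 * x\<^sup>2 * 1) + ?b p * (1 * (2 * y\<^sup>2))" by (simp only: distrib_left mult_1 mult_1_right)
  finally have "ennreal (?b p * (real (snd p) - real (fst p))\<^sup>2) <= ennreal (?b p * (2 * x\<^sup>2 * 1) + ?b p * (1 * (2 * y\<^sup>2)))"
   by (rule ennreal_leI)
  also have "... = ennreal (?b p * (2 * x\<^sup>2 * 1)) + ennreal (?b p * (1 * (2 * y\<^sup>2)))"
   using assms(1) by (intro ennreal_plus) auto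
  finally show "ennreal (?b p) * ennreal ((real (snd p) - real (fst p))\<^sup>2) <= ennreal (?b p * (2 * (real (fst p) - t)\<^sup>2 * 1)) + ennreal (?b p * (1 * (2 * (real (snd p) - t)\<^sup>2)))"
   unfolding xy using assms(1) by (subst ennreal_mult[symmetric]) auto
 qed
 also have "... = ennreal (2 * t * 1) + ennreal (1 * (2 * t))"
 proof -
  have s: "(%m. pq t m * (2 * (real m - t)\<^sup>2)) sums (2 * t)"
   using sums_mult[OF pq_moments(1)[of t], of 2] by (simp add: mult_ac)
  have "(\<integral>\<^sup>+p. ennreal (?b p * (2 * (real (fst p) - t)\<^sup>2 * 1)) \<partial>cs) = ennreal (2 * t * 1)"
   using nn_pq2[of t "%m. 2 * (real m - t)\<^sup>2" "2 * t" "%_. 1" 1] s pq_sums[of t] assms(1) by simp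
  moreover have "(\<integral>\<^sup>+p. ennreal (?b p * (1 * (2 * (real (snd p) - t)\<^sup>2))) \<partial>cs) = ennreal (1 * (2 * t))"
   using nn_pq2[of t "%_. 1" 1 "%m. 2 * (real m - t)\<^sup>2" "2 * t"] s pq_sums[of t] assms(1) by simp
  ultimately show ?thesis by (subst nn_integral_add) auto
 qed
 also have "... = ennreal (4 * t)" using assms(1) by (simp add: ennreal_plus[symmetric] del: ennreal_plus)
 finally show "an2 F <= ennreal (4 * t)" .
qed

lemma heat_axis_diff:
 fixes j :: "'n::finite"
 assumes "0 < t" defines "F \<equiv> %\<xi>::real^'n. fd j \<xi> * complex_of_real (exp (- (t * s1 (\<xi> $ j))))"
 shows "W F" "an1 F <= ennreal (1 / sqrt t)" "1 <= t ==> an2 F <= ennreal (7 * sqrt t)"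
proof -
 let ?b = "%p. (real (fst p) / t - 1) * (pq t (fst p) * pq t (snd p))"
 define r where "r = sqrt t"
 have r: "0 < r" "r * r = t" using assms(1) by (auto simp: r_def)
 have one: "(\<integral>m. of_real ((real m / t - 1) * pq t m) * z ^ m \<partial>cs) = (z - 1) * exp (of_real t * (z - 1))"
  "integrable cs (%m. of_real ((real m / t - 1) * pq t m) * z ^ m)" if z: "z = cis \<theta>" for z \<theta>
 proof -
  have S: "summable (%m. norm (of_real (pq t m) * z ^ m :: complex))"
   using pq_sums[of t] assms by (simp add: norm_mult norm_power sums_iff z)
  have "(\<integral>m. of_real (pq t m) * z ^ m \<partial>cs) = exp (of_real t * (z - 1))" using poisson_char(1)[of t \<theta>] assms(1) z by simp
  then have s1: "(%m. of_real (pq t m) * z ^ m) sums exp (of_real t * (z - 1))"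
   using S summable_norm_cancel[OF S] by (subst (asm) integral_count_space_nat) (auto simp: integrable_count_space_nat_iff sums_iff)
  have e: "of_real (real (Suc m) / t * pq t (Suc m)) * z ^ Suc m = z * (of_real (pq t m) * z ^ m)" for m
  proof -
   have "real (Suc m) / t * pq t (Suc m) = pq t m" using assms(1) pq_Suc[of m t] by (simp add: field_simps)
   then show ?thesis by simp
  qed
  have "(%m. of_real (real (Suc m) / t * pq t (Suc m)) * z ^ Suc m) sums (z * exp (of_real t * (z - 1)))"
   unfolding e by (rule sums_mult[OF s1])
  then have "(%m. of_real (real m / t * pq t m) * z ^ m) sums (z * exp (of_real t * (z - 1)))"
   by (subst (asm) sums_Suc_iff) simp
  from sums_diff[OF this s1] have s2: "(%m. of_real ((real m / t - 1) * pq t m) * z ^ m) sums ((z - 1) * exp (of_real t * (z - 1)))"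
   by (simp add: algebra_simps)
  have "summable (%m. norm (z * (of_real (pq t m) * z ^ m)))"
   using S by (simp add: norm_mult z)
  then have "summable (%m. norm (of_real (real (Suc m) / t * pq t (Suc m)) * z ^ Suc m))"
   unfolding e .
  then have "summable (%m. norm (of_real (real m / t * pq t m) * z ^ m))"
   by (subst (asm) summable_Suc_iff)
  from summable_add[OF this S] have "summable (%m. norm (of_real ((real m / t - 1) * pq t m) * z ^ m))"
  proof (rule summable_comparison_test'[of _ 0])
   fix m :: nat
   have "of_real ((real m / t - 1) * pq t m) * z ^ m = of_real (real m / t * pq t m) * z ^ m - of_real (pq t m) * z ^ m"
    by (simp add: algebra_simps)
   then show "norm (norm (of_real ((real m / t - 1) * pq t m) * z ^ m)) <= norm (of_real (real m / t * pq t m) * z ^ m) + norm (of_real (pq t m) * z ^ m)"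
    by (simp only: real_norm_def abs_norm_cancel norm_triangle_ineq4)
  qed
  then show i: "integrable cs (%m. of_real ((real m / t - 1) * pq t m) * z ^ m)"
   by (simp add: integrable_count_space_nat_iff)
  show "(\<integral>m. of_real ((real m / t - 1) * pq t m) * z ^ m \<partial>cs) = (z - 1) * exp (of_real t * (z - 1))"
   using s2 by (subst integral_count_space_nat[OF i]) (simp add: sums_iff)
 qed
 have F: "F \<xi> = (\<integral>p. of_real (?b p) * chr (axis j (int (snd p) - int (fst p))) \<xi> \<partial>cs)" for \<xi>
 proof -
  have "(\<integral>p. of_real (?b p) * chr (axis j (int (snd p) - int (fst p))) \<xi> \<partial>cs)
   = (\<integral>p. (of_real ((real (fst p) / t - 1) * pq t (fst p)) * cis (\<xi> $ j) ^ fst p) * (of_real (pq t (snd p)) * cis (- \<xi> $ j) ^ snd p) \<partial>cs)"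
   by (intro Bochner_Integration.integral_cong refl)
    (simp add: chr_axis_diff mult_ac)
  also have "... = ((cis (\<xi> $ j) - 1) * exp (of_real t * (cis (\<xi> $ j) - 1))) * exp (of_real t * (cis (- \<xi> $ j) - 1))"
   by (subst integral_cs_prod[OF one(2)[OF refl] poisson_char(2)[OF less_imp_le[OF assms(1)]]])
    (simp only: one(1)[OF refl] poisson_char(1)[OF less_imp_le[OF assms(1)]])
  also have "... = (cis (\<xi> $ j) - 1) * exp (of_real t * (cis (\<xi> $ j) - 1) + of_real t * (cis (- \<xi> $ j) - 1))"
   by (simp add: exp_add mult.assoc)
  also have "of_real t * (cis (\<xi> $ j) - 1) + of_real t * (cis (- \<xi> $ j) - 1) = of_real (- (t * s1 (\<xi> $ j)))"
   by (simp add: complex_eq_iff s1_alt algebra_simps)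
  also have "(cis (\<xi> $ j) - 1) * exp (of_real (- (t * s1 (\<xi> $ j)))) = F \<xi>"
   by (simp only: F_def fd_def exp_of_real)
  finally show ?thesis by simp
 qed
 have ab: "\<bar>?b p\<bar> = pq t (fst p) * pq t (snd p) * (\<bar>real (fst p) - t\<bar> / t)" for p
 proof -
  have "real (fst p) / t - 1 = (real (fst p) - t) / t" using assms(1) by (simp add: field_simps)
  then show ?thesis using assms(1) by (simp add: abs_mult)
 qed
 have s0: "(%m. pq t m * 1) sums 1" using pq_sums[of t] by simp
 have sA: "(%m. pq t m * (((real m - t)\<^sup>2 / r + r) / (2 * t))) sums (1 / r)"
 proof -
  have "(%m. (pq t m * (real m - t)\<^sup>2) * (1 / (2 * t * r)) + pq t m * (r / (2 * t))) sums (t * (1 / (2 * t * r)) + 1 * (r / (2 * t)))"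
   by (intro sums_add sums_mult2 pq_moments pq_sums)
  moreover have "t * (1 / (2 * t * r)) + 1 * (r / (2 * t)) = 1 / r"
   unfolding r(2)[symmetric] using r(1) by (simp add: field_simps)
  moreover have "(pq t m * (real m - t)\<^sup>2) * (1 / (2 * t * r)) + pq t m * (r / (2 * t)) = pq t m * (((real m - t)\<^sup>2 / r + r) / (2 * t))" for m
   using r(1) assms(1) by (simp add: field_simps)
  ultimately show ?thesis by simp
 qed
 have absb: "\<bar>x\<bar> <= (x\<^sup>2 / r + r) / 2" for x
 proof -
  have "0 <= (\<bar>x\<bar> - r)\<^sup>2" by simp
  then have "2 * r * \<bar>x\<bar> <= x\<^sup>2 + r\<^sup>2" by (simp add: power2_eq_square algebra_simps)
  then show ?thesis using r(1) by (simp add: field_simps power2_eq_square)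
 qed
 have "(\<integral>\<^sup>+p. ennreal \<bar>?b p\<bar> \<partial>cs) <= (\<integral>\<^sup>+p. ennreal (pq t (fst p) * pq t (snd p) * (((real (fst p) - t)\<^sup>2 / r + r) / (2 * t) * 1)) \<partial>cs)"
 proof (intro nn_integral_mono ennreal_leI)
  fix p :: "nat \<times> nat"
  have "\<bar>real (fst p) - t\<bar> / t <= ((real (fst p) - t)\<^sup>2 / r + r) / (2 * t) * 1"
   using absb[of "real (fst p) - t"] assms(1) by (simp add: field_simps)
  then show "\<bar>?b p\<bar> <= pq t (fst p) * pq t (snd p) * (((real (fst p) - t)\<^sup>2 / r + r) / (2 * t) * 1)"
   unfolding ab using assms(1) by (intro mult_left_mono) auto
 qed
 also have "... = ennreal (1 / r * 1)"
  using r assms(1) by (intro nn_pq2 sA s0) auto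
 finally have b: "(\<integral>\<^sup>+p. ennreal \<bar>?b p\<bar> \<partial>cs) <= ennreal (1 / r)" by simp
 also have "... < \<infinity>" by simp
 finally have b': "(\<integral>\<^sup>+p. ennreal \<bar>?b p\<bar> \<partial>cs) < \<infinity>" .
 note * = axis_series[where b = ?b and j = j, OF b', unfolded F[symmetric]]
 show "W F" using *(1) by simp
 show "an1 F <= ennreal (1 / sqrt t)" using *(2)[of "%_. 1"] b by (simp add: r_def)
 assume t1: "1 <= t"
 have "an2 F <= (\<integral>\<^sup>+p. ennreal \<bar>?b p\<bar> * ennreal ((real (snd p) - real (fst p))\<^sup>2) \<partial>cs)"
  using *(2)[of sqw] by (simp add: sqw_axis)
 also have "... <= (\<integral>\<^sup>+p. ennreal (pq t (fst p) * pq t (snd p) * (((real (fst p) - t)\<^sup>2 * r + (real (fst p) - t)^4 / r) / t * 1)) +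
   ennreal (pq t (fst p) * pq t (snd p) * (((real (fst p) - t)\<^sup>2 / r + r) / (2 * t) * (2 * (real (snd p) - t)\<^sup>2))) \<partial>cs)"
 proof (rule nn_integral_mono)
  fix p :: "nat \<times> nat"
  obtain x y where xy: "x = real (fst p) - t" "y = real (snd p) - t" by auto
  have "(y - x)\<^sup>2 <= 2 * x\<^sup>2 + 2 * y\<^sup>2" using sum_squares_ge_zero[of "x + y" 0] by (simp add: power2_eq_square algebra_simps)
  moreover have "real (snd p) - real (fst p) = y - x" by (simp add: xy)
  ultimately have 1: "(real (snd p) - real (fst p))\<^sup>2 <= 2 * x\<^sup>2 + 2 * y\<^sup>2" by simp
  have "\<bar>x\<bar> / t * (real (snd p) - real (fst p))\<^sup>2 <= ((x\<^sup>2 / r + r) / 2) / t * (2 * x\<^sup>2 + 2 * y\<^sup>2)"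
   using assms(1) r(1) by (intro mult_mono 1 divide_right_mono absb) auto
  also have "... = (x\<^sup>2 * r + x ^ 4 / r) / t * 1 + (x\<^sup>2 / r + r) / (2 * t) * (2 * y\<^sup>2)"
   using r(1) assms(1) by (simp add: field_simps power2_eq_square power4_eq_xxxx)
  finally have "pq t (fst p) * pq t (snd p) * (\<bar>x\<bar> / t * (real (snd p) - real (fst p))\<^sup>2) \<le>
    pq t (fst p) * pq t (snd p) * ((x\<^sup>2 * r + x ^ 4 / r) / t * 1 + (x\<^sup>2 / r + r) / (2 * t) * (2 * y\<^sup>2))"
   using assms(1) by (intro mult_left_mono) auto
  then have "ennreal (\<bar>?b p\<bar> * (real (snd p) - real (fst p))\<^sup>2) <= ennreal (pq t (fst p) * pq t (snd p) * ((x\<^sup>2 * r + x ^ 4 / r) / t * 1)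
    + pq t (fst p) * pq t (snd p) * ((x\<^sup>2 / r + r) / (2 * t) * (2 * y\<^sup>2)))"
   unfolding ab by (intro ennreal_leI) (simp add: xy[symmetric] algebra_simps)
  then show "ennreal \<bar>?b p\<bar> * ennreal ((real (snd p) - real (fst p))\<^sup>2) <= ennreal (pq t (fst p) * pq t (snd p) * (((real (fst p) - t)\<^sup>2 * r + (real (fst p) - t)^4 / r) / t * 1)) +
   ennreal (pq t (fst p) * pq t (snd p) * (((real (fst p) - t)\<^sup>2 / r + r) / (2 * t) * (2 * (real (snd p) - t)\<^sup>2)))"
   using r(1) assms(1) unfolding xy by (subst (asm) ennreal_plus) (auto simp: ennreal_mult intro!: mult_nonneg_nonneg divide_nonneg_nonneg add_nonneg_nonneg)
 qed
 also have "... = ennreal ((t * r + (3 * t\<^sup>2 + t) / r) / t * 1) + ennreal (1 / r * (2 * t))"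
 proof -
  have s1: "(%m. pq t m * (((real m - t)\<^sup>2 * r + (real m - t)^4 / r) / t)) sums ((t * r + (3 * t\<^sup>2 + t) / r) / t)"
   using sums_divide[OF sums_add[OF sums_mult2[OF pq_moments(1)[of t], of r] sums_divide[OF pq_moments(2)[of t], of r]], of t]
   by (simp add: field_simps)
  have s2: "(%m. pq t m * (2 * (real m - t)\<^sup>2)) sums (2 * t)"
   using sums_mult[OF pq_moments(1)[of t], of 2] by (simp add: mult_ac)
  show ?thesis
   using r(1) assms(1) by (subst nn_integral_add, simp, simp, subst nn_pq2[OF _ _ s1 _ s0], simp, simp, simp, subst nn_pq2[OF _ _ sA _ s2]) auto
 qed
 also have "... <= ennreal (7 * sqrt t)"
 proof -
  have "(t * r + (3 * t\<^sup>2 + t) / r) / t * 1 + 1 / r * (2 * t) = r + 3 * r + 1 / r + 2 * r"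
   unfolding r(2)[symmetric] using r(1) by (simp add: field_simps power2_eq_square)
  also have "... <= 7 * r"
  proof -
   have "1 <= r" using t1 by (simp add: r_def)
   then have "1 / r <= r" using r(2) t1 by (simp add: field_simps)
   then show ?thesis by simp
  qed
  finally have le: "(t * r + (3 * t\<^sup>2 + t) / r) / t * 1 + 1 / r * (2 * t) <= 7 * r" .
  have "0 <= (t * r + (3 * t\<^sup>2 + t) / r) / t * 1" "0 <= 1 / r * (2 * t)"
   using r(1) assms(1) by (auto intro!: divide_nonneg_nonneg add_nonneg_nonneg mult_nonneg_nonneg)
  then show ?thesis unfolding r_def[symmetric] using le by (metis ennreal_leI ennreal_plus)
 qed
 finally show "an2 F <= ennreal (7 * sqrt t)" .
qed


lemma W_mult_bounds:
 fixes F :: "real^'n => complex"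
 assumes "W F" "W G" "an1 F <= ennreal a" "an1 G <= ennreal a'" "0 <= a" "0 <= a'"
 shows "an1 (%\<xi>. F \<xi> * G \<xi>) <= ennreal (a * a')"
  and "an2 F <= ennreal b ==> an2 G <= ennreal b' ==> 0 <= b ==> 0 <= b' ==>
   an2 (%\<xi>. F \<xi> * G \<xi>) <= ennreal (2 * (b * a' + a * b'))"
proof -
 show "an1 (%\<xi>. F \<xi> * G \<xi>) <= ennreal (a * a')"
  using order_trans[OF an1_mult_le[OF assms(1,2)] mult_mono[OF assms(3,4)]] assms(5,6)
  by (simp add: ennreal_mult)
 assume b: "an2 F <= ennreal b" "an2 G <= ennreal b'" "0 <= b" "0 <= b'"
 have "an2 (%\<xi>. F \<xi> * G \<xi>) <= 2 * (ennreal b * ennreal a' + ennreal a * ennreal b')"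
  by (rule order_trans[OF an2_mult_le[OF assms(1,2)]]) (intro mult_left_mono add_mono mult_mono b assms zero_le)
 also have "... = ennreal (2 * (b * a' + a * b'))"
 proof -
  have "ennreal (b * a' + a * b') = ennreal b * ennreal a' + ennreal a * ennreal b'"
   using b assms by (simp add: ennreal_mult)
  moreover have "ennreal (2 * (b * a' + a * b')) = 2 * ennreal (b * a' + a * b')"
   using b assms by (subst ennreal_mult) auto
  ultimately show ?thesis by simp
 qed
 finally show "an2 (%\<xi>. F \<xi> * G \<xi>) <= ennreal (2 * (b * a' + a * b'))" .
qed

lemma heat_axes:
 fixes J :: "'n::finite set"
 shows "\<exists>C\<ge>0. \<forall>t\<ge>0. W (%\<xi>. of_real (exp (- (t * (\<Sum>j\<in>J. s1 (\<xi> $ j))))))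
  & an1 (%\<xi>. of_real (exp (- (t * (\<Sum>j\<in>J. s1 (\<xi> $ j)))))) <= ennreal 1
  & an2 (%\<xi>. of_real (exp (- (t * (\<Sum>j\<in>J. s1 (\<xi> $ j)))))) <= ennreal (C * t)"
proof (induction J rule: infinite_finite_induct)
 case empty
 have "an2 (%\<xi>::real^'n. 1) = 0"
 proof -
  have "chr (0::int^'n) = (%\<xi>. 1)" by (simp add: fun_eq_iff)
  then show ?thesis using an_chr[of sqw "0::int^'n"] by (simp add: sqw_def)
 qed
 then show ?case by (intro exI[of _ 0]) (auto simp: W_const an1_const)
next
 case (insert j J)
 then obtain C where C: "0 <= C" and IH: "!!t. 0 <= t ==> W (%\<xi>. of_real (exp (- (t * (\<Sum>j\<in>J. s1 (\<xi> $ j))))))"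
  "!!t. 0 <= t ==> an1 (%\<xi>. of_real (exp (- (t * (\<Sum>j\<in>J. s1 (\<xi> $ j)))))) <= ennreal 1"
  "!!t. 0 <= t ==> an2 (%\<xi>. of_real (exp (- (t * (\<Sum>j\<in>J. s1 (\<xi> $ j)))))) <= ennreal (C * t)"
  by auto
 have e: "(%\<xi>. complex_of_real (exp (- (t * (\<Sum>j\<in>insert j J. s1 (\<xi> $ j))))))
  = (%\<xi>. of_real (exp (- (t * s1 (\<xi> $ j)))) * of_real (exp (- (t * (\<Sum>j\<in>J. s1 (\<xi> $ j))))))" for t
  using insert(1,2) by (simp add: distrib_left exp_add[symmetric] flip: of_real_mult)
 show ?case
 proof (intro exI[of _ "8 + 2 * C"] conjI allI impI)
  fix t :: real assume t: "0 <= t"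
  show "W (%\<xi>. complex_of_real (exp (- (t * (\<Sum>j\<in>insert j J. s1 (\<xi> $ j))))))"
   unfolding e by (rule W_mult[OF heat_axis(1)[OF t] IH(1)[OF t]])
  show "an1 (%\<xi>. complex_of_real (exp (- (t * (\<Sum>j\<in>insert j J. s1 (\<xi> $ j)))))) <= ennreal 1"
   unfolding e using W_mult_bounds(1)[OF heat_axis(1)[OF t] IH(1)[OF t] _ IH(2)[OF t], of j 1] heat_axis(2)[OF t, of j] by (simp del: of_real_mult)
  have "an2 (%\<xi>. complex_of_real (exp (- (t * (\<Sum>j\<in>insert j J. s1 (\<xi> $ j)))))) <= ennreal (2 * (4 * t * 1 + 1 * (C * t)))"
   unfolding e using heat_axis(2)[OF t]  t C
   by (intro W_mult_bounds(2)[OF heat_axis(1)[OF t] IH(1)[OF t] _ IH(2)[OF t] _ _ heat_axis(3)[OF t] IH(3)[OF t]]) auto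
  then show "an2 (%\<xi>. complex_of_real (exp (- (t * (\<Sum>j\<in>insert j J. s1 (\<xi> $ j)))))) <= ennreal ((8 + 2 * C) * t)"
   by (simp add: algebra_simps)
 qed (use C in auto)
qed auto

lemma heat_W: "0 <= t ==> W (heat t)" and heat_an1: "0 <= t ==> an1 (heat t) <= 1"
 using heat_axes[of "UNIV"] unfolding heat_def[abs_def] sg_def[abs_def] by auto

lemma fd_chr: "fd j = (%\<xi>. chr (axis j (- 1)) \<xi> - chr 0 \<xi>)"
 by (auto simp: fd_def chr_axis)

lemma fd_W: "W (fd j)" unfolding fd_chr by (intro W_diff W_chr)

lemma fd_an1: "an1 (fd j) <= ennreal 2"
 unfolding fd_chr using an_diff_le[OF W_chr W_chr, of "%_. 1" "axis j (- 1)" 0] by (simp add: an_chr)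

lemma fd_an2: "an2 (fd j) <= ennreal 1"
 unfolding fd_chr using an_diff_le[OF W_chr W_chr, of sqw "axis j (- 1)" 0] by (simp add: an_chr sqw_axis) (simp add: sqw_def)

lemma fd_heat:
 fixes j :: "'n::finite"
 shows "\<exists>C\<ge>0. \<forall>t>0. W (%\<xi>. fd j \<xi> * heat t \<xi>) & an1 (%\<xi>. fd j \<xi> * heat t \<xi>) <= ennreal (1 / sqrt t)
  & (1 <= t --> an2 (%\<xi>. fd j \<xi> * heat t \<xi>) <= ennreal (C * sqrt t))"
proof -
 obtain C where C: "0 <= C" and H: "!!t. 0 <= t ==> W (%\<xi>. of_real (exp (- (t * (\<Sum>j\<in>UNIV-{j}. s1 (\<xi> $ j))))))"
  "!!t. 0 <= t ==> an1 (%\<xi>. of_real (exp (- (t * (\<Sum>j\<in>UNIV-{j}. s1 (\<xi> $ j)))))) <= ennreal 1"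
  "!!t. 0 <= t ==> an2 (%\<xi>. of_real (exp (- (t * (\<Sum>j\<in>UNIV-{j}. s1 (\<xi> $ j)))))) <= ennreal (C * t)"
  using heat_axes[of "UNIV - {j}"] by auto
 have e: "(%\<xi>. fd j \<xi> * heat t \<xi>) = (%\<xi>. (fd j \<xi> * of_real (exp (- (t * s1 (\<xi> $ j))))) * of_real (exp (- (t * (\<Sum>j\<in>UNIV-{j}. s1 (\<xi> $ j))))))" for t
  unfolding heat_def sg_def by (subst sum.remove[of UNIV j]) (auto simp: distrib_left exp_add[symmetric] mult.assoc simp flip: of_real_mult)
 show ?thesis
 proof (intro exI[of _ "14 + 2 * C"] conjI allI impI)
  fix t :: real assume t: "0 < t"
  note H = H[OF less_imp_le[OF t]] and D = heat_axis_diff[OF t, of j]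
  show "W (%\<xi>. fd j \<xi> * heat t \<xi>)" unfolding e by (rule W_mult[OF D(1) H(1)])
  show "an1 (%\<xi>. fd j \<xi> * heat t \<xi>) <= ennreal (1 / sqrt t)"
   unfolding e using W_mult_bounds(1)[OF D(1) H(1) D(2) H(2)] t by simp
  assume t1: "1 <= t"
  have "an2 (%\<xi>. fd j \<xi> * heat t \<xi>) <= ennreal (2 * (7 * sqrt t * 1 + 1 / sqrt t * (C * t)))"
   unfolding e using t C by (intro W_mult_bounds(2)[OF D(1) H(1) D(2) H(2) _ _ D(3)[OF t1] H(3)]) auto
  also have "2 * (7 * sqrt t * 1 + 1 / sqrt t * (C * t)) = (14 + 2 * C) * sqrt t"
  proof -
   have "1 / sqrt t * (C * t) = C * sqrt t" using t by (simp add: field_simps)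
   then show ?thesis by (simp add: algebra_simps)
  qed
  finally show "an2 (%\<xi>. fd j \<xi> * heat t \<xi>) <= ennreal ((14 + 2 * C) * sqrt t)" .
 qed (use C in auto)
qed

lemma heat_split: "heat t \<xi> = heat (t / 2) \<xi> * heat (t / 2) \<xi>"
 by (simp add: heat_def exp_add[symmetric] flip: of_real_mult)

text \<open>
  Two differences of the heat kernel gain a factor \<open>1 / t\<close> in \<open>L\<^sup>1\<close>, while the second
  moment stays bounded. Interpolating between the two estimates at \<open>t = R\<^sup>2\<close> gives the decay
  of the differenced Riesz kernel beyond distance \<open>R\<close>.
\<close>

lemma fd_fd_heat:
 fixes j k :: "'n::finite"
 shows "\<exists>C\<ge>0. \<forall>t>0. W (%\<xi>. fd k \<xi> * (fd j \<xi> * heat t \<xi>)) & an1 (%\<xi>. fd k \<xi> * (fd j \<xi> * heat t \<xi>)) <= ennreal (2 / t)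
  & an2 (%\<xi>. fd k \<xi> * (fd j \<xi> * heat t \<xi>)) <= ennreal C"
proof -
 obtain C where C: "0 <= C" and H: "!!t. 0 < t ==> W (%\<xi>. fd j \<xi> * heat t \<xi>)"
  "!!t. 0 < t ==> an1 (%\<xi>. fd j \<xi> * heat t \<xi>) <= ennreal (1 / sqrt t)"
  "!!t. 1 <= t ==> an2 (%\<xi>. fd j \<xi> * heat t \<xi>) <= ennreal (C * sqrt t)"
  using fd_heat[of j] by (auto simp: order_less_le_trans[OF zero_less_one])
 obtain C' where C': "0 <= C'" and H': "!!t. 0 < t ==> W (%\<xi>. fd k \<xi> * heat t \<xi>)"
  "!!t. 0 < t ==> an1 (%\<xi>. fd k \<xi> * heat t \<xi>) <= ennreal (1 / sqrt t)"
  "!!t. 1 <= t ==> an2 (%\<xi>. fd k \<xi> * heat t \<xi>) <= ennreal (C' * sqrt t)"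
  using fd_heat[of k] by (auto simp: order_less_le_trans[OF zero_less_one])
 obtain D where D: "0 <= D" and HD: "!!t. 0 <= t ==> an2 (heat t :: real^'n => complex) <= ennreal (D * t)"
  using heat_axes[of "UNIV :: 'n set"] unfolding heat_def[abs_def] sg_def[abs_def] by auto
 define E where "E = max (2 * (C' + C)) (2 * (8 * 1 + 4 * (2 * D)))"
 have e: "(%\<xi>. fd k \<xi> * (fd j \<xi> * heat t \<xi>)) = (%\<xi>. (fd k \<xi> * heat (t / 2) \<xi>) * (fd j \<xi> * heat (t / 2) \<xi>))" for t
  by (subst heat_split) (simp add: mult_ac)
 show ?thesis
 proof (intro exI[of _ E] conjI allI impI)
  show "0 <= E" using C C' by (simp add: E_def)
  fix t :: real assume t: "0 < t"
  then have t2: "0 < t / 2" by simp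
  show "W (%\<xi>. fd k \<xi> * (fd j \<xi> * heat t \<xi>))" unfolding e by (rule W_mult[OF H'(1)[OF t2] H(1)[OF t2]])
  have "an1 (%\<xi>. fd k \<xi> * (fd j \<xi> * heat t \<xi>)) <= ennreal (1 / sqrt (t / 2) * (1 / sqrt (t / 2)))"
   unfolding e using t by (intro W_mult_bounds(1)[OF H'(1)[OF t2] H(1)[OF t2] H'(2)[OF t2] H(2)[OF t2]]) auto
  also have "1 / sqrt (t / 2) * (1 / sqrt (t / 2)) = 2 / t" using t by (simp add: field_simps)
  finally show "an1 (%\<xi>. fd k \<xi> * (fd j \<xi> * heat t \<xi>)) <= ennreal (2 / t)" .
  show "an2 (%\<xi>. fd k \<xi> * (fd j \<xi> * heat t \<xi>)) <= ennreal E"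
  proof (cases "2 <= t")
   case True
   then have t1: "1 <= t / 2" by simp
   have "an2 (%\<xi>. fd k \<xi> * (fd j \<xi> * heat t \<xi>)) <= ennreal (2 * ((C' * sqrt (t / 2)) * (1 / sqrt (t / 2)) + (1 / sqrt (t / 2)) * (C * sqrt (t / 2))))"
    unfolding e using t C C' by (intro W_mult_bounds(2)[OF H'(1)[OF t2] H(1)[OF t2] H'(2)[OF t2] H(2)[OF t2] _ _ H'(3)[OF t1] H(3)[OF t1]]) auto
   also have "2 * ((C' * sqrt (t / 2)) * (1 / sqrt (t / 2)) + (1 / sqrt (t / 2)) * (C * sqrt (t / 2))) = 2 * (C' + C)"
    using t by simp
   also have "ennreal ... <= ennreal E" by (intro ennreal_leI) (simp add: E_def)
   finally show ?thesis .
  next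
   case False
   have ff: "W (%\<xi>. fd k \<xi> * fd j \<xi>)" "an1 (%\<xi>. fd k \<xi> * fd j \<xi>) <= ennreal 4" "an2 (%\<xi>. fd k \<xi> * fd j \<xi>) <= ennreal 8"
    using W_mult[OF fd_W fd_W, of k j] W_mult_bounds(1)[OF fd_W fd_W fd_an1 fd_an1, of k j]
     W_mult_bounds(2)[OF fd_W fd_W fd_an1 fd_an1 _ _ fd_an2 fd_an2, of k j] by auto
   have e': "(%\<xi>. fd k \<xi> * (fd j \<xi> * heat t \<xi>)) = (%\<xi>. (fd k \<xi> * fd j \<xi>) * heat t \<xi>)" by (simp add: mult.assoc)
   have h1: "an1 (heat t :: real^'n => complex) <= ennreal 1" using heat_an1[of t] t by simp
   have "an2 (heat t :: real^'n => complex) <= ennreal (D * t)" using HD t by simp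
   also have "... <= ennreal (2 * D)" using D False mult_left_mono[of t 2 D] by (intro ennreal_leI) (simp add: mult.commute)
   finally have h2: "an2 (heat t :: real^'n => complex) <= ennreal (2 * D)" .
   have "an2 (%\<xi>. fd k \<xi> * (fd j \<xi> * heat t \<xi>)) <= ennreal (2 * (8 * 1 + 4 * (2 * D)))"
    unfolding e' using D t by (intro W_mult_bounds(2)[OF ff(1) heat_W ff(2) h1 _ _ ff(3) h2]) auto
   also have "... <= ennreal E" by (intro ennreal_leI) (simp add: E_def)
   finally show ?thesis .
  qed
 qed
qed

section \<open>Orthogonal expansions and one-dimensional Fourier series\<close>

lemma cnj_measurable [measurable]: "cnj : borel_measurable borel"
 by (intro borel_measurable_continuous_onI continuous_intros)

lemma parseval_finite:
 fixes e :: "'i => 'a => complex"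
 assumes M: "finite_measure M" and F: "finite F"
  and [measurable]: "!!i. e i : borel_measurable M" and b: "!!i x. norm (e i x) <= 1"
  and orth: "!!i j. i : F ==> j : F ==> (\<integral>x. e i x * cnj (e j x) \<partial>M) = (if i = j then of_real c else 0)"
 shows "(\<integral>x. (norm (\<Sum>i\<in>F. a i * e i x))\<^sup>2 \<partial>M) = c * (\<Sum>i\<in>F. (norm (a i))\<^sup>2)"
proof -
 interpret finite_measure M by fact
 have [simp]: "integrable M (%x. e i x * cnj (e j x))" for i j
  by (rule integrable_const_bound[where B = 1]) (auto simp: norm_mult intro!: mult_le_one b)
 have "complex_of_real (\<integral>x. (norm (\<Sum>i\<in>F. a i * e i x))\<^sup>2 \<partial>M) = (\<integral>x. (\<Sum>i\<in>F. \<Sum>j\<in>F. (a i * cnj (a j)) * (e i x * cnj (e j x))) \<partial>M)"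
  unfolding integral_complex_of_real[symmetric]
  by (intro Bochner_Integration.integral_cong refl) (simp only: complex_norm_square cnj_sum sum_product complex_cnj_mult mult_ac)
 also have "... = (\<Sum>i\<in>F. \<Sum>j\<in>F. (a i * cnj (a j)) * (if i = j then of_real c else 0))"
  by (simp add: orth)
 also have "... = (\<Sum>i\<in>F. of_real (c * (norm (a i))\<^sup>2))"
  by (intro sum.cong refl) (simp add: if_distrib sum.delta F complex_norm_square mult_ac del: of_real_power cong: if_cong)
 also have "... = of_real (c * (\<Sum>i\<in>F. (norm (a i))\<^sup>2))" by (simp add: sum_distrib_left)
 finally show ?thesis by (simp only: of_real_eq_iff)
qed

lemma bessel:
 fixes e :: "'i => 'a => complex"
 assumes M: "finite_measure M" and F: "finite F"
  and [measurable]: "!!i. e i : borel_measurable M" and b: "!!i x. norm (e i x) <= 1"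
  and orth: "!!i j. i : F ==> j : F ==> (\<integral>x. e i x * cnj (e j x) \<partial>M) = (if i = j then of_real c else 0)"
  and c: "0 < c" and [measurable]: "g : borel_measurable M" and gB: "!!x. x : space M ==> norm (g x) <= B"
 shows "(\<Sum>i\<in>F. (norm (\<integral>x. g x * cnj (e i x) \<partial>M))\<^sup>2) <= c * (\<integral>x. (norm (g x))\<^sup>2 \<partial>M)"
proof -
 interpret finite_measure M by fact
 define a where "a i = (\<integral>x. g x * cnj (e i x) \<partial>M) / of_real c" for i
 define S where "S x = (\<Sum>i\<in>F. a i * e i x)" for x
 have [measurable]: "S : borel_measurable M" unfolding S_def[abs_def] by measurable
 have B0: "norm (g x) <= \<bar>B\<bar>" if "x : space M" for x using gB[OF that] by simp
 have ge: "integrable M (%x. g x * cnj (e i x))" for i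
 proof (rule integrable_const_bound[where B = "\<bar>B\<bar> * 1"])
  show "AE x in M. norm (g x * cnj (e i x)) <= \<bar>B\<bar> * 1"
   unfolding norm_mult complex_mod_cnj by (intro AE_I2 mult_mono b B0) auto
 qed measurable
 have SB: "norm (S x) <= (\<Sum>i\<in>F. norm (a i))" for x
  unfolding S_def by (rule order_trans[OF norm_sum]) (intro sum_mono, simp add: norm_mult b mult_left_le)
 have gg: "integrable M (%x. (norm (g x))\<^sup>2)"
  by (rule integrable_const_bound[where B = "B\<^sup>2"]) (auto intro!: AE_I2 power_mono gB)
 have SS: "integrable M (%x. (norm (S x))\<^sup>2)"
  by (rule integrable_const_bound[where B = "(\<Sum>i\<in>F. norm (a i))\<^sup>2"]) (auto intro!: AE_I2 power_mono SB)
 have gS: "integrable M (%x. g x * cnj (S x))"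
  by (rule integrable_const_bound[where B = "\<bar>B\<bar> * (\<Sum>i\<in>F. norm (a i))"]) (auto simp: norm_mult intro!: AE_I2 mult_mono SB B0)
 define A where "A = (\<Sum>i\<in>F. (norm (a i))\<^sup>2)"
 have "(\<integral>x. g x * cnj (S x) \<partial>M) = (\<integral>x. (\<Sum>i\<in>F. cnj (a i) * (g x * cnj (e i x))) \<partial>M)"
  unfolding S_def by (intro Bochner_Integration.integral_cong refl) (simp add: sum_distrib_left mult_ac)
 also have "... = (\<Sum>i\<in>F. cnj (a i) * (of_real c * a i))"
  using c by (subst Bochner_Integration.integral_sum) (auto simp: ge a_def)
 also have "... = of_real (c * A)"
  by (simp add: A_def sum_distrib_left complex_norm_square mult_ac del: of_real_power)
 finally have i1: "(\<integral>x. g x * cnj (S x) \<partial>M) = of_real (c * A)" .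
 have i2: "(\<integral>x. (norm (S x))\<^sup>2 \<partial>M) = c * A"
  unfolding S_def A_def by (rule parseval_finite[OF M F]) (auto simp: b orth)
 define R where "R x = Re (g x * cnj (S x))" for x
 have R: "integrable M R" "(\<integral>x. R x \<partial>M) = c * A"
  using integrable_Re[OF gS] integral_Re[OF gS] i1 by (simp_all add: R_def[abs_def])
 have "0 <= (\<integral>x. (norm (g x - S x))\<^sup>2 \<partial>M)" by simp
 also have "(\<integral>x. (norm (g x - S x))\<^sup>2 \<partial>M) = (\<integral>x. (norm (g x))\<^sup>2 + (norm (S x))\<^sup>2 - 2 * R x \<partial>M)"
 proof (rule Bochner_Integration.integral_cong)
  show "(norm (g x - S x))\<^sup>2 = (norm (g x))\<^sup>2 + (norm (S x))\<^sup>2 - 2 * R x" for x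
   unfolding R_def cmod_power2 by (simp add: power2_eq_square algebra_simps)
 qed simp
 also have "... = (\<integral>x. (norm (g x))\<^sup>2 \<partial>M) + c * A - 2 * (c * A)"
  using gg SS R by (simp add: i2)
 finally have "c * A <= (\<integral>x. (norm (g x))\<^sup>2 \<partial>M)" by (simp add: mult.commute)
 moreover have "(\<Sum>i\<in>F. (norm (\<integral>x. g x * cnj (e i x) \<partial>M))\<^sup>2) = c * (c * A)"
  using c by (simp add: A_def a_def norm_divide power_divide sum_divide_distrib[symmetric] power2_eq_square)
 ultimately show ?thesis using c by simp
qed

definition IM :: "real measure" where "IM = restrict_space lborel {-pi<..<pi}"

lemma space_IM [simp]: "space IM = {-pi<..<pi}" by (simp add: IM_def space_restrict_space)

lemma IM_borel: "f : borel_measurable borel ==> f : borel_measurable IM"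
 by (simp add: IM_def measurable_restrict_space1)

lemma cis_measurable [measurable]: "cis : borel_measurable borel"
 unfolding cis_conv_exp[abs_def] by measurable

interpretation IM: finite_measure IM
proof (rule finite_measureI)
 have "emeasure IM {-pi<..<pi} = emeasure lborel {-pi<..<pi}"
  unfolding IM_def by (rule emeasure_restrict_space) auto
 then show "emeasure IM (space IM) ~= \<infinity>" by simp
qed

lemma integral_IM: "(\<integral>x. f x \<partial>IM) = (\<integral>x. indicator {-pi<..<pi} x *\<^sub>R f x \<partial>lborel)"
 for f :: "real => 'a::{banach, second_countable_topology}"
 unfolding IM_def by (rule integral_restrict_space) auto

lemma integral_IM_cis: "(\<integral>x. cis (of_int k * x) \<partial>IM) = (if k = 0 then of_real (2 * pi) else 0)"
 unfolding integral_IM by (rule integral_cis_int)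

lemma bounded_int_seq_tendsto:
 fixes \<gamma> :: "int => complex"
 assumes "!!F. finite F ==> (\<Sum>i\<in>F. (norm (\<gamma> i))\<^sup>2) <= B"
 shows "(%n. \<gamma> (int n)) \<longlonglongrightarrow> 0" "(%n. \<gamma> (- int n)) \<longlonglongrightarrow> 0"
proof -
 have *: "(%n. \<gamma> (f n)) \<longlonglongrightarrow> 0" if "inj f" for f :: "nat => int"
 proof -
  have "summable (%n. (norm (\<gamma> (f n)))\<^sup>2)"
  proof (rule summableI_nonneg_bounded)
   fix n
   have "(\<Sum>i<n. (norm (\<gamma> (f i)))\<^sup>2) = (\<Sum>i\<in>f ` {..<n}. (norm (\<gamma> i))\<^sup>2)"
    using that by (subst sum.reindex) (auto intro: inj_on_subset)
   then show "(\<Sum>i<n. (norm (\<gamma> (f i)))\<^sup>2) <= B" using assms by simp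
  qed auto
  then have "(%n. (norm (\<gamma> (f n)))\<^sup>2) \<longlonglongrightarrow> 0" by (rule summable_LIMSEQ_zero)
  then have "(%n. sqrt ((norm (\<gamma> (f n)))\<^sup>2)) \<longlonglongrightarrow> sqrt 0" by (rule tendsto_real_sqrt)
  then show ?thesis by (simp add: tendsto_norm_zero_iff)
 qed
 show "(%n. \<gamma> (int n)) \<longlonglongrightarrow> 0" "(%n. \<gamma> (- int n)) \<longlonglongrightarrow> 0"
  by (rule *; simp add: inj_def)+
qed

lemma cis_eq_1_imp: assumes "cis t = 1" "\<bar>t\<bar> < 2 * pi" shows "t = 0"
proof -
 have "cos t = 1" using assms(1) by (simp add: complex_eq_iff)
 then obtain n :: int where n: "t = of_int n * 2 * pi" by (auto simp: cos_one_2pi_int)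
 have "\<bar>real_of_int n\<bar> < 1" using assms(2) by (simp add: n abs_mult)
 then have "n = 0" by linarith
 then show ?thesis by (simp add: n)
qed

text \<open>The difference quotient against the character telescopes the Fourier series, and its own
  Fourier coefficients tend to zero by Bessel's inequality.\<close>

lemma fourier_1d:
 fixes \<psi> \<psi>' :: "real => real"
 assumes d: "!!x. (\<psi> has_real_derivative \<psi>' x) (at x)" and x: "x : {-pi<..<pi}"
 defines "c \<equiv> %n::int. (\<integral>y. of_real (\<psi> y) * cis (of_int n * y) \<partial>IM) / of_real (2 * pi)"
 assumes sc: "integrable cs c"
 shows "(\<integral>n. c n * cis (- (of_int n * x)) \<partial>cs) = of_real (\<psi> x)"
proof -
 have cont: "continuous_on A \<psi>" for A
  by (meson d DERIV_isCont continuous_at_imp_continuous_on)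
 define G where "G y = (if y = x then of_real (\<psi>' x) / \<i> else of_real (\<psi> y - \<psi> x) / (cis (y - x) - 1))" for y
 have nz: "cis (y - x) - 1 ~= 0" if "y : {-pi..pi}" "y ~= x" for y
 proof -
  have "\<bar>y - x\<bar> < 2 * pi" using that x by (auto simp: abs_if)
  then show ?thesis using cis_eq_1_imp[of "y - x"] that by auto
 qed
 have "continuous_on {-pi..pi} G"
  unfolding continuous_on_eq_continuous_within
 proof
  fix y assume y: "y : {-pi..pi}"
  show "continuous (at y within {-pi..pi}) G"
  proof (cases "y = x")
   case True
   have "((%y. (of_real ((\<psi> y - \<psi> x) / (y - x)) :: complex)) \<longlongrightarrow> of_real (\<psi>' x)) (at x)"
    using d[of x] by (intro tendsto_of_real) (simp add: has_field_derivative_iff)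
   moreover have "((%y. (cis (y - x) - 1) / of_real (y - x)) \<longlongrightarrow> \<i>) (at x)"
   proof -
    have "((%z. exp (\<i> * (z - of_real x))) has_field_derivative \<i>) (at (of_real x))"
     by (auto intro!: derivative_eq_intros)
    then have "((%z. (exp (\<i> * (z - of_real x)) - 1) / (z - of_real x)) \<longlongrightarrow> \<i>) (at (of_real x))"
     by (simp add: has_field_derivative_iff)
    moreover have "filterlim complex_of_real (at (of_real x)) (at x)"
     by (intro filterlim_atI tendsto_intros) (auto simp: eventually_at_filter)
    ultimately have "((%y. (exp (\<i> * (of_real y - of_real x)) - 1) / (of_real y - of_real x)) \<longlongrightarrow> \<i>) (at x)"
     by (rule filterlim_compose)
    then show ?thesis by (simp add: cis_conv_exp)
   qed
   ultimately have "((%y. of_real ((\<psi> y - \<psi> x) / (y - x)) / ((cis (y - x) - 1) / of_real (y - x))) \<longlongrightarrow> of_real (\<psi>' x) / \<i>) (at x)"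
    by (intro tendsto_divide) auto
   then have "(G \<longlongrightarrow> of_real (\<psi>' x) / \<i>) (at x)"
    by (rule Lim_transform_eventually) (auto simp: G_def eventually_at_filter)
   then have "(G \<longlongrightarrow> G x) (at x)" by (simp add: G_def)
   then show ?thesis unfolding True using continuous_at_imp_continuous_within[of x G] by (simp add: continuous_at)
  next
   case False
   have "continuous (at y within {-pi..pi}) (%y. of_real (\<psi> y - \<psi> x) / (cis (y - x) - 1))"
    using nz[OF y False] d[of y, THEN DERIV_isCont]
    unfolding cis_conv_exp by (intro continuous_intros) (auto intro: continuous_at_imp_continuous_within)
   moreover have "\<forall>\<^sub>F z in at y within {-pi..pi}. of_real (\<psi> z - \<psi> x) / (cis (z - x) - 1) = G z"
    using False by (auto simp: G_def eventually_at intro!: exI[of _ "dist x y"] simp: dist_commute)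
   ultimately show ?thesis
    using False unfolding continuous_within by (auto simp: G_def elim!: Lim_transform_eventually)
  qed
 qed
 note contG = this
 then have "compact (G ` {-pi..pi})" by (intro compact_continuous_image) auto
 then obtain B where B: "!!y. y : {-pi..pi} ==> norm (G y) <= B"
  using compact_imp_bounded by (force simp: bounded_iff)
 have Gm [measurable]: "G : borel_measurable IM"
 proof -
  have "continuous_on {-pi<..<pi} G" by (rule continuous_on_subset[OF contG]) auto
  then show ?thesis
   unfolding IM_def measurable_cong_sets[OF sets_restrict_space_cong[OF sets_lborel] refl]
   by (rule borel_measurable_continuous_on_restrict)
 qed
 have [measurable]: "\<psi> : borel_measurable IM" by (intro IM_borel borel_measurable_continuous_onI cont)
 have [measurable]: "(%y. cis (of_int n * y)) : borel_measurable IM" "(%y. cis (of_int n * (y - x))) : borel_measurable IM" for n :: int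
  by (rule IM_borel; measurable)+
 have Gi: "integrable IM (%y. G y * cis (of_int n * (y - x)))" for n :: int
  by (rule IM.integrable_const_bound[where B = B]) (auto simp: norm_mult intro!: AE_I2 B)
 have pi: "integrable IM (%y. of_real (\<psi> y) * cis (of_int n * y) :: complex)" for n :: int
 proof -
  have "compact (\<psi> ` {-pi..pi})" by (intro compact_continuous_image cont) auto
  then obtain B where "!!y. y : {-pi..pi} ==> norm (\<psi> y) <= B"
   using compact_imp_bounded by (force simp: bounded_iff)
  then show ?thesis
   by (intro IM.integrable_const_bound[where B = B]) (auto simp: norm_mult intro!: AE_I2)
 qed
 have ci: "integrable IM (%y. cis (of_int n * y))" for n :: int
  by (rule IM.integrable_const_bound[where B = 1]) auto
 define \<gamma> where "\<gamma> n = (\<integral>y. G y * cis (of_int n * (y - x)) \<partial>IM)" for n :: int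
 have tel: "\<gamma> (n + 1) - \<gamma> n = of_real (2 * pi) * (c n * cis (- (of_int n * x)) - (if n = 0 then of_real (\<psi> x) else 0))" for n
 proof -
  have "\<gamma> (n + 1) - \<gamma> n = (\<integral>y. G y * cis (of_int (n + 1) * (y - x)) - G y * cis (of_int n * (y - x)) \<partial>IM)"
   unfolding \<gamma>_def by (rule Bochner_Integration.integral_diff[symmetric]) (rule Gi)+
  also have "... = (\<integral>y. (of_real (\<psi> y) * cis (of_int n * y)) * cis (- (of_int n * x)) - (of_real (\<psi> x) * cis (- (of_int n * x))) * cis (of_int n * y) \<partial>IM)"
  proof (rule Bochner_Integration.integral_cong)
   fix y assume "y : space IM"
   then have y: "y : {-pi..pi}" by auto
   have 1: "G y * (cis (y - x) - 1) = of_real (\<psi> y - \<psi> x)"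
    using nz[OF y] by (auto simp: G_def)
   have c1: "cis (of_int (n + 1) * (y - x)) = cis (y - x) * cis (of_int n * (y - x))"
    by (simp only: cis_mult) (simp add: algebra_simps)
   have c2: "cis (of_int n * (y - x)) = cis (of_int n * y) * cis (- (of_int n * x))"
    by (simp only: cis_mult) (simp add: algebra_simps)
   have "G y * cis (of_int (n + 1) * (y - x)) - G y * cis (of_int n * (y - x)) = G y * (cis (y - x) - 1) * cis (of_int n * (y - x))"
    unfolding c1 by (simp only: right_diff_distrib left_diff_distrib mult_1_right mult.assoc)
   also have "... = of_real (\<psi> y - \<psi> x) * (cis (of_int n * y) * cis (- (of_int n * x)))"
    by (simp only: 1 c2)
   finally have A: "G y * cis (of_int (n + 1) * (y - x)) - G y * cis (of_int n * (y - x)) = of_real (\<psi> y - \<psi> x) * (cis (of_int n * y) * cis (- (of_int n * x)))" .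
   show "G y * cis (of_int (n + 1) * (y - x)) - G y * cis (of_int n * (y - x)) = (of_real (\<psi> y) * cis (of_int n * y)) * cis (- (of_int n * x)) - (of_real (\<psi> x) * cis (- (of_int n * x))) * cis (of_int n * y)"
   proof -
    have "(a - b) * (P * Q) = (a * P) * Q - (b * Q) * P" for a b P Q :: complex
     by (simp add: algebra_simps)
    then show ?thesis unfolding A of_real_diff .
   qed
  qed simp
  also have "... = (\<integral>y. of_real (\<psi> y) * cis (of_int n * y) \<partial>IM) * cis (- (of_int n * x)) - (of_real (\<psi> x) * cis (- (of_int n * x))) * (\<integral>y. cis (of_int n * y) \<partial>IM)"
   using pi ci by (subst Bochner_Integration.integral_diff) (auto simp del: integral_mult_right_zero integral_mult_left_zero intro!: arg_cong2[where f="(-)"] integral_mult_right_zero integral_mult_left_zero)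
  also have "... = of_real (2 * pi) * (c n * cis (- (of_int n * x)) - (if n = 0 then of_real (\<psi> x) else 0))"
   by (simp add: c_def integral_IM_cis right_diff_distrib)
  finally show ?thesis .
 qed
 define a where "a n = c n * cis (- (of_int n * x)) - (if n = 0 then of_real (\<psi> x) else 0)" for n
 have ai: "integrable cs a"
  unfolding a_def using integral_cs_single(2)[of "0::int" "of_real (\<psi> x) :: complex"] sc
  by (intro Bochner_Integration.integrable_diff) (auto simp: integrable_cs_iff norm_mult)
 have bess: "(\<Sum>n\<in>F. (norm (\<gamma> n))\<^sup>2) <= 2 * pi * (\<integral>y. (norm (G y))\<^sup>2 \<partial>IM)" if "finite F" for F
 proof -
  have "(\<Sum>n\<in>F. (norm (\<integral>y. G y * cnj (cis (- of_int n * (y - x))) \<partial>IM))\<^sup>2) <= 2 * pi * (\<integral>y. (norm (G y))\<^sup>2 \<partial>IM)"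
  proof (rule bessel[OF IM.finite_measure_axioms that, where B = B])
   show "(%y. cis (- of_int n * (y - x))) : borel_measurable IM" for n :: int by (rule IM_borel) measurable
   fix i j :: int
   have "(\<integral>y. cis (- of_int i * (y - x)) * cnj (cis (- of_int j * (y - x))) \<partial>IM) = (\<integral>y. cis ((of_int i - of_int j) * x) * cis (of_int (j - i) * y) \<partial>IM)"
    by (intro Bochner_Integration.integral_cong refl) (simp add: cis_cnj cis_mult algebra_simps)
   then show "(\<integral>y. cis (- of_int i * (y - x)) * cnj (cis (- of_int j * (y - x))) \<partial>IM) = (if i = j then of_real (2 * pi) else 0)"
    by (simp only: integral_mult_right_zero integral_IM_cis) auto
  qed (use B in auto)
  then show ?thesis by (simp add: \<gamma>_def cis_cnj)
 qed
 have lim: "(%N. \<gamma> (int N) - \<gamma> (- int N)) \<longlonglongrightarrow> 0 - 0"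
  by (intro tendsto_diff bounded_int_seq_tendsto[OF bess])
 have part: "\<gamma> (int N) - \<gamma> (- int N) = of_real (2 * pi) * (\<Sum>n\<in>{- int N..<int N}. a n)" for N
 proof -
  have "(\<Sum>n\<in>{- int N..<- int N + int k}. a n) * of_real (2 * pi) = \<gamma> (- int N + int k) - \<gamma> (- int N)" for k
  proof (induction k)
   case (Suc k)
   have "{- int N..<- int N + int (Suc k)} = insert (- int N + int k) {- int N..<- int N + int k}" by auto
   then have "(\<Sum>n\<in>{- int N..<- int N + int (Suc k)}. a n) * of_real (2 * pi) = a (- int N + int k) * of_real (2 * pi) + (\<gamma> (- int N + int k) - \<gamma> (- int N))"
    using Suc by (simp add: distrib_right)
   moreover have "\<gamma> (- int N + int k + 1) - \<gamma> (- int N + int k) = of_real (2 * pi) * a (- int N + int k)"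
    unfolding a_def by (rule tel)
   moreover have "- int N + int (Suc k) = - int N + int k + 1" by simp
   ultimately show ?case by (simp only: mult.commute) (simp add: algebra_simps)
  qed simp
  from this[of "2 * N"] show ?thesis by (simp add: mult.commute)
 qed
 have "(%N. \<integral>n. indicator {- int N..<int N} n *\<^sub>R a n \<partial>cs) \<longlonglongrightarrow> (\<integral>n. a n \<partial>cs)"
 proof (rule integral_dominated_convergence[where w = "%n. norm (a n)"])
  show "AE n in cs. (%N. indicator {- int N..<int N} n *\<^sub>R a n) \<longlonglongrightarrow> a n"
  proof (rule AE_I2)
   fix n :: int
   have "\<forall>\<^sub>F N in sequentially. indicator {- int N..<int N} n *\<^sub>R a n = a n"
    using eventually_gt_at_top[of "nat \<bar>n\<bar>"] by eventually_elim (auto simp: indicator_def)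
   then show "(%N. indicator {- int N..<int N} n *\<^sub>R a n) \<longlonglongrightarrow> a n" by (rule tendsto_eventually)
  qed
 qed (use ai in \<open>auto split: split_indicator\<close>)
 moreover have "(\<integral>n. indicator {- int N..<int N} n *\<^sub>R a n \<partial>cs) = (\<Sum>n\<in>{- int N..<int N}. a n)" for N
 proof -
  have "(\<integral>n. indicator {- int N..<int N} n *\<^sub>R a n \<partial>cs) = (\<Sum>n | n : UNIV & indicator {- int N..<int N} n *\<^sub>R a n ~= 0. indicator {- int N..<int N} n *\<^sub>R a n)"
   by (rule lebesgue_integral_count_space_finite_support) (rule finite_subset[of _ "{- int N..<int N}"], auto simp: indicator_def split: if_splits)
  also have "... = (\<Sum>n\<in>{- int N..<int N}. a n)"
   by (rule sum.mono_neutral_cong_left) (auto simp: indicator_def split: if_splits)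
  finally show ?thesis .
 qed
 ultimately have "(%N. of_real (2 * pi) * (\<Sum>n\<in>{- int N..<int N}. a n)) \<longlonglongrightarrow> of_real (2 * pi) * (\<integral>n. a n \<partial>cs)"
  by (intro tendsto_mult_left) simp
 with lim have "of_real (2 * pi) * (\<integral>n. a n \<partial>cs) = 0"
  unfolding part using LIMSEQ_unique by fastforce
 then have "(\<integral>n. a n \<partial>cs) = 0" by simp
 moreover have "(\<integral>n. a n \<partial>cs) = (\<integral>n. c n * cis (- (of_int n * x)) \<partial>cs) - of_real (\<psi> x)"
  unfolding a_def using sc
  by (subst Bochner_Integration.integral_diff) (auto simp: integral_cs_single integrable_cs_iff norm_mult)
 ultimately show ?thesis by simp
qed

lemma integral_IM_Icc:
 fixes f :: "real => 'a::{banach, second_countable_topology}"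
 assumes [measurable]: "f : borel_measurable borel"
 shows "(\<integral>x. f x \<partial>IM) = (\<integral>x. indicator {-pi..pi} x *\<^sub>R f x \<partial>lborel)"
 unfolding integral_IM
proof (rule integral_cong_AE)
 show "AE x in lborel. indicator {-pi<..<pi} x *\<^sub>R f x = indicator {-pi..pi} x *\<^sub>R f x"
 proof (rule AE_I')
  show "{-pi, pi} : null_sets lborel" by (intro finite_imp_null_set_lborel) auto
 qed (auto split: split_indicator)
qed auto

lemma fourier_coeff_by_parts:
 fixes \<psi> \<psi>' \<psi>'' :: "real => real" and n :: int
 assumes d1: "!!x. (\<psi> has_real_derivative \<psi>' x) (at x)" and d2: "!!x. (\<psi>' has_real_derivative \<psi>'' x) (at x)"
  and c2: "!!A. continuous_on A \<psi>''" and per: "\<psi> pi = \<psi> (- pi)" and n: "n ~= 0"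
 shows "(of_int n)\<^sup>2 * norm (\<integral>y. of_real (\<psi> y) * cis (of_int n * y) \<partial>IM)
  <= \<bar>\<psi>' pi - \<psi>' (- pi)\<bar> + (\<integral>y. \<bar>\<psi>'' y\<bar> \<partial>IM)"
proof -
 define e where "e x = cis (of_int n * x)" for x
 define a b :: complex where "a = 1 / (\<i> * of_int n)" and "b = 1 / (of_int n)\<^sup>2"
 have cont: "continuous_on A \<psi>" "continuous_on A \<psi>'" for A
  by (meson d1 d2 DERIV_isCont continuous_at_imp_continuous_on)+
 have ce: "continuous_on A e" for A unfolding e_def[abs_def] by (intro continuous_intros)
 have De: "(e has_vector_derivative (\<i> * of_int n * e x)) (at x within S)" for x S
 proof -
  have "((%z. exp (\<i> * of_int n * z)) has_field_derivative \<i> * of_int n * exp (\<i> * of_int n * of_real x)) (at (of_real x))"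
   by (auto intro!: derivative_eq_intros)
  then have "((%x. exp (\<i> * of_int n * of_real x)) has_vector_derivative \<i> * of_int n * exp (\<i> * of_int n * of_real x)) (at x within S)"
   by (rule has_vector_derivative_real_field)
  then show ?thesis by (simp add: e_def[abs_def] cis_conv_exp mult.assoc)
 qed
 have D: "((%x. of_real (f x) * e x) has_vector_derivative (of_real (f x) * (\<i> * of_int n * e x) + of_real (f' x) * e x)) (at x within S)"
  if "!!x. (f has_real_derivative f' x) (at x)" for f f' x S
  by (intro has_vector_derivative_mult De has_vector_derivative_of_real)
   (use that in \<open>auto simp: has_real_derivative_iff_has_vector_derivative intro: has_vector_derivative_at_within\<close>)
 define H where "H x = a * (of_real (\<psi> x) * e x) + b * (of_real (\<psi>' x) * e x)" for x
 have ab: "a * (\<i> * of_int n) = 1" "a + b * (\<i> * of_int n) = 0"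
  using n by (simp_all add: a_def b_def field_simps power2_eq_square)
 have DH: "(H has_vector_derivative (of_real (\<psi> x) * e x + b * (of_real (\<psi>'' x) * e x))) (at x within S)" for x S
 proof -
  have "(H has_vector_derivative (a * (of_real (\<psi> x) * (\<i> * of_int n * e x) + of_real (\<psi>' x) * e x)
    + b * (of_real (\<psi>' x) * (\<i> * of_int n * e x) + of_real (\<psi>'' x) * e x))) (at x within S)"
   unfolding H_def[abs_def]
   by (intro has_vector_derivative_add has_vector_derivative_mult_right D d1 d2)
  also have "a * (of_real (\<psi> x) * (\<i> * of_int n * e x) + of_real (\<psi>' x) * e x)
    + b * (of_real (\<psi>' x) * (\<i> * of_int n * e x) + of_real (\<psi>'' x) * e x)
    = (a * (\<i> * of_int n)) * (of_real (\<psi> x) * e x) + (a + b * (\<i> * of_int n)) * (of_real (\<psi>' x) * e x) + b * (of_real (\<psi>'' x) * e x)"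
   by (simp add: algebra_simps)
  finally show ?thesis by (simp add: ab)
 qed
 have i1: "set_integrable lborel {-pi..pi} (%x. of_real (\<psi> x) * e x)"
  and i2: "set_integrable lborel {-pi..pi} (%x. of_real (\<psi>'' x) * e x)"
  by (intro borel_integrable_atLeastAtMost' continuous_intros cont c2 ce)+
 have bm: "(%x. of_real (\<psi> x) * e x) : borel_measurable borel" "(%x. of_real (\<psi>'' x) * e x) : borel_measurable borel" "\<psi>'' : borel_measurable borel"
  by (intro borel_measurable_continuous_onI continuous_intros cont c2 ce)+
 have eper: "e pi = e (- pi)"
 proof -
  have "e pi = e (- pi) * cis (2 * pi * of_int n)"
   unfolding e_def by (simp only: cis_mult) (simp add: algebra_simps)
  then show ?thesis by (simp add: cis_multiple_2pi)
 qed
 have "(\<integral>x. indicator {-pi..pi} x *\<^sub>R (of_real (\<psi> x) * e x + b * (of_real (\<psi>'' x) * e x)) \<partial>lborel) = H pi - H (- pi)"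
  by (rule integral_FTC_atLeastAtMost) (auto intro!: DH continuous_intros cont c2 ce)
 also have "H pi - H (- pi) = b * (of_real (\<psi>' pi - \<psi>' (- pi)) * e pi)"
  by (simp add: H_def eper per algebra_simps)
 also have "(\<integral>x. indicator {-pi..pi} x *\<^sub>R (of_real (\<psi> x) * e x + b * (of_real (\<psi>'' x) * e x)) \<partial>lborel)
   = (\<integral>x. of_real (\<psi> x) * e x \<partial>IM) + b * (\<integral>x. of_real (\<psi>'' x) * e x \<partial>IM)"
 proof -
  have "(\<integral>x. indicator {-pi..pi} x *\<^sub>R (of_real (\<psi> x) * e x + b * (of_real (\<psi>'' x) * e x)) \<partial>lborel)
   = (\<integral>x. indicator {-pi..pi} x *\<^sub>R (of_real (\<psi> x) * e x) + b * (indicator {-pi..pi} x *\<^sub>R (of_real (\<psi>'' x) * e x)) \<partial>lborel)"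
   by (intro Bochner_Integration.integral_cong refl) (simp add: scaleR_conv_of_real algebra_simps)
  also have "... = (\<integral>x. indicator {-pi..pi} x *\<^sub>R (of_real (\<psi> x) * e x) \<partial>lborel) + (\<integral>x. b * (indicator {-pi..pi} x *\<^sub>R (of_real (\<psi>'' x) * e x)) \<partial>lborel)"
   using i1 i2 unfolding set_integrable_def
   by (intro Bochner_Integration.integral_add Bochner_Integration.integrable_mult_right) auto
  finally show ?thesis by (simp only: integral_IM_Icc[OF bm(1)] integral_IM_Icc[OF bm(2)] integral_mult_right_zero)
 qed
 finally have "(\<integral>x. of_real (\<psi> x) * e x \<partial>IM) = b * (of_real (\<psi>' pi - \<psi>' (- pi)) * e pi - (\<integral>x. of_real (\<psi>'' x) * e x \<partial>IM))"
  by (simp add: algebra_simps)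
 then have "(of_int n)\<^sup>2 * (\<integral>x. of_real (\<psi> x) * e x \<partial>IM) = of_real (\<psi>' pi - \<psi>' (- pi)) * e pi - (\<integral>x. of_real (\<psi>'' x) * e x \<partial>IM)"
  using n by (simp add: b_def)
 then have "norm ((of_int n)\<^sup>2 * (\<integral>x. of_real (\<psi> x) * e x \<partial>IM)) <= norm (of_real (\<psi>' pi - \<psi>' (- pi)) * e pi) + norm (\<integral>x. of_real (\<psi>'' x) * e x \<partial>IM)"
  by (simp only: norm_triangle_ineq4)
 also have "norm (of_real (\<psi>' pi - \<psi>' (- pi)) * e pi) = \<bar>\<psi>' pi - \<psi>' (- pi)\<bar>"
  by (simp add: norm_mult e_def flip: of_real_diff)
 also have "norm (\<integral>x. of_real (\<psi>'' x) * e x \<partial>IM) <= (\<integral>x. norm (of_real (\<psi>'' x) * e x) \<partial>IM)"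
  by (rule integral_norm_bound)
 also have "... = (\<integral>x. \<bar>\<psi>'' x\<bar> \<partial>IM)" by (simp add: norm_mult e_def)
 finally show ?thesis by (simp add: norm_mult norm_power e_def)
qed

lemma sum_inverse_square_le:
 fixes r :: real assumes r: "1 <= r"
 shows "(\<integral>\<^sup>+n. ennreal (1 / (1 + (of_int (n::int))\<^sup>2 / r\<^sup>2)) \<partial>cs) <= ennreal (6 * r)"
proof -
 define f where "f n = 1 / (1 + (of_int n)\<^sup>2 / r\<^sup>2)" for n :: int
 have f0: "0 <= f n" for n by (auto simp: f_def)
 have step: "f (int (Suc m)) <= 2 * r\<^sup>2 * (1 / (r + real m) - 1 / (r + real (Suc m)))" for m
 proof -
  have 1: "f (int (Suc m)) = r\<^sup>2 / (r\<^sup>2 + (real (Suc m))\<^sup>2)"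
   using r by (simp add: f_def field_simps)
  have 2: "(r + real m) * (r + real (Suc m)) <= 2 * (r\<^sup>2 + (real (Suc m))\<^sup>2)"
  proof -
   have "(r + real m) * (r + real (Suc m)) <= (r + real (Suc m)) * (r + real (Suc m))"
    using r by (intro mult_right_mono) auto
   also have "... <= 2 * (r\<^sup>2 + (real (Suc m))\<^sup>2)"
    using zero_le_power2[of "r - real (Suc m)"] by (simp add: power2_eq_square algebra_simps)
   finally show ?thesis .
  qed
  have "1 / (r + real m) - 1 / (r + real (Suc m)) = 1 / ((r + real m) * (r + real (Suc m)))"
   using r by (simp add: field_simps)
  moreover have "r\<^sup>2 / (r\<^sup>2 + (real (Suc m))\<^sup>2) <= 2 * r\<^sup>2 * (1 / ((r + real m) * (r + real (Suc m))))"
  proof -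
   have "r\<^sup>2 * ((r + real m) * (r + real (Suc m))) <= r\<^sup>2 * (2 * (r\<^sup>2 + (real (Suc m))\<^sup>2))"
    by (intro mult_left_mono 2) auto
   moreover have "0 < (r + real m) * (r + real (Suc m))" using r by (intro mult_pos_pos) auto
   moreover have "0 < r\<^sup>2 + (real (Suc m))\<^sup>2" using r by (intro add_pos_pos) auto
   ultimately show ?thesis by (simp add: divide_le_eq le_divide_eq mult_ac del: of_nat_Suc) (simp add: field_simps del: of_nat_Suc)
  qed
  ultimately show ?thesis unfolding 1 by simp
 qed
 have part: "(\<Sum>m<N. f (int m)) <= 3 * r" for N
 proof -
  have "(\<Sum>m<N. f (int (Suc m))) <= 2 * r\<^sup>2 * (1 / r - 1 / (r + real N))"
  proof (induction N)
   case (Suc N)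
   then show ?case using step[of N] by (simp add: right_diff_distrib)
  qed simp
  also have "... <= 2 * r\<^sup>2 * (1 / r)" using r by (intro mult_left_mono) auto
  also have "... = 2 * r" using r by (simp add: power2_eq_square)
  finally have A: "(\<Sum>m<N. f (int (Suc m))) <= 2 * r" .
  have "(\<Sum>m<N. f (int m)) <= (\<Sum>m<Suc N. f (int m))" using f0 by simp
  also have "... = f 0 + (\<Sum>m<N. f (int (Suc m)))" by (subst sum.lessThan_Suc_shift) simp
  also have "... <= 1 + 2 * r" using A by (simp add: f_def)
  finally show ?thesis using r by simp
 qed
 have half: "(\<integral>\<^sup>+m. ennreal (f (int m)) \<partial>cs) <= ennreal (3 * r)"
  unfolding nn_integral_count_space_nat suminf_eq_SUP
  by (rule SUP_least) (use part f0 in \<open>simp add: sum_ennreal ennreal_leI\<close>)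
 have img: "(\<integral>\<^sup>+n. ennreal (f n) * indicator (range g) n \<partial>cs) = (\<integral>\<^sup>+m. ennreal (f (g m)) \<partial>cs)" if "inj g" for g :: "nat => int"
  using nn_integral_bij_count_space[OF inj_on_imp_bij_betw[OF that], of "%n. ennreal (f n)"]
  by (cases "range g = UNIV") (simp_all add: nn_integral_count_space_indicator)
 have "(\<integral>\<^sup>+n. ennreal (f n) \<partial>cs) <= (\<integral>\<^sup>+n. ennreal (f n) * indicator (range int) n + ennreal (f n) * indicator (range (%m. - int m)) n \<partial>cs)"
 proof (rule nn_integral_mono)
  fix n :: int
  have "n : range int | n : range (%m. - int m)"
   by (cases n rule: int_cases2) auto
  then show "ennreal (f n) <= ennreal (f n) * indicator (range int) n + ennreal (f n) * indicator (range (%m. - int m)) n"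
   by (auto simp: indicator_def)
 qed
 also have "... = (\<integral>\<^sup>+m. ennreal (f (int m)) \<partial>cs) + (\<integral>\<^sup>+m. ennreal (f (- int m)) \<partial>cs)"
  by (subst nn_integral_add) (auto simp: img inj_def)
 also have "... <= ennreal (3 * r) + ennreal (3 * r)"
  using half by (intro add_mono) (auto simp: f_def)
 also have "... = ennreal (6 * r)" using r by (subst ennreal_plus[symmetric]) auto
 finally show ?thesis by (simp add: f_def)
qed

lemma fourier_1d_bound:
 fixes \<psi> \<psi>' \<psi>'' :: "real => real"
 assumes d1: "!!x. (\<psi> has_real_derivative \<psi>' x) (at x)" and d2: "!!x. (\<psi>' has_real_derivative \<psi>'' x) (at x)"
  and c2: "!!A. continuous_on A \<psi>''" and per: "\<psi> pi = \<psi> (- pi)" and r: "1 <= r"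
  and A: "(\<integral>y. \<bar>\<psi> y\<bar> \<partial>IM) <= A" and B: "\<bar>\<psi>' pi - \<psi>' (- pi)\<bar> + (\<integral>y. \<bar>\<psi>'' y\<bar> \<partial>IM) <= B"
 obtains c :: "int => complex" where "integrable cs c" "(\<integral>\<^sup>+n. ennreal (norm (c n)) \<partial>cs) <= ennreal (6 * r * (A + B / r\<^sup>2))"
  "!!x. x : {-pi<..<pi} ==> (\<integral>n. c n * cis (- (of_int n * x)) \<partial>cs) = of_real (\<psi> x)"
proof -
 define c where "c = (%n::int. (\<integral>y. of_real (\<psi> y) * cis (of_int n * y) \<partial>IM) / of_real (2 * pi))"
 have AB: "0 <= A" "0 <= B" using order_trans[OF _ A] order_trans[OF _ B] by auto
 have pi2: "1 <= 2 * pi" using pi_gt3 by simp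
 have cn: "norm (c n) <= (A + B / r\<^sup>2) * (1 / (1 + (of_int n)\<^sup>2 / r\<^sup>2))" for n
 proof -
  define I where "I = norm (\<integral>y. of_real (\<psi> y) * cis (of_int n * y) \<partial>IM)"
  have "I <= (\<integral>y. norm (of_real (\<psi> y) * cis (of_int n * y)) \<partial>IM)" unfolding I_def by (rule integral_norm_bound)
  also have "... <= A" using A by (simp add: norm_mult)
  finally have 1: "I <= A" .
  have 2: "(of_int n)\<^sup>2 * I <= B"
  proof (cases "n = 0")
   case False
   show ?thesis using order_trans[OF fourier_coeff_by_parts[OF d1 d2 c2 per False] B] by (simp add: I_def)
  qed (use AB in auto)
  have "norm (c n) = I / (2 * pi)" by (simp add: c_def I_def norm_divide norm_mult)
  also have "... <= I" using pi2 by (simp add: divide_le_eq I_def mult_le_cancel_left1)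
  finally have "norm (c n) * (1 + (of_int n)\<^sup>2 / r\<^sup>2) <= I * (1 + (of_int n)\<^sup>2 / r\<^sup>2)"
   by (intro mult_right_mono) (auto intro!: add_nonneg_nonneg)
  also have "... = I + ((of_int n)\<^sup>2 * I) / r\<^sup>2" by (simp add: algebra_simps)
  also have "... <= A + B / r\<^sup>2" by (intro add_mono 1 divide_right_mono 2) auto
  finally have "norm (c n) * (1 + (of_int n)\<^sup>2 / r\<^sup>2) <= A + B / r\<^sup>2" .
  moreover have "0 < 1 + (of_int n)\<^sup>2 / r\<^sup>2" by (intro add_pos_nonneg) auto
  ultimately show ?thesis by (simp add: pos_le_divide_eq)
 qed
 have "(\<integral>\<^sup>+n. ennreal (norm (c n)) \<partial>cs) <= (\<integral>\<^sup>+n. ennreal (A + B / r\<^sup>2) * ennreal (1 / (1 + (of_int n)\<^sup>2 / r\<^sup>2)) \<partial>cs)"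
  using AB cn by (intro nn_integral_mono) (subst ennreal_mult[symmetric], auto intro!: ennreal_leI)
 also have "... <= ennreal (A + B / r\<^sup>2) * ennreal (6 * r)"
  by (subst nn_integral_cmult) (auto intro!: mult_left_mono sum_inverse_square_le r)
 also have "... = ennreal (6 * r * (A + B / r\<^sup>2))" using AB r by (subst ennreal_mult[symmetric]) (auto simp: mult_ac)
 finally have le: "(\<integral>\<^sup>+n. ennreal (norm (c n)) \<partial>cs) <= ennreal (6 * r * (A + B / r\<^sup>2))" .
 then have ic: "integrable cs c" by (auto simp: integrable_cs_iff le_less_trans)
 show ?thesis
  by (rule that[OF ic le]) (use fourier_1d[OF d1] ic in \<open>auto simp: c_def\<close>)
qed

section \<open>Comparison of the two symbols\<close>

lemma abs_sin_diff_le: "\<bar>sin y - y\<bar> <= \<bar>y\<bar> ^ 3 / 6" for y :: real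
proof -
 have "(\<Sum>m<3. sin_coeff m * y ^ m) = y"
  by (simp add: eval_nat_numeral sin_coeff_def)
 then show ?thesis using Maclaurin_sin_bound[of y 3] by (simp add: eval_nat_numeral)
qed

lemma sin_sq_diff: "0 <= y\<^sup>2 - (sin y)\<^sup>2" "y\<^sup>2 - (sin y)\<^sup>2 <= y ^ 4 / 3" for y :: real
proof -
 have a: "\<bar>sin y\<bar> <= \<bar>y\<bar>" by (rule abs_sin_x_le_abs_x)
 show "0 <= y\<^sup>2 - (sin y)\<^sup>2" using power_mono[OF a, of 2] by simp
 have "\<bar>y\<^sup>2 - (sin y)\<^sup>2\<bar> = \<bar>sin y - y\<bar> * \<bar>y + sin y\<bar>"
  by (simp add: abs_mult[symmetric] power2_eq_square algebra_simps abs_minus_commute)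
 also have "... <= (\<bar>y\<bar> ^ 3 / 6) * (2 * \<bar>y\<bar>)"
  using a by (intro mult_mono abs_sin_diff_le) auto
 also have "... = y ^ 4 / 3" by (simp add: power4_eq_xxxx power3_eq_cube)
 finally show "y\<^sup>2 - (sin y)\<^sup>2 <= y ^ 4 / 3" by (rule order_trans[OF abs_ge_self])
qed

lemma s1_le: "s1 x <= x\<^sup>2" and s1_diff_le: "x\<^sup>2 - s1 x <= x ^ 4 / 12"
 using sin_sq_diff[of "x / 2"] by (simp_all add: s1_def power_divide)

lemma s1_ge: assumes "\<bar>x\<bar> <= pi" shows "x\<^sup>2 / 9 <= s1 x"
proof -
 define y where "y = \<bar>x\<bar> / 2"
 have y: "0 <= y" "y <= 2" using assms pi_less_4 by (auto simp: y_def)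
 have "y - \<bar>y\<bar> ^ 3 / 6 <= sin y" using abs_sin_diff_le[of y] by linarith
 moreover have "y / 3 <= y - \<bar>y\<bar> ^ 3 / 6"
 proof -
  have "y * y <= 2 * 2" using y by (intro mult_mono) auto
  then have "y * (y * y) <= y * 4" using y by (intro mult_left_mono) auto
  then show ?thesis using y by (simp add: power3_eq_cube)
 qed
 ultimately have "y / 3 <= sin y" by simp
 then have "(y / 3)\<^sup>2 <= (sin y)\<^sup>2" using y by (intro power_mono) auto
 moreover have "(sin y)\<^sup>2 = (sin (x / 2))\<^sup>2" by (auto simp: y_def abs_if)
 ultimately show ?thesis by (simp add: s1_def y_def power_divide)
qed

definition C0 :: real where "C0 = 36 ^ 4"

lemma exp_decay: assumes "0 <= z" shows "exp (- (z / 9)) <= C0 / (1 + z) ^ 4"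
proof -
 have "1 + z / 36 <= exp (z / 36)" by (rule exp_ge_add_one_self)
 then have "(1 + z / 36) ^ 4 <= exp (z / 36) ^ 4" using assms by (intro power_mono) auto
 also have "... = exp (z / 9)" by (simp add: exp_of_nat_mult[symmetric])
 finally have 1: "(1 + z / 36) ^ 4 <= exp (z / 9)" .
 have "(1 + z) ^ 4 <= (36 * (1 + z / 36)) ^ 4" using assms by (intro power_mono) auto
 also have "... = C0 * (1 + z / 36) ^ 4" by (simp only: power_mult_distrib C0_def)
 also have "... <= C0 * exp (z / 9)" using 1 by (simp add: C0_def)
 finally show ?thesis using assms by (simp add: exp_minus field_simps)
qed

definition psi :: "real => real => real" where "psi u x = exp (- (u * s1 x)) - exp (- (u * x\<^sup>2))"
definition psi1 :: "real => real => real" where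
 "psi1 u x = - 2 * u * sin x * exp (- (u * s1 x)) + 2 * u * x * exp (- (u * x\<^sup>2))"
definition psi2 :: "real => real => real" where
 "psi2 u x = (4 * u\<^sup>2 * (sin x)\<^sup>2 - 2 * u * cos x) * exp (- (u * s1 x)) - (4 * u\<^sup>2 * x\<^sup>2 - 2 * u) * exp (- (u * x\<^sup>2))"

lemma psi_deriv: "(psi u has_real_derivative psi1 u x) (at x)"
 unfolding psi_def[abs_def] psi1_def s1_alt by (auto intro!: derivative_eq_intros)

lemma psi1_deriv: "(psi1 u has_real_derivative psi2 u x) (at x)"
 unfolding psi1_def[abs_def] psi2_def s1_alt
 by (auto intro!: derivative_eq_intros) (simp add: power2_eq_square algebra_simps)

lemma psi2_cont: "continuous_on A (psi2 u)"
 unfolding psi2_def[abs_def] s1_alt by (intro continuous_intros)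

lemma psi_bounds:
 assumes u: "0 < u" and x: "\<bar>x\<bar> <= pi" defines "z \<equiv> u * x\<^sup>2"
 shows "\<bar>psi u x\<bar> <= C0 / u * (1 / (1 + z))" "\<bar>psi2 u x\<bar> <= C0 * (1 / (1 + z))"
  "\<bar>psi u x\<bar> <= 256 * u" "\<bar>psi2 u x\<bar> <= 16 * C0 * u"
proof -
 define E Q where "E = exp (- (u * s1 x))" and "Q = exp (- z)"
 have z: "0 <= z" using u by (simp add: z_def)
 have EQ: "0 <= E - Q" "E - Q <= u * (x ^ 4 / 12) * E"
 proof -
  show "0 <= E - Q" using s1_le[of x] u by (simp add: E_def Q_def z_def)
  have "Q = E * exp (- (u * (x\<^sup>2 - s1 x)))" by (simp add: E_def Q_def z_def exp_add[symmetric] algebra_simps)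
  moreover have "1 - u * (x\<^sup>2 - s1 x) <= exp (- (u * (x\<^sup>2 - s1 x)))" using exp_ge_add_one_self[of "- (u * (x\<^sup>2 - s1 x))"] by simp
  ultimately have "E * (1 - u * (x\<^sup>2 - s1 x)) <= Q" by (simp add: E_def)
  then have "E - Q <= u * (x\<^sup>2 - s1 x) * E" by (simp add: algebra_simps)
  also have "... <= u * (x ^ 4 / 12) * E" using u s1_diff_le[of x] by (intro mult_right_mono mult_left_mono) (auto simp: E_def)
  finally show "E - Q <= u * (x ^ 4 / 12) * E" .
 qed
 have E1: "0 <= E" "E <= 1" using u by (auto simp: E_def)
 have Ez: "E <= C0 / (1 + z) ^ 4"
 proof -
  have "E <= exp (- (z / 9))" using s1_ge[OF x] u by (simp add: E_def z_def)
  then show ?thesis using exp_decay[OF z] by simp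
 qed
 have C0: "0 <= C0" by (simp add: C0_def)
 have psi: "psi u x = E - Q" by (simp add: psi_def E_def Q_def z_def)
 have x4: "u * x ^ 4 = z\<^sup>2 / u" using u by (simp add: z_def power2_eq_square power4_eq_xxxx)
 have q: "z\<^sup>2 / (1 + z) ^ 4 <= 1 / (1 + z)" "z * (1 + z)\<^sup>2 / (1 + z) ^ 4 <= 1 / (1 + z)" "z * (1 + z)\<^sup>2 / (1 + z) ^ 4 <= z"
 proof -
  have 1: "z * (1 + z)\<^sup>2 / (1 + z) ^ 4 = z / (1 + z)\<^sup>2" using z by (simp add: power2_eq_square power4_eq_xxxx)
  have "z / (1 + z)\<^sup>2 <= (1 + z) / (1 + z)\<^sup>2" using z by (intro divide_right_mono) auto
  also have "... = 1 / (1 + z)" using z by (simp add: power2_eq_square)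
  finally have 2: "z / (1 + z)\<^sup>2 <= 1 / (1 + z)" .
  show "z * (1 + z)\<^sup>2 / (1 + z) ^ 4 <= 1 / (1 + z)" using 1 2 by simp
  have "z\<^sup>2 / (1 + z) ^ 4 <= z * (1 + z)\<^sup>2 / (1 + z) ^ 4"
   using z by (intro divide_right_mono) (auto simp: power2_eq_square algebra_simps)
  then show "z\<^sup>2 / (1 + z) ^ 4 <= 1 / (1 + z)" using 1 2 by simp
  have "1 <= (1 + z)\<^sup>2" using z by simp
  then have "z * 1 <= z * (1 + z)\<^sup>2" using z by (intro mult_left_mono) auto
  then show "z * (1 + z)\<^sup>2 / (1 + z) ^ 4 <= z" unfolding 1 using z by (subst pos_divide_le_eq) auto
 qed
 have "\<bar>psi u x\<bar> <= z\<^sup>2 / u * E"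
 proof -
  have "E - Q <= (z\<^sup>2 / u) / 12 * E" using EQ(2) x4 by simp
  also have "... <= z\<^sup>2 / u * E"
  proof (intro mult_right_mono E1)
   have gen: "a / 12 <= a" if "0 <= a" for a :: real using that by simp
   show "(z\<^sup>2 / u) / 12 <= z\<^sup>2 / u" by (rule gen) (use u in auto)
  qed
  finally show ?thesis using EQ by (simp add: psi)
 qed
 also have "... <= z\<^sup>2 / u * (C0 / (1 + z) ^ 4)" using u by (intro mult_left_mono Ez) auto
 also have "... = C0 / u * (z\<^sup>2 / (1 + z) ^ 4)" by simp
 also have "... <= C0 / u * (1 / (1 + z))" using u C0 by (intro mult_left_mono q) auto
 finally show "\<bar>psi u x\<bar> <= C0 / u * (1 / (1 + z))" .
 have x16: "x\<^sup>2 <= 16"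
 proof -
  have "\<bar>x\<bar>\<^sup>2 <= 4\<^sup>2" using x pi_less_4 by (intro power_mono) auto
  then show ?thesis by simp
 qed
 have "x ^ 4 <= 256"
 proof -
  have "x ^ 4 = x\<^sup>2 * x\<^sup>2" by (simp add: power2_eq_square power4_eq_xxxx)
  also have "... <= 16 * 16" using x16 by (intro mult_mono) auto
  finally show ?thesis by simp
 qed
 then have "u * (x ^ 4 / 12) * E <= u * 256 * 1" using u E1 by (intro mult_mono) auto
 then show "\<bar>psi u x\<bar> <= 256 * u" using EQ by (simp add: psi)
 have p2: "psi2 u x = 4 * u\<^sup>2 * ((sin x)\<^sup>2 - x\<^sup>2) * E + 4 * u\<^sup>2 * x\<^sup>2 * (E - Q) + u * s1 x * E - 2 * u * (E - Q)"
  unfolding psi2_def E_def[symmetric] z_def[symmetric] Q_def[symmetric] by (simp add: s1_alt algebra_simps)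
 have "\<bar>psi2 u x\<bar> <= \<bar>4 * u\<^sup>2 * ((sin x)\<^sup>2 - x\<^sup>2) * E\<bar> + \<bar>4 * u\<^sup>2 * x\<^sup>2 * (E - Q)\<bar> + \<bar>u * s1 x * E\<bar> + \<bar>2 * u * (E - Q)\<bar>"
  unfolding p2 by linarith
 also have "... <= 4 * u\<^sup>2 * (x ^ 4 / 3) * E + 4 * u\<^sup>2 * x\<^sup>2 * (u * (x ^ 4 / 12) * E) + u * x\<^sup>2 * E + 2 * u * (u * (x ^ 4 / 12) * E)"
 proof (intro add_mono)
  have "\<bar>(sin x)\<^sup>2 - x\<^sup>2\<bar> <= x ^ 4 / 3" using sin_sq_diff[of x] by linarith
  then show "\<bar>4 * u\<^sup>2 * ((sin x)\<^sup>2 - x\<^sup>2) * E\<bar> <= 4 * u\<^sup>2 * (x ^ 4 / 3) * E"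
   unfolding abs_mult using E1 u by (intro mult_mono) auto
  show "\<bar>4 * u\<^sup>2 * x\<^sup>2 * (E - Q)\<bar> <= 4 * u\<^sup>2 * x\<^sup>2 * (u * (x ^ 4 / 12) * E)"
   unfolding abs_mult using EQ by (intro mult_mono) auto
  show "\<bar>u * s1 x * E\<bar> <= u * x\<^sup>2 * E"
   unfolding abs_mult using E1 u s1_le[of x] by (intro mult_mono) auto
  show "\<bar>2 * u * (E - Q)\<bar> <= 2 * u * (u * (x ^ 4 / 12) * E)"
   unfolding abs_mult using EQ u by (intro mult_mono) auto
 qed
 also have "... = (z + 3 / 2 * z\<^sup>2 + z * z\<^sup>2 / 3) * E"
  by (simp add: z_def power2_eq_square power4_eq_xxxx algebra_simps)
 also have "... <= (z * (1 + z)\<^sup>2) * E"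
 proof (intro mult_right_mono E1)
  have "0 <= z\<^sup>2" "0 <= z * z\<^sup>2" using z by auto
  moreover have "z * (1 + z)\<^sup>2 = z + 2 * z\<^sup>2 + z * z\<^sup>2" by (simp add: power2_eq_square algebra_simps)
  ultimately show "z + 3 / 2 * z\<^sup>2 + z * z\<^sup>2 / 3 <= z * (1 + z)\<^sup>2" using z by linarith
 qed
 also have "... <= (z * (1 + z)\<^sup>2) * (C0 / (1 + z) ^ 4)" using z by (intro mult_left_mono Ez) auto
 also have "... = C0 * (z * (1 + z)\<^sup>2 / (1 + z) ^ 4)" by simp
 finally have p2': "\<bar>psi2 u x\<bar> <= C0 * (z * (1 + z)\<^sup>2 / (1 + z) ^ 4)" .
 show "\<bar>psi2 u x\<bar> <= C0 * (1 / (1 + z))" by (rule order_trans[OF p2']) (intro mult_left_mono q C0)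
 have "\<bar>psi2 u x\<bar> <= C0 * z" by (rule order_trans[OF p2']) (intro mult_left_mono q C0)
 also have "... <= C0 * (u * 16)" unfolding z_def using u x16 C0 by (intro mult_left_mono) auto
 finally show "\<bar>psi2 u x\<bar> <= 16 * C0 * u" by (simp add: mult_ac)
qed

lemma integral_IM_mono:
 fixes f g :: "real => real"
 assumes "integrable IM g" "!!x. \<bar>x\<bar> <= pi ==> \<bar>f x\<bar> <= g x" "f : borel_measurable borel"
 shows "(\<integral>x. \<bar>f x\<bar> \<partial>IM) <= (\<integral>x. g x \<partial>IM)"
 by (rule integral_mono') (use assms(1,2) order_trans[OF abs_ge_zero assms(2)] in auto)

lemma integral_IM_lorentz:
 assumes u: "0 < u"
 shows "integrable IM (%x. 1 / (1 + u * x\<^sup>2))" "(\<integral>x. 1 / (1 + u * x\<^sup>2) \<partial>IM) <= 4 / sqrt u"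
proof -
 have pos: "0 < 1 + u * x\<^sup>2" for x using u by (intro add_pos_nonneg) auto
 have m: "(%x. 1 / (1 + u * x\<^sup>2)) : borel_measurable borel" by measurable
 show "integrable IM (%x. 1 / (1 + u * x\<^sup>2))"
  using pos u by (intro IM.integrable_const_bound[where B = 1] IM_borel m AE_I2) (auto simp: divide_le_eq_1 intro: less_imp_le)
 have "(\<integral>x. 1 / (1 + u * x\<^sup>2) \<partial>IM) = (\<integral>x. indicator {-pi..pi} x *\<^sub>R (1 / (1 + u * x\<^sup>2)) \<partial>lborel)"
  by (rule integral_IM_Icc[OF m])
 also have "... = arctan (sqrt u * pi) / sqrt u - arctan (sqrt u * (- pi)) / sqrt u"
 proof (rule integral_FTC_atLeastAtMost)
  fix x
  have "((%x. arctan (sqrt u * x) / sqrt u) has_real_derivative 1 / (1 + u * x\<^sup>2)) (at x within {-pi..pi})"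
   using u by (auto intro!: derivative_eq_intros simp: power_mult_distrib divide_inverse)
  then show "((%x. arctan (sqrt u * x) / sqrt u) has_vector_derivative 1 / (1 + u * x\<^sup>2)) (at x within {-pi..pi})"
   by (simp add: has_real_derivative_iff_has_vector_derivative)
 qed (use pos in \<open>auto intro!: continuous_intros simp: less_imp_neq[symmetric]\<close>)
 also have "... <= 4 / sqrt u"
 proof -
  have "arctan (sqrt u * pi) - arctan (sqrt u * (- pi)) <= 4"
   using arctan_ubound[of "sqrt u * pi"] arctan_lbound[of "sqrt u * (- pi)"] pi_less_4 by linarith
  then show ?thesis using u by (simp add: diff_divide_distrib[symmetric] divide_right_mono)
 qed
 finally show "(\<integral>x. 1 / (1 + u * x\<^sup>2) \<partial>IM) <= 4 / sqrt u" .
qed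

lemma psi1_jump: assumes u: "0 < u" shows "\<bar>psi1 u pi - psi1 u (- pi)\<bar> <= 16 * u * exp (- (u * pi\<^sup>2))"
proof -
 have "psi1 u pi - psi1 u (- pi) = 4 * pi * u * exp (- (u * pi\<^sup>2))" by (simp add: psi1_def)
 moreover have "4 * pi * u * exp (- (u * pi\<^sup>2)) <= 16 * u * exp (- (u * pi\<^sup>2))"
  using u pi_less_4 by (intro mult_right_mono) auto
 ultimately show ?thesis using u by simp
qed

lemma integral_IM_const_le: fixes c :: real assumes "0 <= c" shows "(\<integral>x. c \<partial>IM) <= 8 * c"
proof -
 have "(\<integral>x. c \<partial>IM) = c * (2 * pi)" using integral_IM_Icc[of "%_. c"] by (simp add: measure_def)
 also have "... <= c * 8" using assms pi_less_4 by (intro mult_left_mono) auto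
 finally show ?thesis by simp
qed

definition C1 :: real where "C1 = 6 * (2048 + 16 + 128 * C0)"

lemma psi_fourier:
 assumes u: "0 < u"
 obtains c :: "int => complex" where "integrable cs c" "(\<integral>\<^sup>+n. ennreal (norm (c n)) \<partial>cs) <= ennreal (C1 * min u (1 / u))"
  "!!x. x : {-pi<..<pi} ==> (\<integral>n. c n * cis (- (of_int n * x)) \<partial>cs) = of_real (psi u x)"
proof -
 have per: "psi u pi = psi u (- pi)" by (simp add: psi_def s1_def)
 have C0: "1 <= C0" by (simp add: C0_def)
 have mb: "psi u : borel_measurable borel" "psi2 u : borel_measurable borel"
  unfolding psi_def[abs_def] psi2_def[abs_def] s1_def by measurable
 note exp1 = psi1_jump[OF u]
 show ?thesis
 proof (cases "1 <= u")
  case True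
  have r: "1 <= sqrt u" using True by simp
  have A: "(\<integral>y. \<bar>psi u y\<bar> \<partial>IM) <= 4 * C0 / (u * sqrt u)"
  proof -
   have "(\<integral>y. \<bar>psi u y\<bar> \<partial>IM) <= (\<integral>y. C0 / u * (1 / (1 + u * y\<^sup>2)) \<partial>IM)"
    by (rule integral_IM_mono[OF Bochner_Integration.integrable_mult_right[OF integral_IM_lorentz(1)[OF u]] psi_bounds(1)[OF u] mb(1)])
   also have "... = C0 / u * (\<integral>y. 1 / (1 + u * y\<^sup>2) \<partial>IM)" by (rule integral_mult_right_zero)
   also have "... <= C0 / u * (4 / sqrt u)" using u C0 by (intro mult_left_mono integral_IM_lorentz) auto
   finally show ?thesis by (simp add: mult_ac)
  qed
  have "(\<integral>y. \<bar>psi2 u y\<bar> \<partial>IM) <= (\<integral>y. C0 * (1 / (1 + u * y\<^sup>2)) \<partial>IM)"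
   by (rule integral_IM_mono[OF Bochner_Integration.integrable_mult_right[OF integral_IM_lorentz(1)[OF u]] psi_bounds(2)[OF u] mb(2)])
  also have "... = C0 * (\<integral>y. 1 / (1 + u * y\<^sup>2) \<partial>IM)" by (rule integral_mult_right_zero)
  also have "... <= C0 * (4 / sqrt u)" using u C0 by (intro mult_left_mono integral_IM_lorentz) auto
  finally have B1: "(\<integral>y. \<bar>psi2 u y\<bar> \<partial>IM) <= 4 * C0 / sqrt u" by (simp add: mult_ac)
  have "16 * u * exp (- (u * pi\<^sup>2)) <= 16 * C0 / sqrt u"
  proof -
   have "9 * 1 <= 9 * pi\<^sup>2"
    using pi_gt3 one_le_power[of pi 2] by simp
   then have "u * 1 <= u * (9 * pi\<^sup>2)" using u by (intro mult_left_mono) auto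
   then have "exp (- (u * pi\<^sup>2)) <= exp (- (u / 9))" by simp
   also have "... <= C0 / (1 + u) ^ 4" using u by (intro exp_decay) auto
   finally have "u * exp (- (u * pi\<^sup>2)) <= u * (C0 / (1 + u) ^ 4)" using u by (intro mult_left_mono) auto
   also have "... <= C0 / sqrt u"
   proof -
    have "u * sqrt u <= u * u"
     using True u real_sqrt_le_mono[of u "u * u"] by (intro mult_left_mono) (auto simp: real_sqrt_mult mult_le_cancel_left1)
    also have "... <= (1 + u)\<^sup>2" using u by (simp add: power2_eq_square algebra_simps)
    also have "... <= (1 + u) ^ 4" using u by (intro power_increasing) auto
    finally have "C0 * (u * sqrt u) <= C0 * (1 + u) ^ 4" using C0 by (intro mult_left_mono) auto
    then show ?thesis using u by (simp add: field_simps)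
   qed
   finally show ?thesis by simp
  qed
  then have B: "\<bar>psi1 u pi - psi1 u (- pi)\<bar> + (\<integral>y. \<bar>psi2 u y\<bar> \<partial>IM) <= 20 * C0 / sqrt u"
   using exp1 B1 by (simp add: add_divide_distrib[symmetric])
  obtain c where c: "integrable cs c" "(\<integral>\<^sup>+n. ennreal (norm (c n)) \<partial>cs) <= ennreal (6 * sqrt u * (4 * C0 / (u * sqrt u) + 20 * C0 / sqrt u / (sqrt u)\<^sup>2))"
    "!!x. x : {-pi<..<pi} ==> (\<integral>n. c n * cis (- (of_int n * x)) \<partial>cs) = of_real (psi u x)"
   by (rule fourier_1d_bound[OF psi_deriv psi1_deriv psi2_cont per r A B]) (rule that)
  have "6 * sqrt u * (4 * C0 / (u * sqrt u) + 20 * C0 / sqrt u / (sqrt u)\<^sup>2) = 144 * C0 * (1 / u)"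
   using u by (simp add: field_simps)
  also have "... <= C1 * min u (1 / u)"
  proof -
   have "1 <= u * u" using True u mult_mono[of 1 u 1 u] by simp
   then have "min u (1 / u) = 1 / u" using u by (simp add: min_def field_simps)
   then show ?thesis using C0 u by (simp add: C1_def divide_right_mono)
  qed
  finally show ?thesis by (intro that[OF c(1) order_trans[OF c(2)] c(3)] ennreal_leI)
 next
  case False
  have A: "(\<integral>y. \<bar>psi u y\<bar> \<partial>IM) <= 2048 * u"
  proof -
   have "(\<integral>y. \<bar>psi u y\<bar> \<partial>IM) <= (\<integral>y. 256 * u \<partial>IM)"
    by (rule integral_IM_mono) (use psi_bounds(3)[OF u] mb in auto)
   also have "... <= 8 * (256 * u)" using u by (intro integral_IM_const_le) auto
   finally show ?thesis by simp
  qed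
  have "(\<integral>y. \<bar>psi2 u y\<bar> \<partial>IM) <= (\<integral>y. 16 * C0 * u \<partial>IM)"
   by (rule integral_IM_mono) (use psi_bounds(4)[OF u] mb in auto)
  also have "... <= 8 * (16 * C0 * u)" using u C0 by (intro integral_IM_const_le) auto
  finally have B1: "(\<integral>y. \<bar>psi2 u y\<bar> \<partial>IM) <= 128 * C0 * u" by simp
  have "16 * u * exp (- (u * pi\<^sup>2)) <= 16 * u * 1" using u by (intro mult_left_mono) auto
  then have B: "\<bar>psi1 u pi - psi1 u (- pi)\<bar> + (\<integral>y. \<bar>psi2 u y\<bar> \<partial>IM) <= 16 * u + 128 * C0 * u"
   using exp1 B1 by simp
  obtain c where c: "integrable cs c" "(\<integral>\<^sup>+n. ennreal (norm (c n)) \<partial>cs) <= ennreal (6 * 1 * (2048 * u + (16 * u + 128 * C0 * u) / 1\<^sup>2))"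
    "!!x. x : {-pi<..<pi} ==> (\<integral>n. c n * cis (- (of_int n * x)) \<partial>cs) = of_real (psi u x)"
   by (rule fourier_1d_bound[OF psi_deriv psi1_deriv psi2_cont per order_refl A B]) (rule that)
  have "6 * 1 * (2048 * u + (16 * u + 128 * C0 * u) / 1\<^sup>2) = C1 * u" by (simp add: C1_def algebra_simps)
  also have "... <= C1 * min u (1 / u)"
  proof -
   have "u * u <= 1" using False u mult_mono[of u 1 u 1] by simp
   then have "min u (1 / u) = u" using u by (simp add: min_def field_simps)
   then show ?thesis by simp
  qed
  finally show ?thesis by (intro that[OF c(1) order_trans[OF c(2)] c(3)] ennreal_leI)
 qed
qed

lemma C1_nonneg: "0 <= C1" by (simp add: C1_def C0_def)

text \<open>
  The difference between the continuous Gaussian and the lattice heat symbol is small both for small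
  and for large time; for small time it is quadratic in the symbols, for large time both decay.
\<close>

lemma psi_axis:
 fixes j :: "'n::finite"
 assumes u: "0 < u" defines "F \<equiv> %\<xi>::real^'n. complex_of_real (psi u (\<xi> $ j))"
 shows "W F" "an1 F <= ennreal (C1 * min u (1 / u))"
proof -
 obtain c :: "int => complex" where c: "integrable cs c" "(\<integral>\<^sup>+n. ennreal (norm (c n)) \<partial>cs) <= ennreal (C1 * min u (1 / u))"
  "!!x. x : {-pi<..<pi} ==> (\<integral>n. c n * cis (- (of_int n * x)) \<partial>cs) = of_real (psi u x)"
  using psi_fourier[OF u] by blast
 define G where "G i \<xi> = c i * chr (axis j i) \<xi>" for i and \<xi> :: "real^'n"
 have WG: "W (G i)" for i unfolding G_def[abs_def] by (intro W_cmult W_chr)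
 have aG: "an1 (G i) = ennreal (norm (c i))" for i unfolding G_def[abs_def] by (simp add: an_cmult[OF W_chr] an_chr)
 have fin: "(\<integral>\<^sup>+i. an1 (G i) \<partial>cs) < \<infinity>" unfolding aG using le_less_trans[OF c(2)] by simp
 have e: "(\<integral>i. G i \<xi> \<partial>cs) = F \<xi>" if "\<xi> : pbox" for \<xi>
 proof -
  have "\<xi> $ j : {-pi<..<pi}" using that by (auto simp: pbox_def mem_box_cart)
  then show ?thesis using c(3) by (simp add: G_def F_def chr_axis)
 qed
 show "W F" using W_series(1)[OF WG fin] W_cong[of "%\<xi>. \<integral>i. G i \<xi> \<partial>cs" F, OF e] by simp
 show "an1 F <= ennreal (C1 * min u (1 / u))"
  using order_trans[OF W_series(2)[OF WG fin, of "%_. 1"]] c(2) an_cong[of "%\<xi>. \<integral>i. G i \<xi> \<partial>cs" F, OF e]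
  unfolding aG by simp
qed

lemma gauss_axis:
 fixes j :: "'n::finite"
 assumes u: "0 < u" defines "F \<equiv> %\<xi>::real^'n. complex_of_real (exp (- (u * (\<xi> $ j)\<^sup>2)))"
 shows "W F" "an1 F <= ennreal (1 + C1)"
proof -
 have F: "F = (%\<xi>. complex_of_real (exp (- (u * s1 (\<xi> $ j)))) - complex_of_real (psi u (\<xi> $ j)))"
  by (simp add: F_def psi_def)
 note h = heat_axis[of u j, OF less_imp_le[OF u]] and p = psi_axis[OF u, of j]
 show "W F" unfolding F by (rule W_diff[OF h(1) p(1)])
 have "min u (1 / u) <= 1" using u by (auto simp: min_le_iff_disj divide_le_eq_1)
 then have "C1 * min u (1 / u) <= C1 * 1" using C1_nonneg by (intro mult_left_mono) auto
 then have "an1 (%\<xi>::real^'n. complex_of_real (psi u (\<xi> $ j))) <= ennreal C1"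
  by (intro order_trans[OF p(2)] ennreal_leI) simp
 then have "an1 F <= 1 + ennreal C1"
  unfolding F by (intro order_trans[OF an_diff_le[OF h(1) p(1)]] add_mono h(2))
 then show "an1 F <= ennreal (1 + C1)" using C1_nonneg by simp
qed

text \<open>The two Gaussians are compared by replacing one variable at a time.\<close>

lemma gauss_minus_heat:
 fixes J :: "'n::finite set"
 shows "\<exists>C\<ge>0. \<forall>u>0. W (%\<xi>. of_real (exp (- (u * (\<Sum>j\<in>J. (\<xi> $ j)\<^sup>2)))))
  & an1 (%\<xi>. of_real (exp (- (u * (\<Sum>j\<in>J. (\<xi> $ j)\<^sup>2))))) <= ennreal C
  & W (%\<xi>. of_real (exp (- (u * (\<Sum>j\<in>J. s1 (\<xi> $ j))))) - of_real (exp (- (u * (\<Sum>j\<in>J. (\<xi> $ j)\<^sup>2)))))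
  & an1 (%\<xi>. of_real (exp (- (u * (\<Sum>j\<in>J. s1 (\<xi> $ j))))) - of_real (exp (- (u * (\<Sum>j\<in>J. (\<xi> $ j)\<^sup>2))))) <= ennreal (C * min u (1 / u))"
proof (induction J rule: infinite_finite_induct)
 case empty
 show ?case by (intro exI[of _ 1]) (auto simp: W_const an1_const an_zero)
next
 case (insert j J)
 define A where "A u \<xi> = complex_of_real (exp (- (u * (\<Sum>j\<in>J. (\<xi> $ j)\<^sup>2))))" for u and \<xi> :: "real^'n"
 define B where "B u \<xi> = complex_of_real (exp (- (u * (\<Sum>j\<in>J. s1 (\<xi> $ j)))))" for u and \<xi> :: "real^'n"
 define a where "a u \<xi> = complex_of_real (exp (- (u * (\<xi> $ j)\<^sup>2)))" for u and \<xi> :: "real^'n"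
 define b where "b u \<xi> = complex_of_real (exp (- (u * s1 (\<xi> $ j))))" for u and \<xi> :: "real^'n"
 define p where "p u \<xi> = complex_of_real (psi u (\<xi> $ j))" for u and \<xi> :: "real^'n"
 obtain C where C: "0 <= C" and IH: "!!u. 0 < u ==> W (A u)" "!!u. 0 < u ==> an1 (A u) <= ennreal C"
  "!!u. 0 < u ==> W (%\<xi>. B u \<xi> - A u \<xi>)" "!!u. 0 < u ==> an1 (%\<xi>. B u \<xi> - A u \<xi>) <= ennreal (C * min u (1 / u))"
  using insert(3) unfolding A_def[abs_def] B_def[abs_def] by auto
 have e1: "(%\<xi>. complex_of_real (exp (- (u * (\<Sum>j\<in>insert j J. (\<xi> $ j)\<^sup>2))))) = (%\<xi>. a u \<xi> * A u \<xi>)" for u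
  using insert(1,2) by (simp add: a_def A_def distrib_left exp_add[symmetric] flip: of_real_mult)
 have e2: "(%\<xi>. complex_of_real (exp (- (u * (\<Sum>j\<in>insert j J. s1 (\<xi> $ j)))))) = (%\<xi>. b u \<xi> * B u \<xi>)" for u
  using insert(1,2) by (simp add: b_def B_def distrib_left exp_add[symmetric] flip: of_real_mult)
 have e3: "(%\<xi>. complex_of_real (exp (- (u * (\<Sum>j\<in>insert j J. s1 (\<xi> $ j))))) - of_real (exp (- (u * (\<Sum>j\<in>insert j J. (\<xi> $ j)\<^sup>2)))))
   = (%\<xi>. b u \<xi> * (B u \<xi> - A u \<xi>) + p u \<xi> * A u \<xi>)" for u
 proof -
  have "p u \<xi> = b u \<xi> - a u \<xi>" for \<xi> by (simp add: p_def a_def b_def psi_def)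
  then show ?thesis
   by (intro ext) (simp only: fun_cong[OF e1] fun_cong[OF e2], simp add: right_diff_distrib left_diff_distrib \<open>!!\<xi>. p u \<xi> = b u \<xi> - a u \<xi>\<close>)
 qed
 show ?case
 proof (intro exI[of _ "(1 + C1) * C + C"] conjI allI impI)
  show "0 <= (1 + C1) * C + C" using C C1_nonneg by simp
  fix u :: real assume u: "0 < u"
  have m0: "0 <= min u (1 / u)" using u by auto
  have Wa: "W (a u)" "an1 (a u) <= ennreal (1 + C1)" unfolding a_def[abs_def] using gauss_axis[OF u] by auto
  have Wb: "W (b u)" "an1 (b u) <= ennreal 1" unfolding b_def[abs_def] using heat_axis(1,2)[OF less_imp_le[OF u]] by auto
  have Wp: "W (p u)" "an1 (p u) <= ennreal (C1 * min u (1 / u))" unfolding p_def[abs_def] using psi_axis[OF u] by auto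
  show "W (%\<xi>. complex_of_real (exp (- (u * (\<Sum>j\<in>insert j J. (\<xi> $ j)\<^sup>2)))))"
   unfolding e1 by (rule W_mult[OF Wa(1) IH(1)[OF u]])
  have "an1 (%\<xi>. a u \<xi> * A u \<xi>) <= ennreal ((1 + C1) * C)"
   using C C1_nonneg by (intro W_mult_bounds(1)[OF Wa(1) IH(1)[OF u] Wa(2) IH(2)[OF u]]) auto
  also have "... <= ennreal ((1 + C1) * C + C)" using C by (intro ennreal_leI) auto
  finally show "an1 (%\<xi>. complex_of_real (exp (- (u * (\<Sum>j\<in>insert j J. (\<xi> $ j)\<^sup>2))))) <= ennreal ((1 + C1) * C + C)"
   unfolding e1 .
  note W1 = W_mult[OF Wb(1) IH(3)[OF u]] and W2 = W_mult[OF Wp(1) IH(1)[OF u]]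
  show "W (%\<xi>. complex_of_real (exp (- (u * (\<Sum>j\<in>insert j J. s1 (\<xi> $ j))))) - of_real (exp (- (u * (\<Sum>j\<in>insert j J. (\<xi> $ j)\<^sup>2)))))"
   unfolding e3 by (rule W_add[OF W1 W2])
  have "an1 (%\<xi>. b u \<xi> * (B u \<xi> - A u \<xi>)) <= ennreal (1 * (C * min u (1 / u)))"
   using C m0 by (intro W_mult_bounds(1)[OF Wb(1) IH(3)[OF u] Wb(2) IH(4)[OF u]] mult_nonneg_nonneg) auto
  moreover have "an1 (%\<xi>. p u \<xi> * A u \<xi>) <= ennreal ((C1 * min u (1 / u)) * C)"
   using C m0 C1_nonneg by (intro W_mult_bounds(1)[OF Wp(1) IH(1)[OF u] Wp(2) IH(2)[OF u]] mult_nonneg_nonneg) auto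
  ultimately have "an1 (%\<xi>. b u \<xi> * (B u \<xi> - A u \<xi>) + p u \<xi> * A u \<xi>) <= ennreal (1 * (C * min u (1 / u))) + ennreal ((C1 * min u (1 / u)) * C)"
   by (intro order_trans[OF an_add_le[OF W1 W2]] add_mono)
  also have "... = ennreal (1 * (C * min u (1 / u)) + (C1 * min u (1 / u)) * C)"
   using C m0 C1_nonneg by (intro ennreal_plus[symmetric] mult_nonneg_nonneg) auto
  also have "... <= ennreal (((1 + C1) * C + C) * min u (1 / u))"
  proof (rule ennreal_leI)
   have "0 <= C * min u (1 / u)" using C m0 by (rule mult_nonneg_nonneg)
   then show "1 * (C * min u (1 / u)) + (C1 * min u (1 / u)) * C <= ((1 + C1) * C + C) * min u (1 / u)"
    by (simp add: algebra_simps)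
  qed
  finally show "an1 (%\<xi>. complex_of_real (exp (- (u * (\<Sum>j\<in>insert j J. s1 (\<xi> $ j))))) - of_real (exp (- (u * (\<Sum>j\<in>insert j J. (\<xi> $ j)\<^sup>2))))) <= ennreal (((1 + C1) * C + C) * min u (1 / u))"
   unfolding e3 .
 qed
qed auto

subsection \<open>Integrals over the half line\<close>

definition PM :: "real measure" where "PM = restrict_space lborel {0<..}"

lemma space_PM [simp]: "space PM = {0<..}" by (simp add: PM_def space_restrict_space)

lemma PM_sigma_finite: "sigma_finite_measure PM"
 unfolding PM_def by (rule sigma_finite_measure_restrict_space) (auto intro: lborel.sigma_finite_measure_axioms)

lemma PM_borel: "f : borel_measurable borel ==> f : borel_measurable PM"
 by (simp add: PM_def measurable_restrict_space1)

lemma id_PM: "(%x. x) : PM \<rightarrow>\<^sub>M borel"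
 by (rule PM_borel) simp

lemma id_TM: "(%x. x) : TM \<rightarrow>\<^sub>M borel"
 by (rule TM_borel) simp

lemma fst_PM [measurable]: "fst : PM \<Otimes>\<^sub>M M \<rightarrow>\<^sub>M borel"
 by (rule measurable_compose[OF measurable_fst id_PM])

lemma snd_TM [measurable]: "snd : M \<Otimes>\<^sub>M TM \<rightarrow>\<^sub>M borel"
 by (rule measurable_compose[OF measurable_snd id_TM])

lemma nn_integral_PM: "f : borel_measurable borel ==> (\<integral>\<^sup>+x. f x \<partial>PM) = (\<integral>\<^sup>+x. f x * indicator {0<..} x \<partial>lborel)"
 unfolding PM_def by (subst nn_integral_restrict_space) auto

lemma integral_PM: "(\<integral>x. f x \<partial>PM) = (\<integral>x. indicator {0<..} x *\<^sub>R f x \<partial>lborel)"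
 for f :: "real => 'a::{banach, second_countable_topology}"
 unfolding PM_def by (rule integral_restrict_space) auto

lemma nn_integral_PM_min:
 assumes a: "-1 < a" and b: "b < -1"
 shows "(\<integral>\<^sup>+t. ennreal (min (t powr a) (t powr b)) \<partial>PM) < \<infinity>"
proof -
 have "(\<integral>\<^sup>+t. ennreal (min (t powr a) (t powr b)) \<partial>PM) = (\<integral>\<^sup>+t. ennreal (min (t powr a) (t powr b)) * indicator {0<..} t \<partial>lborel)"
  by (rule nn_integral_PM) measurable
 also have "... <= (\<integral>\<^sup>+t. ennreal (indicator {0..1} t * t powr a) + ennreal (indicator {1..} t * t powr b) \<partial>lborel)"
  by (intro nn_integral_mono) (auto simp: indicator_def intro!: ennreal_leI)
 also have "... = (\<integral>\<^sup>+t. ennreal (indicator {0..1} t * t powr a) \<partial>lborel) + (\<integral>\<^sup>+t. ennreal (indicator {1..} t * t powr b) \<partial>lborel)"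
  by (rule nn_integral_add) measurable
 also have "(\<integral>\<^sup>+t. ennreal (indicator {0..1} t * t powr a) \<partial>lborel) = ennreal (1 powr (a + 1) / (a + 1))"
  by (rule nn_integral_has_integral_lebesgue[OF _ has_integral_powr_from_0[OF a]]) auto
 also have "(\<integral>\<^sup>+t. ennreal (indicator {1..} t * t powr b) \<partial>lborel) = ennreal (- (1 powr (b + 1)) / (b + 1))"
  by (rule nn_integral_has_integral_lebesgue[OF _ has_integral_powr_to_inf[OF b]]) auto
 finally show ?thesis by (auto simp: le_less_trans)
qed

lemma integral_PM_scale:
 fixes f :: "real => real"
 assumes s: "0 < s" shows "(\<integral>t. f (t * s) \<partial>PM) = (1 / s) * (\<integral>t. f t \<partial>PM)"
proof -
 have "(\<integral>t. f t \<partial>PM) = \<bar>s\<bar> *\<^sub>R (\<integral>t. indicator {0<..} (0 + s * t) *\<^sub>R f (0 + s * t) \<partial>lborel)"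
  unfolding integral_PM by (rule lborel_integral_real_affine) (use s in auto)
 also have "(\<integral>t. indicator {0<..} (0 + s * t) *\<^sub>R f (0 + s * t) \<partial>lborel) = (\<integral>t. f (t * s) \<partial>PM)"
  unfolding integral_PM
  by (intro Bochner_Integration.integral_cong refl) (use s in \<open>auto simp: indicator_def zero_less_mult_iff mult.commute\<close>)
 finally show ?thesis using s by simp
qed

lemma integral_PM_pos:
 fixes f :: "real => real"
 assumes i: "integrable PM f" and p: "!!t. 0 < t ==> 0 < f t" shows "0 < (\<integral>t. f t \<partial>PM)"
proof -
 have n: "AE t in PM. 0 <= f t" by (rule AE_I2) (auto intro: less_imp_le p)
 have "(\<integral>t. f t \<partial>PM) ~= 0"
 proof
  assume "(\<integral>t. f t \<partial>PM) = 0"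
  then have "AE t in PM. f t = 0" using integral_nonneg_eq_0_iff_AE[OF i n] by simp
  with AE_space have "AE t in PM. False" by eventually_elim (use p in force)
  then have "emeasure PM (space PM) = 0" using AE_iff_measurable[of "space PM" PM "%_. False"] sets.top[of PM] by (simp add: greaterThan_def)
  moreover have "emeasure PM {0<..} = emeasure lborel {0::real<..}"
   unfolding PM_def by (rule emeasure_restrict_space) auto
  moreover have "emeasure lborel {0<..1::real} <= emeasure lborel {0::real<..}" by (intro emeasure_mono) auto
  ultimately show False by simp
 qed
 moreover have "0 <= (\<integral>t. f t \<partial>PM)" by (rule integral_nonneg_AE[OF n])
 ultimately show ?thesis by simp
qed

text \<open>
  The logarithm of a quotient as an integral of differences of exponentials, which turns the quotient
  of the two symbols into a difference of Gaussian and heat kernels.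
\<close>

lemma frullani:
 assumes b: "0 < b" and ab: "b <= a"
 shows "(\<integral>u. (exp (- (u * b)) - exp (- (u * a))) / u \<partial>PM) = ln (a / b)"
proof -
 have "(\<integral>\<^sup>+u. ennreal ((exp (- (u * b)) - exp (- (u * a))) / u) \<partial>PM) = (\<integral>\<^sup>+u. (\<integral>\<^sup>+s. ennreal (exp (- (u * s))) * indicator {b..a} s \<partial>lborel) \<partial>PM)"
 proof (rule nn_integral_cong)
  fix u :: real assume "u : space PM" then have u: "0 < u" by simp
  have "(\<integral>\<^sup>+s. ennreal (exp (- (u * s))) * indicator {b..a} s \<partial>lborel) = ennreal (- exp (- (u * a)) / u - - exp (- (u * b)) / u)"
   by (rule nn_integral_FTC_Icc) (use u ab in \<open>auto intro!: derivative_eq_intros\<close>)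
  then show "ennreal ((exp (- (u * b)) - exp (- (u * a))) / u) = (\<integral>\<^sup>+s. ennreal (exp (- (u * s))) * indicator {b..a} s \<partial>lborel)"
   by (simp add: diff_divide_distrib)
 qed
 also have "... = (\<integral>\<^sup>+s. (\<integral>\<^sup>+u. ennreal (exp (- (u * s))) * indicator {b..a} s \<partial>PM) \<partial>lborel)"
 proof -
  interpret P: sigma_finite_measure PM by (rule PM_sigma_finite)
  interpret pair_sigma_finite PM "lborel :: real measure" ..
  show ?thesis by (rule Fubini'[symmetric]) (unfold case_prod_beta, measurable)
 qed
 also have "... = (\<integral>\<^sup>+s. ennreal (1 / s) * indicator {b..a} s \<partial>lborel)"
 proof (rule nn_integral_cong)
  fix s :: real
  show "(\<integral>\<^sup>+u. ennreal (exp (- (u * s))) * indicator {b..a} s \<partial>PM) = ennreal (1 / s) * indicator {b..a} s"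
  proof (cases "s : {b..a}")
   case True
   then have s: "0 < s" using b by auto
   have "(\<integral>\<^sup>+u. ennreal (exp (- (u * s))) \<partial>PM) = (\<integral>\<^sup>+u. ennreal (exp (- (u * s))) * indicator {0<..} u \<partial>lborel)"
    by (rule nn_integral_PM) measurable
   also have "... = (\<integral>\<^sup>+u. ennreal (exp (- (u * s))) * indicator {0..} u \<partial>lborel)"
   proof (rule nn_integral_cong_AE)
    show "AE u in lborel. ennreal (exp (- (u * s))) * indicator {0<..} u = ennreal (exp (- (u * s))) * indicator {0..} u"
     by (rule AE_I'[of "{0}"]) (auto split: split_indicator)
   qed
   also have "... = ennreal (0 - - exp (- (0 * s)) / s)"
   proof (rule nn_integral_FTC_atLeast)
    show "((%u. - exp (- (u * s)) / s) \<longlongrightarrow> 0) at_top" using s by real_asymp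
   qed (use s in \<open>auto intro!: derivative_eq_intros\<close>)
   finally show ?thesis using True by simp
  qed simp
 qed
 also have "... = ennreal (ln a - ln b)"
  by (rule nn_integral_FTC_Icc) (use b ab in \<open>auto intro!: derivative_eq_intros simp: field_simps\<close>)
 also have "ln a - ln b = ln (a / b)" using b ab by (simp add: ln_div)
 finally have n: "(\<integral>\<^sup>+u. ennreal ((exp (- (u * b)) - exp (- (u * a))) / u) \<partial>PM) = ennreal (ln (a / b))" .
 show ?thesis
 proof (subst integral_eq_nn_integral)
  show "AE u in PM. 0 <= (exp (- (u * b)) - exp (- (u * a))) / u" using ab by (intro AE_I2) auto
  show "enn2real (\<integral>\<^sup>+u. ennreal ((exp (- (u * b)) - exp (- (u * a))) / u) \<partial>PM) = ln (a / b)"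
   unfolding n using b ab by (intro enn2real_ennreal ln_ge_zero) (simp add: field_simps)
 qed (rule PM_borel, measurable)
qed

lemma W_congI: "W F ==> (!!\<xi>. \<xi> : pbox ==> F \<xi> = G \<xi>) ==> W G"
 using W_cong[of F G] by blast

lemma sg_measurable [measurable]: "sg : borel_measurable borel"
 unfolding sg_def[abs_def] s1_def by measurable

lemma norm_sq_sum: "(norm \<xi>)\<^sup>2 = (\<Sum>j\<in>UNIV. (\<xi> $ j)\<^sup>2)" for \<xi> :: "real^'n"
 unfolding power2_norm_eq_inner inner_vec_def by (simp add: power2_eq_square)

lemma sg_le: "sg \<xi> <= (norm \<xi>)\<^sup>2"
 unfolding sg_def norm_sq_sum by (intro sum_mono s1_le)

lemma sg_ge: assumes "!!j. \<bar>\<xi> $ j\<bar> <= pi" shows "(norm \<xi>)\<^sup>2 / 9 <= sg \<xi>"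
 unfolding sg_def norm_sq_sum sum_divide_distrib by (intro sum_mono s1_ge assms)

lemma sg_pos: assumes "\<xi> : pbox" shows "0 < sg \<xi>"
proof -
 have "0 < (norm \<xi>)\<^sup>2 / 9" using assms by (auto simp: pbox_def)
 also have "... <= sg \<xi>"
 proof (rule sg_ge)
  fix j
  have "- pi < \<xi> $ j" "\<xi> $ j < pi" using assms by (auto simp: pbox_def mem_box_cart)
  then show "\<bar>\<xi> $ j\<bar> <= pi" by linarith
 qed
 finally show ?thesis .
qed

text \<open>The logarithm of the quotient of the two symbols is a Frullani integral of differences of
  Gaussians, hence has an absolutely convergent Fourier series.\<close>

lemma W_log_ratio: "W (%\<xi>::real^'n. of_real (ln ((norm \<xi>)\<^sup>2 / sg \<xi>)))"
proof -
 define D where "D u \<xi> = complex_of_real (exp (- (u * sg \<xi>))) - of_real (exp (- (u * (norm \<xi>)\<^sup>2)))" for u and \<xi> :: "real^'n"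
 obtain C where C: "0 <= C" and D: "!!u. 0 < u ==> W (D u)" "!!u. 0 < u ==> an1 (D u) <= ennreal (C * min u (1 / u))"
  using gauss_minus_heat[of "UNIV :: 'n set"] unfolding D_def[abs_def] sg_def norm_sq_sum by auto
 define F where "F u \<xi> = of_real (1 / u) * D u \<xi>" for u \<xi>
 have WF: "W (F u)" if "u : space PM" for u using that unfolding F_def[abs_def] by (intro W_cmult D) auto
 have meas: "case_prod F : borel_measurable (PM \<Otimes>\<^sub>M TM)"
  unfolding F_def[abs_def] D_def case_prod_beta by measurable
 have "(\<integral>\<^sup>+u. an1 (F u) \<partial>PM) <= (\<integral>\<^sup>+u. ennreal C * ennreal (min (u powr 0) (u powr (-2))) \<partial>PM)"
 proof (rule nn_integral_mono)
  fix u :: real assume "u : space PM"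
  then have u: "0 < u" by simp
  have "an1 (F u) <= ennreal (1 / u) * ennreal (C * min u (1 / u))"
   unfolding F_def[abs_def] an_cmult[OF D(1)[OF u]] using u by (intro mult_mono D(2)[OF u]) (auto simp: norm_divide)
  also have "... = ennreal (C * (min u (1 / u) / u))" using u C by (subst ennreal_mult[symmetric]) (auto simp: min_def)
  also have "min u (1 / u) / u = min (u powr 0) (u powr (-2))"
  proof -
   have "u powr (-2) = 1 / (u * u)" using u by (simp add: powr_minus powr_numeral divide_inverse power2_eq_square)
   moreover have "1 / u / u = 1 / (u * u)" by simp
   moreover have "min u (1 / u) / u = min (u / u) (1 / u / u)" using u by (auto simp: min_def pos_le_divide_eq)
   ultimately show ?thesis using u by simp
  qed
  also have "ennreal (C * ...) = ennreal C * ennreal (min (u powr 0) (u powr (-2)))" using C by (intro ennreal_mult) auto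
  finally show "an1 (F u) <= ennreal C * ennreal (min (u powr 0) (u powr (-2)))" .
 qed
 also have "... < \<infinity>"
  using nn_integral_PM_min[of 0 "-2"]
  by (subst nn_integral_cmult) (auto simp: ennreal_mult_less_top intro!: PM_borel)
 finally have fin: "(\<integral>\<^sup>+u. an1 (F u) \<partial>PM) < \<infinity>" .
 have e: "(\<integral>u. F u \<xi> \<partial>PM) = of_real (ln ((norm \<xi>)\<^sup>2 / sg \<xi>))" if \<xi>: "\<xi> : pbox" for \<xi>
 proof -
  have "(\<integral>u. F u \<xi> \<partial>PM) = (\<integral>u. complex_of_real ((exp (- (u * sg \<xi>)) - exp (- (u * (norm \<xi>)\<^sup>2))) / u) \<partial>PM)"
   by (intro Bochner_Integration.integral_cong refl) (simp add: F_def D_def)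
  also have "... = of_real (ln ((norm \<xi>)\<^sup>2 / sg \<xi>))"
   by (subst integral_complex_of_real) (simp add: frullani[OF sg_pos[OF \<xi>] sg_le])
  finally show ?thesis .
 qed
 have "W (%\<xi>. \<integral>u. F u \<xi> \<partial>PM)" by (rule W_integral(1)[OF PM_sigma_finite meas WF fin])
 then show ?thesis by (rule W_congI) (rule e)
qed

definition ratio :: "real => real^'n => complex" where
 "ratio \<alpha> \<xi> = of_real (((norm \<xi>)\<^sup>2 / sg \<xi>) powr \<alpha>)"

text \<open>
  The exponential of a multiple of \<open>ln (\<bar>\<xi>\<bar>\<^sup>2 / \<sigma>(\<xi>))\<close>, with \<open>\<sigma>\<close> the symbol of the
  discrete Laplacian.
\<close>

lemma W_ratio: "W (ratio \<alpha>)"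
proof -
 have e: "exp (of_real \<alpha> * of_real (ln ((norm \<xi>)\<^sup>2 / sg \<xi>))) = ratio \<alpha> \<xi>" if "\<xi> : pbox" for \<xi>
 proof -
  have "\<xi> ~= 0" "sg \<xi> ~= 0" using sg_pos[OF that] that by (auto simp: pbox_def)
  then show ?thesis by (simp add: ratio_def powr_def flip: of_real_mult exp_of_real)
 qed
 show ?thesis by (rule W_congI[OF W_exp[OF W_cmult[OF W_log_ratio]]]) (rule e)
qed

lemma integrable_PM_nn:
 fixes f :: "real => real"
 assumes "f : borel_measurable borel" "!!t. 0 < t ==> 0 <= f t" "!!t. 0 < t ==> f t <= C * min (t powr a) (t powr b)"
  "0 <= C" "-1 < a" "b < -1"
 shows "integrable PM f"
 unfolding integrable_iff_bounded
proof
 show "f : borel_measurable PM" by (rule PM_borel) fact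
 have "(\<integral>\<^sup>+t. ennreal (norm (f t)) \<partial>PM) <= (\<integral>\<^sup>+t. ennreal C * ennreal (min (t powr a) (t powr b)) \<partial>PM)"
  using assms by (intro nn_integral_mono) (auto simp: ennreal_mult[symmetric] intro!: ennreal_leI)
 also have "... < \<infinity>"
  using nn_integral_PM_min[OF assms(5,6)]
  by (subst nn_integral_cmult) (auto simp: ennreal_mult_less_top intro!: PM_borel)
 finally show "(\<integral>\<^sup>+t. ennreal (norm (f t)) \<partial>PM) < \<infinity>" .
qed

definition pint :: "real => real" where "pint \<alpha> = (\<integral>t. (1 - exp (- t)) * t powr (- 1 - \<alpha>) \<partial>PM)"
definition gint :: real where "gint = (\<integral>t. exp (- t) * t powr (- 1 / 2) \<partial>PM)"

lemma one_minus_exp_le: "1 - exp (- t) <= (t::real)"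
 using exp_ge_add_one_self[of "- t"] by simp

lemma pint_integrable: assumes "0 < \<alpha>" "\<alpha> < 1" shows "integrable PM (%t. (1 - exp (- t)) * t powr (- 1 - \<alpha>))"
proof (rule integrable_PM_nn[where C = 1 and a = "- \<alpha>" and b = "- 1 - \<alpha>"])
 fix t :: real assume t: "0 < t"
 have "(1 - exp (- t)) * t powr (- 1 - \<alpha>) <= t * t powr (- 1 - \<alpha>)" by (intro mult_right_mono one_minus_exp_le) auto
 also have "t * t powr (- 1 - \<alpha>) = t powr (- \<alpha>)" using t powr_add[of t 1 "- 1 - \<alpha>"] by simp
 finally have 1: "(1 - exp (- t)) * t powr (- 1 - \<alpha>) <= t powr (- \<alpha>)" .
 have "(1 - exp (- t)) * t powr (- 1 - \<alpha>) <= 1 * t powr (- 1 - \<alpha>)" by (intro mult_right_mono) auto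
 with 1 show "(1 - exp (- t)) * t powr (- 1 - \<alpha>) <= 1 * min (t powr (- \<alpha>)) (t powr (- 1 - \<alpha>))" by simp
 show "0 <= (1 - exp (- t)) * t powr (- 1 - \<alpha>)" using t by simp
qed (use assms in auto)

lemma gint_integrable: "integrable PM (%t. exp (- t) * t powr (- 1 / 2))"
proof (rule integrable_PM_nn[where C = 1 and a = "- 1 / 2" and b = "- 3 / 2"])
 fix t :: real assume t: "0 < t"
 have 1: "exp (- t) * t powr (- 1 / 2) <= 1 * t powr (- 1 / 2)" using t by (intro mult_right_mono) auto
 have "t * exp (- t) <= 1"
 proof -
  have "t <= exp t" using exp_ge_add_one_self[of t] by linarith
  then show ?thesis by (simp add: exp_minus field_simps)
 qed
 then have "(t * exp (- t)) * t powr (- 3 / 2) <= 1 * t powr (- 3 / 2)" by (intro mult_right_mono) auto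
 moreover have e: "t powr (- 1 / 2) = t * t powr (- 3 / 2)" using t powr_add[of t 1 "- 3 / 2"] by simp
 have "exp (- t) * t powr (- 1 / 2) = (t * exp (- t)) * t powr (- 3 / 2)" unfolding e by (simp only: mult_ac)
 ultimately have "exp (- t) * t powr (- 1 / 2) <= t powr (- 3 / 2)" by (simp only: mult_1)
 with 1 show "exp (- t) * t powr (- 1 / 2) <= 1 * min (t powr (- 1 / 2)) (t powr (- 3 / 2))" by simp
qed auto

lemma pint_pos: "0 < \<alpha> ==> \<alpha> < 1 ==> 0 < pint \<alpha>"
 unfolding pint_def by (rule integral_PM_pos[OF pint_integrable]) auto

lemma gint_pos: "0 < gint"
 unfolding gint_def by (rule integral_PM_pos[OF gint_integrable]) auto

lemma pint_scale:
 assumes "0 < s" shows "(\<integral>t. (1 - exp (- (t * s))) * t powr (- 1 - \<alpha>) \<partial>PM) = pint \<alpha> * s powr \<alpha>"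
proof -
 have "(\<integral>t. (1 - exp (- (t * s))) * t powr (- 1 - \<alpha>) \<partial>PM) = (\<integral>t. s powr (1 + \<alpha>) * ((1 - exp (- (t * s))) * (t * s) powr (- 1 - \<alpha>)) \<partial>PM)"
 proof (rule Bochner_Integration.integral_cong)
  fix t :: real assume "t : space PM"
  then have "s powr (1 + \<alpha>) * (t * s) powr (- 1 - \<alpha>) = t powr (- 1 - \<alpha>) * (s powr (1 + \<alpha>) * s powr (- 1 - \<alpha>))"
   using assms by (simp add: powr_mult)
  also have "s powr (1 + \<alpha>) * s powr (- 1 - \<alpha>) = 1" using assms by (simp add: powr_add[symmetric])
  finally show "(1 - exp (- (t * s))) * t powr (- 1 - \<alpha>) = s powr (1 + \<alpha>) * ((1 - exp (- (t * s))) * (t * s) powr (- 1 - \<alpha>))" by (simp add: mult_ac)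
 qed simp
 also have "... = s powr (1 + \<alpha>) * ((1 / s) * pint \<alpha>)"
  unfolding pint_def using integral_PM_scale[OF assms, of "%t. (1 - exp (- t)) * t powr (- 1 - \<alpha>)"] by simp
 also have "... = pint \<alpha> * s powr \<alpha>" using assms by (simp add: powr_add)
 finally show ?thesis .
qed

lemma gint_scale:
 assumes "0 < s" shows "(\<integral>t. exp (- (t * s)) * t powr (- 1 / 2) \<partial>PM) = gint * s powr (- 1 / 2)"
  "integrable PM (%t. exp (- (t * s)) * t powr (- 1 / 2))"
proof -
 have "(\<integral>t. exp (- (t * s)) * t powr (- 1 / 2) \<partial>PM) = (\<integral>t. s powr (1 / 2) * (exp (- (t * s)) * (t * s) powr (- 1 / 2)) \<partial>PM)"
 proof (rule Bochner_Integration.integral_cong)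
  fix t :: real assume "t : space PM"
  then have "s powr (1 / 2) * (t * s) powr (- 1 / 2) = t powr (- 1 / 2) * (s powr (1 / 2) * s powr (- 1 / 2))"
   using assms by (simp add: powr_mult)
  also have "s powr (1 / 2) * s powr (- 1 / 2) = 1" using assms by (simp add: powr_add[symmetric])
  finally show "exp (- (t * s)) * t powr (- 1 / 2) = s powr (1 / 2) * (exp (- (t * s)) * (t * s) powr (- 1 / 2))" by (simp add: mult_ac)
 qed simp
 also have "... = s powr (1 / 2) * ((1 / s) * gint)"
  unfolding gint_def using integral_PM_scale[OF assms, of "%t. exp (- t) * t powr (- 1 / 2)"] by simp
 also have "... = gint * s powr (- 1 / 2)"
 proof -
  have "s powr (1 / 2) = s * s powr (- 1 / 2)" using assms powr_add[of s 1 "- 1 / 2"] by simp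
  then have "s powr (1 / 2) * (1 / s * gint) = (s * (1 / s)) * (gint * s powr (- 1 / 2))" by (simp only: mult_ac)
  then show ?thesis using assms by simp
 qed
 finally show 1: "(\<integral>t. exp (- (t * s)) * t powr (- 1 / 2) \<partial>PM) = gint * s powr (- 1 / 2)" .
 show "integrable PM (%t. exp (- (t * s)) * t powr (- 1 / 2))"
 proof (rule ccontr)
  assume "~ integrable PM (%t. exp (- (t * s)) * t powr (- 1 / 2))"
  then have "gint * s powr (- 1 / 2) = 0" unfolding 1[symmetric] by (rule not_integrable_integral_eq)
  then show False using gint_pos assms by simp
 qed
qed

lemma W_sg: "W (%\<xi>. of_real (sg \<xi>))"
proof -
 have e: "of_real (s1 (\<xi> $ j)) = 2 - (chr (axis j 1) \<xi> + chr (axis j (- 1)) \<xi>)" for j and \<xi> :: "real^'n"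
  by (simp add: chr_axis s1_alt complex_eq_iff)
 show ?thesis
  unfolding sg_def of_real_sum e by (rule W_sum, rule W_diff[OF W_const W_add[OF W_chr W_chr]])
qed

lemma one_minus_heat:
 assumes t: "0 < t" shows "W (%\<xi>::real^'n. 1 - heat t \<xi>)" "an1 (%\<xi>::real^'n. 1 - heat t \<xi>) <= ennreal 2"
  "an1 (%\<xi>::real^'n. 1 - heat t \<xi>) <= ennreal t * an1 (%\<xi>::real^'n. of_real (sg \<xi>))"
proof -
 show "W (%\<xi>::real^'n. 1 - heat t \<xi>)" using t by (intro W_diff W_const heat_W) auto
 have "an1 (%\<xi>::real^'n. 1 - heat t \<xi>) <= an1 (%\<xi>::real^'n. 1) + an1 (heat t :: real^'n => complex)"
  using t by (intro an_diff_le W_const heat_W) auto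
 also have "... <= 1 + 1" using t by (intro add_mono heat_an1) (auto simp: an1_const)
 finally show "an1 (%\<xi>::real^'n. 1 - heat t \<xi>) <= ennreal 2" by simp
 define M where "M = restrict_space lborel {0..t}"
 have sM: "space M = {0..t}" by (simp add: M_def space_restrict_space)
 have sf: "sigma_finite_measure M"
  unfolding M_def by (rule sigma_finite_measure_restrict_space) (auto intro: lborel.sigma_finite_measure_axioms)
 define F where "F r \<xi> = of_real (sg \<xi>) * heat r \<xi>" for r and \<xi> :: "real^'n"
 have WF: "W (F r)" if "r : space M" for r using that unfolding F_def[abs_def] sM by (intro W_mult W_sg heat_W) auto
 have aF: "an1 (F r) <= an1 (%\<xi>::real^'n. of_real (sg \<xi>))" if "r : space M" for r
 proof -
  have "an1 (F r) <= an1 (%\<xi>::real^'n. of_real (sg \<xi>)) * an1 (heat r :: real^'n => complex)"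
   unfolding F_def[abs_def] using that sM by (intro an1_mult_le W_sg heat_W) auto
  also have "... <= an1 (%\<xi>::real^'n. of_real (sg \<xi>)) * 1" using that sM by (intro mult_left_mono heat_an1) auto
  finally show ?thesis by simp
 qed
 have fstM [measurable]: "fst : M \<Otimes>\<^sub>M (TM :: (real^'n) measure) \<rightarrow>\<^sub>M borel"
 proof -
  have "(%x. x) : M \<rightarrow>\<^sub>M borel" unfolding M_def by (intro measurable_restrict_space1) simp
  then show ?thesis by (rule measurable_compose[OF measurable_fst])
 qed
 have meas: "case_prod F : borel_measurable (M \<Otimes>\<^sub>M TM)"
  unfolding F_def[abs_def] heat_def case_prod_beta by measurable
 have eM: "emeasure M (space M) = ennreal t"
  unfolding sM unfolding M_def using t by (subst emeasure_restrict_space) auto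
 have le: "(\<integral>\<^sup>+r. an1 (F r) \<partial>M) <= ennreal t * an1 (%\<xi>::real^'n. of_real (sg \<xi>))"
 proof -
  have "(\<integral>\<^sup>+r. an1 (F r) \<partial>M) <= (\<integral>\<^sup>+r. an1 (%\<xi>::real^'n. of_real (sg \<xi>)) \<partial>M)" by (intro nn_integral_mono aF)
  also have "... = an1 (%\<xi>::real^'n. of_real (sg \<xi>)) * emeasure M (space M)" by (rule nn_integral_const)
  finally show ?thesis unfolding eM by (subst mult.commute)
 qed
 also have "... < \<infinity>" using W_an1[OF W_sg, where 'a='n] by (simp add: ennreal_mult_less_top)
 finally have fin: "(\<integral>\<^sup>+r. an1 (F r) \<partial>M) < \<infinity>" .
 have e: "(\<integral>r. F r \<xi> \<partial>M) = 1 - heat t \<xi>" for \<xi>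
 proof -
  have "(\<integral>r. F r \<xi> \<partial>M) = of_real (\<integral>r. sg \<xi> * exp (- (r * sg \<xi>)) \<partial>M)"
   by (subst integral_complex_of_real[symmetric]) (simp add: F_def heat_def)
  also have "(\<integral>r. sg \<xi> * exp (- (r * sg \<xi>)) \<partial>M) = (\<integral>r. indicator {0..t} r *\<^sub>R (sg \<xi> * exp (- (r * sg \<xi>))) \<partial>lborel)"
   unfolding M_def by (rule integral_restrict_space) auto
  also have "... = - exp (- (t * sg \<xi>)) - - exp (- (0 * sg \<xi>))"
  proof (rule integral_FTC_atLeastAtMost)
   fix r
   show "((%r. - exp (- (r * sg \<xi>))) has_vector_derivative sg \<xi> * exp (- (r * sg \<xi>))) (at r within {0..t})"
    unfolding has_real_derivative_iff_has_vector_derivative[symmetric] by (auto intro!: derivative_eq_intros)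
  qed (use t in \<open>auto intro!: continuous_intros\<close>)
  finally show ?thesis by (simp add: heat_def)
 qed
 show "an1 (%\<xi>::real^'n. 1 - heat t \<xi>) <= ennreal t * an1 (%\<xi>::real^'n. of_real (sg \<xi>))"
  using order_trans[OF W_integral(2)[OF sf meas WF fin, of "%_. 1"] le] unfolding e .
qed

lemma W_sg_powr_small:
 assumes \<alpha>: "0 < \<alpha>" "\<alpha> < 1" shows "W (%\<xi>::real^'n. of_real (sg \<xi> powr \<alpha>))"
proof -
 obtain a where a: "an1 (%\<xi>::real^'n. of_real (sg \<xi>)) = ennreal a" "0 <= a"
  using W_an1[OF W_sg, where 'a='n] by (cases "an1 (%\<xi>::real^'n. of_real (sg \<xi>))") auto
 define F where "F t \<xi> = of_real (t powr (- 1 - \<alpha>)) * (1 - heat t \<xi>)" for t and \<xi> :: "real^'n"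
 have WF: "W (F t)" if "t : space PM" for t using that unfolding F_def[abs_def] by (intro W_cmult one_minus_heat) auto
 have meas: "case_prod F : borel_measurable (PM \<Otimes>\<^sub>M TM)"
  unfolding F_def[abs_def] heat_def case_prod_beta by measurable
 have "(\<integral>\<^sup>+t. an1 (F t) \<partial>PM) <= (\<integral>\<^sup>+t. ennreal (2 + a) * ennreal (min (t powr (- \<alpha>)) (t powr (- 1 - \<alpha>))) \<partial>PM)"
 proof (rule nn_integral_mono)
  fix t :: real assume "t : space PM"
  then have t: "0 < t" by simp
  have m: "an1 (%\<xi>::real^'n. 1 - heat t \<xi>) <= ennreal ((2 + a) * min t 1)"
  proof (cases "t <= 1")
   case True
   have "an1 (%\<xi>::real^'n. 1 - heat t \<xi>) <= ennreal (t * a)"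
    using one_minus_heat(3)[OF t, where 'n='n] t a by (simp add: ennreal_mult)
   also have "... <= ennreal ((2 + a) * min t 1)" using True t by (intro ennreal_leI) (simp add: algebra_simps)
   finally show ?thesis .
  next
   case False
   have "an1 (%\<xi>::real^'n. 1 - heat t \<xi>) <= ennreal 2" by (rule one_minus_heat(2)[OF t])
   also have "... <= ennreal ((2 + a) * min t 1)" using False a by (intro ennreal_leI) simp
   finally show ?thesis .
  qed
  have "an1 (F t) <= ennreal (t powr (- 1 - \<alpha>)) * ennreal ((2 + a) * min t 1)"
   unfolding F_def[abs_def] an_cmult[OF one_minus_heat(1)[OF t]] by (intro mult_mono m) auto
  also have "... = ennreal ((2 + a) * (t powr (- 1 - \<alpha>) * min t 1))"
   using t a by (subst ennreal_mult[symmetric]) (auto simp: mult_ac)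
  also have "t powr (- 1 - \<alpha>) * min t 1 = min (t powr (- \<alpha>)) (t powr (- 1 - \<alpha>))"
  proof -
   have "t powr (- 1 - \<alpha>) * t = t powr (- \<alpha>)" using t powr_add[of t "- 1 - \<alpha>" 1] by simp
   moreover have "t powr (- 1 - \<alpha>) * min t 1 = min (t powr (- 1 - \<alpha>) * t) (t powr (- 1 - \<alpha>) * 1)"
    using t by (auto simp: min_def mult_le_cancel_left1)
   ultimately show ?thesis by simp
  qed
  also have "ennreal ((2 + a) * min (t powr (- \<alpha>)) (t powr (- 1 - \<alpha>))) = ennreal (2 + a) * ennreal (min (t powr (- \<alpha>)) (t powr (- 1 - \<alpha>)))"
   using a by (intro ennreal_mult) auto
  finally show "an1 (F t) <= ennreal (2 + a) * ennreal (min (t powr (- \<alpha>)) (t powr (- 1 - \<alpha>)))" .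
 qed
 also have "... < \<infinity>"
  using nn_integral_PM_min[of "- \<alpha>" "- 1 - \<alpha>"] \<alpha>
  by (subst nn_integral_cmult) (auto simp: ennreal_mult_less_top intro!: PM_borel)
 finally have fin: "(\<integral>\<^sup>+t. an1 (F t) \<partial>PM) < \<infinity>" .
 have e: "of_real (1 / pint \<alpha>) * (\<integral>t. F t \<xi> \<partial>PM) = of_real (sg \<xi> powr \<alpha>)" if \<xi>: "\<xi> : pbox" for \<xi>
 proof -
  have "(\<integral>t. F t \<xi> \<partial>PM) = (\<integral>t. complex_of_real ((1 - exp (- (t * sg \<xi>))) * t powr (- 1 - \<alpha>)) \<partial>PM)"
   by (intro Bochner_Integration.integral_cong refl) (simp add: F_def heat_def)
  also have "... = of_real (pint \<alpha> * sg \<xi> powr \<alpha>)"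
   by (subst integral_complex_of_real) (simp add: pint_scale[OF sg_pos[OF \<xi>]])
  finally show ?thesis using pint_pos[OF \<alpha>] by simp
 qed
 have "W (%\<xi>. \<integral>t. F t \<xi> \<partial>PM)" by (rule W_integral(1)[OF PM_sigma_finite meas WF fin])
 from W_cmult[OF this] show ?thesis by (rule W_congI) (rule e)
qed

text \<open>
  Integer powers are polynomials in the characters; the fractional part is an integral of
  \<open>1 - heat t\<close> against \<open>t powr (- 1 - \<alpha>)\<close>.
\<close>

lemma W_sg_powr:
 assumes "0 <= \<alpha>" shows "W (%\<xi>::real^'n. of_real (sg \<xi> powr \<alpha>))"
proof (cases "\<alpha> = 0")
 case True
 have "of_real (sg \<xi> powr \<alpha>) = (1::complex)" if "\<xi> : pbox" for \<xi> :: "real^'n"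
  using sg_pos[OF that] True by simp
 then have "W (%\<xi>::real^'n. of_real (sg \<xi> powr \<alpha>)) \<longleftrightarrow> W (%_::real^'n. 1)" by (intro W_cong) auto
 then show ?thesis using W_const[of 1] by simp
next
 case False
 obtain k :: nat where k: "\<alpha> < real k" using reals_Archimedean2 by blast
 have k0: "0 < k" using k assms by (cases k) auto
 have "W (%\<xi>. of_real (sg \<xi> powr (\<alpha> / k)) ^ k)"
  using k k0 assms False by (intro W_power W_sg_powr_small) auto
 moreover have "of_real (sg \<xi> powr (\<alpha> / k)) ^ k = (of_real (sg \<xi> powr \<alpha>) :: complex)" if "\<xi> : pbox" for \<xi> :: "real^'n"
  using sg_pos[OF that] k0 by (simp add: powr_powr flip: of_real_power powr_realpow' powr_realpow)
 ultimately show ?thesis by (rule W_congI)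
qed

section \<open>Calderon-Zygmund theory on the lattice\<close>

lemma vec_box:
 fixes I :: "'n::finite => int set"
 assumes "!!i. finite (I i)"
 shows "finite {m::int^'n. ALL i. m $ i : I i}" "card {m::int^'n. ALL i. m $ i : I i} = (\<Prod>i\<in>UNIV. card (I i))"
proof -
 have b: "bij_betw vec_nth {m::int^'n. ALL i. m $ i : I i} (PiE UNIV I)"
  by (rule bij_betw_byWitness[where f' = vec_lambda]) (auto simp: PiE_iff)
 have "finite (PiE UNIV I)" using assms by (intro finite_PiE) auto
 then show "finite {m::int^'n. ALL i. m $ i : I i}" using bij_betw_finite[OF b] by simp
 show "card {m::int^'n. ALL i. m $ i : I i} = (\<Prod>i\<in>UNIV. card (I i))"
  using bij_betw_same_card[OF b] by (simp add: card_PiE)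
qed

subsection \<open>Dyadic cubes\<close>

definition cube :: "nat => int^'n => (int^'n) set" where
 "cube k n = {m. ALL i. m $ i div 2 ^ k = n $ i div 2 ^ k}"

lemma cube_self [simp]: "n : cube k n" by (simp add: cube_def)

lemma div_eq_iff_interval: "0 < c ==> m div c = q \<longleftrightarrow> m : {q * c..<(q + 1) * c}" for m c q :: int
proof
 assume c: "0 < c" and e: "m div c = q"
 have "q * c + m mod c = m" using div_mult_mod_eq[of m c] by (simp only: e)
 moreover have "0 <= m mod c" "m mod c < c" using c by simp_all
 moreover have "(q + 1) * c = q * c + c" by (simp only: distrib_right mult_1)
 ultimately show "m : {q * c..<(q + 1) * c}" unfolding atLeastLessThan_iff by linarith
next
 assume c: "0 < c" and "m : {q * c..<(q + 1) * c}"
 moreover have "(q + 1) * c = q * c + c" by (simp only: distrib_right mult_1)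
 ultimately have "0 <= m - q * c" "m - q * c < c" unfolding atLeastLessThan_iff by linarith+
 moreover have "m = c * q + (m - q * c)" by (simp add: mult.commute)
 ultimately show "m div c = q" by (intro int_div_pos_eq)
qed

lemma cube_finite: "finite (cube k n)" and cube_card: "card (cube k n) = 2 ^ (k * CARD('n))"
 for n :: "int^'n"
proof -
 have e: "cube k n = {m. ALL i. m $ i : {n $ i div 2 ^ k * 2 ^ k..<(n $ i div 2 ^ k + 1) * 2 ^ k}}"
  unfolding cube_def by (intro Collect_cong all_cong1 div_eq_iff_interval) simp
 show "finite (cube k n)" unfolding e by (rule vec_box) simp
 have "card (cube k n) = (\<Prod>i\<in>(UNIV::'n set). 2 ^ k)"
  unfolding e by (subst vec_box(2)) (auto simp: distrib_right nat_power_eq)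
 then show "card (cube k n) = 2 ^ (k * CARD('n))" by (simp add: power_mult)
qed

lemma cube_eq: assumes "m : cube k n" "k <= j" shows "cube j m = cube j n"
proof -
 have e: "x div 2 ^ j = (x div 2 ^ k) div 2 ^ (j - k)" for x :: int
 proof -
  have "(2::int) ^ j = 2 ^ k * 2 ^ (j - k)" using assms(2) by (simp add: power_add[symmetric])
  then show ?thesis by (simp only: zdiv_zmult2_eq zero_le_power zero_le_numeral)
 qed
 have "m $ i div 2 ^ k = n $ i div 2 ^ k" for i using assms(1) by (simp add: cube_def)
 then have "m $ i div 2 ^ j = n $ i div 2 ^ j" for i by (simp only: e)
 then show ?thesis by (simp add: cube_def)
qed

lemma cube_mono: assumes "k <= j" shows "cube k n <= cube j n"
proof
 fix m assume "m : cube k n"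
 then have "cube j m = cube j n" using assms by (rule cube_eq)
 then show "m : cube j n" using cube_self[of m j] by simp
qed

lemma cube_diff_le:
 assumes "m : cube k n" shows "\<bar>(m - n) $ i\<bar> <= 2 ^ k"
proof -
 define c :: int where "c = 2 ^ k"
 have c: "0 < c" by (simp add: c_def)
 have e: "m $ i div c = n $ i div c" using assms by (simp add: cube_def c_def)
 obtain q where q: "n $ i div c = q" by simp
 have "m $ i : {q * c..<(q + 1) * c}" "n $ i : {q * c..<(q + 1) * c}"
  using div_eq_iff_interval[OF c] e q by auto
 moreover have "(q + 1) * c = q * c + c" by (simp only: distrib_right mult_1)
 ultimately have "\<bar>m $ i - n $ i\<bar> <= c" unfolding atLeastLessThan_iff by linarith
 then show ?thesis by (simp add: c_def)
qed

subsection \<open>Singular kernels\<close>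

definition fsupp :: "(int^'n => complex) => bool" where "fsupp f \<longleftrightarrow> finite {n. f n ~= 0}"

definition l2_bounded :: "real => (int^'n => complex) => bool" where
 "l2_bounded A K \<longleftrightarrow> (ALL f. fsupp f -->
   (\<integral>\<^sup>+n. ennreal ((norm (conv K f n))\<^sup>2) \<partial>cs) <= ennreal A * (\<integral>\<^sup>+n. ennreal ((norm (f n))\<^sup>2) \<partial>cs))"

text \<open>
  The kernel may change by at most a fixed amount in \<open>L\<^sup>1\<close> under a translation by \<open>v\<close>, once
  the distance to the origin exceeds twice the size of \<open>v\<close>.
\<close>

definition hoermander :: "real => (int^'n => complex) => bool" where
 "hoermander A K \<longleftrightarrow> (\<forall>r::nat. ALL v. 1 <= r --> (ALL i. \<bar>v $ i\<bar> <= int r) -->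
   (\<integral>\<^sup>+z. ennreal (norm (K (z - v) - K z)) * indicator {z. EX i. 2 * int r < \<bar>z $ i\<bar>} z \<partial>cs) <= ennreal A)"

lemma conv_fsupp:
 assumes "finite S" "!!n. n \<notin> S ==> f n = 0" shows "conv K f n = (\<Sum>y\<in>S. K (n - y) * f y)"
proof -
 have "finite {a : UNIV. K (n - a) * f a ~= 0}" by (rule finite_subset[OF _ assms(1)]) (use assms(2) in auto)
 then have "conv K f n = (\<Sum>y | y : UNIV & K (n - y) * f y ~= 0. K (n - y) * f y)"
  unfolding conv_def by (rule lebesgue_integral_count_space_finite_support)
 also have "... = (\<Sum>y\<in>S. K (n - y) * f y)"
  by (rule sum.mono_neutral_left) (use assms in auto)
 finally show ?thesis .
qed

lemma nn_fsupp:
 fixes g :: "int^'n => real"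
 assumes "finite S" "!!n. n \<notin> S ==> g n = 0" "!!n. 0 <= g n" shows "(\<integral>\<^sup>+n. ennreal (g n) \<partial>cs) = ennreal (\<Sum>n\<in>S. g n)"
 using assms by (subst nn_integral_count_space'[of S]) (auto simp: sum_ennreal)

lemma ennreal_mult3: "0 <= a ==> 0 <= b ==> 0 <= c ==> ennreal (a * (b * c)) = ennreal a * (ennreal b * ennreal c)"
 by (simp add: ennreal_mult)

lemma chebyshev_cs:
 fixes h :: "'a => real"
 assumes "0 < t" shows "emeasure cs {n. t < h n & n : P} <= ennreal (1 / t) * (\<integral>\<^sup>+n. ennreal (h n) * indicator P n \<partial>cs)"
proof -
 have "emeasure cs {n. t < h n & n : P} = (\<integral>\<^sup>+n. indicator {n. t < h n & n : P} n \<partial>cs)" by simp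
 also have "... <= (\<integral>\<^sup>+n. ennreal (1 / t) * (ennreal (h n) * indicator P n) \<partial>cs)"
 proof (rule nn_integral_mono)
  fix n
  show "indicator {n. t < h n & n : P} n <= ennreal (1 / t) * (ennreal (h n) * indicator P n)"
  proof (cases "t < h n & n : P")
   case True
   have "1 <= 1 / t * h n" using True assms by (simp add: field_simps)
   then have "ennreal 1 <= ennreal (1 / t) * ennreal (h n)" using assms True by (subst ennreal_mult[symmetric]) (auto intro!: ennreal_leI)
   then show ?thesis using True by simp
  qed auto
 qed
 also have "... = ennreal (1 / t) * (\<integral>\<^sup>+n. ennreal (h n) * indicator P n \<partial>cs)" by (rule nn_integral_cmult) simp
 finally show ?thesis .
qed

text \<open>The Calderon-Zygmund decomposition at height \<open>t\<close>: on the maximal dyadic cubes on which the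
  average of the modulus exceeds \<open>t\<close>, the function is replaced by its average.\<close>

lemma weak_type:
 fixes K f :: "int^'n => complex"
 assumes K2: "l2_bounded A K" and KH: "hoermander B K" and A: "0 <= A" and B: "0 <= B"
  and fin: "fsupp f" and t: "0 < t"
 defines "L \<equiv> (\<Sum>n | f n ~= 0. norm (f n))"
 shows "emeasure cs {n. t < norm (conv K f n)} <= ennreal ((4 * A * 2 ^ CARD('n) + 4 * B + 5 ^ CARD('n)) * L / t)"
proof -
 define S where "S = {n. f n ~= 0}"
 have S: "finite S" "!!n. n \<notin> S ==> f n = 0" using fin by (auto simp: S_def fsupp_def)
 have L0: "0 <= L" unfolding L_def by (rule sum_nonneg) simp
 have sumL: "(\<Sum>n\<in>F. norm (f n)) <= L" if "finite F" for F
 proof -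
  have "(\<Sum>n\<in>F. norm (f n)) = (\<Sum>n\<in>F \<inter> S. norm (f n))"
   by (rule sum.mono_neutral_right) (use that S in auto)
  also have "... <= (\<Sum>n\<in>S. norm (f n))" by (rule sum_mono2) (use S in auto)
  finally show ?thesis by (simp add: L_def S_def)
 qed
 let ?d = "CARD('n)"
 have d: "1 <= ?d" by (simp add: Suc_leI)
 define s where "s k n = (\<Sum>m\<in>cube k n. norm (f m))" for k n
 define bad where "bad n k \<longleftrightarrow> t * 2 ^ (k * ?d) < s k n" for n k
 have bad_fin: "finite {k. bad n k}" for n
 proof -
  obtain N :: nat where N: "L / t < 2 ^ N" using real_arch_pow[of 2 "L / t"] by auto
  have "k < N" if "bad n k" for k
  proof (rule ccontr)
   assume "~ k < N"
   then have "N * 1 <= k * ?d" using d by (intro mult_le_mono) auto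
   then have "(2::real) ^ N <= 2 ^ (k * ?d)" by (intro power_increasing) auto
   then have "t * 2 ^ N <= t * 2 ^ (k * ?d)" using t by (intro mult_left_mono) auto
   moreover have "L < t * 2 ^ N" using N t by (simp add: field_simps)
   ultimately have "L < t * 2 ^ (k * ?d)" by simp
   then show False using that sumL[OF cube_finite, of k n] by (simp add: bad_def s_def)
  qed
  then have "{k. bad n k} <= {..<N}" by auto
  then show ?thesis by (rule finite_subset) simp
 qed
 define \<Omega> where "\<Omega> = {n. EX k. bad n k}"
 define \<kappa> where "\<kappa> n = Max {k. bad n k}" for n
 have \<kappa>: "bad n (\<kappa> n)" "!!k. bad n k ==> k <= \<kappa> n" if "n : \<Omega>" for n
  using Max_in[OF bad_fin, of n] Max_ge[OF bad_fin, of _ n] that by (auto simp: \<Omega>_def \<kappa>_def)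
 define q where "q n = cube (\<kappa> n) n" for n
 have bad_eq: "bad m j \<longleftrightarrow> bad n j" if "m : cube k n" "k <= j" for m n j k
  using cube_eq[OF that] by (simp add: bad_def s_def)
 have q_in: "m : \<Omega>" and q_\<kappa>: "\<kappa> m = \<kappa> n" and q_eq: "q m = q n" if n: "n : \<Omega>" and m: "m : q n" for m n
 proof -
  have m': "m : cube (\<kappa> n) n" using m by (simp add: q_def)
  have "bad m (\<kappa> n)" using bad_eq[OF m' order_refl] \<kappa>(1)[OF n] by simp
  then show mO: "m : \<Omega>" by (auto simp: \<Omega>_def)
  have 1: "\<kappa> n <= \<kappa> m" by (rule \<kappa>(2)[OF mO]) fact
  have "bad n (\<kappa> m)" using bad_eq[OF m' 1] \<kappa>(1)[OF mO] by simp
  then have "\<kappa> m <= \<kappa> n" by (rule \<kappa>(2)[OF n])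
  with 1 show e: "\<kappa> m = \<kappa> n" by simp
  show "q m = q n" using cube_eq[OF m' order_refl] by (simp add: q_def e)
 qed
 have q_self: "n : q n" for n by (simp add: q_def)
 have q_fin: "finite (q n)" for n by (simp add: q_def cube_finite)
 have q_card: "card (q n) = 2 ^ (\<kappa> n * ?d)" for n by (simp add: q_def cube_card)
 have q_sum: "t * real (card (q n)) < (\<Sum>m\<in>q n. norm (f m))" if "n : \<Omega>" for n
  using \<kappa>(1)[OF that] by (simp add: bad_def s_def q_def cube_card)
 have \<Omega>_sub: "\<Omega> <= (\<Union>m\<in>S \<inter> \<Omega>. q m)"
 proof
  fix n assume n: "n : \<Omega>"
  have "0 < (\<Sum>m\<in>q n. norm (f m))" using t by (intro le_less_trans[OF _ q_sum[OF n]]) auto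
  then have "\<exists>m\<in>q n. f m ~= 0" by (intro ccontr[of "\<exists>m\<in>q n. f m ~= 0"]) auto
  then obtain m where m: "m : q n" "f m ~= 0" by auto
  have "n : q m" unfolding q_eq[OF n m(1)] by (rule q_self)
  then show "n : (\<Union>m\<in>S \<inter> \<Omega>. q m)" using m q_in[OF n m(1)] by (auto simp: S_def)
 qed
 have \<Omega>_fin: "finite \<Omega>" by (rule finite_subset[OF \<Omega>_sub]) (use S q_fin in auto)
 define \<Q> where "\<Q> = q ` \<Omega>"
 have \<Q>_fin: "finite \<Q>" using \<Omega>_fin by (simp add: \<Q>_def)
 have \<Q>_Un: "\<Union>\<Q> = \<Omega>" using q_self q_in by (auto simp: \<Q>_def)
 have sum_\<Q>: "sum h \<Omega> = (\<Sum>Q\<in>\<Q>. sum h Q)" for h :: "int^'n => 'b::comm_monoid_add"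
 proof -
  have "sum h (\<Union>\<Q>) = (sum \<circ> sum) h \<Q>"
  proof (rule sum.Union_disjoint)
   show "\<forall>A\<in>\<Q>. finite A" by (auto simp: \<Q>_def q_fin)
   show "\<forall>A\<in>\<Q>. \<forall>B\<in>\<Q>. A ~= B --> A \<inter> B = {}" 
   proof (intro ballI impI)
    fix P R assume PR: "P : \<Q>" "R : \<Q>" "P ~= R"
    show "P \<inter> R = {}"
    proof (rule ccontr)
     assume "P \<inter> R ~= {}"
     then obtain x where x: "x : P" "x : R" by auto
     obtain a b where ab: "a : \<Omega>" "P = q a" "b : \<Omega>" "R = q b" using PR by (auto simp: \<Q>_def)
     have "q x = q a" by (rule q_eq[OF ab(1)]) (use x ab in simp)
     moreover have "q x = q b" by (rule q_eq[OF ab(3)]) (use x ab in simp)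
     ultimately show False using PR ab by simp
    qed
   qed
  qed
  then show ?thesis by (simp add: \<Q>_Un)
 qed
 have card_\<Omega>: "t * real (card \<Omega>) <= L"
 proof -
  have "t * real (card \<Omega>) = t * (\<Sum>n\<in>\<Omega>. 1)" by simp
  also have "... = (\<Sum>Q\<in>\<Q>. t * real (card Q))" unfolding sum_\<Q> by (simp add: sum_distrib_left)
  also have "... <= (\<Sum>Q\<in>\<Q>. \<Sum>m\<in>Q. norm (f m))"
   by (rule sum_mono) (use q_sum in \<open>auto simp: \<Q>_def less_imp_le\<close>)
  also have "... <= L" unfolding sum_\<Q>[symmetric] by (rule sumL[OF \<Omega>_fin])
  finally show ?thesis .
 qed
 define g where "g n = (if n : \<Omega> then (\<Sum>m\<in>q n. f m) / of_nat (card (q n)) else f n)" for n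
 define b where "b n = f n - g n" for n
 have card_pos: "0 < real (card (q n))" for n by (simp add: q_card)
 have g_le: "norm (g n) <= 2 ^ ?d * t" for n
 proof (cases "n : \<Omega>")
  case True
  have "~ bad n (Suc (\<kappa> n))" using \<kappa>(2)[OF True] by force
  then have 1: "s (Suc (\<kappa> n)) n <= t * 2 ^ (Suc (\<kappa> n) * ?d)" by (simp add: bad_def)
  have "norm (\<Sum>m\<in>q n. f m) <= (\<Sum>m\<in>q n. norm (f m))" by (rule norm_sum)
  also have "... <= s (Suc (\<kappa> n)) n"
   unfolding s_def q_def by (rule sum_mono2) (auto simp: cube_finite intro: cube_mono[THEN subsetD, rotated])
  also have "... <= (2 ^ ?d * t) * real (card (q n))" using 1 by (simp add: q_card power_add mult_ac)
  finally show ?thesis using card_pos[of n] True by (simp add: g_def norm_divide pos_divide_le_eq)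
 next
  case False
  then have "~ bad n 0" by (auto simp: \<Omega>_def)
  then have "norm (f n) <= t" by (simp add: bad_def s_def cube_def vec_eq_iff[symmetric])
  also have "... <= 2 ^ ?d * t" using t by simp
  finally show ?thesis using False by (simp add: g_def)
 qed
 define U where "U = \<Omega> \<union> S"
 have U: "finite U" by (simp add: U_def \<Omega>_fin S)
 have gU: "g n = 0" and bU: "b n = 0" and fU: "f n = 0" if "n \<notin> U" for n
  using that S(2) by (auto simp: U_def g_def b_def)
 have g_sum: "(\<Sum>n\<in>U. norm (g n)) <= L"
 proof -
  have "(\<Sum>n\<in>\<Omega>. norm (g n)) = (\<Sum>Q\<in>\<Q>. \<Sum>n\<in>Q. norm (g n))" by (rule sum_\<Q>)
  also have "... <= (\<Sum>Q\<in>\<Q>. \<Sum>m\<in>Q. norm (f m))"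
  proof (rule sum_mono)
   fix Q assume "Q : \<Q>"
   then obtain n where n: "n : \<Omega>" "Q = q n" by (auto simp: \<Q>_def)
   have "(\<Sum>m\<in>Q. norm (g m)) = (\<Sum>m\<in>Q. norm (\<Sum>m\<in>q n. f m) / real (card (q n)))"
   proof (rule sum.cong)
    fix m assume "m : Q"
    then have "m : \<Omega>" "q m = q n" using q_in[OF n(1)] q_eq[OF n(1)] unfolding n(2) by blast+
    then show "norm (g m) = norm (\<Sum>m\<in>q n. f m) / real (card (q n))" by (simp add: g_def norm_divide)
   qed simp
   also have "... = norm (\<Sum>m\<in>q n. f m)" using card_pos[of n] by (simp add: n)
   also have "... <= (\<Sum>m\<in>Q. norm (f m))" unfolding n by (rule norm_sum)
   finally show "(\<Sum>m\<in>Q. norm (g m)) <= (\<Sum>m\<in>Q. norm (f m))" .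
  qed
  also have "... = (\<Sum>n\<in>\<Omega>. norm (f n))" by (rule sum_\<Q>[symmetric])
  finally have 1: "(\<Sum>n\<in>\<Omega>. norm (g n)) <= (\<Sum>n\<in>\<Omega>. norm (f n))" .
  have "(\<Sum>n\<in>U. norm (g n)) = (\<Sum>n\<in>\<Omega>. norm (g n)) + (\<Sum>n\<in>U - \<Omega>. norm (g n))"
   using U by (subst sum.subset_diff[of \<Omega> U]) (auto simp: U_def)
  also have "... <= (\<Sum>n\<in>\<Omega>. norm (f n)) + (\<Sum>n\<in>U - \<Omega>. norm (f n))"
   by (intro add_mono 1 sum_mono) (auto simp: g_def)
  also have "... = (\<Sum>n\<in>U. norm (f n))" using U by (subst sum.subset_diff[of \<Omega> U]) (auto simp: U_def)
  also have "... <= L" by (rule sumL[OF U])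
  finally show ?thesis .
 qed
 have b_sum: "(\<Sum>n\<in>U. norm (b n)) <= 2 * L"
 proof -
  have "(\<Sum>n\<in>U. norm (b n)) <= (\<Sum>n\<in>U. norm (f n) + norm (g n))" unfolding b_def by (intro sum_mono norm_triangle_ineq4)
  then show ?thesis using g_sum sumL[OF U] by (simp add: sum.distrib)
 qed
 have b_out: "b n = 0" if "n \<notin> \<Omega>" for n using that by (simp add: b_def g_def)
 have b_mean: "(\<Sum>m\<in>q n. b m) = 0" if "n : \<Omega>" for n
 proof -
  have "(\<Sum>m\<in>q n. g m) = (\<Sum>m\<in>q n. (\<Sum>m\<in>q n. f m) / of_nat (card (q n)))"
  proof (rule sum.cong)
   fix m assume "m : q n"
   then have "m : \<Omega>" "q m = q n" using q_in[OF that] q_eq[OF that] by blast+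
   then show "g m = (\<Sum>m\<in>q n. f m) / of_nat (card (q n))" by (simp add: g_def)
  qed simp
  then show ?thesis using card_pos[of n] by (simp add: b_def sum_subtractf)
 qed
 \<comment> \<open>The good part, by the bound on square sums.\<close>
 have good: "emeasure cs {n. t / 2 < norm (conv K g n)} <= ennreal (4 * A * 2 ^ ?d * L / t)"
 proof -
  have "{n. t / 2 < norm (conv K g n)} = {n. (t / 2)\<^sup>2 < (norm (conv K g n))\<^sup>2 & n : UNIV}"
   using t by (auto intro!: power_strict_mono dest: power_less_imp_less_base)
  then have "emeasure cs {n. t / 2 < norm (conv K g n)} <= ennreal (1 / (t / 2)\<^sup>2) * (\<integral>\<^sup>+n. ennreal ((norm (conv K g n))\<^sup>2) \<partial>cs)"
   using chebyshev_cs[of "(t / 2)\<^sup>2" "%n. (norm (conv K g n))\<^sup>2" UNIV] t by simp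
  also have "... <= ennreal (1 / (t / 2)\<^sup>2) * (ennreal A * ennreal (2 ^ ?d * t * L))"
  proof (intro mult_left_mono)
   have "fsupp g" unfolding fsupp_def by (rule finite_subset[OF _ U]) (use gU in auto)
   then have "(\<integral>\<^sup>+n. ennreal ((norm (conv K g n))\<^sup>2) \<partial>cs) <= ennreal A * (\<integral>\<^sup>+n. ennreal ((norm (g n))\<^sup>2) \<partial>cs)"
    using K2 by (simp add: l2_bounded_def)
   also have "(\<integral>\<^sup>+n. ennreal ((norm (g n))\<^sup>2) \<partial>cs) = ennreal (\<Sum>n\<in>U. (norm (g n))\<^sup>2)"
    by (rule nn_fsupp[OF U]) (auto simp: gU)
   also have "(\<Sum>n\<in>U. (norm (g n))\<^sup>2) <= (\<Sum>n\<in>U. (2 ^ ?d * t) * norm (g n))"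
    unfolding power2_eq_square by (intro sum_mono mult_right_mono g_le) auto
   also have "... <= (2 ^ ?d * t) * L" unfolding sum_distrib_left[symmetric] using t by (intro mult_left_mono g_sum) auto
   finally show "(\<integral>\<^sup>+n. ennreal ((norm (conv K g n))\<^sup>2) \<partial>cs) <= ennreal A * ennreal (2 ^ ?d * t * L)"
    by (meson ennreal_leI mult_left_mono order_trans zero_le)
  qed simp
  also have "... = ennreal (1 / (t / 2)\<^sup>2 * (A * (2 ^ ?d * t * L)))"
   by (rule ennreal_mult3[symmetric]) (use t A L0 in auto)
  also have "1 / (t / 2)\<^sup>2 * (A * (2 ^ ?d * t * L)) = 4 * A * 2 ^ ?d * L / t" using t by (simp add: power2_eq_square field_simps)
  finally show ?thesis .
 qed
 \<comment> \<open>The enlarged cubes.\<close>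
 define c where "c Q = (SOME n. n : \<Omega> & q n = Q)" for Q
 have c: "c Q : \<Omega>" "q (c Q) = Q" if "Q : \<Q>" for Q
  using someI_ex[of "%n. n : \<Omega> & q n = Q"] that by (auto simp: c_def \<Q>_def)
 define st where "st Q = {x. ALL i. (x - c Q) $ i : {- (2 * 2 ^ \<kappa> (c Q))..2 * 2 ^ \<kappa> (c Q)}}" for Q
 have st: "finite (st Q)" "card (st Q) <= 5 ^ ?d * card Q" if "Q : \<Q>" for Q
 proof -
  let ?r = "2 ^ \<kappa> (c Q) :: int"
  have "a - b : {- (2 * r)..2 * r} \<longleftrightarrow> a : {b - 2 * r..b + 2 * r}" for a b r :: int by auto
  then have e: "st Q = {x. ALL i. x $ i : {c Q $ i - 2 * ?r..c Q $ i + 2 * ?r}}" by (simp add: st_def)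
  show "finite (st Q)" unfolding e by (rule vec_box) simp
  have "card (st Q) = (\<Prod>i\<in>(UNIV::'n set). nat (4 * ?r + 1))" unfolding e by (subst vec_box(2)) (auto intro!: prod.cong)
  also have "... = (nat (4 * ?r + 1)) ^ ?d" by simp
  also have "... <= (5 * 2 ^ \<kappa> (c Q)) ^ ?d"
  proof (intro power_mono)
   have "4 * ?r + 1 <= 5 * ?r" by simp
   then show "nat (4 * ?r + 1) <= 5 * 2 ^ \<kappa> (c Q)" by (simp add: nat_le_iff)
  qed simp
  also have "... = 5 ^ ?d * card (q (c Q))" by (simp add: q_card power_mult_distrib power_mult)
  finally show "card (st Q) <= 5 ^ ?d * card Q" using c[OF that] by simp
 qed
 define E where "E = (\<Union>Q\<in>\<Q>. st Q)"
 have E_card: "emeasure cs E <= ennreal (5 ^ ?d * L / t)"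
 proof -
  have fE: "finite E" using \<Q>_fin st by (auto simp: E_def)
  have "card E <= (\<Sum>Q\<in>\<Q>. card (st Q))" unfolding E_def by (rule card_UN_le[OF \<Q>_fin])
  also have "... <= (\<Sum>Q\<in>\<Q>. 5 ^ ?d * card Q)" by (intro sum_mono st)
  also have "... = 5 ^ ?d * card \<Omega>" using sum_\<Q>[of "%_. 1::nat"] by (simp add: sum_distrib_left)
  finally have "real (card E) <= 5 ^ ?d * real (card \<Omega>)" by (metis of_nat_le_iff of_nat_mult of_nat_power of_nat_numeral)
  also have "... <= 5 ^ ?d * (L / t)" using card_\<Omega> t by (intro mult_left_mono) (auto simp: field_simps)
  finally show ?thesis using fE by (simp add: emeasure_count_space_finite ennreal_of_nat_eq_real_of_nat ennreal_leI)
 qed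
 \<comment> \<open>The bad part, off the enlarged cubes, by the mean value zero on each cube.\<close>
 have Tb: "norm (conv K b x) <= (\<Sum>Q\<in>\<Q>. \<Sum>y\<in>Q. norm (b y) * norm (K (x - y) - K (x - c Q)))" for x
 proof -
  have "conv K b x = (\<Sum>y\<in>\<Omega>. K (x - y) * b y)" by (rule conv_fsupp[OF \<Omega>_fin b_out])
  also have "... = (\<Sum>Q\<in>\<Q>. \<Sum>y\<in>Q. K (x - y) * b y)" by (rule sum_\<Q>)
  also have "... = (\<Sum>Q\<in>\<Q>. \<Sum>y\<in>Q. b y * (K (x - y) - K (x - c Q)))"
  proof (rule sum.cong)
   fix Q assume Q: "Q : \<Q>"
   have "(\<Sum>y\<in>Q. b y * (K (x - y) - K (x - c Q))) = (\<Sum>y\<in>Q. K (x - y) * b y) - (\<Sum>y\<in>Q. b y) * K (x - c Q)"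
    by (simp add: algebra_simps sum_subtractf sum_distrib_right)
   also have "(\<Sum>y\<in>Q. b y) = 0" using b_mean[OF c(1)[OF Q]] c(2)[OF Q] by simp
   finally show "(\<Sum>y\<in>Q. K (x - y) * b y) = (\<Sum>y\<in>Q. b y * (K (x - y) - K (x - c Q)))" by simp
  qed simp
  also have "norm ... <= (\<Sum>Q\<in>\<Q>. norm (\<Sum>y\<in>Q. b y * (K (x - y) - K (x - c Q))))" by (rule norm_sum)
  also have "... <= (\<Sum>Q\<in>\<Q>. \<Sum>y\<in>Q. norm (b y * (K (x - y) - K (x - c Q))))" by (intro sum_mono norm_sum)
  finally show ?thesis by (simp add: norm_mult)
 qed
 have off: "(\<integral>\<^sup>+x. ennreal (norm (K (x - y) - K (x - c Q))) * indicator (- E) x \<partial>cs) <= ennreal B" if Q: "Q : \<Q>" and y: "y : Q" for Q y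
 proof -
  let ?r = "2 ^ \<kappa> (c Q) :: nat"
  have "y : cube (\<kappa> (c Q)) (c Q)" using y c(2)[OF Q] by (simp add: q_def)
  then have v: "\<bar>(y - c Q) $ i\<bar> <= int ?r" for i using cube_diff_le by force
  have "(\<integral>\<^sup>+x. ennreal (norm (K (x - y) - K (x - c Q))) * indicator (- E) x \<partial>cs)
    <= (\<integral>\<^sup>+x. ennreal (norm (K ((x - c Q) - (y - c Q)) - K (x - c Q))) * indicator {z. EX i. 2 * int ?r < \<bar>z $ i\<bar>} (x - c Q) \<partial>cs)"
  proof (rule nn_integral_mono)
   fix x
   have "x : E" if "~ (EX i. 2 * int ?r < \<bar>(x - c Q) $ i\<bar>)"
   proof -
    have "(x - c Q) $ i : {- (2 * 2 ^ \<kappa> (c Q))..2 * 2 ^ \<kappa> (c Q)}" for i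
     using that[simplified not_ex not_less, rule_format, of i] by (simp add: abs_le_iff)
    then show ?thesis using Q by (auto simp: E_def st_def)
   qed
   then show "ennreal (norm (K (x - y) - K (x - c Q))) * indicator (- E) x
     <= ennreal (norm (K ((x - c Q) - (y - c Q)) - K (x - c Q))) * indicator {z. EX i. 2 * int ?r < \<bar>z $ i\<bar>} (x - c Q)"
    by (auto simp: indicator_def)
  qed
  also have "... = (\<integral>\<^sup>+z. ennreal (norm (K (z - (y - c Q)) - K z)) * indicator {z. EX i. 2 * int ?r < \<bar>z $ i\<bar>} z \<partial>cs)"
   by (rule nn_shift(2)[of "%z. ennreal (norm (K (z - (y - c Q)) - K z)) * indicator {z. EX i. 2 * int ?r < \<bar>z $ i\<bar>} z" "c Q"])
  also have "... <= ennreal B" 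
  proof -
   have "1 <= ?r" by simp
   then show ?thesis using KH[unfolded hoermander_def, rule_format, of ?r "y - c Q"] v by blast
  qed
  finally show ?thesis .
 qed
 have badp: "emeasure cs {n. t / 2 < norm (conv K b n) & n : - E} <= ennreal (4 * B * L / t)"
 proof -
  have "emeasure cs {n. t / 2 < norm (conv K b n) & n : - E} <= ennreal (1 / (t / 2)) * (\<integral>\<^sup>+n. ennreal (norm (conv K b n)) * indicator (- E) n \<partial>cs)"
   by (rule chebyshev_cs) (use t in simp)
  also have "(\<integral>\<^sup>+n. ennreal (norm (conv K b n)) * indicator (- E) n \<partial>cs)
    <= (\<integral>\<^sup>+x. (\<Sum>Q\<in>\<Q>. \<Sum>y\<in>Q. ennreal (norm (b y)) * (ennreal (norm (K (x - y) - K (x - c Q))) * indicator (- E) x)) \<partial>cs)"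
  proof (rule nn_integral_mono)
   fix x
   have "ennreal (norm (conv K b x)) <= (\<Sum>Q\<in>\<Q>. \<Sum>y\<in>Q. ennreal (norm (b y)) * ennreal (norm (K (x - y) - K (x - c Q))))"
   proof -
    have "(\<Sum>Q\<in>\<Q>. \<Sum>y\<in>Q. ennreal (norm (b y)) * ennreal (norm (K (x - y) - K (x - c Q))))
      = (\<Sum>Q\<in>\<Q>. \<Sum>y\<in>Q. ennreal (norm (b y) * norm (K (x - y) - K (x - c Q))))"
     by (intro sum.cong refl) (simp add: ennreal_mult)
    also have "... = ennreal (\<Sum>Q\<in>\<Q>. \<Sum>y\<in>Q. norm (b y) * norm (K (x - y) - K (x - c Q)))"
     by (simp add: sum_ennreal sum_nonneg)
    finally show ?thesis using ennreal_leI[OF Tb[of x]] by simp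
   qed
   then have "ennreal (norm (conv K b x)) * indicator (- E) x <= (\<Sum>Q\<in>\<Q>. \<Sum>y\<in>Q. ennreal (norm (b y)) * ennreal (norm (K (x - y) - K (x - c Q)))) * indicator (- E) x"
    by (rule mult_right_mono) simp
   then show "ennreal (norm (conv K b x)) * indicator (- E) x <= (\<Sum>Q\<in>\<Q>. \<Sum>y\<in>Q. ennreal (norm (b y)) * (ennreal (norm (K (x - y) - K (x - c Q))) * indicator (- E) x))"
    by (simp add: sum_distrib_right mult.assoc)
  qed
  also have "... = (\<Sum>Q\<in>\<Q>. \<Sum>y\<in>Q. ennreal (norm (b y)) * (\<integral>\<^sup>+x. ennreal (norm (K (x - y) - K (x - c Q))) * indicator (- E) x \<partial>cs))"
   by (simp add: nn_integral_sum nn_integral_cmult)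
  also have "... <= (\<Sum>Q\<in>\<Q>. \<Sum>y\<in>Q. ennreal (norm (b y)) * ennreal B)"
   by (intro sum_mono mult_left_mono off) auto
  also have "... = (\<Sum>y\<in>\<Omega>. ennreal (norm (b y)) * ennreal B)" by (rule sum_\<Q>[symmetric])
  also have "... = (\<Sum>y\<in>\<Omega>. ennreal (norm (b y))) * ennreal B" by (rule sum_distrib_right[symmetric])
  also have "... = ennreal (\<Sum>y\<in>\<Omega>. norm (b y)) * ennreal B" by (simp add: sum_ennreal)
  also have "... <= ennreal (2 * L) * ennreal B"
  proof (intro mult_right_mono ennreal_leI)
   have "(\<Sum>y\<in>\<Omega>. norm (b y)) <= (\<Sum>y\<in>U. norm (b y))" using U by (intro sum_mono2) (auto simp: U_def)
   then show "(\<Sum>y\<in>\<Omega>. norm (b y)) <= 2 * L" using b_sum by simp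
  qed simp
  finally have "emeasure cs {n. t / 2 < norm (conv K b n) & n : - E} <= ennreal (1 / (t / 2)) * (ennreal (2 * L) * ennreal B)"
   by (simp add: mult_left_mono)
  also have "... = ennreal (1 / (t / 2) * ((2 * L) * B))" by (rule ennreal_mult3[symmetric]) (use t L0 B in auto)
  also have "1 / (t / 2) * ((2 * L) * B) = 4 * B * L / t" by simp
  finally show ?thesis .
 qed
 have fgb: "conv K f n = conv K g n + conv K b n" for n
 proof -
  have "conv K f n = (\<Sum>y\<in>U. K (n - y) * f y)" by (rule conv_fsupp[OF U fU])
  also have "... = (\<Sum>y\<in>U. K (n - y) * g y) + (\<Sum>y\<in>U. K (n - y) * b y)"
   unfolding sum.distrib[symmetric] by (intro sum.cong) (auto simp: b_def algebra_simps)
  also have "(\<Sum>y\<in>U. K (n - y) * g y) = conv K g n" by (rule conv_fsupp[OF U gU, symmetric])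
  also have "(\<Sum>y\<in>U. K (n - y) * b y) = conv K b n" by (rule conv_fsupp[OF U bU, symmetric])
  finally show ?thesis .
 qed
 have "{n. t < norm (conv K f n)} <= ({n. t / 2 < norm (conv K g n)} \<union> {n. t / 2 < norm (conv K b n) & n : - E}) \<union> E"
 proof
  fix n assume "n : {n. t < norm (conv K f n)}"
  then have "t < norm (conv K g n) + norm (conv K b n)" using norm_triangle_ineq[of "conv K g n" "conv K b n"] by (simp add: fgb)
  then show "n : ({n. t / 2 < norm (conv K g n)} \<union> {n. t / 2 < norm (conv K b n) & n : - E}) \<union> E" by auto
 qed
 then have "emeasure cs {n. t < norm (conv K f n)} <= emeasure cs (({n. t / 2 < norm (conv K g n)} \<union> {n. t / 2 < norm (conv K b n) & n : - E}) \<union> E)"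
  by (rule emeasure_mono) simp
 also have "... <= (emeasure cs {n. t / 2 < norm (conv K g n)} + emeasure cs {n. t / 2 < norm (conv K b n) & n : - E}) + emeasure cs E"
  by (intro order_trans[OF emeasure_subadditive] add_mono emeasure_subadditive) auto
 also have "... <= (ennreal (4 * A * 2 ^ ?d * L / t) + ennreal (4 * B * L / t)) + ennreal (5 ^ ?d * L / t)"
  by (intro add_mono good badp E_card)
 also have "... = ennreal (4 * A * 2 ^ ?d * L / t + 4 * B * L / t + 5 ^ ?d * L / t)"
  using t A B L0 by (simp add: ennreal_plus)
 also have "4 * A * 2 ^ ?d * L / t + 4 * B * L / t + 5 ^ ?d * L / t = (4 * A * 2 ^ ?d + 4 * B + 5 ^ ?d) * L / t"
  by (simp add: algebra_simps add_divide_distrib)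
 finally show ?thesis .
qed


subsection \<open>Interpolation and duality\<close>

lemma nn_integral_PM_below:
 assumes "0 < p" "0 <= x"
 shows "(\<integral>\<^sup>+t. ennreal (t powr (p - 1)) * indicator {..<x} t \<partial>PM) = ennreal (x powr p / p)"
proof -
 have "(\<integral>\<^sup>+t. ennreal (t powr (p - 1)) * indicator {..<x} t \<partial>PM) = (\<integral>\<^sup>+t. ennreal (t powr (p - 1)) * indicator {..<x} t * indicator {0<..} t \<partial>lborel)"
  by (rule nn_integral_PM) measurable
 also have "... = (\<integral>\<^sup>+t. ennreal (indicator {0..x} t * t powr (p - 1)) \<partial>lborel)"
 proof (rule nn_integral_cong_AE)
  show "AE t in lborel. ennreal (t powr (p - 1)) * indicator {..<x} t * indicator {0<..} t = ennreal (indicator {0..x} t * t powr (p - 1))"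
  proof (rule AE_I')
   show "{0, x} : null_sets lborel" by (intro finite_imp_null_set_lborel) auto
  qed (auto split: split_indicator)
 qed
 also have "... = ennreal (x powr (p - 1 + 1) / (p - 1 + 1))"
  by (rule nn_integral_has_integral_lebesgue[OF _ has_integral_powr_from_0]) (use assms in auto)
 finally show ?thesis by simp
qed

lemma nn_integral_PM_above:
 assumes "p < 2" "0 < x"
 shows "(\<integral>\<^sup>+t. ennreal (t powr (p - 3)) * indicator {x..} t \<partial>PM) = ennreal (x powr (p - 2) / (2 - p))"
proof -
 have "(\<integral>\<^sup>+t. ennreal (t powr (p - 3)) * indicator {x..} t \<partial>PM) = (\<integral>\<^sup>+t. ennreal (t powr (p - 3)) * indicator {x..} t * indicator {0<..} t \<partial>lborel)"
  by (rule nn_integral_PM) measurable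
 also have "... = (\<integral>\<^sup>+t. ennreal (indicator {x..} t * t powr (p - 3)) \<partial>lborel)"
  by (intro nn_integral_cong) (use assms in \<open>auto split: split_indicator\<close>)
 also have "... = ennreal (- (x powr (p - 3 + 1)) / (p - 3 + 1))"
  by (rule nn_integral_has_integral_lebesgue[OF _ has_integral_powr_to_inf]) (use assms in auto)
 also have "- (x powr (p - 3 + 1)) / (p - 3 + 1) = x powr (p - 2) / (2 - p)"
  using assms by (simp add: field_simps)
 finally show ?thesis .
qed

lemma ennreal_mult_eq: "0 <= a ==> 0 <= b ==> 0 <= c ==> 0 <= d ==> a * b = c * d ==> ennreal a * ennreal b = ennreal c * ennreal d"
 by (simp add: ennreal_mult[symmetric])

lemma ennreal_comb: "0 <= a ==> 0 <= b ==> 0 <= c ==> 0 <= d ==> ennreal (a * b + c * d) = ennreal a * ennreal b + ennreal c * ennreal d"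
 by (simp add: ennreal_mult)

definition lp_bounded :: "real => real => (int^'n => complex) => bool" where
 "lp_bounded p C K \<longleftrightarrow> (ALL f. fsupp f -->
   (\<integral>\<^sup>+n. ennreal (norm (conv K f n) powr p) \<partial>cs) <= ennreal C * (\<integral>\<^sup>+n. ennreal (norm (f n) powr p) \<partial>cs))"

text \<open>
  Interpolation between weak type (1,1) and \<open>L\<^sup>2\<close>: at each height the function is cut at that
  height, the large part is treated by the weak estimate and the small part by the square function
  estimate, and the two resulting integrals over the height converge for \<open>1 < p < 2\<close>.
\<close>

lemma marcinkiewicz:
 fixes K :: "int^'n => complex"
 assumes K2: "l2_bounded A K" and KH: "hoermander B K" and A: "0 <= A" and B: "0 <= B"
  and p: "1 < p" "p < 2"
 defines "Cw \<equiv> 4 * A * 2 ^ CARD('n) + 4 * B + 5 ^ CARD('n)"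
 shows "lp_bounded p (2 powr p * (p * Cw / (p - 1) + p * A / (2 - p))) K"
 unfolding lp_bounded_def
proof (intro allI impI)
 fix f :: "int^'n => complex" assume f: "fsupp f"
 define S where "S = {n. f n ~= 0}"
 have S: "finite S" "!!n. n \<notin> S ==> f n = 0" using f by (auto simp: S_def fsupp_def)
 have Cw_nonneg: "0 <= Cw" using A B by (simp add: Cw_def)
 have level: "emeasure cs {n. 2 * t < norm (conv K f n)} \<le>
   (\<Sum>n\<in>S. ennreal (Cw * norm (f n) / t) * indicator {..<norm (f n)} t + ennreal (A * (norm (f n))\<^sup>2 / t\<^sup>2) * indicator {norm (f n)..} t)"
  if t: "0 < t" for t
 proof -
  define f1 where "f1 n = (if t < norm (f n) then f n else 0)" for n
  define f2 where "f2 n = (if t < norm (f n) then 0 else f n)" for n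
  have z: "f1 n = 0" "f2 n = 0" if "n \<notin> S" for n using S(2)[OF that] by (auto simp: f1_def f2_def)
  have fs1: "fsupp f1" unfolding fsupp_def by (rule finite_subset[OF _ S(1)]) (use z in auto)
  have fs2: "fsupp f2" unfolding fsupp_def by (rule finite_subset[OF _ S(1)]) (use z in auto)
  have add: "conv K f n = conv K f1 n + conv K f2 n" for n
  proof -
   have "conv K f n = (\<Sum>y\<in>S. K (n - y) * f y)" by (rule conv_fsupp[OF S])
   also have "... = (\<Sum>y\<in>S. K (n - y) * f1 y) + (\<Sum>y\<in>S. K (n - y) * f2 y)"
    unfolding sum.distrib[symmetric] by (intro sum.cong) (auto simp: f1_def f2_def)
   also have "(\<Sum>y\<in>S. K (n - y) * f1 y) = conv K f1 n" by (rule conv_fsupp[OF S(1) z(1), symmetric])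
   also have "(\<Sum>y\<in>S. K (n - y) * f2 y) = conv K f2 n" by (rule conv_fsupp[OF S(1) z(2), symmetric])
   finally show ?thesis .
  qed
  have "{n. 2 * t < norm (conv K f n)} <= {n. t < norm (conv K f1 n)} \<union> {n. t < norm (conv K f2 n)}"
  proof
   fix n assume "n : {n. 2 * t < norm (conv K f n)}"
   then have "2 * t < norm (conv K f1 n) + norm (conv K f2 n)" using norm_triangle_ineq[of "conv K f1 n" "conv K f2 n"] by (simp add: add)
   then show "n : {n. t < norm (conv K f1 n)} \<union> {n. t < norm (conv K f2 n)}" by auto
  qed
  then have "emeasure cs {n. 2 * t < norm (conv K f n)} <= emeasure cs ({n. t < norm (conv K f1 n)} \<union> {n. t < norm (conv K f2 n)})"
   by (rule emeasure_mono) simp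
  also have "... <= emeasure cs {n. t < norm (conv K f1 n)} + emeasure cs {n. t < norm (conv K f2 n)}"
   by (rule emeasure_subadditive) auto
  also have "... <= (\<Sum>n\<in>S. ennreal (Cw * norm (f n) / t) * indicator {..<norm (f n)} t) + (\<Sum>n\<in>S. ennreal (A * (norm (f n))\<^sup>2 / t\<^sup>2) * indicator {norm (f n)..} t)"
  proof (rule add_mono)
   have "emeasure cs {n. t < norm (conv K f1 n)} <= ennreal (Cw * (\<Sum>n | f1 n ~= 0. norm (f1 n)) / t)"
    unfolding Cw_def by (rule weak_type[OF K2 KH A B fs1 t])
   also have "(\<Sum>n | f1 n ~= 0. norm (f1 n)) = (\<Sum>n\<in>S. norm (f1 n))"
    by (rule sum.mono_neutral_left) (use S z in auto)
   also have "ennreal (Cw * (\<Sum>n\<in>S. norm (f1 n)) / t) = (\<Sum>n\<in>S. ennreal (Cw * norm (f1 n) / t))"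
    using Cw_nonneg t by (subst sum_ennreal) (auto simp: sum_distrib_left sum_divide_distrib)
   also have "... = (\<Sum>n\<in>S. ennreal (Cw * norm (f n) / t) * indicator {..<norm (f n)} t)"
    by (intro sum.cong) (auto simp: f1_def)
   finally show "emeasure cs {n. t < norm (conv K f1 n)} <= ..." .
   have "{n. t < norm (conv K f2 n)} = {n. t\<^sup>2 < (norm (conv K f2 n))\<^sup>2 & n : UNIV}"
    using t by (auto intro!: power_strict_mono dest: power_less_imp_less_base)
   then have "emeasure cs {n. t < norm (conv K f2 n)} <= ennreal (1 / t\<^sup>2) * (\<integral>\<^sup>+n. ennreal ((norm (conv K f2 n))\<^sup>2) \<partial>cs)"
    using chebyshev_cs[of "t\<^sup>2" "%n. (norm (conv K f2 n))\<^sup>2" UNIV] t by simp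
   also have "... <= ennreal (1 / t\<^sup>2) * (ennreal A * (\<integral>\<^sup>+n. ennreal ((norm (f2 n))\<^sup>2) \<partial>cs))"
    using K2 fs2 by (intro mult_left_mono) (auto simp: l2_bounded_def)
   also have "(\<integral>\<^sup>+n. ennreal ((norm (f2 n))\<^sup>2) \<partial>cs) = ennreal (\<Sum>n\<in>S. (norm (f2 n))\<^sup>2)"
    by (rule nn_fsupp[OF S(1)]) (auto simp: z)
   also have "ennreal (1 / t\<^sup>2) * (ennreal A * ennreal (\<Sum>n\<in>S. (norm (f2 n))\<^sup>2)) = ennreal (1 / t\<^sup>2 * (A * (\<Sum>n\<in>S. (norm (f2 n))\<^sup>2)))"
    by (rule ennreal_mult3[symmetric]) (use A in \<open>auto simp: sum_nonneg\<close>)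
   also have "1 / t\<^sup>2 * (A * (\<Sum>n\<in>S. (norm (f2 n))\<^sup>2)) = (\<Sum>n\<in>S. A * (norm (f2 n))\<^sup>2 / t\<^sup>2)"
    by (simp add: sum_distrib_left sum_divide_distrib)
   also have "ennreal ... = (\<Sum>n\<in>S. ennreal (A * (norm (f2 n))\<^sup>2 / t\<^sup>2))"
    using A by (subst sum_ennreal) auto
   also have "... = (\<Sum>n\<in>S. ennreal (A * (norm (f n))\<^sup>2 / t\<^sup>2) * indicator {norm (f n)..} t)"
    by (intro sum.cong) (auto simp: f2_def not_less)
   finally show "emeasure cs {n. t < norm (conv K f2 n)} <= ..." .
  qed
  also have "... = (\<Sum>n\<in>S. ennreal (Cw * norm (f n) / t) * indicator {..<norm (f n)} t + ennreal (A * (norm (f n))\<^sup>2 / t\<^sup>2) * indicator {norm (f n)..} t)"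
   by (simp add: sum.distrib)
  finally show ?thesis .
 qed
 have "(\<integral>\<^sup>+n. ennreal (norm (conv K f n) powr p) \<partial>cs) =
   (\<integral>\<^sup>+n. \<integral>\<^sup>+t. ennreal (2 powr p * p) * (ennreal (t powr (p - 1)) * indicator {..<norm (conv K f n) / 2} t) \<partial>PM \<partial>cs)"
 proof (rule nn_integral_cong)
  fix n
  have "norm (conv K f n) powr p = 2 powr p * p * ((norm (conv K f n) / 2) powr p / p)"
   using p by (simp add: powr_divide)
  also have "ennreal ... = ennreal (2 powr p * p) * ennreal ((norm (conv K f n) / 2) powr p / p)"
   using p by (intro ennreal_mult) auto
  also have "ennreal ((norm (conv K f n) / 2) powr p / p) = (\<integral>\<^sup>+t. ennreal (t powr (p - 1)) * indicator {..<norm (conv K f n) / 2} t \<partial>PM)"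
   using p by (subst nn_integral_PM_below) auto
  also have "ennreal (2 powr p * p) * ... = (\<integral>\<^sup>+t. ennreal (2 powr p * p) * (ennreal (t powr (p - 1)) * indicator {..<norm (conv K f n) / 2} t) \<partial>PM)"
   by (rule nn_integral_cmult[symmetric]) (rule PM_borel, measurable)
  finally show "ennreal (norm (conv K f n) powr p) = ..." .
 qed
 also have "... = (\<integral>\<^sup>+t. \<integral>\<^sup>+n. ennreal (2 powr p * p) * (ennreal (t powr (p - 1)) * indicator {..<norm (conv K f n) / 2} t) \<partial>cs \<partial>PM)"
  by (rule cs_nn_swap) (rule PM_borel, measurable)
 also have "... <= (\<integral>\<^sup>+t. ennreal (2 powr p * p) * (\<Sum>n\<in>S. ennreal (Cw * norm (f n)) * (ennreal (t powr (p - 1 - 1)) * indicator {..<norm (f n)} t)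
   + ennreal (A * (norm (f n))\<^sup>2) * (ennreal (t powr (p - 3)) * indicator {norm (f n)..} t)) \<partial>PM)"
 proof (rule nn_integral_mono)
  fix t :: real assume "t : space PM"
  then have t: "0 < t" by simp
  have "(\<integral>\<^sup>+n. ennreal (2 powr p * p) * (ennreal (t powr (p - 1)) * indicator {..<norm (conv K f n) / 2} t) \<partial>cs)
    = (\<integral>\<^sup>+n. ennreal (2 powr p * p) * ennreal (t powr (p - 1)) * indicator {n. 2 * t < norm (conv K f n)} n \<partial>cs)"
   by (intro nn_integral_cong) (auto simp: indicator_def mult.assoc)
  also have "... = ennreal (2 powr p * p) * (ennreal (t powr (p - 1)) * emeasure cs {n. 2 * t < norm (conv K f n)})"
   by (subst nn_integral_cmult_indicator) (auto simp: mult.assoc)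
  also have "... <= ennreal (2 powr p * p) * (ennreal (t powr (p - 1)) * (\<Sum>n\<in>S. ennreal (Cw * norm (f n) / t) * indicator {..<norm (f n)} t + ennreal (A * (norm (f n))\<^sup>2 / t\<^sup>2) * indicator {norm (f n)..} t))"
   by (intro mult_left_mono level[OF t]) auto
  also have "ennreal (t powr (p - 1)) * (\<Sum>n\<in>S. ennreal (Cw * norm (f n) / t) * indicator {..<norm (f n)} t + ennreal (A * (norm (f n))\<^sup>2 / t\<^sup>2) * indicator {norm (f n)..} t)
    = (\<Sum>n\<in>S. ennreal (Cw * norm (f n)) * (ennreal (t powr (p - 1 - 1)) * indicator {..<norm (f n)} t)
   + ennreal (A * (norm (f n))\<^sup>2) * (ennreal (t powr (p - 3)) * indicator {norm (f n)..} t))"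
   unfolding sum_distrib_left
  proof (rule sum.cong)
   fix n
   have e1: "t powr (p - 1) / t = t powr (p - 1 - 1)"
   proof -
    have "t powr (p - 1) = t powr (p - 1 - 1) * t" using t powr_add[of t "p - 1 - 1" 1] by simp
    then show ?thesis using t by simp
   qed
   have e2: "t powr (p - 1) / t\<^sup>2 = t powr (p - 3)"
   proof -
    have "t powr (p - 3) * t powr 2 = t powr (p - 1)" using powr_add[of t "p - 3" 2] by simp
    moreover have "t powr 2 = t\<^sup>2" using t by (simp add: powr_numeral)
    ultimately have "t powr (p - 1) = t powr (p - 3) * t\<^sup>2" by simp
    then show ?thesis using t by simp
   qed
   have mv: "a * (b / c) = b * (a / c)" for a b c :: real by simp
   have r: "t powr (p - 1) * (Cw * norm (f n) / t) = Cw * norm (f n) * t powr (p - 1 - 1)"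
    "t powr (p - 1) * (A * (norm (f n))\<^sup>2 / t\<^sup>2) = A * (norm (f n))\<^sup>2 * t powr (p - 3)"
    by (simp_all only: mv[of "t powr (p - 1)" "Cw * norm (f n)" t] mv[of "t powr (p - 1)" "A * (norm (f n))\<^sup>2" "t\<^sup>2"] e1 e2)
   have "ennreal (t powr (p - 1)) * ennreal (Cw * norm (f n) / t) = ennreal (Cw * norm (f n)) * ennreal (t powr (p - 1 - 1))"
    by (rule ennreal_mult_eq[OF _ _ _ _ r(1)]) (use t Cw_nonneg in auto)
   moreover have "ennreal (t powr (p - 1)) * ennreal (A * (norm (f n))\<^sup>2 / t\<^sup>2) = ennreal (A * (norm (f n))\<^sup>2) * ennreal (t powr (p - 3))"
    by (rule ennreal_mult_eq[OF _ _ _ _ r(2)]) (use t A in auto)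
   ultimately have "ennreal (t powr (p - 1)) * ennreal (Cw * norm (f n) / t) = ennreal (Cw * norm (f n)) * ennreal (t powr (p - 1 - 1))"
    "ennreal (t powr (p - 1)) * ennreal (A * (norm (f n))\<^sup>2 / t\<^sup>2) = ennreal (A * (norm (f n))\<^sup>2) * ennreal (t powr (p - 3))" .
   then show "ennreal (t powr (p - 1)) * (ennreal (Cw * norm (f n) / t) * indicator {..<norm (f n)} t + ennreal (A * (norm (f n))\<^sup>2 / t\<^sup>2) * indicator {norm (f n)..} t)
    = ennreal (Cw * norm (f n)) * (ennreal (t powr (p - 1 - 1)) * indicator {..<norm (f n)} t) + ennreal (A * (norm (f n))\<^sup>2) * (ennreal (t powr (p - 3)) * indicator {norm (f n)..} t)"
    unfolding distrib_left mult.assoc[symmetric] by simp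
  qed simp
  finally show "(\<integral>\<^sup>+n. ennreal (2 powr p * p) * (ennreal (t powr (p - 1)) * indicator {..<norm (conv K f n) / 2} t) \<partial>cs) \<le>
   ennreal (2 powr p * p) * (\<Sum>n\<in>S. ennreal (Cw * norm (f n)) * (ennreal (t powr (p - 1 - 1)) * indicator {..<norm (f n)} t)
   + ennreal (A * (norm (f n))\<^sup>2) * (ennreal (t powr (p - 3)) * indicator {norm (f n)..} t))" .
 qed
 also have "... = ennreal (2 powr p * p) * (\<Sum>n\<in>S. ennreal (Cw * norm (f n)) * (\<integral>\<^sup>+t. ennreal (t powr (p - 1 - 1)) * indicator {..<norm (f n)} t \<partial>PM)
   + ennreal (A * (norm (f n))\<^sup>2) * (\<integral>\<^sup>+t. ennreal (t powr (p - 3)) * indicator {norm (f n)..} t \<partial>PM))"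
 proof -
  have m: "(%t. ennreal (t powr (p - 1 - 1)) * indicator {..<norm (f n)} t) : borel_measurable PM"
   "(%t. ennreal (t powr (p - 3)) * indicator {norm (f n)..} t) : borel_measurable PM" for n
   by (rule PM_borel, measurable)+
  have i: "(\<integral>\<^sup>+t. ennreal a * (ennreal (t powr (p - 1 - 1)) * indicator {..<norm (f n)} t) + ennreal b * (ennreal (t powr (p - 3)) * indicator {norm (f n)..} t) \<partial>PM)
   = ennreal a * (\<integral>\<^sup>+t. ennreal (t powr (p - 1 - 1)) * indicator {..<norm (f n)} t \<partial>PM) + ennreal b * (\<integral>\<^sup>+t. ennreal (t powr (p - 3)) * indicator {norm (f n)..} t \<partial>PM)" for n a b
   unfolding nn_integral_cmult[OF m(1), symmetric] nn_integral_cmult[OF m(2), symmetric]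
   by (rule nn_integral_add) (intro borel_measurable_times_ennreal borel_measurable_const m)+
  have m3: "(%t. ennreal a * (ennreal (t powr (p - 1 - 1)) * indicator {..<norm (f n)} t) + ennreal b * (ennreal (t powr (p - 3)) * indicator {norm (f n)..} t)) : borel_measurable PM" for n a b
   by (intro borel_measurable_add borel_measurable_times_ennreal borel_measurable_const m)
  show ?thesis
   by (subst nn_integral_cmult, rule borel_measurable_sum, rule m3, subst nn_integral_sum, rule m3, simp only: i)
 qed
 also have "... = ennreal (2 powr p * p) * (\<Sum>n\<in>S. ennreal (Cw / (p - 1) + A / (2 - p)) * ennreal (norm (f n) powr p))"
 proof (intro arg_cong2[where f="(*)"] refl sum.cong)
  fix n assume "n : S"
  then have n: "0 < norm (f n)" by (simp add: S_def)
  have "norm (f n) * norm (f n) powr (p - 1) = norm (f n) powr p" "(norm (f n))\<^sup>2 * norm (f n) powr (p - 2) = norm (f n) powr p"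
   using n powr_add[of "norm (f n)" 1 "p - 1"] powr_add[of "norm (f n)" 2 "p - 2"] by (simp_all add: powr_numeral)
  then have e: "Cw * norm (f n) * (norm (f n) powr (p - 1) / (p - 1)) + A * (norm (f n))\<^sup>2 * (norm (f n) powr (p - 2) / (2 - p)) = (Cw / (p - 1) + A / (2 - p)) * norm (f n) powr p"
   by (simp add: distrib_right mult.assoc)
  have "ennreal (Cw * norm (f n)) * (\<integral>\<^sup>+t. ennreal (t powr (p - 1 - 1)) * indicator {..<norm (f n)} t \<partial>PM)
   + ennreal (A * (norm (f n))\<^sup>2) * (\<integral>\<^sup>+t. ennreal (t powr (p - 3)) * indicator {norm (f n)..} t \<partial>PM)
   = ennreal (Cw * norm (f n)) * ennreal (norm (f n) powr (p - 1) / (p - 1)) + ennreal (A * (norm (f n))\<^sup>2) * ennreal (norm (f n) powr (p - 2) / (2 - p))"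
   using p n by (subst nn_integral_PM_below, simp, simp, subst nn_integral_PM_above) auto
  also have "... = ennreal (Cw * norm (f n) * (norm (f n) powr (p - 1) / (p - 1)) + A * (norm (f n))\<^sup>2 * (norm (f n) powr (p - 2) / (2 - p)))"
   by (rule ennreal_comb[symmetric]) (use Cw_nonneg A p in auto)
  also have "... = ennreal (Cw / (p - 1) + A / (2 - p)) * ennreal (norm (f n) powr p)"
   unfolding e using Cw_nonneg A p by (intro ennreal_mult) auto
  finally show "ennreal (Cw * norm (f n)) * (\<integral>\<^sup>+t. ennreal (t powr (p - 1 - 1)) * indicator {..<norm (f n)} t \<partial>PM)
   + ennreal (A * (norm (f n))\<^sup>2) * (\<integral>\<^sup>+t. ennreal (t powr (p - 3)) * indicator {norm (f n)..} t \<partial>PM) = ..." .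
 qed
 also have "... = ennreal (2 powr p * p) * (ennreal (Cw / (p - 1) + A / (2 - p)) * (\<integral>\<^sup>+n. ennreal (norm (f n) powr p) \<partial>cs))"
 proof -
  have "(\<integral>\<^sup>+n. ennreal (norm (f n) powr p) \<partial>cs) = ennreal (\<Sum>n\<in>S. norm (f n) powr p)"
   by (rule nn_fsupp[OF S(1)]) (use S(2) p in auto)
  then show ?thesis by (simp add: sum_distrib_left[symmetric] sum_ennreal)
 qed
 also have "... = ennreal (2 powr p * (p * Cw / (p - 1) + p * A / (2 - p))) * (\<integral>\<^sup>+n. ennreal (norm (f n) powr p) \<partial>cs)"
 proof -
  have "2 powr p * (p * Cw / (p - 1) + p * A / (2 - p)) = (2 powr p * p) * (Cw / (p - 1) + A / (2 - p))"
   by (simp add: distrib_left mult.assoc)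
  moreover have "ennreal ((2 powr p * p) * (Cw / (p - 1) + A / (2 - p))) = ennreal (2 powr p * p) * ennreal (Cw / (p - 1) + A / (2 - p))"
   using Cw_nonneg A p by (intro ennreal_mult) auto
  ultimately show ?thesis by (simp only: mult.assoc)
 qed
 finally show "(\<integral>\<^sup>+n. ennreal (norm (conv K f n) powr p) \<partial>cs) \<le>
   ennreal (2 powr p * (p * Cw / (p - 1) + p * A / (2 - p))) * (\<integral>\<^sup>+n. ennreal (norm (f n) powr p) \<partial>cs)" .
qed

definition bx :: "nat => (int^'n) set" where "bx k = {n. ALL i. n $ i : {- int k..int k}}"

lemma bx_finite: "finite (bx k)" unfolding bx_def by (rule vec_box) simp

lemma bx_eventually: "\<forall>\<^sub>F k in sequentially. n : bx k"
proof -
 define N where "N = (\<Sum>i\<in>UNIV. nat \<bar>n $ i\<bar>)"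
 have "n : bx k" if "N <= k" for k
 proof -
  have "nat \<bar>n $ i\<bar> <= N" for i unfolding N_def by (rule member_le_sum) auto
  then have "nat \<bar>n $ i\<bar> <= k" for i using that order_trans by blast
  then have "\<bar>n $ i\<bar> <= int k" for i by (metis nat_le_iff)
  then show ?thesis unfolding bx_def by (auto simp: abs_le_iff) (metis abs_le_iff minus_le_iff)
 qed
 then show ?thesis by (auto simp: eventually_sequentially)
qed

lemma fatou_cs:
 fixes u :: "nat => 'a => ennreal"
 assumes "!!n. (%k. u k n) \<longlonglongrightarrow> h n" "!!k. (\<integral>\<^sup>+n. u k n \<partial>cs) <= c"
 shows "(\<integral>\<^sup>+n. h n \<partial>cs) <= c"
proof -
 have "(\<integral>\<^sup>+n. h n \<partial>cs) = (\<integral>\<^sup>+n. liminf (%k. u k n) \<partial>cs)"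
  by (intro nn_integral_cong lim_imp_Liminf[symmetric] assms) simp
 also have "... <= liminf (%k. \<integral>\<^sup>+n. u k n \<partial>cs)" by (rule nn_integral_liminf) simp
 also have "... <= limsup (%k. \<integral>\<^sup>+n. u k n \<partial>cs)" by (rule Liminf_le_Limsup) simp
 also have "... <= c" by (rule Limsup_bounded) (simp add: assms)
 finally show ?thesis .
qed

lemma nn_cs_le:
 fixes h :: "int^'n => ennreal"
 assumes "!!F. finite F ==> (\<Sum>n\<in>F. h n) <= c" shows "(\<integral>\<^sup>+n. h n \<partial>cs) <= c"
proof (rule fatou_cs)
 show "(%k. h n * indicator (bx k) n) \<longlonglongrightarrow> h n" for n
  by (rule tendsto_eventually) (use bx_eventually[of n] in eventually_elim, simp)
 show "(\<integral>\<^sup>+n. h n * indicator (bx k) n \<partial>cs) <= c" for k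
 proof -
  have "(\<integral>\<^sup>+n. h n * indicator (bx k) n \<partial>cs) = (\<Sum>n\<in>bx k. h n * indicator (bx k) n)"
   by (rule nn_integral_count_space') (auto simp: bx_finite)
  also have "... = (\<Sum>n\<in>bx k. h n)" by (rule sum.cong) auto
  finally show ?thesis using assms[OF bx_finite] by simp
 qed
qed

lemma lp_imp_bounded:
 fixes g :: "int^'n => complex"
 assumes "(\<integral>\<^sup>+n. ennreal (norm (g n) powr p) \<partial>cs) < \<infinity>" and p: "0 < p"
 obtains M where "!!n. norm (g n) <= M"
proof -
 obtain c where c: "(\<integral>\<^sup>+n. ennreal (norm (g n) powr p) \<partial>cs) = ennreal c" "0 <= c"
  using assms by (cases "\<integral>\<^sup>+n. ennreal (norm (g n) powr p) \<partial>cs") auto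
 have "norm (g n) <= c powr (1 / p)" for n
 proof -
  have "ennreal (norm (g n) powr p) = (\<integral>\<^sup>+m. (if m = n then ennreal (norm (g n) powr p) else 0) \<partial>cs)" by (simp add: nn_cs_single)
  also have "... <= (\<integral>\<^sup>+n. ennreal (norm (g n) powr p) \<partial>cs)" by (intro nn_integral_mono) auto
  finally have "norm (g n) powr p <= c" using c by simp
  then have "(norm (g n) powr p) powr (1 / p) <= c powr (1 / p)" using p by (intro powr_mono2) auto
  then show ?thesis using p by (simp add: powr_powr)
 qed
 then show ?thesis using that by blast
qed

text \<open>
  Finitely supported functions suffice: an \<open>L\<^sup>p\<close> function is the limit of its restrictions to
  boxes, the convolutions converge pointwise, and Fatou's lemma passes the bound to the limit.
\<close>

lemma lp_bounded_extend:
 fixes K g :: "int^'n => complex"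
 assumes lp: "lp_bounded p C K" and K: "integrable cs K" and p: "0 < p"
  and g: "(\<integral>\<^sup>+n. ennreal (norm (g n) powr p) \<partial>cs) < \<infinity>"
 shows "(\<integral>\<^sup>+n. ennreal (norm (conv K g n) powr p) \<partial>cs) <= ennreal C * (\<integral>\<^sup>+n. ennreal (norm (g n) powr p) \<partial>cs)"
proof -
 obtain M where M: "!!n. norm (g n) <= M" using lp_imp_bounded[OF g p] by blast
 define gk where "gk k n = (if n : bx k then g n else 0)" for k n
 have "fsupp (gk k)" for k unfolding fsupp_def by (rule finite_subset[OF _ bx_finite[of k]]) (auto simp: gk_def split: if_splits)
 then have "(\<integral>\<^sup>+n. ennreal (norm (conv K (gk k) n) powr p) \<partial>cs) <= ennreal C * (\<integral>\<^sup>+n. ennreal (norm (gk k n) powr p) \<partial>cs)" for k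
  using lp by (simp add: lp_bounded_def)
 also have "... k <= ennreal C * (\<integral>\<^sup>+n. ennreal (norm (g n) powr p) \<partial>cs)" for k
  using p by (intro mult_left_mono nn_integral_mono) (auto simp: gk_def)
 finally have 1: "(\<integral>\<^sup>+n. ennreal (norm (conv K (gk k) n) powr p) \<partial>cs) <= ennreal C * (\<integral>\<^sup>+n. ennreal (norm (g n) powr p) \<partial>cs)" for k .
 have "(%k. conv K (gk k) n) \<longlonglongrightarrow> conv K g n" for n
  unfolding conv_def
 proof (rule integral_dominated_convergence[where w = "%y. norm (K (n - y)) * M"])
  have "integrable cs (%y. K (n - y))" using K nn_shift(3)[of "%y. ennreal (norm (K y))" n] by (simp add: integrable_cs_iff)
  then show "integrable cs (%y. norm (K (n - y)) * M)" by simp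
  show "AE y in cs. (%k. K (n - y) * gk k y) \<longlonglongrightarrow> K (n - y) * g y"
  proof (rule AE_I2)
   fix y
   show "(%k. K (n - y) * gk k y) \<longlonglongrightarrow> K (n - y) * g y"
    by (rule tendsto_eventually) (use bx_eventually[of y] in eventually_elim, simp add: gk_def)
  qed
  have "norm (gk k y) <= M" for k y using M[of y] order_trans[OF norm_ge_zero M[of y]] by (simp add: gk_def)
  then show "AE y in cs. norm (K (n - y) * gk k y) <= norm (K (n - y)) * M" for k
   by (intro AE_I2) (simp add: norm_mult mult_left_mono)
 qed auto
 then have "(%k. ennreal (norm (conv K (gk k) n) powr p)) \<longlonglongrightarrow> ennreal (norm (conv K g n) powr p)" for n
  using p by (intro tendsto_ennrealI tendsto_powr2 tendsto_norm tendsto_const) auto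
 then show ?thesis using 1 by (rule fatou_cs)
qed

lemma young_param:
 fixes a b s :: real
 assumes "0 <= a" "0 <= b" "0 < s" "1 < p" "1 < q" "1 / p + 1 / q = 1"
 shows "a * b <= s powr p * a powr p / p + s powr (- q) * b powr q / q"
proof -
 have "(s * a) * (b / s) <= (s * a) powr p / p + (b / s) powr q / q"
  using assms by (intro Youngs_inequality) auto
 moreover have "(s * a) * (b / s) = a * b" using assms by simp
 moreover have "(s * a) powr p = s powr p * a powr p" using assms by (simp add: powr_mult)
 moreover have "(b / s) powr q = s powr (- q) * b powr q"
  using assms by (simp add: powr_divide powr_minus_divide)
 ultimately show ?thesis by simp
qed

text \<open>Duality: pairing with the conjugate power of the image and absorbing by Young's inequality.\<close>

lemma lp_bounded_dual:
 fixes K :: "int^'n => complex"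
 assumes lp: "lp_bounded q C (%n. K (- n))" and pq: "1 < p" "1 < q" "1 / p + 1 / q = 1" and C: "0 <= C"
 defines "s \<equiv> (2 * C + 1) powr (1 / q)"
 shows "lp_bounded p (2 * s powr p / p) K"
 unfolding lp_bounded_def
proof (intro allI impI, rule nn_cs_le)
 fix f :: "int^'n => complex" and F :: "(int^'n) set" assume f: "fsupp f" and F: "finite F"
 define S where "S = {n. f n ~= 0}"
 have S: "finite S" "!!n. n \<notin> S ==> f n = 0" using f by (auto simp: S_def fsupp_def)
 define T where "T n = conv K f n" for n
 define g where "g n = (if n : F then cnj (T n) * of_real (norm (T n) powr (p - 2)) else 0)" for n
 have gF: "g n = 0" if "n \<notin> F" for n using that by (simp add: g_def)
 have fg: "fsupp g" unfolding fsupp_def by (rule finite_subset[OF _ F]) (use gF in auto)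
 define X where "X = (\<Sum>n\<in>F. norm (T n) powr p)"
 define Y where "Y = (\<Sum>n\<in>S. norm (f n) powr p)"
 define G where "G y = conv (%n. K (- n)) g y" for y
 have s: "0 < s" using C by (simp add: s_def)
 have XY: "0 <= X" "0 <= Y" by (auto simp: X_def Y_def intro: sum_nonneg)
 have pw: "r * r powr (p - 1) = r powr p" if "0 <= r" for r
  using that pq powr_add[of r 1 "p - 1"] by (cases "r = 0") auto
 have Tg: "T n * g n = of_real (norm (T n) powr p)" if "n : F" for n
 proof -
  have "norm (T n) * norm (T n) * norm (T n) powr (p - 2) = norm (T n) powr p"
   using powr_add[of "norm (T n)" 2 "p - 2"] by (cases "T n = 0") (auto simp: powr_numeral power2_eq_square)
  moreover have "T n * g n = (T n * cnj (T n)) * of_real (norm (T n) powr (p - 2))" using that by (simp only: g_def if_True mult.assoc)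
  moreover have "T n * cnj (T n) = of_real (norm (T n) * norm (T n))" by (simp only: complex_norm_square[symmetric] power2_eq_square)
  ultimately show ?thesis by (simp only: of_real_mult[symmetric])
 qed
 have gq: "norm (g n) powr q = norm (T n) powr p" if "n : F" for n
 proof -
  have "norm (g n) = norm (T n) powr (p - 1)"
   using that powr_add[of "norm (T n)" 1 "p - 2"] by (cases "T n = 0") (auto simp: g_def norm_mult)
  moreover have "(p - 1) * q = p" using pq by (simp add: field_simps)
  ultimately show ?thesis by (simp add: powr_powr)
 qed
 have "of_real X = (\<Sum>n\<in>F. T n * g n)" unfolding X_def of_real_sum by (rule sum.cong) (auto simp: Tg)
 also have "... = (\<Sum>n\<in>F. \<Sum>y\<in>S. f y * (K (- (y - n)) * g n))"
  by (simp add: T_def conv_fsupp[where K = K, OF S] sum_distrib_left sum_distrib_right mult_ac)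
 also have "... = (\<Sum>y\<in>S. \<Sum>n\<in>F. f y * (K (- (y - n)) * g n))" by (rule sum.swap)
 also have "... = (\<Sum>y\<in>S. f y * G y)"
  by (simp add: G_def conv_fsupp[where f = g, OF F gF] sum_distrib_left)
 finally have "X <= norm (\<Sum>y\<in>S. f y * G y)" using XY by (metis norm_of_real abs_of_nonneg order_refl)
 also have "... <= (\<Sum>y\<in>S. norm (f y) * norm (G y))" by (rule order_trans[OF norm_sum]) (simp add: norm_mult)
 also have "... <= (\<Sum>y\<in>S. s powr p * norm (f y) powr p / p + s powr (- q) * norm (G y) powr q / q)"
  by (intro sum_mono young_param) (use s pq in auto)
 also have "... = s powr p / p * Y + s powr (- q) / q * (\<Sum>y\<in>S. norm (G y) powr q)"
  by (simp add: sum.distrib Y_def sum_distrib_left)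
 finally have Xle: "X <= s powr p / p * Y + s powr (- q) / q * (\<Sum>y\<in>S. norm (G y) powr q)" .
 have Gle: "(\<Sum>y\<in>S. norm (G y) powr q) <= C * X"
 proof -
  have "ennreal (\<Sum>y\<in>S. norm (G y) powr q) = (\<integral>\<^sup>+y. ennreal (norm (G y) powr q) * indicator S y \<partial>cs)"
   by (subst nn_integral_count_space'[of S]) (auto simp: S sum_ennreal)
  also have "... <= (\<integral>\<^sup>+y. ennreal (norm (G y) powr q) \<partial>cs)" by (intro nn_integral_mono) (auto simp: indicator_def)
  also have "... <= ennreal C * (\<integral>\<^sup>+n. ennreal (norm (g n) powr q) \<partial>cs)"
   using lp fg unfolding lp_bounded_def G_def by blast
  also have "(\<integral>\<^sup>+n. ennreal (norm (g n) powr q) \<partial>cs) = ennreal (\<Sum>n\<in>F. norm (g n) powr q)"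
   by (rule nn_fsupp[OF F]) (use gF pq in auto)
  also have "(\<Sum>n\<in>F. norm (g n) powr q) = X" unfolding X_def by (rule sum.cong) (auto simp: gq)
  finally show ?thesis using C XY by (simp add: ennreal_mult[symmetric])
 qed
 have "X <= s powr p / p * Y + s powr (- q) / q * (C * X)"
  by (rule order_trans[OF Xle]) (intro add_left_mono mult_left_mono Gle, use pq in simp)
 moreover have "s powr (- q) / q * (C * X) <= X / 2"
 proof -
  have "s powr q = 2 * C + 1" using pq C by (simp add: s_def powr_powr)
  then have "s powr (- q) = 1 / (2 * C + 1)" by (simp add: powr_minus divide_inverse)
  then have "s powr (- q) / q * C = C / ((2 * C + 1) * q)" by simp
  also have "... <= 1 / 2"
  proof -
   have "2 * C * 1 <= (2 * C + 1) * q" using C pq by (intro mult_mono) auto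
   moreover have "0 < (2 * C + 1) * q" using C pq by simp
   ultimately show ?thesis by (simp add: divide_le_eq)
  qed
  finally have "(s powr (- q) / q * C) * X <= 1 / 2 * X" using XY by (intro mult_right_mono)
  then show ?thesis by (simp add: mult.assoc)
 qed
 moreover have "2 * s powr p / p * Y = 2 * (s powr p / p * Y)" by simp
 ultimately have "X <= 2 * s powr p / p * Y" by linarith
 then have "ennreal X <= ennreal (2 * s powr p / p) * ennreal Y" using XY pq by (subst ennreal_mult[symmetric]) (auto intro: ennreal_leI)
 moreover have "(\<integral>\<^sup>+n. ennreal (norm (f n) powr p) \<partial>cs) = ennreal Y"
  unfolding Y_def by (rule nn_fsupp[OF S(1)]) (use S(2) pq in auto)
 moreover have "(\<Sum>n\<in>F. ennreal (norm (conv K f n) powr p)) = ennreal X" by (simp add: X_def T_def)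
 ultimately show "(\<Sum>n\<in>F. ennreal (norm (conv K f n) powr p)) <= ennreal (2 * s powr p / p) * (\<integral>\<^sup>+n. ennreal (norm (f n) powr p) \<partial>cs)" by simp
qed

subsection \<open>Multipliers with singular kernels\<close>

lemma wien_fsupp:
 assumes "finite S" "!!n. n \<notin> S ==> f n = 0" shows "wien (%\<xi>. \<Sum>n\<in>S. f n * chr n \<xi>) f"
proof -
 have fs: "finite {a : UNIV. f a * chr a \<xi> ~= 0}" for \<xi> by (rule finite_subset[OF _ assms(1)]) (use assms(2) in auto)
 have "(\<integral>\<^sup>+n. ennreal (norm (f n)) \<partial>cs) = ennreal (\<Sum>n\<in>S. norm (f n))"
  by (rule nn_fsupp[OF assms(1)]) (use assms(2) in auto)
 moreover have "(\<integral>n. f n * chr n \<xi> \<partial>cs) = (\<Sum>n\<in>S. f n * chr n \<xi>)" for \<xi>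
  by (subst lebesgue_integral_count_space_finite_support[OF fs]) (rule sum.mono_neutral_left, use assms in auto)
 ultimately show ?thesis by (simp add: wien_def integrable_cs_iff)
qed

lemma chr_orth: "(\<integral>\<xi>. chr m \<xi> * cnj (chr n \<xi>) \<partial>TM) = (if m = n then of_real ((2 * pi) ^ CARD('n)) else 0)"
 for m n :: "int^'n"
 using integral_chr[of "m - n"] chr_add[of m "- n"] by simp

text \<open>A bounded symbol gives an operator bounded on square summable functions: Bessel for the image,
  Parseval for the argument.\<close>

lemma W_l2_bounded:
 fixes F :: "real^'n => complex"
 assumes WF: "wien F K" and b: "!!\<xi>. \<xi> : pbox ==> norm (F \<xi>) <= 1" shows "l2_bounded 1 K"
 unfolding l2_bounded_def
proof (intro allI impI, rule nn_cs_le)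
 fix f :: "int^'n => complex" and N :: "(int^'n) set" assume f: "fsupp f" and N: "finite N"
 define S where "S = {n. f n ~= 0}"
 have S: "finite S" "!!n. n \<notin> S ==> f n = 0" using f by (auto simp: S_def fsupp_def)
 define H where "H \<xi> = (\<Sum>n\<in>S. f n * chr n \<xi>)" for \<xi>
 have WH: "wien H f" unfolding H_def[abs_def] by (rule wien_fsupp[OF S])
 have k: "ker (%\<xi>. F \<xi> * H \<xi>) = conv K f" by (rule wien_coeff[OF wien_mult[OF WF WH]])
 let ?c = "(2 * pi) ^ CARD('n) :: real"
 have c: "0 < ?c" by simp
 have Hb: "norm (H \<xi>) <= (\<Sum>n\<in>S. norm (f n))" for \<xi>
  unfolding H_def by (rule order_trans[OF norm_sum]) (simp add: norm_mult)
 have FH: "norm (F \<xi> * H \<xi>) <= norm (H \<xi>)" if "\<xi> : pbox" for \<xi>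
  using mult_right_mono[OF b[OF that], of "norm (H \<xi>)"] by (simp add: norm_mult)
 have m [measurable]: "F : borel_measurable TM" "H : borel_measurable TM"
  using W_measurable[OF wien_imp_W[OF WF]] W_measurable[OF wien_imp_W[OF WH]] by auto
 have "(\<Sum>n\<in>N. (norm (\<integral>\<xi>. F \<xi> * H \<xi> * cnj (chr n \<xi>) \<partial>TM))\<^sup>2) <= ?c * (\<integral>\<xi>. (norm (F \<xi> * H \<xi>))\<^sup>2 \<partial>TM)"
 proof (rule bessel[OF TM.finite_measure_axioms N _ _ _ c, where B = "\<Sum>n\<in>S. norm (f n)"])
  show "(\<integral>\<xi>. chr m \<xi> * cnj (chr n \<xi>) \<partial>TM) = (if m = n then of_real ?c else 0)" for m n :: "int^'n" by (rule chr_orth)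
  show "norm (F \<xi> * H \<xi>) <= (\<Sum>n\<in>S. norm (f n))" if "\<xi> : space TM" for \<xi>
   by (rule order_trans[OF FH Hb]) (use that in simp)
 qed simp_all
 also have "... <= ?c * (\<integral>\<xi>. (norm (H \<xi>))\<^sup>2 \<partial>TM)"
 proof (intro mult_left_mono integral_mono)
  show h: "integrable TM (%\<xi>. (norm (H \<xi>))\<^sup>2)"
   by (rule TM.integrable_const_bound[where B = "(\<Sum>n\<in>S. norm (f n))\<^sup>2"]) (auto intro!: AE_I2 power_mono Hb)
  show "integrable TM (%\<xi>. (norm (F \<xi> * H \<xi>))\<^sup>2)"
   by (rule Bochner_Integration.integrable_bound[OF h]) (auto intro!: AE_I2 power_mono FH)
  show "(norm (F \<xi> * H \<xi>))\<^sup>2 <= (norm (H \<xi>))\<^sup>2" if "\<xi> : space TM" for \<xi> using that by (intro power_mono FH) auto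
 qed (use c in auto)
 also have "(\<integral>\<xi>. (norm (H \<xi>))\<^sup>2 \<partial>TM) = ?c * (\<Sum>n\<in>S. (norm (f n))\<^sup>2)"
  unfolding H_def by (rule parseval_finite[OF TM.finite_measure_axioms S(1)]; (rule chr_orth | simp))
 finally have "(\<Sum>n\<in>N. (norm (\<integral>\<xi>. F \<xi> * H \<xi> * cnj (chr n \<xi>) \<partial>TM))\<^sup>2) <= ?c * (?c * (\<Sum>n\<in>S. (norm (f n))\<^sup>2))" .
 moreover have "(\<Sum>n\<in>N. (norm (\<integral>\<xi>. F \<xi> * H \<xi> * cnj (chr n \<xi>) \<partial>TM))\<^sup>2) = ?c * ?c * (\<Sum>n\<in>N. (norm (conv K f n))\<^sup>2)"
 proof -
  have e: "norm (\<integral>\<xi>. F \<xi> * H \<xi> * cnj (chr n \<xi>) \<partial>TM) = ?c * norm (conv K f n)" for n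
  proof -
   have "(\<integral>\<xi>. F \<xi> * H \<xi> * cnj (chr n \<xi>) \<partial>TM) = of_real ?c * conv K f n"
    unfolding k[symmetric] ker_def using c by simp
   then show ?thesis using c by (simp add: norm_mult norm_power)
  qed
  show ?thesis unfolding e sum_distrib_left by (simp only: power2_eq_square mult_ac)
 qed
 ultimately have "(\<Sum>n\<in>N. (norm (conv K f n))\<^sup>2) <= (\<Sum>n\<in>S. (norm (f n))\<^sup>2)" using c by (simp add: mult.assoc)
 then have "ennreal (\<Sum>n\<in>N. (norm (conv K f n))\<^sup>2) <= ennreal (\<Sum>n\<in>S. (norm (f n))\<^sup>2)" by (rule ennreal_leI)
 moreover have "(\<integral>\<^sup>+n. ennreal ((norm (f n))\<^sup>2) \<partial>cs) = ennreal (\<Sum>n\<in>S. (norm (f n))\<^sup>2)"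
  by (rule nn_fsupp[OF S(1)]) (use S(2) in auto)
 ultimately show "(\<Sum>n\<in>N. ennreal ((norm (conv K f n))\<^sup>2)) <= ennreal 1 * (\<integral>\<^sup>+n. ennreal ((norm (f n))\<^sup>2) \<partial>cs)" by simp
qed

lemma pbox_minus: assumes "\<xi> : pbox" shows "- \<xi> : pbox"
proof -
 have "- pi < - (\<xi> $ i) & - (\<xi> $ i) < pi" for i
 proof -
  have "- pi < \<xi> $ i & \<xi> $ i < pi" using assms by (simp add: pbox_def mem_box_cart)
  then show ?thesis by linarith
 qed
 then show ?thesis using assms by (simp add: pbox_def mem_box_cart)
qed

lemma wien_reflect: assumes "wien F K" shows "wien (%\<xi>. F (- \<xi>)) (%n. K (- n))"
 unfolding wien_def
proof (intro conjI ballI)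
 show "integrable cs (%n. K (- n))"
  using assms nn_shift(4)[of "%n. ennreal (norm (K n))"] by (simp add: wien_def integrable_cs_iff)
 fix \<xi> :: "real^'a" assume "\<xi> : pbox"
 then have "- \<xi> : pbox" by (rule pbox_minus)
 then have "(\<integral>n. K n * chr n (- \<xi>) \<partial>cs) = F (- \<xi>)" by (rule wienD(2)[OF assms])
 moreover have "(\<integral>n. K (- n) * chr n \<xi> \<partial>cs) = (\<integral>n. K n * chr n (- \<xi>) \<partial>cs)"
  using integral_shift(4)[of "%n. K n * chr (- n) \<xi>"] by (simp add: chr_minus_arg)
 ultimately show "(\<integral>n. K (- n) * chr n \<xi> \<partial>cs) = F (- \<xi>)" by simp
qed

lemma hoermander_reflect:
 fixes K :: "int^'n => complex"
 assumes "hoermander B K" shows "hoermander B (%n. K (- n))"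
 unfolding hoermander_def
proof (intro allI impI)
 fix r :: nat and v :: "int^'n" assume r: "1 <= r" and v: "ALL i. \<bar>v $ i\<bar> <= int r"
 have "(\<integral>\<^sup>+z. ennreal (norm (K (- (z - v)) - K (- z))) * indicator {z. EX i. 2 * int r < \<bar>z $ i\<bar>} z \<partial>cs)
  = (\<integral>\<^sup>+z. ennreal (norm (K (z - (- v)) - K z)) * indicator {z. EX i. 2 * int r < \<bar>z $ i\<bar>} z \<partial>cs)"
  using nn_shift(4)[of "%z. ennreal (norm (K (z - (- v)) - K z)) * indicator {z. EX i. 2 * int r < \<bar>z $ i\<bar>} z"]
  by (simp add: indicator_def algebra_simps)
 also have "... <= ennreal B"
 proof -
  have "ALL i. \<bar>(- v) $ i\<bar> <= int r" using v by simp
  then show ?thesis using assms r unfolding hoermander_def by blast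
 qed
 finally show "(\<integral>\<^sup>+z. ennreal (norm (K (- (z - v)) - K (- z))) * indicator {z. EX i. 2 * int r < \<bar>z $ i\<bar>} z \<partial>cs) <= ennreal B" .
qed

lemma lp_bounded_2: "l2_bounded A K ==> lp_bounded 2 A K"
 by (simp add: l2_bounded_def lp_bounded_def powr_numeral)

text \<open>
  The constant depends only on \<open>p\<close>, the dimension and the Hoermander constant; the summability of the
  kernel enters qualitatively and its size does not appear. For \<open>p > 2\<close> the adjoint is used, whose
  kernel is the reflected one.
\<close>

theorem singular_multiplier_lp:
 assumes p: "1 < p" and B: "0 <= B"
 shows "\<exists>C\<ge>0. \<forall>F :: real^'n => complex. W F --> (\<forall>\<xi>\<in>pbox. norm (F \<xi>) <= 1) --> hoermander B (ker F) -->
  lp_bounded p C (ker F) & lp_bounded p C (%n. ker F (- n))"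
proof -
 define good where "good K \<longleftrightarrow> l2_bounded 1 K & hoermander B K" for K :: "int^'n => complex"
 have low: "\<exists>C\<ge>0. ALL K. good K --> lp_bounded p C K" if p: "1 < p" "p < 2" for p
 proof (intro exI conjI allI impI)
  fix K assume "good K"
  then show "lp_bounded p (2 powr p * (p * (4 * 1 * 2 ^ CARD('n) + 4 * B + 5 ^ CARD('n)) / (p - 1) + p * 1 / (2 - p))) K"
   unfolding good_def by (intro marcinkiewicz) (use p B in auto)
 qed (use p B in \<open>auto intro!: mult_nonneg_nonneg add_nonneg_nonneg divide_nonneg_nonneg\<close>)
 have "\<exists>C\<ge>0. ALL K. good K --> good (%n. K (- n)) --> lp_bounded p C K"
 proof -
  consider "p < 2" | "p = 2" | "2 < p" by linarith
  then show ?thesis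
  proof cases
   case 1 then show ?thesis using low[OF p] by blast
  next
   case 2 then show ?thesis by (intro exI[of _ 1]) (auto simp: good_def lp_bounded_2)
  next
   case 3
   define q where "q = p / (p - 1)"
   have q: "1 < q" "q < 2" "1 / p + 1 / q = 1" using 3 by (auto simp: q_def field_simps)
   obtain C where C: "0 <= C" "!!K. good K ==> lp_bounded q C K" using low[OF q(1,2)] by blast
   show ?thesis
   proof (intro exI conjI allI impI)
    fix K assume "good K" "good (%n. K (- n))"
    then show "lp_bounded p (2 * ((2 * C + 1) powr (1 / q)) powr p / p) K"
     by (intro lp_bounded_dual[where q = q] C) (use 3 q C in auto)
   qed (use p in auto)
  qed
 qed
 then obtain C where C: "0 <= C" "!!K. good K ==> good (%n. K (- n)) ==> lp_bounded p C K" by blast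
 show ?thesis
 proof (intro exI[of _ C] conjI allI impI C(1))
  fix F :: "real^'n => complex" assume F: "W F" "\<forall>\<xi>\<in>pbox. norm (F \<xi>) <= 1" "hoermander B (ker F)"
  have g1: "good (ker F)" using W_l2_bounded[OF F(1)] F by (simp add: good_def)
  have "norm (F (- \<xi>)) <= 1" if "\<xi> : pbox" for \<xi>
  proof -
   have "- \<xi> : pbox" by (rule pbox_minus[OF that])
   then show ?thesis using F(2) by blast
  qed
  then have g2: "good (%n. ker F (- n))"
   using W_l2_bounded[OF wien_reflect[OF F(1)]] hoermander_reflect[OF F(3)] by (simp add: good_def)
  show "lp_bounded p C (ker F)" by (rule C(2)[OF g1 g2])
  show "lp_bounded p C (%n. ker F (- n))" by (rule C(2)[OF g2]) (use g1 in simp)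
 qed
qed

section \<open>Norms of sequences on the lattice\<close>

definition Np :: "real => (int^'n => complex) => ennreal" where
 "Np p f = (\<integral>\<^sup>+n. ennreal (norm (f n) powr p) \<partial>cs)"

definition lpn :: "real => (int^'n => complex) => ennreal" where
 "lpn p f = (if Np p f = \<infinity> then \<infinity> else ennreal (enn2real (Np p f) powr (1 / p)))"

lemma lpn_top: "Np p f = \<infinity> ==> lpn p f = \<infinity>" by (simp add: lpn_def)

lemma lpn_ennreal: "Np p f = ennreal a ==> 0 <= a ==> lpn p f = ennreal (a powr (1 / p))"
 by (simp add: lpn_def)

lemma lpn_le_of_Np:
 assumes "Np p g <= ennreal C * Np p f" "0 < C" "0 < p"
 shows "lpn p g <= ennreal (C powr (1 / p)) * lpn p f"
proof (cases "Np p f = \<infinity>")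
 case True
 then show ?thesis using assms by (simp add: lpn_top ennreal_mult_top)
next
 case False
 then obtain a where a: "Np p f = ennreal a" "0 <= a" by (cases "Np p f") auto
 have "Np p g <= ennreal (C * a)" using assms a by (simp add: ennreal_mult)
 moreover from this obtain b where b: "Np p g = ennreal b" "0 <= b" by (cases "Np p g") (auto simp: top_unique)
 ultimately have "b <= C * a" using a assms by simp
 then have "b powr (1 / p) <= (C * a) powr (1 / p)" using b assms by (intro powr_mono2) auto
 then show ?thesis
  using a assms by (simp add: lpn_ennreal[OF a] lpn_ennreal[OF b] powr_mult ennreal_mult[symmetric] ennreal_leI)
qed

text \<open>
  Convexity of \<open>x powr p\<close> at the point \<open>(x + y) / (a + b)\<close>; with \<open>a\<close> and \<open>b\<close> the two norms it gives the
  triangle inequality after summation.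
\<close>

lemma powr_convex_combination:
 fixes x y a b p :: real
 assumes "0 <= x" "0 <= y" "0 < a" "0 < b" "1 <= p"
 shows "(x + y) powr p <= (a + b) powr (p - 1) * (a powr (1 - p) * x powr p + b powr (1 - p) * y powr p)"
proof -
 have mono: "1 <= (a + b) powr (p - 1) * c powr (1 - p)" if "0 < c" "c <= a + b" for c
 proof -
  have "c powr (p - 1) * c powr (1 - p) <= (a + b) powr (p - 1) * c powr (1 - p)"
   using that assms by (intro mult_right_mono powr_mono2) auto
  moreover have "c powr (p - 1) * c powr (1 - p) = 1" using that by (simp add: powr_add[symmetric])
  ultimately show ?thesis by simp
 qed
 have m1: "x powr p <= (a + b) powr (p - 1) * (a powr (1 - p) * x powr p)"
  using mult_right_mono[OF mono[of a], of "x powr p"] assms by (simp add: mult.assoc)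
 have m2: "y powr p <= (a + b) powr (p - 1) * (b powr (1 - p) * y powr p)"
  using mult_right_mono[OF mono[of b], of "y powr p"] assms by (simp add: mult.assoc)
 consider "x = 0" | "y = 0" | "0 < x" "0 < y" using assms by linarith
 then show ?thesis
 proof cases
  case 1 then show ?thesis using m2 assms by simp
 next
  case 2 then show ?thesis using m1 assms by simp
 next
  case 3
  define t where "t = b / (a + b)"
  have t: "0 <= t" "t <= 1" "1 - t = a / (a + b)" using assms by (auto simp: t_def field_simps)
  have "((1 - t) *\<^sub>R (x / a) + t *\<^sub>R (y / b)) powr p <= (1 - t) * (x / a) powr p + t * (y / b) powr p"
   using 3 assms by (intro convex_onD[OF powr_convex[OF assms(5)] t(1,2)]) auto
  also have "(1 - t) *\<^sub>R (x / a) + t *\<^sub>R (y / b) = (x + y) / (a + b)"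
   unfolding t(3) using assms by (simp add: t_def add_divide_distrib)
  finally have 1: "(x + y) powr p / (a + b) powr p <= a / (a + b) * (x powr p / a powr p) + b / (a + b) * (y powr p / b powr p)"
   using 3 assms unfolding t(3) by (simp add: t_def powr_divide)
  have s: "c / c powr p = c powr (1 - p)" if "0 < c" for c using that by (simp add: powr_diff)
  have s2: "(a + b) powr p / (a + b) = (a + b) powr (p - 1)" using assms by (simp add: powr_diff)
  have pos: "0 < (a + b) powr p" using assms by simp
  have "(x + y) powr p <= (a / (a + b) * (x powr p / a powr p) + b / (a + b) * (y powr p / b powr p)) * (a + b) powr p"
   using 1 pos by (simp only: pos_divide_le_eq)
  also have "... = ((a + b) powr p / (a + b)) * ((a / a powr p) * x powr p + (b / b powr p) * y powr p)"
   by (simp add: algebra_simps)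
  finally show ?thesis by (simp only: s[OF assms(3)] s[OF assms(4)] s2)
 qed
qed

lemma lpn_triangle:
 assumes p: "1 < p" shows "lpn p (%n. f n + g n) <= lpn p f + lpn p g"
proof (cases "Np p f = \<infinity> | Np p g = \<infinity>")
 case True
 then show ?thesis by (auto simp: lpn_top)
next
 case False
 then obtain A B where A: "Np p f = ennreal A" "0 <= A" and B: "Np p g = ennreal B" "0 <= B"
  by (cases "Np p f"; cases "Np p g") auto
 define a b where "a = A powr (1 / p)" and "b = B powr (1 / p)"
 have ab: "0 <= a" "0 <= b" by (auto simp: a_def b_def)
 have AB: "A = a powr p" "B = b powr p" using A B p by (auto simp: a_def b_def powr_powr)
 have main: "lpn p (%n. f n + g n) <= ennreal (a' + b')" if a': "a < a'" and b': "b < b'" for a' b'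
 proof -
  have pos: "0 < a'" "0 < b'" using a' b' ab by auto
  define c1 c2 where "c1 = (a' + b') powr (p - 1) * a' powr (1 - p)" and "c2 = (a' + b') powr (p - 1) * b' powr (1 - p)"
  have c: "0 <= c1" "0 <= c2" by (auto simp: c1_def c2_def)
  have "Np p (%n. f n + g n) <= (\<integral>\<^sup>+n. ennreal c1 * ennreal (norm (f n) powr p) + ennreal c2 * ennreal (norm (g n) powr p) \<partial>cs)"
   unfolding Np_def
  proof (rule nn_integral_mono)
   fix n
   have "norm (f n + g n) powr p <= (norm (f n) + norm (g n)) powr p" using p by (intro powr_mono2 norm_triangle_ineq) auto
   also have "... <= c1 * norm (f n) powr p + c2 * norm (g n) powr p"
    using powr_convex_combination[of "norm (f n)" "norm (g n)" a' b' p] pos p by (simp add: c1_def c2_def algebra_simps)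
   finally show "ennreal (norm (f n + g n) powr p) <= ennreal c1 * ennreal (norm (f n) powr p) + ennreal c2 * ennreal (norm (g n) powr p)"
    using c by (subst ennreal_comb[symmetric]) (auto intro: ennreal_leI simp del: ennreal_plus)
  qed
  also have "... = ennreal c1 * Np p f + ennreal c2 * Np p g"
   by (simp add: nn_integral_add nn_integral_cmult Np_def)
  also have "... = ennreal (c1 * A + c2 * B)" unfolding A(1) B(1) using A B c by (intro ennreal_comb[symmetric]) auto
  also have "... <= ennreal ((a' + b') powr p)"
  proof (rule ennreal_leI)
   have e: "r powr (1 - p) * r powr p = r" if "0 < r" for r using that by (simp add: powr_add[symmetric])
   have "c1 * A + c2 * B <= c1 * a' powr p + c2 * b' powr p"
    unfolding AB using a' b' ab p c by (intro add_mono mult_left_mono powr_mono2) auto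
   also have "... = (a' + b') powr (p - 1) * (a' powr (1 - p) * a' powr p + b' powr (1 - p) * b' powr p)"
    by (simp add: c1_def c2_def algebra_simps)
   also have "... = (a' + b') powr (p - 1) * (a' + b')" by (simp only: e[OF pos(1)] e[OF pos(2)])
   also have "... = (a' + b') powr p" using pos powr_add[of "a' + b'" "p - 1" 1] by simp
   finally show "c1 * A + c2 * B <= (a' + b') powr p" .
  qed
  finally have le: "Np p (%n. f n + g n) <= ennreal ((a' + b') powr p)" .
  then obtain E where E: "Np p (%n. f n + g n) = ennreal E" "0 <= E" by (cases "Np p (%n. f n + g n)") (auto simp: top_unique)
  have "E <= (a' + b') powr p" using le E by simp
  then have "E powr (1 / p) <= ((a' + b') powr p) powr (1 / p)" using E p by (intro powr_mono2) auto
  also have "... = a' + b'" using p pos by (simp add: powr_powr)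
  finally show ?thesis by (simp add: lpn_ennreal[OF E] ennreal_leI)
 qed
 have "lpn p (%n. f n + g n) <= ennreal (a + b)"
 proof (rule ennreal_le_epsilon)
  fix e :: real assume e: "0 < e"
  have "lpn p (%n. f n + g n) <= ennreal ((a + e / 2) + (b + e / 2))" by (rule main) (use e in auto)
  also have "... = ennreal (a + b) + ennreal e" using ab e by (simp add: ennreal_plus[symmetric] del: ennreal_plus)
  finally show "lpn p (%n. f n + g n) <= ennreal (a + b) + ennreal e" .
 qed
 also have "... = lpn p f + lpn p g" using ab by (simp add: lpn_ennreal[OF A] lpn_ennreal[OF B] a_def b_def)
 finally show ?thesis .
qed

lemma lpn_sum_le:
 fixes f :: "'j => int^'n => complex"
 assumes p: "1 < p" and "finite J" shows "lpn p (%n. \<Sum>j\<in>J. f j n) <= (\<Sum>j\<in>J. lpn p (f j))"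
 using assms(2)
proof (induction J)
 case empty
 have "Np p (%n::int^'n. 0) = ennreal 0" using p by (simp add: Np_def)
 from lpn_ennreal[OF this] show ?case using p by simp
next
 case (insert j J)
 then show ?case using lpn_triangle[OF p, of "f j" "%n. \<Sum>j\<in>J. f j n"] by (auto intro: order_trans[OF _ add_left_mono])
qed

text \<open>
  Each value of the convolution is bounded by Young's inequality with a free parameter \<open>M\<close>, chosen
  afterwards pointwise; this replaces Hoelder's inequality for the measure with density \<open>K\<close>.
\<close>

lemma young_l1:
 fixes K f :: "int^'n => complex"
 assumes p: "1 < p" and k: "(\<integral>\<^sup>+n. ennreal (norm (K n)) \<partial>cs) <= ennreal k" "0 < k"
 shows "lpn p (conv K f) <= ennreal k * lpn p f"
proof (cases "Np p f = \<infinity>")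
 case True
 then show ?thesis using k by (simp add: lpn_top ennreal_mult_top)
next
 case False
 then have "(\<integral>\<^sup>+n. ennreal (norm (f n) powr p) \<partial>cs) < \<infinity>" by (simp add: Np_def less_top)
 then obtain M0 where M0: "!!n. norm (f n) <= M0" using lp_imp_bounded p by (metis less_trans zero_less_one)
 have pt: "ennreal (norm (conv K f n) powr p) <= ennreal (k powr (p - 1)) * (\<integral>\<^sup>+y. ennreal (norm (K (n - y))) * ennreal (norm (f y) powr p) \<partial>cs)" for n
 proof -
  define I where "I = (\<integral>\<^sup>+y. ennreal (norm (K (n - y))) * ennreal (norm (f y) powr p) \<partial>cs)"
  have Kn: "(\<integral>\<^sup>+y. ennreal (norm (K (n - y))) \<partial>cs) <= ennreal k" using nn_shift(3)[of "%y. ennreal (norm (K y))" n] k by simp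
  have "I <= (\<integral>\<^sup>+y. ennreal (norm (K (n - y))) * ennreal (M0 powr p) \<partial>cs)"
   unfolding I_def using p M0 by (intro nn_integral_mono mult_left_mono ennreal_leI powr_mono2) auto
  also have "... <= ennreal k * ennreal (M0 powr p)" by (subst nn_integral_multc) (auto intro!: mult_right_mono Kn)
  also have "... < \<infinity>" by (simp add: ennreal_mult_less_top)
  finally obtain A where A: "I = ennreal A" "0 <= A" by (cases I) auto
  have bound: "norm (conv K f n) <= M powr (1 - p) / p * A + (1 - 1 / p) * M * k" if M: "0 < M" for M
  proof -
   have y: "x <= M powr (1 - p) / p * x powr p + (1 - 1 / p) * M" if x: "0 <= x" for x
   proof -
    define q where "q = p / (p - 1)"
    have q: "1 < q" "1 / p + 1 / q = 1" using p by (auto simp: q_def field_simps)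
    have "(x / M) * 1 <= (x / M) powr p / p + 1 powr q / q" using x M p q by (intro Youngs_inequality) auto
    also have "1 powr q / q = 1 - 1 / p" using q by simp
    finally have "x / M * M <= ((x / M) powr p / p + (1 - 1 / p)) * M" using M by (intro mult_right_mono) auto
    moreover have "(x / M) powr p * M = M powr (1 - p) * x powr p" using x M by (simp add: powr_divide powr_diff)
    moreover have "((x / M) powr p / p + (1 - 1 / p)) * M = ((x / M) powr p * M) / p + (1 - 1 / p) * M" by (simp add: distrib_right)
    moreover have "x / M * M = x" using M by simp
    ultimately show ?thesis by (metis times_divide_eq_left)
   qed
   have c: "0 <= M powr (1 - p) / p" "0 <= (1 - 1 / p) * M" using M p by auto
   have "ennreal (norm (conv K f n)) <= (\<integral>\<^sup>+y. ennreal (norm (K (n - y) * f y)) \<partial>cs)" unfolding conv_def by (rule nn_norm_integral_le)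
   also have "... <= (\<integral>\<^sup>+y. ennreal (M powr (1 - p) / p) * (ennreal (norm (K (n - y))) * ennreal (norm (f y) powr p)) + ennreal ((1 - 1 / p) * M) * ennreal (norm (K (n - y))) \<partial>cs)"
   proof (rule nn_integral_mono)
    fix y'
    have "norm (K (n - y') * f y') <= norm (K (n - y')) * (M powr (1 - p) / p * norm (f y') powr p + (1 - 1 / p) * M)"
     unfolding norm_mult by (intro mult_left_mono y) auto
    also have "... = (M powr (1 - p) / p) * (norm (K (n - y')) * norm (f y') powr p) + ((1 - 1 / p) * M) * norm (K (n - y'))"
     by (simp only: distrib_left mult_ac)
    finally have "ennreal (norm (K (n - y') * f y')) <= ennreal ..." by (rule ennreal_leI)
    also have "... = ennreal (M powr (1 - p) / p) * ennreal (norm (K (n - y')) * norm (f y') powr p) + ennreal ((1 - 1 / p) * M) * ennreal (norm (K (n - y')))"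
     by (rule ennreal_comb) (use c in auto)
    finally show "ennreal (norm (K (n - y') * f y')) <= ennreal (M powr (1 - p) / p) * (ennreal (norm (K (n - y'))) * ennreal (norm (f y') powr p)) + ennreal ((1 - 1 / p) * M) * ennreal (norm (K (n - y')))"
     by (simp only: ennreal_mult[OF norm_ge_zero powr_ge_zero])
   qed
   also have "... = ennreal (M powr (1 - p) / p) * I + ennreal ((1 - 1 / p) * M) * (\<integral>\<^sup>+y. ennreal (norm (K (n - y))) \<partial>cs)"
    by (simp add: nn_integral_add nn_integral_cmult I_def)
   also have "... <= ennreal (M powr (1 - p) / p) * ennreal A + ennreal ((1 - 1 / p) * M) * ennreal k"
    unfolding A(1) by (intro add_left_mono mult_left_mono Kn) simp
   also have "... = ennreal (M powr (1 - p) / p * A + (1 - 1 / p) * M * k)"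
    by (rule ennreal_comb[symmetric]) (use c A k in auto)
   finally show ?thesis
    using add_nonneg_nonneg[OF mult_nonneg_nonneg[OF c(1) A(2)] mult_nonneg_nonneg[OF c(2) less_imp_le[OF k(2)]]]
    by (simp only: ennreal_le_iff)
  qed
  have "norm (conv K f n) powr p <= k powr (p - 1) * A"
  proof (cases "A = 0")
   case True
   have "norm (conv K f n) <= 0 + e" if e: "0 < e" for e
   proof -
    define M where "M = e / ((1 - 1 / p) * k)"
    have "0 < (1 - 1 / p) * k" using p k by simp
    then have "0 < M" "(1 - 1 / p) * M * k = e" using e by (auto simp: M_def)
    then show ?thesis using bound[of M] True by simp
   qed
   then have "norm (conv K f n) <= 0" by (rule field_le_epsilon)
   then show ?thesis using True p by simp
  next
   case False
   then have A0: "0 < A" using A by simp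
   define M where "M = (A / k) powr (1 / p)"
   have M: "0 < M" using A0 k by (simp add: M_def)
   have "M powr p = A / k" using A0 k p by (simp add: M_def powr_powr)
   then have AM: "A = k * M powr p" using k by simp
   have "M powr (1 - p) * M powr p = M" using M by (simp add: powr_add[symmetric])
   then have "M powr (1 - p) / p * A + (1 - 1 / p) * M * k = k * M / p + (1 - 1 / p) * M * k" unfolding AM by (simp add: mult_ac)
   also have "... = k * M" by (simp add: algebra_simps)
   finally have "norm (conv K f n) <= k * M" using bound[OF M] by simp
   then have "norm (conv K f n) powr p <= (k * M) powr p" using p by (intro powr_mono2) auto
   also have "... = k powr (p - 1) * A" using k M powr_add[of k "p - 1" 1] unfolding AM by (simp add: powr_mult)
   finally show ?thesis .
  qed
  then have "ennreal (norm (conv K f n) powr p) <= ennreal (k powr (p - 1)) * ennreal A" using A by (simp add: ennreal_mult[symmetric] ennreal_leI)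
  then show ?thesis by (simp only: A(1)[symmetric] I_def)
 qed
 have "Np p (conv K f) <= (\<integral>\<^sup>+n. ennreal (k powr (p - 1)) * (\<integral>\<^sup>+y. ennreal (norm (K (n - y))) * ennreal (norm (f y) powr p) \<partial>cs) \<partial>cs)"
  unfolding Np_def by (intro nn_integral_mono pt)
 also have "... = ennreal (k powr (p - 1)) * (\<integral>\<^sup>+n. \<integral>\<^sup>+y. ennreal (norm (K (n - y))) * ennreal (norm (f y) powr p) \<partial>cs \<partial>cs)"
  by (rule nn_integral_cmult) simp
 also have "(\<integral>\<^sup>+n. \<integral>\<^sup>+y. ennreal (norm (K (n - y))) * ennreal (norm (f y) powr p) \<partial>cs \<partial>cs)
   = (\<integral>\<^sup>+y. \<integral>\<^sup>+n. ennreal (norm (K (n - y))) * ennreal (norm (f y) powr p) \<partial>cs \<partial>cs)" by (rule cs_nn_swap) simp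
 also have "... = (\<integral>\<^sup>+y. (\<integral>\<^sup>+n. ennreal (norm (K n)) \<partial>cs) * ennreal (norm (f y) powr p) \<partial>cs)"
  by (intro nn_integral_cong) (subst nn_integral_multc, simp, simp only: nn_shift(2)[of "%n. ennreal (norm (K n))"])
 also have "... = (\<integral>\<^sup>+n. ennreal (norm (K n)) \<partial>cs) * Np p f" unfolding Np_def by (rule nn_integral_cmult) simp
 also have "ennreal (k powr (p - 1)) * ((\<integral>\<^sup>+n. ennreal (norm (K n)) \<partial>cs) * Np p f) <= ennreal (k powr (p - 1)) * (ennreal k * Np p f)"
  by (intro mult_left_mono mult_right_mono k) auto
 also have "... = ennreal (k powr p) * Np p f"
  using k powr_add[of k "p - 1" 1] by (simp add: ennreal_mult[symmetric] mult.assoc[symmetric])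
 finally have "Np p (conv K f) <= ennreal (k powr p) * Np p f" .
 then have "lpn p (conv K f) <= ennreal ((k powr p) powr (1 / p)) * lpn p f" by (rule lpn_le_of_Np) (use k p in auto)
 then show ?thesis using k p by (simp add: powr_powr)
qed

lemma conv_assoc:
 fixes K L f :: "int^'n => complex"
 assumes K: "integrable cs K" and L: "integrable cs L" and f: "!!n. norm (f n) <= M"
 shows "conv (conv K L) f n = conv K (conv L f) n"
proof -
 have M: "0 <= M" using f[of 0] norm_ge_zero order_trans by blast
 have "conv K (conv L f) n = (\<integral>w. \<integral>y. K (n - w) * L (w - y) * f y \<partial>cs \<partial>cs)"
  unfolding conv_def by (simp add: mult.assoc)
 also have "... = (\<integral>y. \<integral>w. K (n - w) * L (w - y) * f y \<partial>cs \<partial>cs)"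
 proof (rule cs_integral_swap(1))
  have "(\<integral>\<^sup>+w. \<integral>\<^sup>+y. ennreal (norm (K (n - w) * L (w - y) * f y)) \<partial>cs \<partial>cs)
   <= (\<integral>\<^sup>+w. \<integral>\<^sup>+y. ennreal (norm (K (n - w))) * (ennreal M * ennreal (norm (L (w - y)))) \<partial>cs \<partial>cs)"
  proof (intro nn_integral_mono)
   fix w y
   have "norm (K (n - w) * L (w - y) * f y) <= norm (K (n - w)) * (M * norm (L (w - y)))"
    unfolding norm_mult using f[of y] by (simp add: mult.assoc mult_left_mono mult.commute[of M])
   then show "ennreal (norm (K (n - w) * L (w - y) * f y)) <= ennreal (norm (K (n - w))) * (ennreal M * ennreal (norm (L (w - y))))"
    using M by (simp add: ennreal_mult3[symmetric] ennreal_leI)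
  qed
  also have "... = (\<integral>\<^sup>+w. ennreal (norm (K (n - w))) * (ennreal M * (\<integral>\<^sup>+y. ennreal (norm (L y)) \<partial>cs)) \<partial>cs)"
   using nn_shift(3)[of "%y. ennreal (norm (L y))"] by (simp add: nn_integral_cmult)
  also have "... = (\<integral>\<^sup>+w. ennreal (norm (K w)) \<partial>cs) * (ennreal M * (\<integral>\<^sup>+y. ennreal (norm (L y)) \<partial>cs))"
   using nn_shift(3)[of "%y. ennreal (norm (K y))"] by (simp add: nn_integral_multc)
  also have "... < \<infinity>" using K L by (simp add: integrable_cs_iff ennreal_mult_less_top)
  finally show "(\<integral>\<^sup>+w. \<integral>\<^sup>+y. ennreal (norm (K (n - w) * L (w - y) * f y)) \<partial>cs \<partial>cs) < \<infinity>" .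
 qed (auto intro: sigma_finite_measure_count_space)
 also have "... = (\<integral>y. conv K L (n - y) * f y \<partial>cs)"
 proof (rule Bochner_Integration.integral_cong)
  fix y
  have "(\<integral>w. K (n - w) * L (w - y) * f y \<partial>cs) = (\<integral>z. K (n - (z + y)) * L ((z + y) - y) * f y \<partial>cs)"
   by (rule integral_shift(1)[symmetric])
  also have "... = (\<integral>z. (K (n - y - z) * L z) * f y \<partial>cs)" by (simp add: algebra_simps)
  also have "... = conv K L (n - y) * f y" unfolding conv_def by (rule integral_mult_left_zero)
  finally show "(\<integral>w. K (n - w) * L (w - y) * f y \<partial>cs) = conv K L (n - y) * f y" .
 qed simp
 finally show ?thesis by (simp add: conv_def)
qed

section \<open>Discrete Riesz transforms\<close>

text \<open>
  The symbols \<open>(e + \<sigma>) powr (- 1 / 2)\<close> and \<open>(e + \<sigma>) powr (1 / 2)\<close>. The positive parameter makes the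
  kernels summable; all bounds that survive the limit are uniform in it.
\<close>

definition res :: "real => real^'n => complex" where "res e \<xi> = of_real ((e + sg \<xi>) powr (- 1 / 2))"
definition rt :: "real => real^'n => complex" where "rt e \<xi> = of_real ((e + sg \<xi>) powr (1 / 2))"
text \<open>
  The regularized Riesz transform in direction \<open>j\<close>.
\<close>

definition rz :: "'n => real => real^'n => complex" where "rz j e \<xi> = fd j \<xi> * res e \<xi>"

definition rint :: "real => real => real^'n => complex" where
 "rint e t \<xi> = of_real (exp (- (t * e)) * t powr (- 1 / 2)) * heat t \<xi>"

lemma rint_measurable: "case_prod (rint e) : borel_measurable (PM \<Otimes>\<^sub>M TM)"
 unfolding rint_def[abs_def] heat_def case_prod_beta by measurable

lemma rint_W: assumes "0 < t" shows "W (rint e t)" "an w (rint e t) = ennreal (exp (- (t * e)) * t powr (- 1 / 2)) * an w (heat t)"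
 unfolding rint_def[abs_def] using an_cmult[OF heat_W, of t w "of_real (exp (- (t * e)) * t powr (- 1 / 2))"] assms
 by (auto intro!: W_cmult heat_W simp: norm_mult)

lemma rint_integral:
 assumes "0 < e" shows "(\<integral>t. rint e t \<xi> \<partial>PM) = of_real gint * res e \<xi>"
proof -
 have p: "0 < e + sg \<xi>" using assms sg_nonneg[of \<xi>] by linarith
 have "(\<integral>t. rint e t \<xi> \<partial>PM) = (\<integral>t. complex_of_real (exp (- (t * (e + sg \<xi>))) * t powr (- 1 / 2)) \<partial>PM)"
  by (intro Bochner_Integration.integral_cong refl) (simp add: rint_def heat_def distrib_left exp_add[symmetric] mult_ac flip: of_real_mult)
 also have "... = of_real (gint * (e + sg \<xi>) powr (- 1 / 2))"
  by (subst integral_complex_of_real) (simp only: gint_scale(1)[OF p])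
 finally show ?thesis by (simp add: res_def)
qed

lemma nn_rint: assumes "0 < e" shows "(\<integral>\<^sup>+t. ennreal (exp (- (t * e)) * t powr (- 1 / 2)) \<partial>PM) = ennreal (gint * e powr (- 1 / 2))"
 using nn_integral_eq_integral[OF gint_scale(2)[OF assms]] gint_scale(1)[OF assms] by simp

lemma res_W:
 assumes e: "0 < e" shows "W (res e :: real^'n => complex)" "an1 (res e :: real^'n => complex) <= ennreal (e powr (- 1 / 2))"
proof -
 have le: "(\<integral>\<^sup>+t. an1 (rint e t :: real^'n => complex) \<partial>PM) <= ennreal (gint * e powr (- 1 / 2))"
 proof -
  have "(\<integral>\<^sup>+t. an1 (rint e t :: real^'n => complex) \<partial>PM) <= (\<integral>\<^sup>+t. ennreal (exp (- (t * e)) * t powr (- 1 / 2)) \<partial>PM)"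
  proof (rule nn_integral_mono)
   fix t assume "t : space PM"
   then have t: "0 < t" by simp
   have "an1 (rint e t :: real^'n => complex) <= ennreal (exp (- (t * e)) * t powr (- 1 / 2)) * 1"
    unfolding rint_W(2)[OF t] using t by (intro mult_left_mono heat_an1) auto
   then show "an1 (rint e t :: real^'n => complex) <= ennreal (exp (- (t * e)) * t powr (- 1 / 2))" by simp
  qed
  then show ?thesis by (simp only: nn_rint[OF e])
 qed
 then have fin: "(\<integral>\<^sup>+t. an1 (rint e t :: real^'n => complex) \<partial>PM) < \<infinity>" by (rule le_less_trans) simp
 have Wr: "!!t. t : space PM ==> W (rint e t :: real^'n => complex)" by (rule rint_W) simp
 note I = W_integral[OF PM_sigma_finite rint_measurable Wr fin]
 have e2: "res e = (%\<xi>::real^'n. of_real (1 / gint) * (\<integral>t. rint e t \<xi> \<partial>PM))"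
  using gint_pos by (simp add: rint_integral[OF e] fun_eq_iff)
 have W1: "W (%\<xi>::real^'n. \<integral>t. rint e t \<xi> \<partial>PM)" by (rule I(1))
 show "W (res e :: real^'n => complex)" unfolding e2 by (rule W_cmult[OF W1])
 have "an1 (%\<xi>::real^'n. of_real (1 / gint) * (\<integral>t. rint e t \<xi> \<partial>PM)) = ennreal (1 / gint) * an1 (%\<xi>::real^'n. \<integral>t. rint e t \<xi> \<partial>PM)"
  using an_cmult[OF W1, of "%_. 1" "of_real (1 / gint)"] gint_pos by (simp only: norm_of_real) simp
 also have "... <= ennreal (1 / gint) * ennreal (gint * e powr (- 1 / 2))"
  by (intro mult_left_mono order_trans[OF I(2) le]) auto
 also have "... = ennreal (e powr (- 1 / 2))" using gint_pos by (simp add: ennreal_mult[symmetric])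
 finally show "an1 (res e :: real^'n => complex) <= ennreal (e powr (- 1 / 2))" unfolding e2[symmetric] .
qed

lemma pint_scale_integrable:
 assumes "0 < s" "0 < \<alpha>" "\<alpha> < 1" shows "integrable PM (%t. (1 - exp (- (t * s))) * t powr (- 1 - \<alpha>))"
proof (rule ccontr)
 assume "~ ?thesis"
 then have "pint \<alpha> * s powr \<alpha> = 0" unfolding pint_scale[OF assms(1), symmetric] by (rule not_integrable_integral_eq)
 then show False using pint_pos[OF assms(2,3)] assms by simp
qed

text \<open>
  The regularized root differs from \<open>\<sigma> powr (1 / 2)\<close> by a kernel of norm at most the root of the
  parameter, so the regularization disappears in the limit on every \<open>L\<^sup>p\<close>.
\<close>

lemma rt_W:
 assumes e: "0 < e"
 shows "W (%\<xi>::real^'n. rt e \<xi> - rt 0 \<xi>)" "an1 (%\<xi>::real^'n. rt e \<xi> - rt 0 \<xi>) <= ennreal (e powr (1 / 2))"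
proof -
 let ?c = "%t. (1 - exp (- (t * e))) * t powr (- 1 - 1 / 2)"
 define F where "F t \<xi> = of_real (?c t) * heat t \<xi>" for t and \<xi> :: "real^'n"
 have c0: "0 <= ?c t" if "0 < t" for t using that e by simp
 have P: "0 < pint (1 / 2)" by (rule pint_pos) auto
 have meas: "case_prod F : borel_measurable (PM \<Otimes>\<^sub>M TM)"
  unfolding F_def[abs_def] heat_def case_prod_beta by measurable
 have WF: "W (F t)" if "t : space PM" for t using that unfolding F_def[abs_def] by (intro W_cmult heat_W) auto
 have le: "(\<integral>\<^sup>+t. an1 (F t) \<partial>PM) <= ennreal (pint (1 / 2) * e powr (1 / 2))"
 proof -
  have "(\<integral>\<^sup>+t. an1 (F t) \<partial>PM) <= (\<integral>\<^sup>+t. ennreal (?c t) \<partial>PM)"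
  proof (rule nn_integral_mono)
   fix t assume "t : space PM"
   then have t: "0 < t" by simp
   have "an1 (F t) = ennreal (norm (complex_of_real (?c t))) * an1 (heat t :: real^'n => complex)"
    unfolding F_def[abs_def] using t by (intro an_cmult heat_W) auto
   also have "... <= ennreal (?c t) * 1" using t c0[OF t] by (intro mult_mono heat_an1) (simp_all only: norm_of_real abs_of_nonneg order_refl zero_le less_imp_le)
   finally show "an1 (F t) <= ennreal (?c t)" by simp
  qed
  also have "... = ennreal (\<integral>t. ?c t \<partial>PM)"
   by (rule nn_integral_eq_integral[OF pint_scale_integrable[OF e]]) (use c0 in \<open>auto intro!: AE_I2\<close>)
  finally show ?thesis by (simp only: pint_scale[OF e])
 qed
 then have fin: "(\<integral>\<^sup>+t. an1 (F t) \<partial>PM) < \<infinity>" by (rule le_less_trans) simp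
 note I = W_integral[OF PM_sigma_finite meas WF fin]
 have W1: "W (%\<xi>. \<integral>t. F t \<xi> \<partial>PM)" by (rule I(1))
 have eq: "of_real (1 / pint (1 / 2)) * (\<integral>t. F t \<xi> \<partial>PM) = rt e \<xi> - rt 0 \<xi>" if \<xi>: "\<xi> : pbox" for \<xi>
 proof -
  have s: "0 < sg \<xi>" "0 < e + sg \<xi>" using sg_pos[OF \<xi>] e by auto
  have "(\<integral>t. F t \<xi> \<partial>PM) = (\<integral>t. complex_of_real ((1 - exp (- (t * (e + sg \<xi>)))) * t powr (- 1 - 1 / 2) - (1 - exp (- (t * sg \<xi>))) * t powr (- 1 - 1 / 2)) \<partial>PM)"
  proof (intro Bochner_Integration.integral_cong refl)
   fix t
   have "exp (- (t * (e + sg \<xi>))) = exp (- (t * e)) * exp (- (t * sg \<xi>))" by (simp add: distrib_left exp_add[symmetric])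
   then show "F t \<xi> = complex_of_real ((1 - exp (- (t * (e + sg \<xi>)))) * t powr (- 1 - 1 / 2) - (1 - exp (- (t * sg \<xi>))) * t powr (- 1 - 1 / 2))"
    unfolding F_def heat_def of_real_mult[symmetric] of_real_eq_iff by (simp add: algebra_simps)
  qed
  also have "... = of_real (pint (1 / 2) * (e + sg \<xi>) powr (1 / 2) - pint (1 / 2) * sg \<xi> powr (1 / 2))"
  proof -
   have i: "integrable PM (%t. (1 - exp (- (t * (e + sg \<xi>)))) * t powr (- 1 - 1 / 2))" "integrable PM (%t. (1 - exp (- (t * sg \<xi>))) * t powr (- 1 - 1 / 2))"
    by (rule pint_scale_integrable[OF s(2)], simp, simp) (rule pint_scale_integrable[OF s(1)], simp, simp)
   show ?thesis
    by (subst integral_complex_of_real) (simp only: Bochner_Integration.integral_diff[OF i] pint_scale[OF s(1)] pint_scale[OF s(2)])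
  qed
  finally show ?thesis using P by (simp add: rt_def right_diff_distrib[symmetric])
 qed
 show "W (%\<xi>::real^'n. rt e \<xi> - rt 0 \<xi>)" by (rule W_congI[OF W_cmult[OF W1] eq])
 have "an1 (%\<xi>::real^'n. rt e \<xi> - rt 0 \<xi>) = an1 (%\<xi>. of_real (1 / pint (1 / 2)) * (\<integral>t. F t \<xi> \<partial>PM))"
  by (rule an_cong) (simp only: eq)
 also have "... = ennreal (1 / pint (1 / 2)) * an1 (%\<xi>. \<integral>t. F t \<xi> \<partial>PM)"
  using an_cmult[OF W1, of "%_. 1" "of_real (1 / pint (1 / 2))"] P by (simp only: norm_of_real) simp
 also have "... <= ennreal (1 / pint (1 / 2)) * ennreal (pint (1 / 2) * e powr (1 / 2))"
  by (intro mult_left_mono order_trans[OF I(2) le]) auto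
 also have "... = ennreal (e powr (1 / 2))" using P by (simp add: ennreal_mult[symmetric])
 finally show "an1 (%\<xi>::real^'n. rt e \<xi> - rt 0 \<xi>) <= ennreal (e powr (1 / 2))" .
qed

lemma rt0_W: "W (rt 0 :: real^'n => complex)"
 using W_sg_powr[of "1 / 2"] unfolding rt_def[abs_def] by simp

lemma rt_e_W: assumes "0 < e" shows "W (rt e :: real^'n => complex)"
 using W_add[OF rt_W(1)[OF assms] rt0_W] by simp

lemma rz_W: "0 < e ==> W (rz j e)"
 unfolding rz_def[abs_def] by (intro W_mult fd_W res_W)

lemma fd_cnj: "fd j (- \<xi>) = cnj (fd j \<xi>)" by (simp add: fd_def cis_cnj)

lemma fd_mult_cnj: "cnj (fd j \<xi>) * fd j \<xi> = of_real (s1 (\<xi> $ j))"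
proof -
 have "(sin x)\<^sup>2 + (cos x)\<^sup>2 = 1" for x :: real by simp
 then show ?thesis by (simp add: fd_def s1_alt complex_eq_iff power2_eq_square algebra_simps)
qed

lemma rz_le_1: assumes e: "0 < e" shows "norm (rz j e \<xi>) <= 1"
proof -
 have p: "0 < e + sg \<xi>" using e sg_nonneg[of \<xi>] by linarith
 have "(norm (fd j \<xi>))\<^sup>2 = s1 (\<xi> $ j)"
  using fd_mult_cnj[of j \<xi>] complex_norm_square[of "fd j \<xi>"] by (metis mult.commute of_real_eq_iff)
 also have "... <= sg \<xi>" unfolding sg_def by (rule member_le_sum) auto
 also have "... <= ((e + sg \<xi>) powr (1 / 2))\<^sup>2" using p e by (simp add: powr_half_sqrt)
 finally have "norm (fd j \<xi>) <= (e + sg \<xi>) powr (1 / 2)" by (rule power2_le_imp_le) simp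
 then have "norm (fd j \<xi>) * (e + sg \<xi>) powr (- 1 / 2) <= (e + sg \<xi>) powr (1 / 2) * (e + sg \<xi>) powr (- 1 / 2)"
  by (rule mult_right_mono) simp
 also have "... = 1" using p by (simp add: powr_add[symmetric])
 finally show ?thesis by (simp add: rz_def res_def norm_mult)
qed

lemma rz_rt: assumes e: "0 < e" shows "rz j e \<xi> * rt e \<xi> = fd j \<xi>"
proof -
 have p: "0 < e + sg \<xi>" using e sg_nonneg[of \<xi>] by linarith
 have "(e + sg \<xi>) powr (- 1 / 2) * (e + sg \<xi>) powr (1 / 2) = 1" using p by (simp add: powr_add[symmetric])
 then have "res e \<xi> * rt e \<xi> = 1" unfolding res_def rt_def of_real_mult[symmetric] by simp
 then show ?thesis by (simp add: rz_def mult.assoc)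
qed

lemma sg_minus: "sg (- \<xi>) = sg \<xi>" by (simp add: sg_def s1_alt)

text \<open>
  Because \<open>\<sigma>\<close> is the sum of the \<open>\<bar>fd j\<bar>\<^sup>2\<close>, the root is recovered from the differences by the
  reflected Riesz transforms.
\<close>

lemma rt_split: assumes e: "0 < e" shows "rt e \<xi> = (\<Sum>j\<in>UNIV. rz j e (- \<xi>) * fd j \<xi>) + of_real e * res e \<xi>"
proof -
 have p: "0 < e + sg \<xi>" using e sg_nonneg[of \<xi>] by linarith
 have "(\<Sum>j\<in>UNIV. rz j e (- \<xi>) * fd j \<xi>) = (\<Sum>j\<in>UNIV. of_real (s1 (\<xi> $ j)) * res e \<xi>)"
 proof (rule sum.cong)
  fix j
  have "rz j e (- \<xi>) * fd j \<xi> = (cnj (fd j \<xi>) * fd j \<xi>) * res e \<xi>" by (simp add: rz_def res_def sg_minus fd_cnj)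
  then show "rz j e (- \<xi>) * fd j \<xi> = of_real (s1 (\<xi> $ j)) * res e \<xi>" by (simp only: fd_mult_cnj)
 qed simp
 also have "... = of_real (sg \<xi>) * res e \<xi>" by (simp add: sg_def sum_distrib_right)
 finally have "(\<Sum>j\<in>UNIV. rz j e (- \<xi>) * fd j \<xi>) + of_real e * res e \<xi> = of_real ((e + sg \<xi>) * (e + sg \<xi>) powr (- 1 / 2))"
  by (simp add: res_def algebra_simps)
 also have "(e + sg \<xi>) * (e + sg \<xi>) powr (- 1 / 2) = (e + sg \<xi>) powr (1 / 2)" using p powr_add[of "e + sg \<xi>" 1 "- 1 / 2"] by simp
 finally show ?thesis by (simp add: rt_def)
qed

definition far :: "real => int^'n => ennreal" where
 "far R n = (if R\<^sup>2 <= (\<Sum>i\<in>UNIV. (of_int (n $ i))\<^sup>2) then 1 else 0)"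

lemma an_far_le:
 assumes "0 < R" shows "an (far R) F <= an1 F" "an (far R) F <= ennreal (1 / R\<^sup>2) * an2 F"
proof -
 show "an (far R) F <= an1 F" unfolding an_def by (rule nn_integral_mono) (simp add: far_def)
 have "far R n <= ennreal (1 / R\<^sup>2) * sqw n" for n :: "int^'a"
 proof (cases "R\<^sup>2 <= (\<Sum>i\<in>UNIV. (of_int (n $ i))\<^sup>2)")
  case True
  then have "1 <= 1 / R\<^sup>2 * (\<Sum>i\<in>UNIV. (of_int (n $ i))\<^sup>2)" using assms by (simp add: field_simps)
  then have "ennreal 1 <= ennreal (1 / R\<^sup>2 * (\<Sum>i\<in>UNIV. (of_int (n $ i))\<^sup>2))" by (rule ennreal_leI)
  also have "... = ennreal (1 / R\<^sup>2) * sqw n" unfolding sqw_def by (rule ennreal_mult) (auto intro: sum_nonneg)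
  finally show ?thesis using True by (simp add: far_def)
 qed (simp add: far_def)
 then have "an (far R) F <= (\<integral>\<^sup>+n. ennreal (1 / R\<^sup>2) * (sqw n * ennreal (norm (ker F n))) \<partial>cs)"
  unfolding an_def by (intro nn_integral_mono) (simp add: mult.assoc[symmetric] mult_right_mono)
 also have "... = ennreal (1 / R\<^sup>2) * an2 F" unfolding an_def by (simp add: nn_integral_cmult)
 finally show "an (far R) F <= ennreal (1 / R\<^sup>2) * an2 F" .
qed

text \<open>
  The inverse root is an integral of heat kernels over \<open>t\<close>. Below \<open>t = R\<^sup>2\<close> the second moment
  controls the far part of the kernel, above it the total mass does; both contributions are of order
  \<open>1 / R\<close>.
\<close>

lemma fd_rz_far: "\<exists>D\<ge>0. \<forall>e>0. ALL j k. \<forall>R>0. an (far R) (%\<xi>::real^'n. fd k \<xi> * rz j e \<xi>) <= ennreal (D / R)"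
proof -
 define P where "P j k c \<longleftrightarrow> 0 <= c & (\<forall>t>0. W (%\<xi>::real^'n. fd k \<xi> * (fd j \<xi> * heat t \<xi>)) & an1 (%\<xi>::real^'n. fd k \<xi> * (fd j \<xi> * heat t \<xi>)) <= ennreal (2 / t)
  & an2 (%\<xi>::real^'n. fd k \<xi> * (fd j \<xi> * heat t \<xi>)) <= ennreal c)" for j k :: 'n and c
 have ex: "EX c. P j k c" for j k unfolding P_def using fd_fd_heat[of k j] by blast
 define C where "C j k = (SOME c. P j k c)" for j k
 have PC: "P j k (C j k)" for j k unfolding C_def by (rule someI_ex[OF ex])
 have C0: "0 <= C j k" for j k using PC[of j k] unfolding P_def by blast
 have C: "!!j k t. 0 < t ==> W (%\<xi>::real^'n. fd k \<xi> * (fd j \<xi> * heat t \<xi>))"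
  "!!j k t. 0 < t ==> an1 (%\<xi>::real^'n. fd k \<xi> * (fd j \<xi> * heat t \<xi>)) <= ennreal (2 / t)"
  "!!j k t. 0 < t ==> an2 (%\<xi>::real^'n. fd k \<xi> * (fd j \<xi> * heat t \<xi>)) <= ennreal (C j k)"
  using PC unfolding P_def by blast+
 define E where "E = (\<Sum>j\<in>UNIV. \<Sum>k\<in>UNIV. C j k)"
 have CE: "C j k <= E" for j k
 proof -
  have "C j k <= (\<Sum>k\<in>UNIV. C j k)" by (rule member_le_sum) (auto simp: C0)
  also have "... <= E" unfolding E_def by (rule member_le_sum) (auto intro: sum_nonneg C0)
  finally show ?thesis .
 qed
 have E0: "0 <= E" unfolding E_def by (intro sum_nonneg C0)
 show ?thesis
 proof (intro exI[of _ "(2 * E + 4) / gint"] conjI allI impI)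
  show "0 <= (2 * E + 4) / gint" using E0 gint_pos by simp
  fix e R :: real and j k :: 'n assume e: "0 < e" and R: "0 < R"
  let ?c = "%t. exp (- (t * e)) * t powr (- 1 / 2)"
  define H where "H t \<xi> = fd k \<xi> * (fd j \<xi> * heat t \<xi>)" for t and \<xi> :: "real^'n"
  define F where "F t \<xi> = of_real (?c t) * H t \<xi>" for t and \<xi> :: "real^'n"
  have HW: "W (H t)" if "0 < t" for t unfolding H_def[abs_def] by (rule C(1)[OF that])
  have FW: "W (F t)" if "0 < t" for t unfolding F_def[abs_def] by (rule W_cmult[OF HW[OF that]])
  have Fan: "an w (F t) = ennreal (?c t) * an w (H t)" if "0 < t" for t w
   unfolding F_def[abs_def] by (subst an_cmult[OF HW[OF that]]) (simp add: norm_mult)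
  have fdm: "fd i : borel_measurable borel" for i :: 'n unfolding fd_def cis_conv_exp by measurable
  have meas: "case_prod F : borel_measurable (PM \<Otimes>\<^sub>M TM)"
   using measurable_compose[OF snd_TM fdm]
   unfolding F_def[abs_def] H_def heat_def case_prod_beta by measurable
  have H4: "an1 (H t) <= ennreal 4" if "0 < t" for t
  proof -
   have "an1 (%\<xi>. fd j \<xi> * heat t \<xi>) <= ennreal (2 * 1)"
    by (rule W_mult_bounds(1)[OF fd_W heat_W fd_an1]) (use that heat_an1[of t] in auto)
   then have "an1 (%\<xi>. fd k \<xi> * (fd j \<xi> * heat t \<xi>)) <= ennreal (2 * 2)"
    by (intro W_mult_bounds(1)[OF fd_W W_mult[OF fd_W heat_W] fd_an1]) (use that in auto)
   then show ?thesis by (simp add: H_def[abs_def])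
  qed
  have "(\<integral>\<^sup>+t. an1 (F t) \<partial>PM) <= (\<integral>\<^sup>+t. ennreal (?c t) * ennreal 4 \<partial>PM)"
  proof (rule nn_integral_mono)
   fix t assume "t : space PM"
   then have t: "0 < t" by simp
   show "an1 (F t) <= ennreal (?c t) * ennreal 4" unfolding Fan[OF t] by (rule mult_left_mono[OF H4[OF t]]) simp
  qed
  also have "... = ennreal (gint * e powr (- 1 / 2)) * ennreal 4"
   unfolding nn_rint[OF e, symmetric] by (rule nn_integral_multc) (auto intro!: PM_borel)
  also have "... < \<infinity>" by (simp add: ennreal_mult_less_top)
  finally have fin: "(\<integral>\<^sup>+t. an1 (F t) \<partial>PM) < \<infinity>" .
  have FWs: "!!t. t : space PM ==> W (F t)" using FW by simp
  note I = W_integral[OF PM_sigma_finite meas FWs fin]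
  have W1: "W (%\<xi>. \<integral>t. F t \<xi> \<partial>PM)" by (rule I(1))
  have eq: "(%\<xi>. fd k \<xi> * rz j e \<xi>) = (%\<xi>. of_real (1 / gint) * (\<integral>t. F t \<xi> \<partial>PM))"
  proof
   fix \<xi> :: "real^'n"
   have "(\<integral>t. F t \<xi> \<partial>PM) = (\<integral>t. (fd k \<xi> * fd j \<xi>) * rint e t \<xi> \<partial>PM)"
    by (intro Bochner_Integration.integral_cong refl) (simp add: F_def H_def rint_def mult_ac)
   also have "... = (fd k \<xi> * fd j \<xi>) * (of_real gint * res e \<xi>)" by (simp add: rint_integral[OF e])
   finally show "fd k \<xi> * rz j e \<xi> = of_real (1 / gint) * (\<integral>t. F t \<xi> \<partial>PM)" using gint_pos by (simp add: rz_def)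
  qed
  let ?A = "%t. ennreal (t powr (1 / 2 - 1)) * indicator {..<R\<^sup>2} t"
  let ?B = "%t. ennreal (t powr (3 / 2 - 3)) * indicator {R\<^sup>2..} t"
  have m: "?A : borel_measurable PM" "?B : borel_measurable PM" by (auto intro!: PM_borel)
  have pt: "an (far R) (F t) <= ennreal (E / R\<^sup>2) * ?A t + ennreal 2 * ?B t" if t: "0 < t" for t
  proof -
   have ct: "?c t <= t powr (- 1 / 2)" using mult_right_mono[of "exp (- (t * e))" 1 "t powr (- 1 / 2)"] t e by simp
   show ?thesis
   proof (cases "t < R\<^sup>2")
    case True
    have "an2 (H t) <= ennreal E"
     unfolding H_def[abs_def] by (rule order_trans[OF C(3)[OF t] ennreal_leI[OF CE]])
    then have "an (far R) (H t) <= ennreal (1 / R\<^sup>2) * ennreal E"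
     by (rule order_trans[OF an_far_le(2)[OF R] mult_left_mono]) simp
    then have "an (far R) (F t) <= ennreal (t powr (- 1 / 2)) * (ennreal (1 / R\<^sup>2) * ennreal E)"
     unfolding Fan[OF t] by (rule mult_mono[OF ennreal_leI[OF ct]]) simp_all
    also have "... = ennreal (E / R\<^sup>2) * ennreal (t powr (- 1 / 2))"
    proof -
     have "E / R\<^sup>2 = 1 / R\<^sup>2 * E" by simp
     then have "ennreal (E / R\<^sup>2) = ennreal (1 / R\<^sup>2) * ennreal E" using E0 by (simp only:) (rule ennreal_mult, auto)
     then show ?thesis by (simp only: mult.commute)
    qed
    finally show ?thesis using True by simp
   next
    case False
    have "an (far R) (H t) <= ennreal (2 / t)"
     by (rule order_trans[OF an_far_le(1)[OF R]]) (use C(2)[OF t, of k j] in \<open>simp add: H_def[abs_def]\<close>)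
    then have "an (far R) (F t) <= ennreal (t powr (- 1 / 2)) * ennreal (2 / t)"
     unfolding Fan[OF t] by (rule mult_mono[OF ennreal_leI[OF ct]]) simp_all
    also have "... = ennreal (2 * t powr (- 3 / 2))"
    proof -
     have e: "2 * t powr (- 3 / 2) = t powr (- 1 / 2) * (2 / t)" using t powr_diff[of t "- 1 / 2" 1] by simp
     show ?thesis unfolding e by (rule ennreal_mult[symmetric]) (use t in auto)
    qed
    also have "... = ennreal 2 * ennreal (t powr (- 3 / 2))" by (rule ennreal_mult) auto
    finally show ?thesis using False by simp
   qed
  qed
  have "an (far R) (%\<xi>. fd k \<xi> * rz j e \<xi>) = ennreal (1 / gint) * an (far R) (%\<xi>. \<integral>t. F t \<xi> \<partial>PM)"
   unfolding eq by (subst an_cmult[OF W1]) (use gint_pos in \<open>simp only: norm_of_real\<close>, simp)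
  also have "... <= ennreal (1 / gint) * (\<integral>\<^sup>+t. an (far R) (F t) \<partial>PM)" by (rule mult_left_mono[OF I(2) zero_le])
  also have "... <= ennreal (1 / gint) * (\<integral>\<^sup>+t. ennreal (E / R\<^sup>2) * ?A t + ennreal 2 * ?B t \<partial>PM)"
   by (intro mult_left_mono nn_integral_mono pt) auto
  also have "(\<integral>\<^sup>+t. ennreal (E / R\<^sup>2) * ?A t + ennreal 2 * ?B t \<partial>PM) = ennreal (E / R\<^sup>2) * (\<integral>\<^sup>+t. ?A t \<partial>PM) + ennreal 2 * (\<integral>\<^sup>+t. ?B t \<partial>PM)"
   using m by (subst nn_integral_add) (auto simp: nn_integral_cmult)
  also have "... = ennreal (E / R\<^sup>2) * ennreal (2 * R) + ennreal 2 * ennreal (2 / R)"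
  proof -
   have 1: "(\<integral>\<^sup>+t. ?A t \<partial>PM) = ennreal (2 * R)"
    using R by (subst nn_integral_PM_below) (auto simp: powr_half_sqrt)
   have 2: "(\<integral>\<^sup>+t. ?B t \<partial>PM) = ennreal (2 / R)"
   proof -
    have "(R\<^sup>2) powr (- (1 / 2)) = 1 / R" using R by (simp add: powr_minus_divide powr_half_sqrt)
    then have e: "(R\<^sup>2) powr (3 / 2 - 2) / (2 - 3 / 2) = 2 / R" by simp
    show ?thesis unfolding e[symmetric] by (rule nn_integral_PM_above) (use R in auto)
   qed
   show ?thesis by (simp only: 1 2)
  qed
  also have "... = ennreal ((2 * E + 4) / R)"
  proof -
   have "ennreal (E / R\<^sup>2) * ennreal (2 * R) + ennreal 2 * ennreal (2 / R) = ennreal (E / R\<^sup>2 * (2 * R) + 2 * (2 / R))"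
    by (rule ennreal_comb[symmetric]) (use E0 R in auto)
   also have "E / R\<^sup>2 * (2 * R) + 2 * (2 / R) = (2 * E + 4) / R" using R by (simp add: field_simps power2_eq_square)
   finally show ?thesis .
  qed
  also have "ennreal (1 / gint) * ennreal ((2 * E + 4) / R) = ennreal ((2 * E + 4) / gint / R)"
  proof -
   have e: "(2 * E + 4) / gint / R = 1 / gint * ((2 * E + 4) / R)" by simp
   show ?thesis unfolding e by (rule ennreal_mult[symmetric]) (use gint_pos E0 R in auto)
  qed
  finally show "an (far R) (%\<xi>. fd k \<xi> * rz j e \<xi>) <= ennreal ((2 * E + 4) / gint / R)" .
 qed
qed

lemma integrable_TM_chr: "integrable TM G ==> integrable TM (%\<xi>. G \<xi> * chr n \<xi>)"
 by (rule Bochner_Integration.integrable_bound[of TM G]) (auto simp: norm_mult)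

lemma W_integrable: assumes "W F" shows "integrable TM F"
proof (rule TM.integrable_const_bound[where B = "enn2real (an1 F)"])
 have "norm (F \<xi>) <= enn2real (an1 F)" if "\<xi> : pbox" for \<xi>
  using W_norm_le[OF assms that] W_an1[OF assms] by (cases "an1 F") auto
 then show "AE \<xi> in TM. norm (F \<xi>) <= enn2real (an1 F)" by (intro AE_I2) simp
qed (rule W_measurable[OF assms])

lemma ker_fd: assumes "integrable TM G" shows "ker (%\<xi>. fd k \<xi> * G \<xi>) n = ker G (n + axis k 1) - ker G n"
proof -
 have "fd k \<xi> * G \<xi> * chr (- n) \<xi> = G \<xi> * chr (- (n + axis k 1)) \<xi> - G \<xi> * chr (- n) \<xi>" for \<xi>
 proof -
  have "- (n + axis k 1) = axis k (- 1) + (- n)" by (simp add: vec_eq_iff axis_def)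
  then have "chr (- (n + axis k 1)) \<xi> = chr (axis k (- 1)) \<xi> * chr (- n) \<xi>" by (simp only: chr_add)
  then show ?thesis by (simp add: fd_chr algebra_simps)
 qed
 then have "(\<integral>\<xi>. fd k \<xi> * G \<xi> * chr (- n) \<xi> \<partial>TM) = (\<integral>\<xi>. G \<xi> * chr (- (n + axis k 1)) \<xi> \<partial>TM) - (\<integral>\<xi>. G \<xi> * chr (- n) \<xi> \<partial>TM)"
  by (simp add: Bochner_Integration.integral_diff integrable_TM_chr[OF assms])
 then show ?thesis by (simp add: ker_def diff_divide_distrib)
qed

text \<open>
  A translation by \<open>v\<close> is a chain of at most \<open>d r\<close> unit steps, each of which costs the differenced
  kernel beyond distance \<open>r\<close>, of size \<open>1 / r\<close>.
\<close>

lemma rz_hoermander: "\<exists>B\<ge>0. \<forall>e>0. ALL j. hoermander B (ker (rz j e :: real^'n => complex))"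
proof -
 obtain D where D0: "0 <= D" and D: "!!e j k R. 0 < e ==> 0 < R ==> an (far R) (%\<xi>::real^'n. fd k \<xi> * rz j e \<xi>) <= ennreal (D / R)"
  using fd_rz_far by blast
 show ?thesis
 proof (intro exI[of _ "CARD('n) * D"] conjI allI impI)
  show "0 <= CARD('n) * D" using D0 by simp
  fix e :: real and j :: 'n assume e: "0 < e"
  define K where "K = ker (rz j e :: real^'n => complex)"
  have Ki: "integrable TM (rz j e)" by (rule W_integrable[OF rz_W[OF e]])
  show "hoermander (CARD('n) * D) (ker (rz j e :: real^'n => complex))"
   unfolding hoermander_def K_def[symmetric]
  proof (intro allI impI)
   fix r :: nat and v :: "int^'n" assume r: "1 <= r" and v: "ALL i. \<bar>v $ i\<bar> <= int r"
   let ?I = "indicator {z. EX i. 2 * int r < \<bar>z $ i\<bar>} :: int^'n => ennreal"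
   let ?N = "%v. \<integral>\<^sup>+z. ennreal (norm (K (z - v) - K z)) * ?I z \<partial>cs"
   let ?l = "%v::int^'n. \<Sum>i\<in>UNIV. nat \<bar>v $ i\<bar>"
   have far: "?I z <= far (real r) (z - v)" if v: "ALL i. \<bar>v $ i\<bar> <= int r" for z v
   proof (cases "EX i. 2 * int r < \<bar>z $ i\<bar>")
    case True
    then obtain i where "2 * int r < \<bar>z $ i\<bar>" by blast
    moreover have "\<bar>v $ i\<bar> <= int r" using v by blast
    moreover have "(z - v) $ i = z $ i - v $ i" by simp
    ultimately have "int r <= \<bar>(z - v) $ i\<bar>" by linarith
    then have "real r <= \<bar>real_of_int ((z - v) $ i)\<bar>" by linarith
    then have "(real r)\<^sup>2 <= \<bar>real_of_int ((z - v) $ i)\<bar>\<^sup>2" by (intro power_mono) auto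
    also have "... = (real_of_int ((z - v) $ i))\<^sup>2" by (rule power2_abs)
    also have "... <= (\<Sum>i\<in>UNIV. (real_of_int ((z - v) $ i))\<^sup>2)" by (rule member_le_sum) auto
    finally show ?thesis by (simp add: far_def indicator_def)
   qed simp
   have unit: "(\<integral>\<^sup>+z. ennreal (norm (K (z - v + axis k 1) - K (z - v))) * ?I z \<partial>cs) <= ennreal (D / r)"
    if v: "ALL i. \<bar>v $ i\<bar> <= int r" for v k
   proof -
    let ?G = "%n. far (real r) n * ennreal (norm (ker (%\<xi>. fd k \<xi> * rz j e \<xi>) n))"
    have "(\<integral>\<^sup>+z. ennreal (norm (K (z - v + axis k 1) - K (z - v))) * ?I z \<partial>cs) <= (\<integral>\<^sup>+z. ?G (z - v) \<partial>cs)"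
    proof (rule nn_integral_mono)
     fix z
     have "K (z - v + axis k 1) - K (z - v) = ker (%\<xi>. fd k \<xi> * rz j e \<xi>) (z - v)" unfolding K_def by (rule ker_fd[OF Ki, symmetric])
     then show "ennreal (norm (K (z - v + axis k 1) - K (z - v))) * ?I z <= ?G (z - v)"
      using mult_left_mono[OF far[OF v], of "ennreal (norm (ker (%\<xi>. fd k \<xi> * rz j e \<xi>) (z - v)))" z] by (simp add: mult.commute)
    qed
    also have "... = an (far (real r)) (%\<xi>. fd k \<xi> * rz j e \<xi>)" unfolding an_def by (rule nn_shift(2))
    also have "... <= ennreal (D / r)" by (rule D) (use e r in auto)
    finally show ?thesis .
   qed
   have ind: "(ALL i. \<bar>v $ i\<bar> <= int r) ==> ?l v = m ==> ?N v <= ennreal (m * (D / r))" for m v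
   proof (induction m arbitrary: v)
    case 0
    then have "v = 0" by (simp add: vec_eq_iff)
    then show ?case by simp
   next
    case (Suc m)
    obtain k where k: "v $ k ~= 0"
    proof (cases "ALL k. v $ k = 0")
     case True then show ?thesis using Suc.prems(2) by simp
    qed (use that in blast)
    define v' where "v' = v - axis k (sgn (v $ k))"
    have v'i: "v' $ i = (if i = k then v $ k - sgn (v $ k) else v $ i)" for i by (simp add: v'_def axis_def)
    have "\<bar>v $ k - sgn (v $ k)\<bar> <= \<bar>v $ k\<bar>" using k by (cases "0 < v $ k") auto
    then have "\<bar>v $ k - sgn (v $ k)\<bar> <= int r" using Suc.prems(1) order_trans by blast
    then have v'r: "ALL i. \<bar>v' $ i\<bar> <= int r" using Suc.prems(1) by (simp add: v'i)
    have "?l v = nat \<bar>v $ k\<bar> + (\<Sum>i\<in>UNIV - {k}. nat \<bar>v $ i\<bar>)" by (rule sum.remove) auto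
    moreover have "?l v' = nat \<bar>v' $ k\<bar> + (\<Sum>i\<in>UNIV - {k}. nat \<bar>v' $ i\<bar>)" by (rule sum.remove) auto
    moreover have "(\<Sum>i\<in>UNIV - {k}. nat \<bar>v' $ i\<bar>) = (\<Sum>i\<in>UNIV - {k}. nat \<bar>v $ i\<bar>)" by (rule sum.cong) (auto simp: v'i)
    moreover have "nat \<bar>v $ k\<bar> = Suc (nat \<bar>v' $ k\<bar>)" using k by (auto simp: v'i sgn_if)
    ultimately have l': "?l v' = m" using Suc.prems(2) by simp
    obtain u where u: "ALL i. \<bar>u $ i\<bar> <= int r" "!!z. norm (K (z - v) - K (z - v')) = norm (K (z - u + axis k 1) - K (z - u))"
    proof (cases "0 < v $ k")
     case True
     then have e: "z - v' = z - v + axis k 1" for z by (simp add: v'_def)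
     show ?thesis by (rule that[of v, OF Suc.prems(1)], unfold e) (rule norm_minus_commute)
    next
     case False
     then have "axis k (sgn (v $ k)) = - axis k 1" using k by (simp add: vec_eq_iff axis_def sgn_if)
     then have e: "z - v = z - v' + axis k 1" for z by (simp add: v'_def)
     show ?thesis by (rule that[of v', OF v'r]) (simp only: e)
    qed
    have "?N v <= (\<integral>\<^sup>+z. ennreal (norm (K (z - u + axis k 1) - K (z - u))) * ?I z + ennreal (norm (K (z - v') - K z)) * ?I z \<partial>cs)"
    proof (rule nn_integral_mono)
     fix z
     have "norm (K (z - v) - K z) <= norm (K (z - v) - K (z - v')) + norm (K (z - v') - K z)"
      using norm_triangle_ineq[of "K (z - v) - K (z - v')" "K (z - v') - K z"] by simp
     then have "ennreal (norm (K (z - v) - K z)) <= ennreal (norm (K (z - u + axis k 1) - K (z - u))) + ennreal (norm (K (z - v') - K z))"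
      unfolding u(2) by (simp add: ennreal_plus[symmetric] ennreal_leI del: ennreal_plus)
     then show "ennreal (norm (K (z - v) - K z)) * ?I z <= ennreal (norm (K (z - u + axis k 1) - K (z - u))) * ?I z + ennreal (norm (K (z - v') - K z)) * ?I z"
      unfolding distrib_right[symmetric] by (rule mult_right_mono) simp
    qed
    also have "... = (\<integral>\<^sup>+z. ennreal (norm (K (z - u + axis k 1) - K (z - u))) * ?I z \<partial>cs) + ?N v'" by (rule nn_integral_add) auto
    also have "... <= ennreal (D / r) + ennreal (m * (D / r))" by (intro add_mono unit u(1) Suc.IH v'r l')
    also have "... = ennreal (D / r + m * (D / r))" using D0 by (intro ennreal_plus[symmetric]) auto
    also have "... = ennreal (Suc m * (D / r))" by (simp only: of_nat_Suc distrib_right mult_1 add.commute)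
    finally show ?case .
   qed
   have "nat \<bar>v $ i\<bar> <= r" for i using v by (simp add: nat_le_iff)
   then have "?l v <= CARD('n) * r" using sum_bounded_above[of UNIV "%i. nat \<bar>v $ i\<bar>" r] by simp
   then have "real (?l v) <= real (CARD('n) * r)" by (simp only: of_nat_le_iff)
   then have "real (?l v) * (D / r) <= real (CARD('n) * r) * (D / r)" using D0 by (intro mult_right_mono) auto
   also have "... = CARD('n) * D" using r by simp
   finally show "?N v <= ennreal (CARD('n) * D)" by (rule order_trans[OF ind[OF v refl] ennreal_leI])
  qed
 qed
qed

lemma riesz_lp:
 assumes p: "1 < p"
 shows "\<exists>c>0. \<forall>e>0. ALL j. ALL g. lpn p (conv (ker (rz j e :: real^'n => complex)) g) <= ennreal c * lpn p g \<and>
  lpn p (conv (%n. ker (rz j e :: real^'n => complex) (- n)) g) <= ennreal c * lpn p g"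
proof -
 obtain B where B: "0 <= B" "!!e j. 0 < e ==> hoermander B (ker (rz j e :: real^'n => complex))" using rz_hoermander by blast
 obtain C where C: "0 <= C" "!!F :: real^'n => complex. W F ==> \<forall>\<xi>\<in>pbox. norm (F \<xi>) <= 1 ==> hoermander B (ker F) ==>
  lp_bounded p C (ker F) & lp_bounded p C (%n. ker F (- n))"
  using singular_multiplier_lp[OF p B(1)] by blast
 have gen: "lpn p (conv K g) <= ennreal ((C + 1) powr (1 / p)) * lpn p g"
  if K: "lp_bounded p C K" "integrable cs K" for K g :: "int^'n => complex"
 proof (rule lpn_le_of_Np)
  show "Np p (conv K g) <= ennreal (C + 1) * Np p g"
  proof (cases "Np p g = \<infinity>")
   case True then show ?thesis using C by (simp add: ennreal_mult_top)
  next
   case False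
   then have "Np p (conv K g) <= ennreal C * Np p g"
    unfolding Np_def using p by (intro lp_bounded_extend[OF K]) (auto simp: less_top)
   also have "... <= ennreal (C + 1) * Np p g" by (intro mult_right_mono ennreal_leI) auto
   finally show ?thesis .
  qed
 qed (use C p in auto)
 show ?thesis
 proof (intro exI[of _ "(C + 1) powr (1 / p)"] conjI allI impI)
  show "0 < (C + 1) powr (1 / p)" using C by simp
  fix e :: real and j :: 'n and g :: "int^'n => complex" assume e: "0 < e"
  let ?K = "ker (rz j e :: real^'n => complex)"
  have w: "W (rz j e :: real^'n => complex)" by (rule rz_W[OF e])
  have b: "lp_bounded p C ?K" "lp_bounded p C (%n. ?K (- n))"
   using C(2)[OF w _ B(2)[OF e]] rz_le_1[OF e] by auto
  show "lpn p (conv ?K g) <= ennreal ((C + 1) powr (1 / p)) * lpn p g" by (rule gen[OF b(1) wienD(1)[OF w]])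
  show "lpn p (conv (%n. ?K (- n)) g) <= ennreal ((C + 1) powr (1 / p)) * lpn p g"
   by (rule gen[OF b(2) wienD(1)[OF wien_reflect[OF w]]])
 qed
qed

section \<open>Comparison of the gradient and the square root of the Laplacian\<close>

lemma conv_integrand:
 fixes K f :: "int^'n => complex"
 assumes K: "integrable cs K" and f: "!!n. norm (f n) <= M" shows "integrable cs (%y. K (n - y) * f y)"
proof (rule Bochner_Integration.integrable_bound)
 have "integrable cs (%y. K (n - y))" using K nn_shift(3)[of "%y. ennreal (norm (K y))" n] by (simp add: integrable_cs_iff)
 then show "integrable cs (%y. norm (K (n - y)) * M)" by simp
 show "AE y in cs. norm (K (n - y) * f y) <= norm (norm (K (n - y)) * M)"
  using f by (intro AE_I2) (auto simp: norm_mult abs_mult intro!: mult_left_mono intro: order_trans[OF _ abs_ge_self])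
qed simp

lemma conv_add:
 fixes K L f :: "int^'n => complex"
 assumes "integrable cs K" "integrable cs L" "!!n. norm (f n) <= M"
 shows "conv (%n. K n + L n) f n = conv K f n + conv L f n"
 unfolding conv_def distrib_right
 by (rule Bochner_Integration.integral_add) (rule conv_integrand[OF assms(1,3)], rule conv_integrand[OF assms(2,3)])

lemma conv_sum:
 fixes K :: "'j => int^'n => complex"
 assumes "!!j. integrable cs (K j)" "!!n. norm (f n) <= M"
 shows "conv (%n. \<Sum>j\<in>J. K j n) f n = (\<Sum>j\<in>J. conv (K j) f n)"
 unfolding conv_def sum_distrib_right by (rule Bochner_Integration.integral_sum) (rule conv_integrand[OF assms])

lemma wien_sum: "(!!j. wien (F j) (K j)) ==> wien (%\<xi>. \<Sum>j\<in>J. F j \<xi>) (%n. \<Sum>j\<in>J. K j n)"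
 unfolding wien_def by (auto simp: sum_distrib_right Bochner_Integration.integral_sum)

lemma le_of_sqrt_error:
 assumes "!!e. 0 < e ==> X <= A + ennreal (e powr (1 / 2)) * L" "L < \<infinity>" shows "X <= A"
proof (rule ennreal_le_epsilon)
 fix d :: real assume d: "0 < d"
 obtain l where l: "L = ennreal l" "0 <= l" using assms(2) by (cases L) auto
 define e where "e = (d / (l + 1))\<^sup>2"
 have "0 < e" and "e powr (1 / 2) = d / (l + 1)" using d l by (auto simp: e_def powr_half_sqrt)
 then have "X <= A + ennreal (d / (l + 1)) * L" using assms(1)[of e] by simp
 also have "ennreal (d / (l + 1)) * L <= ennreal d"
  using d l by (simp add: ennreal_mult[symmetric] ennreal_leI field_simps)
 finally show "X <= A + ennreal d" by (simp add: add_left_mono)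
qed

lemma W_mult_lp:
 assumes "W \<mu>" shows "\<exists>c>0. \<forall>p>1. ALL g. lpn p (conv (ker \<mu>) g) <= ennreal c * lpn p g"
proof (intro exI conjI allI impI)
 let ?c = "enn2real (an1 \<mu>) + 1"
 show c: "0 < ?c" using enn2real_nonneg[of "an1 \<mu>"] by linarith
 have "an1 \<mu> <= ennreal ?c" using W_an1[OF assms] by (cases "an1 \<mu>") (auto intro: ennreal_leI)
 then have "(\<integral>\<^sup>+n. ennreal (norm (ker \<mu> n)) \<partial>cs) <= ennreal ?c" by (simp add: an_def)
 then show "lpn p (conv (ker \<mu>) g) <= ennreal ?c * lpn p g" if "1 < p" for p g by (rule young_l1[OF that _ c])
qed

text \<open>
  For positive \<open>e\<close> the differences are Riesz transforms of the regularized root, and the regularized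
  root is a sum of reflected Riesz transforms of the differences up to \<open>e * res e\<close>. The errors are
  of order \<open>e powr (1 / 2)\<close> times the norm of \<open>f\<close>, and \<open>e\<close> tends to zero.
\<close>

lemma gradient_vs_root:
 assumes p: "1 < p"
 shows "\<exists>c>0. \<forall>f :: int^'n => complex. Np p f < \<infinity> -->
  (ALL j. lpn p (conv (ker (fd j)) f) <= ennreal c * lpn p (conv (ker (rt 0)) f)) \<and>
  lpn p (conv (ker (rt 0)) f) <= ennreal c * (\<Sum>j\<in>UNIV. lpn p (conv (ker (fd j)) f))"
proof -
 obtain c where c: "0 < c" and R: "!!e j g. 0 < e ==> lpn p (conv (ker (rz j e :: real^'n => complex)) g) <= ennreal c * lpn p g"
  "!!e j g. 0 < e ==> lpn p (conv (%n. ker (rz j e :: real^'n => complex) (- n)) g) <= ennreal c * lpn p g"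
  using riesz_lp[OF p, where 'n = 'n] by blast
 show ?thesis
 proof (intro exI[of _ c] conjI c allI impI)
  fix f :: "int^'n => complex" assume f: "Np p f < \<infinity>"
  then obtain M where M: "!!n. norm (f n) <= M" using lp_imp_bounded[of f p] p unfolding Np_def by auto
  have Lf: "lpn p f < \<infinity>" using f by (simp add: lpn_def)
  let ?d = "%e. ker (%\<xi>::real^'n. rt e \<xi> - rt 0 \<xi>)"
  let ?r0 = "ker (rt 0 :: real^'n => complex)"
  {
   fix j
   have "lpn p (conv (ker (fd j)) f) <= ennreal c * lpn p (conv ?r0 f) + ennreal (e powr (1 / 2)) * (ennreal c * lpn p f)"
    if e: "0 < e" for e
   proof -
    have "ker (fd j :: real^'n => complex) = ker (%\<xi>. rz j e \<xi> * rt e \<xi>)" by (simp only: rz_rt[OF e])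
    also have "... = conv (ker (rz j e)) (ker (rt e))" by (rule wien_coeff[OF wien_mult[OF rz_W[OF e] rt_e_W[OF e]]])
    finally have e1: "ker (fd j :: real^'n => complex) = conv (ker (rz j e)) (ker (rt e))" .
    have "conv (ker (fd j)) f = conv (ker (rz j e)) (conv (ker (rt e)) f)"
     by (intro ext) (simp only: e1 conv_assoc[where f = f, OF wienD(1)[OF rz_W[OF e]] wienD(1)[OF rt_e_W[OF e]] M])
    then have 1: "lpn p (conv (ker (fd j)) f) <= ennreal c * lpn p (conv (ker (rt e)) f)" using R(1)[OF e] by simp
    have "ker (rt e :: real^'n => complex) = ker (%\<xi>. rt 0 \<xi> + (rt e \<xi> - rt 0 \<xi>))" by simp
    also have "... = (%n. ?r0 n + ?d e n)" by (rule wien_coeff[OF wien_add[OF rt0_W rt_W(1)[OF e]]])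
    finally have e2: "ker (rt e :: real^'n => complex) = (%n. ?r0 n + ?d e n)" .
    have "conv (ker (rt e)) f = (%n. conv ?r0 f n + conv (?d e) f n)"
     by (intro ext) (simp only: e2 conv_add[where f = f, OF wienD(1)[OF rt0_W] wienD(1)[OF rt_W(1)[OF e]] M])
    then have "lpn p (conv (ker (rt e)) f) <= lpn p (conv ?r0 f) + lpn p (conv (?d e) f)" using lpn_triangle[OF p] by simp
    also have "lpn p (conv (?d e) f) <= ennreal (e powr (1 / 2)) * lpn p f"
     by (rule young_l1[OF p]) (use rt_W(2)[OF e] e in \<open>auto simp: an_def\<close>)
    finally have "lpn p (conv (ker (rt e)) f) <= lpn p (conv ?r0 f) + ennreal (e powr (1 / 2)) * lpn p f" by (simp add: add_left_mono)
    then have "ennreal c * lpn p (conv (ker (rt e)) f) <= ennreal c * (lpn p (conv ?r0 f) + ennreal (e powr (1 / 2)) * lpn p f)"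
     by (rule mult_left_mono) simp
    then show ?thesis using 1 by (simp add: distrib_left mult_ac)
   qed
   moreover have "ennreal c * lpn p f < \<infinity>" using Lf by (simp add: ennreal_mult_less_top)
   ultimately show "lpn p (conv (ker (fd j)) f) <= ennreal c * lpn p (conv ?r0 f)" by (rule le_of_sqrt_error)
  }
  have "lpn p (conv ?r0 f) <= ennreal c * (\<Sum>j\<in>UNIV. lpn p (conv (ker (fd j)) f)) + ennreal (e powr (1 / 2)) * (2 * lpn p f)"
   if e: "0 < e" for e
  proof -
   let ?s = "%j n. ker (rz j e :: real^'n => complex) (- n)"
   define A where "A \<xi> = of_real e * res e \<xi> - (rt e \<xi> - rt 0 \<xi>)" for \<xi> :: "real^'n"
   have eW: "W (%\<xi>::real^'n. of_real e * res e \<xi>)" by (rule W_cmult[OF res_W(1)[OF e]])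
   have AW: "W A" unfolding A_def[abs_def] by (rule W_diff[OF eW rt_W(1)[OF e]])
   have "an1 (%\<xi>::real^'n. of_real e * res e \<xi>) = ennreal (norm (complex_of_real e)) * an1 (res e :: real^'n => complex)"
    by (rule an_cmult[OF res_W(1)[OF e]])
   also have "... = ennreal e * an1 (res e :: real^'n => complex)" using e by simp
   also have "... <= ennreal e * ennreal (e powr (- 1 / 2))" by (rule mult_left_mono[OF res_W(2)[OF e]]) simp
   also have "... = ennreal (e powr (1 / 2))" using e powr_add[of e 1 "- 1 / 2"] by (simp add: ennreal_mult[symmetric])
   finally have "an1 A <= ennreal (e powr (1 / 2)) + ennreal (e powr (1 / 2))"
    unfolding A_def[abs_def] by (intro order_trans[OF an_diff_le[OF eW rt_W(1)[OF e]]] add_mono rt_W(2)[OF e])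
   also have "... = ennreal (2 * e powr (1 / 2))" by (simp add: ennreal_plus[symmetric] del: ennreal_plus)
   finally have A1: "(\<integral>\<^sup>+n. ennreal (norm (ker A n)) \<partial>cs) <= ennreal (2 * e powr (1 / 2))" by (simp add: an_def)
   have sw: "wien (%\<xi>. rz j e (- \<xi>) * fd j \<xi>) (conv (?s j) (ker (fd j)))" for j
    by (rule wien_mult[OF wien_reflect[OF rz_W[OF e]] fd_W])
   have si: "integrable cs (conv (?s j) (ker (fd j)))" for j by (rule wienD(1)[OF sw])
   have eq: "rt 0 = (%\<xi>::real^'n. (\<Sum>j\<in>UNIV. rz j e (- \<xi>) * fd j \<xi>) + A \<xi>)"
   proof
    fix \<xi> :: "real^'n"
    show "rt 0 \<xi> = (\<Sum>j\<in>UNIV. rz j e (- \<xi>) * fd j \<xi>) + A \<xi>" using rt_split[OF e, of \<xi>] by (simp add: A_def)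
   qed
   have w: "wien (%\<xi>::real^'n. (\<Sum>j\<in>UNIV. rz j e (- \<xi>) * fd j \<xi>) + A \<xi>) (%n. (\<Sum>j\<in>UNIV. conv (?s j) (ker (fd j)) n) + ker A n)"
    by (intro wien_add wien_sum sw AW)
   have r0: "?r0 = (%n. (\<Sum>j\<in>UNIV. conv (?s j) (ker (fd j)) n) + ker A n)"
    by (rule trans[OF arg_cong[OF eq, of ker] wien_coeff[OF w]])
   have si2: "integrable cs (%n. \<Sum>j\<in>UNIV. conv (?s j) (ker (fd j :: real^'n => complex)) n)"
    by (intro Bochner_Integration.integrable_sum si)
   have "conv ?r0 f = (%n. (\<Sum>j\<in>UNIV. conv (conv (?s j) (ker (fd j))) f n) + conv (ker A) f n)"
    by (intro ext) (simp only: r0 conv_add[where f = f, OF si2 wienD(1)[OF AW] M] conv_sum[where f = f, OF si M])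
   then have "lpn p (conv ?r0 f) <= lpn p (%n. \<Sum>j\<in>UNIV. conv (conv (?s j) (ker (fd j))) f n) + lpn p (conv (ker A) f)"
    using lpn_triangle[OF p] by simp
   also have "... <= (\<Sum>j\<in>UNIV. lpn p (conv (conv (?s j) (ker (fd j))) f)) + ennreal (2 * e powr (1 / 2)) * lpn p f"
    by (intro add_mono young_l1[OF p A1] lpn_sum_le[OF p]) (use e in auto)
   also have "(\<Sum>j\<in>UNIV. lpn p (conv (conv (?s j) (ker (fd j))) f)) <= (\<Sum>j\<in>UNIV. ennreal c * lpn p (conv (ker (fd j)) f))"
   proof (rule sum_mono)
    fix j
    have "conv (conv (?s j) (ker (fd j))) f = conv (?s j) (conv (ker (fd j)) f)"
     by (intro ext) (rule conv_assoc[OF wienD(1)[OF wien_reflect[OF rz_W[OF e]]] wienD(1)[OF fd_W] M])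
    then show "lpn p (conv (conv (?s j) (ker (fd j))) f) <= ennreal c * lpn p (conv (ker (fd j)) f)" using R(2)[OF e] by simp
   qed
   finally show ?thesis
    by (simp add: add_right_mono sum_distrib_left ennreal_mult mult_ac)
  qed
  moreover have "2 * lpn p f < \<infinity>" using Lf by (simp add: ennreal_mult_less_top)
  ultimately show "lpn p (conv ?r0 f) <= ennreal c * (\<Sum>j\<in>UNIV. lpn p (conv (ker (fd j)) f))" by (rule le_of_sqrt_error)
 qed
qed

lemma ratio_rt: assumes "\<xi> : pbox" shows "ratio (1 / 2) \<xi> * rt 0 \<xi> = of_real (norm \<xi>)"
proof -
 have "((norm \<xi>)\<^sup>2 / sg \<xi>) powr (1 / 2) * sg \<xi> powr (1 / 2) = norm \<xi>"
  using sg_pos[OF assms] by (simp add: powr_divide powr_half_sqrt)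
 then show ?thesis unfolding ratio_def rt_def of_real_mult[symmetric] by (simp only: add_0)
qed

lemma W_norm: "W (%\<xi>::real^'n. of_real (norm \<xi>))"
 by (rule W_congI[OF W_mult[OF W_ratio[of "1 / 2"] rt0_W] ratio_rt])

text \<open>
  The root of the Laplacian and \<open>\<bar>\<xi>\<bar>\<close> differ by a factor in the Wiener algebra.
\<close>

lemma gradient_vs_norm:
 assumes p: "1 < p"
 shows "\<exists>c>0. \<forall>f :: int^'n => complex. Np p f < \<infinity> -->
  (\<Sum>j\<in>UNIV. lpn p (conv (ker (fd j)) f)) <= ennreal c * lpn p (conv (ker (%\<xi>. of_real (norm \<xi>))) f) \<and>
  lpn p (conv (ker (%\<xi>. of_real (norm \<xi>))) f) <= ennreal c * (\<Sum>j\<in>UNIV. lpn p (conv (ker (fd j)) f))"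
proof -
 let ?N = "%\<xi>::real^'n. complex_of_real (norm \<xi>)"
 obtain a where a: "0 < a" and ag: "!!f :: int^'n => complex. Np p f < \<infinity> ==>
  (ALL j. lpn p (conv (ker (fd j)) f) <= ennreal a * lpn p (conv (ker (rt 0)) f)) \<and>
  lpn p (conv (ker (rt 0)) f) <= ennreal a * (\<Sum>j\<in>UNIV. lpn p (conv (ker (fd j)) f))"
  using gradient_vs_root[OF p, where 'n = 'n] by blast
 obtain b where b: "0 < b" and bg: "!!g. lpn p (conv (ker (ratio (1 / 2) :: real^'n => complex)) g) <= ennreal b * lpn p g"
  using W_mult_lp[of "ratio (1 / 2) :: real^'n => complex", OF W_ratio] p by blast
 obtain b' where b': "0 < b'" and bg': "!!g. lpn p (conv (ker (ratio (- 1 / 2) :: real^'n => complex)) g) <= ennreal b' * lpn p g"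
  using W_mult_lp[of "ratio (- 1 / 2) :: real^'n => complex", OF W_ratio] p by blast
 have k: "ker ?N = conv (ker (ratio (1 / 2))) (ker (rt 0))"
 proof -
  have "ker ?N = ker (%\<xi>. ratio (1 / 2) \<xi> * rt 0 \<xi>)"
   by (rule ker_cong) (simp only: ratio_rt)
  then show ?thesis by (simp only: wien_coeff[OF wien_mult[OF W_ratio rt0_W]])
 qed
 have k': "ker (rt 0) = conv (ker (ratio (- 1 / 2))) (ker ?N)"
 proof -
  have "ratio (- 1 / 2) \<xi> * ?N \<xi> = rt 0 \<xi>" if "\<xi> : pbox" for \<xi> :: "real^'n"
  proof -
   have s: "0 < sg \<xi>" by (rule sg_pos[OF that])
   have n: "0 < norm \<xi>" using that by (auto simp: pbox_def)
   have "((norm \<xi>)\<^sup>2 / sg \<xi>) powr (- 1 / 2) = sqrt (sg \<xi>) / norm \<xi>"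
    using s n by (simp add: powr_minus_divide powr_divide powr_half_sqrt)
   then have "((norm \<xi>)\<^sup>2 / sg \<xi>) powr (- 1 / 2) * norm \<xi> = sg \<xi> powr (1 / 2)" using s n by (simp add: powr_half_sqrt)
   then show ?thesis unfolding ratio_def rt_def of_real_mult[symmetric] by (simp only: add_0)
  qed
  then have "ker (rt 0) = ker (%\<xi>. ratio (- 1 / 2) \<xi> * ?N \<xi>)" by (intro ker_cong) simp
  then show ?thesis by (simp only: wien_coeff[OF wien_mult[OF W_ratio W_norm]])
 qed
 have comb: "ennreal x * (ennreal y * z) <= ennreal w * z" if "0 < x" "0 < y" "x * y <= w" for x y w z
  using that by (simp add: mult.assoc[symmetric] ennreal_mult[symmetric] mult_right_mono ennreal_leI)
 let ?c = "CARD('n) * (a * b') + b * a"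
 have pos: "0 < ?c" using a b b' by (simp add: add_pos_pos)
 show ?thesis
 proof (intro exI[of _ ?c] conjI pos allI impI)
  fix f :: "int^'n => complex" assume f: "Np p f < \<infinity>"
  then obtain M where M: "!!n. norm (f n) <= M" using lp_imp_bounded[of f p] p unfolding Np_def by auto
  have 1: "conv (ker ?N) f = conv (ker (ratio (1 / 2))) (conv (ker (rt 0)) f)"
   unfolding k by (intro ext) (rule conv_assoc[OF wienD(1)[OF W_ratio] wienD(1)[OF rt0_W] M])
  have 2: "conv (ker (rt 0)) f = conv (ker (ratio (- 1 / 2))) (conv (ker ?N) f)"
   unfolding k' by (intro ext) (rule conv_assoc[OF wienD(1)[OF W_ratio] wienD(1)[OF W_norm] M])
  have "(\<Sum>j\<in>UNIV. lpn p (conv (ker (fd j)) f)) <= (\<Sum>j\<in>(UNIV::'n set). ennreal a * (ennreal b' * lpn p (conv (ker ?N) f)))"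
  proof (rule sum_mono)
   fix j
   have "lpn p (conv (ker (fd j)) f) <= ennreal a * lpn p (conv (ker (rt 0)) f)" using ag[OF f] by blast
   also have "... <= ennreal a * (ennreal b' * lpn p (conv (ker ?N) f))" unfolding 2 by (intro mult_left_mono bg') simp
   finally show "lpn p (conv (ker (fd j)) f) <= ennreal a * (ennreal b' * lpn p (conv (ker ?N) f))" .
  qed
  also have "... = ennreal (CARD('n)) * (ennreal (a * b') * lpn p (conv (ker ?N) f))"
   using a b' by (simp add: ennreal_mult mult.assoc ennreal_of_nat_eq_real_of_nat)
  also have "... <= ennreal ?c * lpn p (conv (ker ?N) f)" by (rule comb) (use a b b' in auto)
  finally show "(\<Sum>j\<in>UNIV. lpn p (conv (ker (fd j)) f)) <= ennreal ?c * lpn p (conv (ker ?N) f)" .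
  have "lpn p (conv (ker ?N) f) <= ennreal b * lpn p (conv (ker (rt 0)) f)" unfolding 1 by (rule bg)
  also have "... <= ennreal b * (ennreal a * (\<Sum>j\<in>UNIV. lpn p (conv (ker (fd j)) f)))" using ag[OF f] by (intro mult_left_mono) auto
  also have "... <= ennreal ?c * (\<Sum>j\<in>UNIV. lpn p (conv (ker (fd j)) f))" by (rule comb) (use a b b' in auto)
  finally show "lpn p (conv (ker ?N) f) <= ennreal ?c * (\<Sum>j\<in>UNIV. lpn p (conv (ker (fd j)) f))" .
 qed
qed

section \<open>From the grid to the lattice\<close>

lemma grid_eq: assumes "0 < h" shows "grid h = range (%n::int^'n. h *\<^sub>R emb n)"
proof (intro set_eqI iffI)
 fix x :: "real^'n" assume "x : grid h"
 then have "ALL i. \<exists>k::int. x $ i = h * of_int k" by (simp add: grid_def)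
 then obtain k :: "'n => int" where "!!i. x $ i = h * of_int (k i)" by metis
 then have "x = h *\<^sub>R emb (\<chi> i. k i)" by (simp add: vec_eq_iff)
 then show "x : range (%n::int^'n. h *\<^sub>R emb n)" by blast
qed (auto simp: grid_def)

lemma grid_inj: "0 < h ==> inj (%n::int^'n. h *\<^sub>R emb n)"
 by (rule injI) (simp add: scaleR_cancel_left)

lemma cs_summable: fixes g :: "'a => complex" shows "g summable_on UNIV \<longleftrightarrow> integrable cs g"
 by (simp add: summable_on_iff_abs_summable_on_complex abs_summable_equivalent Infinite_Set_Sum.abs_summable_on_def)

lemma cs_infsum: fixes g :: "'a => complex" shows "infsum g UNIV = (\<integral>n. g n \<partial>cs)"
proof (cases "integrable cs g")
 case True
 then show ?thesis using infsetsum_infsum[of g UNIV] by (simp add: infsetsum_def Infinite_Set_Sum.abs_summable_on_def)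
next
 case False
 then show ?thesis by (simp add: not_integrable_integral_eq infsum_not_exists cs_summable)
qed

lemma cs_infsum_real:
 fixes u :: "'a => real"
 shows "u summable_on UNIV \<longleftrightarrow> integrable cs u" "integrable cs u ==> infsum u UNIV = (\<integral>n. u n \<partial>cs)"
proof -
 have a: "Infinite_Set_Sum.abs_summable_on u UNIV \<longleftrightarrow> integrable cs u" by (simp only: Infinite_Set_Sum.abs_summable_on_def)
 show "u summable_on UNIV \<longleftrightarrow> integrable cs u"
  by (rule trans[OF trans[OF summable_on_iff_abs_summable_on_real abs_summable_equivalent] a])
 assume "integrable cs u"
 then have "infsetsum u UNIV = infsum u UNIV" by (intro infsetsum_infsum) (simp only: a)
 then show "infsum u UNIV = (\<integral>n. u n \<partial>cs)" by (simp only: infsetsum_def)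
qed

lemma Lp_norm_lattice:
 fixes f :: "real^'n => complex"
 assumes h: "0 < h" and p: "0 < p"
 shows "Lp_norm h p f = ennreal (h powr (CARD('n) / p)) * lpn p (%n. f (h *\<^sub>R emb n))"
proof -
 define F where "F n = f (h *\<^sub>R emb n)" for n
 define u where "u n = norm (F n) powr p" for n
 have uo: "(%x. norm (f x) powr p) \<circ> (%n. h *\<^sub>R emb n) = u" by (auto simp: u_def F_def)
 have s: "(%x. norm (f x) powr p) summable_on grid h \<longleftrightarrow> integrable cs u"
  unfolding grid_eq[OF h] summable_on_reindex[OF grid_inj[OF h]] uo by (rule cs_infsum_real(1))
 have i: "integrable cs u \<longleftrightarrow> Np p F < \<infinity>"
  by (simp add: integrable_iff_bounded Np_def u_def)
 show ?thesis
 proof (cases "integrable cs u")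
  case True
  have inf: "(\<Sum>\<^sub>\<infinity>x\<in>grid h. norm (f x) powr p) = (\<integral>n. u n \<partial>cs)"
   unfolding grid_eq[OF h] infsum_reindex[OF grid_inj[OF h]] uo by (rule cs_infsum_real(2)[OF True])
  have u0: "0 <= (\<integral>n. u n \<partial>cs)" by (rule integral_nonneg_AE) (simp add: u_def)
  have "Np p F = ennreal (\<integral>n. u n \<partial>cs)" using nn_integral_eq_integral[OF True] by (simp add: Np_def u_def[abs_def])
  then have l: "lpn p F = ennreal ((\<integral>n. u n \<partial>cs) powr (1 / p))" using u0 by (rule lpn_ennreal)
  have "(h ^ CARD('n) * (\<integral>n. u n \<partial>cs)) powr (1 / p) = h powr (CARD('n) / p) * (\<integral>n. u n \<partial>cs) powr (1 / p)"
   using h u0 by (simp add: powr_mult powr_realpow[symmetric] powr_powr)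
  then have "Lp_norm h p f = ennreal (h powr (CARD('n) / p) * (\<integral>n. u n \<partial>cs) powr (1 / p))"
   using True s inf by (simp add: Lp_norm_def)
  also have "... = ennreal (h powr (CARD('n) / p)) * lpn p F" unfolding l by (rule ennreal_mult) auto
  finally show ?thesis by (simp add: F_def[abs_def])
 next
  case False
  then have "Np p F = \<infinity>" using i by (simp add: less_top[symmetric])
  then have "lpn p F = \<infinity>" by (rule lpn_top)
  then show ?thesis using False s h by (simp add: Lp_norm_def F_def[abs_def] ennreal_mult_top)
 qed
qed

lemma Lp_space_lattice:
 fixes f :: "real^'n => complex"
 assumes h: "0 < h" and p: "0 < p"
 shows "f : Lp_space h p \<longleftrightarrow> Np p (%n. f (h *\<^sub>R emb n)) < \<infinity>"
 using h by (auto simp: Lp_space_def Lp_norm_lattice[OF h p] lpn_def ennreal_mult_less_top ennreal_mult_top less_top)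

lemma lborel_scale:
 fixes g :: "real^'n => 'b::{banach, second_countable_topology}"
 assumes c: "0 < c" and g: "integrable lborel g"
 shows "integrable lborel (%x. g (c *\<^sub>R x))" "(\<integral>x. g (c *\<^sub>R x) \<partial>lborel) = (1 / c ^ CARD('n)) *\<^sub>R (\<integral>x. g x \<partial>lborel)"
proof -
 let ?k = "c ^ CARD('n)"
 have k: "0 < ?k" using c by simp
 have eq: "lborel = density (distr lborel borel (%x::real^'n. c *\<^sub>R x)) (%_. ennreal ?k)"
  using lborel_affine[of c "0::real^'n"] c by simp
 have [measurable]: "g : borel_measurable borel" using borel_measurable_integrable[OF g] by simp
 have "integrable (density (distr lborel borel (%x::real^'n. c *\<^sub>R x)) (%_. ennreal ?k)) g" using g by (simp only: eq[symmetric])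
 then have "integrable (distr lborel borel (%x::real^'n. c *\<^sub>R x)) (%x. ?k *\<^sub>R g x)"
  using k by (subst (asm) integrable_density) auto
 then have "integrable lborel (%x. ?k *\<^sub>R g (c *\<^sub>R x))" by (subst (asm) integrable_distr_eq) auto
 then have "integrable lborel (%x. (1 / ?k) *\<^sub>R (?k *\<^sub>R g (c *\<^sub>R x)))" by (rule integrable_scaleR_right)
 then show "integrable lborel (%x. g (c *\<^sub>R x))" using c by simp
 have "(\<integral>x. g x \<partial>lborel) = (\<integral>x. g x \<partial>density (distr lborel borel (%x::real^'n. c *\<^sub>R x)) (%_. ennreal ?k))" by (simp only: eq[symmetric])
 also have "... = (\<integral>x. ?k *\<^sub>R g x \<partial>distr lborel borel (%x::real^'n. c *\<^sub>R x))" using k by (intro integral_density) auto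
 also have "... = (\<integral>x. ?k *\<^sub>R g (c *\<^sub>R x) \<partial>lborel)" by (rule integral_distr) auto
 also have "... = ?k *\<^sub>R (\<integral>x. g (c *\<^sub>R x) \<partial>lborel)" by simp
 finally show "(\<integral>x. g (c *\<^sub>R x) \<partial>lborel) = (1 / ?k) *\<^sub>R (\<integral>x. g x \<partial>lborel)" using c by simp
qed

lemma mem_torus: assumes "0 < h" shows "\<xi> : torus h \<longleftrightarrow> (ALL i. \<bar>h * \<xi> $ i\<bar> <= pi)"
proof -
 have "- (pi / h) <= x & x <= pi / h \<longleftrightarrow> \<bar>h * x\<bar> <= pi" for x
  using assms by (simp add: abs_le_iff field_simps) auto
 then show ?thesis by (simp add: torus_def mem_box_cart)
qed

lemma torus_borel [measurable]: "torus h : sets borel" by (simp add: torus_def)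

lemma pbox_subset: "\<eta> : pbox ==> \<eta> : torus 1" by (auto simp: pbox_def mem_box_cart torus_def less_imp_le)

lemma torus_null: "torus 1 - pbox : null_sets (lborel :: (real^'n) measure)"
proof -
 let ?a = "\<chi> i::'n. - pi" and ?b = "\<chi> i::'n. pi"
 have "negligible (cbox ?a ?b - box ?a ?b)" by (rule negligible_frontier_interval)
 then have 1: "cbox ?a ?b - box ?a ?b : null_sets lborel"
  by (simp add: negligible_iff_null_sets null_sets_completion_iff)
 have "{0::real^'n} : null_sets lborel" by (rule finite_imp_null_set_lborel) simp
 then have 2: "(cbox ?a ?b - box ?a ?b) \<union> {0} : null_sets lborel" by (rule null_sets.Un[OF 1])
 have "torus 1 - pbox : sets (lborel :: (real^'n) measure)" by simp
 then show ?thesis by (rule null_sets_subset[OF 2]) (auto simp: torus_def pbox_def)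
qed

lemma torus_TM:
 fixes G :: "real^'n => 'b::{banach, second_countable_topology}"
 assumes h: "0 < h" and G: "set_integrable lborel (torus h) G"
 shows "integrable TM (%\<eta>. G ((1 / h) *\<^sub>R \<eta>))" "(LINT \<xi>:torus h|lborel. G \<xi>) = (1 / h ^ CARD('n)) *\<^sub>R (\<integral>\<eta>. G ((1 / h) *\<^sub>R \<eta>) \<partial>TM)"
proof -
 define g where "g \<xi> = indicator (torus h) \<xi> *\<^sub>R G \<xi>" for \<xi>
 have gi: "integrable lborel g" using G by (simp add: set_integrable_def g_def[abs_def])
 have h1: "0 < 1 / h" using h by simp
 note S = lborel_scale[OF h1 gi]
 have geq: "g ((1 / h) *\<^sub>R \<eta>) = indicator (torus 1) \<eta> *\<^sub>R G ((1 / h) *\<^sub>R \<eta>)" for \<eta>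
  using h by (simp add: g_def indicator_def mem_torus)
 have pb: "indicator pbox \<eta> *\<^sub>R G ((1 / h) *\<^sub>R \<eta>) = indicator pbox \<eta> *\<^sub>R g ((1 / h) *\<^sub>R \<eta>)" for \<eta>
  using pbox_subset[of \<eta>] by (auto simp: geq indicator_def)
 have I: "integrable lborel (%\<eta>. indicator pbox \<eta> *\<^sub>R g ((1 / h) *\<^sub>R \<eta>))"
  by (rule integrable_mult_indicator[OF _ S(1)]) simp
 show "integrable TM (%\<eta>. G ((1 / h) *\<^sub>R \<eta>))" unfolding TM_def using I by (subst integrable_restrict_space) (simp_all add: pb)
 have "(\<integral>\<eta>. G ((1 / h) *\<^sub>R \<eta>) \<partial>TM) = (\<integral>\<eta>. indicator pbox \<eta> *\<^sub>R g ((1 / h) *\<^sub>R \<eta>) \<partial>lborel)"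
  unfolding TM_def by (subst integral_restrict_space) (simp_all add: pb)
 also have "... = (\<integral>\<eta>. g ((1 / h) *\<^sub>R \<eta>) \<partial>lborel)"
 proof (rule integral_cong_AE)
  show "AE \<eta> in lborel. indicator pbox \<eta> *\<^sub>R g ((1 / h) *\<^sub>R \<eta>) = g ((1 / h) *\<^sub>R \<eta>)"
   using AE_not_in[OF torus_null] by eventually_elim (auto simp: geq indicator_def)
 qed (rule borel_measurable_integrable[OF I], rule borel_measurable_integrable[OF S(1)])
 also have "... = h ^ CARD('n) *\<^sub>R (\<integral>\<xi>. g \<xi> \<partial>lborel)" unfolding S(2) by (simp add: power_one_over)
 finally show "(LINT \<xi>:torus h|lborel. G \<xi>) = (1 / h ^ CARD('n)) *\<^sub>R (\<integral>\<eta>. G ((1 / h) *\<^sub>R \<eta>) \<partial>TM)"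
  using h by (simp add: set_lebesgue_integral_def g_def)
qed

lemma chr_grid: "0 < h ==> exp (\<i> * of_real ((h *\<^sub>R emb n) \<bullet> ((1 / h) *\<^sub>R \<eta>))) = chr (- n) \<eta>"
 by (simp add: chr_def cis_conv_exp)

lemma inv_lattice:
 fixes G :: "real^'n => complex"
 assumes h: "0 < h" and G: "set_integrable lborel (torus h) G"
 shows "inv_lattice_fourier h G (h *\<^sub>R emb n) = of_real (1 / h ^ CARD('n)) * ker (%\<eta>. G ((1 / h) *\<^sub>R \<eta>)) n"
proof -
 let ?e = "%\<xi>. exp (\<i> * of_real ((h *\<^sub>R emb n) \<bullet> \<xi>))"
 have "set_integrable lborel (torus h) (%\<xi>. G \<xi> * ?e \<xi>)"
  unfolding set_integrable_def
 proof (rule Bochner_Integration.integrable_bound)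
  show i: "integrable lborel (%\<xi>. indicator (torus h) \<xi> *\<^sub>R G \<xi>)" using G by (simp add: set_integrable_def)
  have "(%\<xi>. (indicator (torus h) \<xi> *\<^sub>R G \<xi>) * ?e \<xi>) : borel_measurable lborel"
   using borel_measurable_integrable[OF i] by measurable
  then show "(%\<xi>. indicator (torus h) \<xi> *\<^sub>R (G \<xi> * ?e \<xi>)) : borel_measurable lborel" by simp
 qed (simp add: norm_mult)
 from torus_TM(2)[OF h this]
 have e: "(LINT \<xi>:torus h|lborel. G \<xi> * ?e \<xi>) = of_real (1 / h ^ CARD('n)) * (\<integral>\<eta>. G ((1 / h) *\<^sub>R \<eta>) * chr (- n) \<eta> \<partial>TM)"
  by (simp only: chr_grid[OF h] scaleR_conv_of_real[where 'a = complex])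
 show ?thesis unfolding inv_lattice_fourier_def ker_def e by simp
qed

lemma conv_cmult: "conv K (%n. c * g n) n = c * conv K g n"
 unfolding conv_def by (simp add: mult.left_commute[of _ c])

text \<open>
  Only integrability of \<open>G\<close> is used, so that the identity applies to the transform of any function
  for which the multiplier is given by an integral over the torus.
\<close>

lemma ker_W_mult:
 fixes G :: "real^'n => complex"
 assumes \<mu>: "W \<mu>" and G: "integrable TM G" shows "ker (%\<eta>. \<mu> \<eta> * G \<eta>) n = conv (ker \<mu>) (ker G) n"
proof -
 let ?K = "ker \<mu>" and ?c = "complex_of_real ((2 * pi) ^ CARD('n))"
 have c: "?c ~= 0" by simp
 have Gm: "G : borel_measurable TM" by (rule borel_measurable_integrable[OF G])
 have nn: "(\<integral>\<^sup>+\<eta>. ennreal (norm (?K k * (G \<eta> * chr (- (n - k)) \<eta>))) \<partial>TM) = ennreal (norm (?K k)) * (\<integral>\<^sup>+\<eta>. ennreal (norm (G \<eta>)) \<partial>TM)" for k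
  using Gm by (subst nn_integral_cmult[symmetric]) (auto simp: norm_mult ennreal_mult intro!: measurable_compose[OF _ measurable_ennreal] borel_measurable_norm)
 have "(\<integral>\<eta>. \<mu> \<eta> * G \<eta> * chr (- n) \<eta> \<partial>TM) = (\<integral>\<eta>. \<integral>k. ?K k * (G \<eta> * chr (- (n - k)) \<eta>) \<partial>cs \<partial>TM)"
 proof (rule Bochner_Integration.integral_cong)
  fix \<eta> :: "real^'n" assume "\<eta> : space TM"
  then have "\<mu> \<eta> * G \<eta> * chr (- n) \<eta> = (\<integral>k. ?K k * chr k \<eta> \<partial>cs) * (G \<eta> * chr (- n) \<eta>)" using wienD(2)[OF \<mu>] by simp
  also have "... = (\<integral>k. ?K k * chr k \<eta> * (G \<eta> * chr (- n) \<eta>) \<partial>cs)" by (rule integral_mult_left_zero[symmetric])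
  also have "... = (\<integral>k. ?K k * (G \<eta> * chr (- (n - k)) \<eta>) \<partial>cs)"
  proof (rule Bochner_Integration.integral_cong)
   fix k
   have "chr (- (n - k)) \<eta> = chr k \<eta> * chr (- n) \<eta>" unfolding chr_add[symmetric] by simp
   then show "?K k * chr k \<eta> * (G \<eta> * chr (- n) \<eta>) = ?K k * (G \<eta> * chr (- (n - k)) \<eta>)" by simp
  qed simp
  finally show "\<mu> \<eta> * G \<eta> * chr (- n) \<eta> = (\<integral>k. ?K k * (G \<eta> * chr (- (n - k)) \<eta>) \<partial>cs)" .
 qed simp
 also have "... = (\<integral>k. \<integral>\<eta>. ?K k * (G \<eta> * chr (- (n - k)) \<eta>) \<partial>TM \<partial>cs)"
 proof (rule cs_integral_swap(1)[symmetric])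
  have "(\<integral>\<^sup>+k. \<integral>\<^sup>+\<eta>. ennreal (norm (?K k * (G \<eta> * chr (- (n - k)) \<eta>))) \<partial>TM \<partial>cs) = (\<integral>\<^sup>+k. ennreal (norm (?K k)) \<partial>cs) * (\<integral>\<^sup>+\<eta>. ennreal (norm (G \<eta>)) \<partial>TM)"
   unfolding nn by (rule nn_integral_multc) simp
  also have "... < \<infinity>" using wienD(1)[OF \<mu>] G by (simp add: integrable_iff_bounded ennreal_mult_less_top)
  finally show "(\<integral>\<^sup>+k. \<integral>\<^sup>+\<eta>. ennreal (norm (?K k * (G \<eta> * chr (- (n - k)) \<eta>))) \<partial>TM \<partial>cs) < \<infinity>" .
  show "(%\<eta>. ?K k * (G \<eta> * chr (- (n - k)) \<eta>)) : borel_measurable TM" for k using Gm by measurable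
 qed (rule TM.sigma_finite_measure_axioms)
 also have "... = (\<integral>k. ?c * (?K k * ker G (n - k)) \<partial>cs)"
  by (intro Bochner_Integration.integral_cong refl) (simp add: ker_def)
 also have "... = ?c * (\<integral>k. ?K k * ker G (n - k) \<partial>cs)" by (rule integral_mult_right_zero)
 also have "(\<integral>k. ?K k * ker G (n - k) \<partial>cs) = conv ?K (ker G) n"
  unfolding conv_def using integral_shift(3)[of "%k. ?K k * ker G (n - k)" n] by simp
 finally show ?thesis unfolding ker_def[of "%\<eta>. \<mu> \<eta> * G \<eta>"] using c by simp
qed

lemma multiplier_transform:
 fixes f :: "real^'n => complex"
 assumes "0 < h" "f : Lp_space h 2" "set_integrable lborel (torus h) (%\<xi>. m \<xi> * lattice_fourier h f \<xi>)"
 shows "fourier_multiplier h m f (h *\<^sub>R emb n) =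
  of_real (1 / h ^ CARD('n)) * ker (%\<eta>. m ((1 / h) *\<^sub>R \<eta>) * lattice_fourier h f ((1 / h) *\<^sub>R \<eta>)) n"
 using assms by (simp add: fourier_multiplier_def inv_lattice)

lemma multiplier_convolution:
 fixes f :: "real^'n => complex"
 assumes h: "0 < h" and n: "~ (f : Lp_space h 2 & set_integrable lborel (torus h) (%\<xi>. m \<xi> * lattice_fourier h f \<xi>))"
  and m: "set_integrable lborel (torus h) m"
 shows "fourier_multiplier h m f (h *\<^sub>R emb n) = conv (ker (%\<eta>. m ((1 / h) *\<^sub>R \<eta>))) (%k. f (h *\<^sub>R emb k)) n"
proof -
 let ?g = "%y. inv_lattice_fourier h m (h *\<^sub>R emb n - y) * f y" and ?k = "ker (%\<eta>. m ((1 / h) *\<^sub>R \<eta>))"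
 have "fourier_multiplier h m f (h *\<^sub>R emb n) = of_real (h ^ CARD('n)) * infsum ?g (grid h)"
  using n by (simp only: fourier_multiplier_def if_False)
 also have "infsum ?g (grid h) = (\<integral>k. (?g \<circ> (%k. h *\<^sub>R emb k)) k \<partial>cs)"
  unfolding grid_eq[OF h] infsum_reindex[OF grid_inj[OF h]] by (rule cs_infsum)
 also have "... = (\<integral>k. of_real (1 / h ^ CARD('n)) * (?k (n - k) * f (h *\<^sub>R emb k)) \<partial>cs)"
 proof (intro Bochner_Integration.integral_cong refl)
  fix k
  have "h *\<^sub>R emb n - h *\<^sub>R emb k = h *\<^sub>R emb (n - k)" by (simp add: scaleR_diff_right)
  then show "(?g \<circ> (%k. h *\<^sub>R emb k)) k = of_real (1 / h ^ CARD('n)) * (?k (n - k) * f (h *\<^sub>R emb k))"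
   by (simp only: o_def inv_lattice[OF h m] mult.assoc)
 qed
 also have "... = of_real (1 / h ^ CARD('n)) * conv ?k (%k. f (h *\<^sub>R emb k)) n"
  unfolding conv_def by (rule integral_mult_right_zero)
 finally show ?thesis using h by simp
qed

lemma quotient_set_integrable:
 fixes g :: "real^'n => complex"
 assumes g: "set_integrable lborel (torus h) (%\<xi>. m' \<xi> * g \<xi>)" and h: "0 < h"
  and \<mu>: "\<mu> : borel_measurable borel" "!!\<eta>. \<eta> : torus 1 ==> norm (\<mu> \<eta>) <= B"
  and rel: "!!\<xi>. \<xi> : torus h ==> m \<xi> = \<mu> (h *\<^sub>R \<xi>) * m' \<xi>"
 shows "set_integrable lborel (torus h) (%\<xi>. m \<xi> * g \<xi>)"
 unfolding set_integrable_def
proof (rule Bochner_Integration.integrable_bound)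
 have i: "integrable lborel (%\<xi>. indicator (torus h) \<xi> *\<^sub>R (m' \<xi> * g \<xi>))" using g by (simp add: set_integrable_def)
 then show "integrable lborel (%\<xi>. of_real B * (indicator (torus h) \<xi> *\<^sub>R (m' \<xi> * g \<xi>)))" by (intro integrable_mult_right)
 have eq: "indicator (torus h) \<xi> *\<^sub>R (m \<xi> * g \<xi>) = \<mu> (h *\<^sub>R \<xi>) * (indicator (torus h) \<xi> *\<^sub>R (m' \<xi> * g \<xi>))" for \<xi>
  using rel[of \<xi>] by (cases "\<xi> : torus h") auto
 have "(%\<xi>. \<mu> (h *\<^sub>R \<xi>)) : borel_measurable lborel" using \<mu>(1) by measurable
 then show "(%\<xi>. indicator (torus h) \<xi> *\<^sub>R (m \<xi> * g \<xi>)) : borel_measurable lborel"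
  unfolding eq by (rule borel_measurable_times) (rule borel_measurable_integrable[OF i])
 show "AE \<xi> in lborel. norm (indicator (torus h) \<xi> *\<^sub>R (m \<xi> * g \<xi>)) <= norm (of_real B * (indicator (torus h) \<xi> *\<^sub>R (m' \<xi> * g \<xi>)))"
 proof (rule AE_I2)
  fix \<xi> :: "real^'n"
  show "norm (indicator (torus h) \<xi> *\<^sub>R (m \<xi> * g \<xi>)) <= norm (of_real B * (indicator (torus h) \<xi> *\<^sub>R (m' \<xi> * g \<xi>)))"
  proof (cases "\<xi> : torus h")
   case True
   then have "h *\<^sub>R \<xi> : torus 1" using h by (simp add: mem_torus)
   then have "norm (\<mu> (h *\<^sub>R \<xi>)) <= \<bar>B\<bar>" using \<mu>(2) by fastforce
   then show ?thesis unfolding eq norm_mult norm_of_real by (rule mult_right_mono) simp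
  qed simp
 qed
qed

text \<open>
  The symbol \<open>(A / h\<^sup>2) powr \<alpha>\<close> after rescaling the frequency to the unit lattice; with \<open>A = \<bar>\<eta>\<bar>\<^sup>2\<close> and
  \<open>A = \<sigma>\<close> it gives the two families of operators.
\<close>

definition psym :: "(real^'n => real) => real => real => real^'n => complex" where
 "psym A \<alpha> h \<xi> = of_real ((A (h *\<^sub>R \<xi>) / h\<^sup>2) powr \<alpha>)"

lemma nabla_pow_sym: assumes "0 < h" shows "nabla_pow h s = fourier_multiplier h (psym (%\<eta>::real^'n. (norm \<eta>)\<^sup>2) (s / 2) h)"
proof -
 have "norm \<xi> powr s = ((norm (h *\<^sub>R \<xi>))\<^sup>2 / h\<^sup>2) powr (s / 2)" for \<xi> :: "real^'n"
 proof -
  have "(norm (h *\<^sub>R \<xi>))\<^sup>2 / h\<^sup>2 = (norm \<xi>)\<^sup>2" using assms by (simp add: power_mult_distrib)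
  moreover have "((norm \<xi>)\<^sup>2) powr (s / 2) = norm \<xi> powr s"
   by (cases "\<xi> = 0") (simp_all add: powr_numeral[symmetric] powr_powr del: powr_numeral)
  ultimately show ?thesis by simp
 qed
 then show ?thesis by (simp only: nabla_pow_def psym_def[abs_def])
qed

lemma laplacian_pow_sym: "neg_laplacian_pow h r = fourier_multiplier h (psym (sg :: real^'n => real) r h)"
proof -
 have "4 / h\<^sup>2 * (\<Sum>j\<in>UNIV. (sin (h * \<xi> $ j / 2))\<^sup>2) = sg (h *\<^sub>R \<xi>) / h\<^sup>2" for \<xi> :: "real^'n"
  by (simp add: sg_def s1_def sum_distrib_left[symmetric])
 then show ?thesis by (simp only: neg_laplacian_pow_def psym_def[abs_def])
qed

lemma ratio_borel: "ratio \<alpha> : borel_measurable borel" unfolding ratio_def[abs_def] by measurable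

lemma torus_bounds:
 assumes "\<eta> : torus 1" shows "(norm \<eta>)\<^sup>2 <= 9 * sg \<eta>" "sg \<eta> <= (norm \<eta>)\<^sup>2" "(norm (\<eta> :: real^'n))\<^sup>2 <= CARD('n) * pi\<^sup>2"
proof -
 have a: "\<bar>\<eta> $ j\<bar> <= pi" for j using assms by (simp add: mem_torus)
 show "(norm \<eta>)\<^sup>2 <= 9 * sg \<eta>" using sg_ge[of \<eta>] a by simp
 show "sg \<eta> <= (norm \<eta>)\<^sup>2" by (rule sg_le)
 have "(\<eta> $ j)\<^sup>2 <= pi\<^sup>2" for j using power_mono[OF a[of j], of 2] by simp
 then show "(norm \<eta>)\<^sup>2 <= CARD('n) * pi\<^sup>2"
  unfolding norm_sq_sum using sum_bounded_above[of UNIV "%j. (\<eta> $ j)\<^sup>2" "pi\<^sup>2"] by simp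
qed

lemma ratio_bound: assumes "\<eta> : torus 1" shows "norm (ratio \<alpha> \<eta>) <= 9 powr \<bar>\<alpha>\<bar>"
proof (cases "sg \<eta> = 0")
 case False
 then have s: "0 < sg \<eta>" by (intro le_neq_trans[OF sg_nonneg]) simp
 let ?q = "(norm \<eta>)\<^sup>2 / sg \<eta>"
 have q: "1 <= ?q" "?q <= 9" using torus_bounds[OF assms] s by (auto simp: field_simps)
 have "?q powr \<alpha> <= ?q powr \<bar>\<alpha>\<bar>" using q by (intro powr_mono) auto
 also have "... <= 9 powr \<bar>\<alpha>\<bar>" using q by (intro powr_mono2) auto
 finally show ?thesis by (simp add: ratio_def)
qed (simp add: ratio_def)

lemma ratio_sym:
 assumes h: "0 < h" and \<xi>: "h *\<^sub>R \<xi> : torus 1"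
 shows "psym (%\<eta>. (norm \<eta>)\<^sup>2) \<alpha> h \<xi> = ratio \<alpha> (h *\<^sub>R \<xi>) * psym sg \<alpha> h \<xi>"
  "psym sg \<alpha> h \<xi> = ratio (- \<alpha>) (h *\<^sub>R \<xi>) * psym (%\<eta>. (norm \<eta>)\<^sup>2) \<alpha> h \<xi>"
proof -
 let ?\<eta> = "h *\<^sub>R \<xi>"
 have inv: "x powr (- \<alpha>) * x powr \<alpha> = 1" if "0 < x" for x :: real using that by (simp add: powr_add[symmetric])
 have "((norm ?\<eta>)\<^sup>2 / h\<^sup>2) powr \<alpha> = ((norm ?\<eta>)\<^sup>2 / sg ?\<eta>) powr \<alpha> * (sg ?\<eta> / h\<^sup>2) powr \<alpha> \<and>
  (sg ?\<eta> / h\<^sup>2) powr \<alpha> = ((norm ?\<eta>)\<^sup>2 / sg ?\<eta>) powr (- \<alpha>) * ((norm ?\<eta>)\<^sup>2 / h\<^sup>2) powr \<alpha>"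
 proof (cases "sg ?\<eta> = 0")
  case True
  then have "(norm ?\<eta>)\<^sup>2 = 0" using torus_bounds(1)[OF \<xi>] by (simp add: le_less)
  then show ?thesis using True by simp
 next
  case False
  then have s: "0 < sg ?\<eta>" by (intro le_neq_trans[OF sg_nonneg]) simp
  moreover have n: "0 < (norm ?\<eta>)\<^sup>2" using torus_bounds(2)[OF \<xi>] s by linarith
  ultimately have q: "0 < (norm ?\<eta>)\<^sup>2 / sg ?\<eta>" "0 < sg ?\<eta> / h\<^sup>2" using h by auto
  have "(norm ?\<eta>)\<^sup>2 / h\<^sup>2 = (norm ?\<eta>)\<^sup>2 / sg ?\<eta> * (sg ?\<eta> / h\<^sup>2)" using s by simp
  then have 1: "((norm ?\<eta>)\<^sup>2 / h\<^sup>2) powr \<alpha> = ((norm ?\<eta>)\<^sup>2 / sg ?\<eta>) powr \<alpha> * (sg ?\<eta> / h\<^sup>2) powr \<alpha>"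
   using q by (metis powr_mult less_imp_le)
  have "((norm ?\<eta>)\<^sup>2 / sg ?\<eta>) powr (- \<alpha>) * ((norm ?\<eta>)\<^sup>2 / sg ?\<eta>) powr \<alpha> = 1" by (rule inv[OF q(1)])
  then show ?thesis unfolding 1 mult.assoc[symmetric] by simp
 qed
 then show "psym (%\<eta>. (norm \<eta>)\<^sup>2) \<alpha> h \<xi> = ratio \<alpha> (h *\<^sub>R \<xi>) * psym sg \<alpha> h \<xi>"
  "psym sg \<alpha> h \<xi> = ratio (- \<alpha>) (h *\<^sub>R \<xi>) * psym (%\<eta>. (norm \<eta>)\<^sup>2) \<alpha> h \<xi>"
  unfolding psym_def ratio_def of_real_mult[symmetric] of_real_eq_iff by blast+
qed

lemma sym_integrable:
 fixes A :: "real^'n => real"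
 assumes h: "0 < h" and \<alpha>: "0 <= \<alpha>" and A: "A : borel_measurable borel" "!!\<eta>. 0 <= A \<eta>" "!!\<eta>. A \<eta> <= (norm \<eta>)\<^sup>2"
 shows "set_integrable lborel (torus h) (psym A \<alpha> h)"
 unfolding set_integrable_def
proof (rule Bochner_Integration.integrable_bound)
 let ?B = "(CARD('n) * pi\<^sup>2 / h\<^sup>2) powr \<alpha>"
 have "integrable lborel (indicator (torus h) :: real^'n => real)"
  by (intro integrable_real_indicator) (auto simp: torus_def emeasure_lborel_cbox_eq)
 then show "integrable lborel (%\<xi>::real^'n. indicator (torus h) \<xi> * ?B)" by (rule integrable_mult_left)
 show "(%\<xi>. indicator (torus h) \<xi> *\<^sub>R psym A \<alpha> h \<xi>) : borel_measurable lborel"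
  using A(1) unfolding psym_def[abs_def] by measurable
 show "AE \<xi> in lborel. norm (indicator (torus h) \<xi> *\<^sub>R psym A \<alpha> h \<xi>) <= norm (indicator (torus h) \<xi> * ?B)"
 proof (rule AE_I2)
  fix \<xi> :: "real^'n"
  show "norm (indicator (torus h) \<xi> *\<^sub>R psym A \<alpha> h \<xi>) <= norm (indicator (torus h) \<xi> * ?B)"
  proof (cases "\<xi> : torus h")
   case True
   then have "h *\<^sub>R \<xi> : torus 1" using h by (simp add: mem_torus)
   then have "A (h *\<^sub>R \<xi>) <= CARD('n) * pi\<^sup>2" using A(3) torus_bounds(3) order_trans by blast
   then have "(A (h *\<^sub>R \<xi>) / h\<^sup>2) powr \<alpha> <= ?B" using \<alpha> A(2) h by (intro powr_mono2 divide_right_mono) auto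
   then show ?thesis using True by (simp add: psym_def)
  qed simp
 qed
qed

lemma sym_W:
 assumes h: "0 < h" and \<alpha>: "0 <= \<alpha>"
 shows "W (%\<eta>::real^'n. psym sg \<alpha> h ((1 / h) *\<^sub>R \<eta>))" "W (%\<eta>::real^'n. psym (%\<eta>. (norm \<eta>)\<^sup>2) \<alpha> h ((1 / h) *\<^sub>R \<eta>))"
proof -
 have "psym sg \<alpha> h ((1 / h) *\<^sub>R \<eta>) = of_real ((1 / h\<^sup>2) powr \<alpha>) * of_real (sg \<eta> powr \<alpha>)" for \<eta> :: "real^'n"
  using h by (simp add: psym_def powr_divide flip: of_real_mult)
 then show 1: "W (%\<eta>::real^'n. psym sg \<alpha> h ((1 / h) *\<^sub>R \<eta>))" by (simp only: W_cmult[OF W_sg_powr[OF \<alpha>]])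
 have "ratio \<alpha> \<eta> * psym sg \<alpha> h ((1 / h) *\<^sub>R \<eta>) = psym (%\<eta>. (norm \<eta>)\<^sup>2) \<alpha> h ((1 / h) *\<^sub>R \<eta>)" if "\<eta> : pbox" for \<eta> :: "real^'n"
  using ratio_sym(1)[OF h, of "(1 / h) *\<^sub>R \<eta>" \<alpha>] h pbox_subset[OF that] by simp
 then show "W (%\<eta>::real^'n. psym (%\<eta>. (norm \<eta>)\<^sup>2) \<alpha> h ((1 / h) *\<^sub>R \<eta>))" by (rule W_congI[OF W_mult[OF W_ratio 1]])
qed

text \<open>
  Both descriptions of the multiplier, by the transform and by convolution, turn a factor in the
  Wiener algebra into a convolution on the outside.
\<close>

lemma multiplier_quotient:
 fixes f :: "real^'n => complex"
 assumes h: "0 < h" and \<mu>: "W \<mu>" and rel: "!!\<xi>. h *\<^sub>R \<xi> : torus 1 ==> m \<xi> = \<mu> (h *\<^sub>R \<xi>) * m' \<xi>"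
  and iff: "set_integrable lborel (torus h) (%\<xi>. m \<xi> * lattice_fourier h f \<xi>) \<longleftrightarrow> set_integrable lborel (torus h) (%\<xi>. m' \<xi> * lattice_fourier h f \<xi>)"
  and reg: "~ (f : Lp_space h 2 & set_integrable lborel (torus h) (%\<xi>. m' \<xi> * lattice_fourier h f \<xi>)) ==>
   set_integrable lborel (torus h) m & set_integrable lborel (torus h) m' & W (%\<eta>. m' ((1 / h) *\<^sub>R \<eta>))"
  and bd: "!!n. norm (f (h *\<^sub>R emb n)) <= M"
 shows "fourier_multiplier h m f (h *\<^sub>R emb n) = conv (ker \<mu>) (%n. fourier_multiplier h m' f (h *\<^sub>R emb n)) n"
proof (cases "f : Lp_space h 2 & set_integrable lborel (torus h) (%\<xi>. m' \<xi> * lattice_fourier h f \<xi>)")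
 case True
 let ?G = "%\<eta>. m' ((1 / h) *\<^sub>R \<eta>) * lattice_fourier h f ((1 / h) *\<^sub>R \<eta>)" and ?c = "complex_of_real (1 / h ^ CARD('n))"
 have G: "integrable TM ?G" using torus_TM(1)[OF h conjunct2[OF True]] .
 have "fourier_multiplier h m f (h *\<^sub>R emb n) = ?c * ker (%\<eta>. m ((1 / h) *\<^sub>R \<eta>) * lattice_fourier h f ((1 / h) *\<^sub>R \<eta>)) n"
  by (rule multiplier_transform[OF h]) (use True iff in auto)
 also have "ker (%\<eta>. m ((1 / h) *\<^sub>R \<eta>) * lattice_fourier h f ((1 / h) *\<^sub>R \<eta>)) = ker (%\<eta>. \<mu> \<eta> * ?G \<eta>)"
  by (rule ker_cong) (use rel h in \<open>simp add: pbox_subset mult.assoc\<close>)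
 also have "?c * ker (%\<eta>. \<mu> \<eta> * ?G \<eta>) n = conv (ker \<mu>) (%n. ?c * ker ?G n) n"
  unfolding ker_W_mult[OF \<mu> G] conv_cmult ..
 also have "(%n. ?c * ker ?G n) = (%n. fourier_multiplier h m' f (h *\<^sub>R emb n))"
  using multiplier_transform[OF h conjunct1[OF True] conjunct2[OF True]] by simp
 finally show ?thesis .
next
 case False
 note R = reg[OF False]
 have F': "~ (f : Lp_space h 2 & set_integrable lborel (torus h) (%\<xi>. m \<xi> * lattice_fourier h f \<xi>))" using False iff by simp
 have "ker (%\<eta>. m ((1 / h) *\<^sub>R \<eta>)) = ker (%\<eta>. \<mu> \<eta> * m' ((1 / h) *\<^sub>R \<eta>))"
  by (rule ker_cong) (use rel h in \<open>simp add: pbox_subset\<close>)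
 also have "... = conv (ker \<mu>) (ker (%\<eta>. m' ((1 / h) *\<^sub>R \<eta>)))" by (rule wien_coeff[OF wien_mult[OF \<mu>]]) (use R in blast)
 finally have k: "ker (%\<eta>. m ((1 / h) *\<^sub>R \<eta>)) = conv (ker \<mu>) (ker (%\<eta>. m' ((1 / h) *\<^sub>R \<eta>)))" .
 have W': "W (%\<eta>. m' ((1 / h) *\<^sub>R \<eta>))" using R by blast
 have 1: "fourier_multiplier h m f (h *\<^sub>R emb n) = conv (ker (%\<eta>. m ((1 / h) *\<^sub>R \<eta>))) (%k. f (h *\<^sub>R emb k)) n"
  by (rule multiplier_convolution[OF h F']) (use R in blast)
 have 2: "(%n. fourier_multiplier h m' f (h *\<^sub>R emb n)) = conv (ker (%\<eta>. m' ((1 / h) *\<^sub>R \<eta>))) (%k. f (h *\<^sub>R emb k))"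
  by (rule ext, rule multiplier_convolution[OF h False]) (use R in blast)
 show ?thesis unfolding 1 2 k by (rule conv_assoc[OF wienD(1)[OF \<mu>] wienD(1)[OF W'] bd])
qed

text \<open>
  The two symbols are bounded Borel multiples of each other on the torus, so both operators are given
  by the transform or both by convolution. In the second case the exponent is nonnegative and the
  symbols lie in the Wiener algebra.
\<close>

lemma powers_comparable:
 fixes f :: "real^'n => complex"
 assumes h: "0 < h" and p: "1 < p" and f: "f : admissible h s p"
 shows "(%n. nabla_pow h s f (h *\<^sub>R emb n)) = conv (ker (ratio (s / 2))) (%n. neg_laplacian_pow h (s / 2) f (h *\<^sub>R emb n))"
  "(%n. neg_laplacian_pow h (s / 2) f (h *\<^sub>R emb n)) = conv (ker (ratio (- (s / 2)))) (%n. nabla_pow h s f (h *\<^sub>R emb n))"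
proof -
 let ?m = "psym (%\<eta>. (norm \<eta>)\<^sup>2) (s / 2) h :: real^'n => complex" and ?m' = "psym sg (s / 2) h :: real^'n => complex"
 let ?I = "%m. set_integrable lborel (torus h) (%\<xi>. m \<xi> * lattice_fourier h f \<xi>)"
 have fp: "f : Lp_space h p" using f by (auto simp: admissible_def split: if_splits)
 have "Np p (%n. f (h *\<^sub>R emb n)) < \<infinity>" using fp Lp_space_lattice[OF h, of p f] p by simp
 then obtain M where M: "!!n. norm (f (h *\<^sub>R emb n)) <= M" using lp_imp_bounded[of "%n. f (h *\<^sub>R emb n)" p] p unfolding Np_def by auto
 have tor: "h *\<^sub>R \<xi> : torus 1" if "\<xi> : torus h" for \<xi> using that h by (simp add: mem_torus)
 have iff: "?I ?m \<longleftrightarrow> ?I ?m'"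
 proof
  show "?I ?m ==> ?I ?m'"
   by (rule quotient_set_integrable[OF _ h ratio_borel ratio_bound ratio_sym(2)[OF h]]) (use tor in auto)
  show "?I ?m' ==> ?I ?m"
   by (rule quotient_set_integrable[OF _ h ratio_borel ratio_bound ratio_sym(1)[OF h]]) (use tor in auto)
 qed
 have s0: "0 <= s / 2" if "~ (f : Lp_space h 2 & ?I ?m')"
 proof (rule ccontr)
  assume "~ 0 <= s / 2"
  then have "f : Lp_space h 2" "set_integrable lborel (torus h) (%\<xi>. of_real (norm \<xi> powr s) * lattice_fourier h f \<xi>)"
   using f by (auto simp: admissible_def split: if_splits)
  moreover have "?m \<xi> = of_real (norm \<xi> powr s)" for \<xi>
  proof -
   have "(norm (h *\<^sub>R \<xi>))\<^sup>2 / h\<^sup>2 = (norm \<xi>)\<^sup>2" using h by (simp add: power_mult_distrib)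
   moreover have "((norm \<xi>)\<^sup>2) powr (s / 2) = norm \<xi> powr s"
    by (cases "\<xi> = 0") (simp_all add: powr_numeral[symmetric] powr_powr del: powr_numeral)
   ultimately show ?thesis by (simp add: psym_def)
  qed
  ultimately show False using that iff by simp
 qed
 have reg: "set_integrable lborel (torus h) ?m & set_integrable lborel (torus h) ?m' & W (%\<eta>. ?m' ((1 / h) *\<^sub>R \<eta>)) & W (%\<eta>. ?m ((1 / h) *\<^sub>R \<eta>))"
  if "~ (f : Lp_space h 2 & ?I ?m')"
 proof (intro conjI)
  show "set_integrable lborel (torus h) ?m" by (rule sym_integrable[OF h s0[OF that]]) auto
  show "set_integrable lborel (torus h) ?m'" by (rule sym_integrable[OF h s0[OF that]]) (auto intro: sg_le)
 qed (rule sym_W[OF h s0[OF that]])+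
 show "(%n. nabla_pow h s f (h *\<^sub>R emb n)) = conv (ker (ratio (s / 2))) (%n. neg_laplacian_pow h (s / 2) f (h *\<^sub>R emb n))"
  unfolding nabla_pow_sym[OF h] laplacian_pow_sym
  by (rule ext, rule multiplier_quotient[OF h W_ratio ratio_sym(1)[OF h] iff _ M]) (use reg in blast)+
 show "(%n. neg_laplacian_pow h (s / 2) f (h *\<^sub>R emb n)) = conv (ker (ratio (- (s / 2)))) (%n. nabla_pow h s f (h *\<^sub>R emb n))"
  unfolding nabla_pow_sym[OF h] laplacian_pow_sym
  by (rule ext, rule multiplier_quotient[OF h W_ratio ratio_sym(2)[OF h] iff[symmetric] _ M]) (use reg iff in blast)+
qed

section \<open>The Fourier transform of square summable functions\<close>

lemma trig_nn:
 fixes a :: "int^'n => complex"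
 assumes B: "finite B"
 shows "(\<integral>\<^sup>+\<xi>. ennreal ((norm (\<Sum>n\<in>B. a n * chr n \<xi>))\<^sup>2) \<partial>TM) = ennreal ((2 * pi) ^ CARD('n) * (\<Sum>n\<in>B. (norm (a n))\<^sup>2))"
  "integrable TM (%\<xi>. (norm (\<Sum>n\<in>B. a n * chr n \<xi>))\<^sup>2)"
proof -
 have b: "norm (\<Sum>n\<in>B. a n * chr n \<xi>) <= (\<Sum>n\<in>B. norm (a n))" for \<xi>
  by (rule order_trans[OF norm_sum]) (simp add: norm_mult)
 show i: "integrable TM (%\<xi>. (norm (\<Sum>n\<in>B. a n * chr n \<xi>))\<^sup>2)"
  by (rule TM.integrable_const_bound[where B = "(\<Sum>n\<in>B. norm (a n))\<^sup>2"]) (auto intro!: AE_I2 power_mono b)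
 have "(\<integral>\<xi>. (norm (\<Sum>n\<in>B. a n * chr n \<xi>))\<^sup>2 \<partial>TM) = (2 * pi) ^ CARD('n) * (\<Sum>n\<in>B. (norm (a n))\<^sup>2)"
  by (rule parseval_finite[OF TM.finite_measure_axioms B]; (rule chr_orth | simp))
 then show "(\<integral>\<^sup>+\<xi>. ennreal ((norm (\<Sum>n\<in>B. a n * chr n \<xi>))\<^sup>2) \<partial>TM) = ennreal ((2 * pi) ^ CARD('n) * (\<Sum>n\<in>B. (norm (a n))\<^sup>2))"
  using nn_integral_eq_integral[OF i] by simp
qed

lemma square_summable_tail:
 fixes F :: "int^'n => complex"
 assumes F: "Np 2 F < \<infinity>" and e: "0 < e"
 shows "EX A. finite A & (ALL B. finite B --> B \<inter> A = {} --> (\<Sum>n\<in>B. (norm (F n))\<^sup>2) <= e)"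
proof -
 let ?u = "%n. (norm (F n))\<^sup>2"
 have "integrable cs ?u" using F by (simp add: integrable_iff_bounded Np_def powr_numeral)
 then have s: "?u summable_on UNIV" by (simp add: cs_infsum_real(1))
 then have "(sum ?u \<longlongrightarrow> infsum ?u UNIV) (finite_subsets_at_top UNIV)" using has_sum_infsum has_sum_def by blast
 then have "eventually (%A. infsum ?u UNIV - e < sum ?u A) (finite_subsets_at_top UNIV)" using e by (intro order_tendstoD(1)) auto
 then obtain A where A: "finite A" "infsum ?u UNIV - e < sum ?u A" by (auto simp: eventually_finite_subsets_at_top)
 have "(\<Sum>n\<in>B. ?u n) <= e" if B: "finite B" "B \<inter> A = {}" for B
 proof -
  have "sum ?u B + sum ?u A = sum ?u (B \<union> A)" using B A(1) by (simp add: sum.union_disjoint)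
  also have "... <= infsum ?u UNIV" by (rule finite_sum_le_infsum[OF s]) (use B A in auto)
  finally show ?thesis using A(2) by linarith
 qed
 then show ?thesis using A(1) by blast
qed

text \<open>
  Partial sums with tails at most \<open>(1 / 4) ^ k\<close> have differences \<open>D k\<close> with
  \<open>\<bar>D k\<bar> \<le> (1 / 2) ^ k + 2 ^ k * \<bar>D k\<bar>\<^sup>2\<close>, whose integrals are summable. Hence the partial sums
  converge almost everywhere, and Fatou's lemma shows that the limit is also the limit in the mean.
\<close>

lemma riesz_fischer:
 fixes F :: "int^'n => complex"
 assumes F: "Np 2 F < \<infinity>"
 shows "\<exists>g\<in>borel_measurable borel. \<forall>e>0. EX A. finite A & (ALL B. finite B --> A <= B -->
  (\<integral>\<^sup>+\<xi>. ennreal ((norm (g \<xi> - (\<Sum>n\<in>B. F n * chr n \<xi>)))\<^sup>2) \<partial>TM) <= ennreal e)"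
proof -
 let ?c = "(2 * pi) ^ CARD('n) :: real"
 have c: "0 < ?c" by simp
 have "ALL k. EX A. finite A & (ALL B. finite B --> B \<inter> A = {} --> (\<Sum>n\<in>B. (norm (F n))\<^sup>2) <= (1 / 4) ^ k)"
  using square_summable_tail[OF F] by simp
 then obtain A0 where A0: "!!k. finite (A0 k)" "!!k B. finite B ==> B \<inter> A0 k = {} ==> (\<Sum>n\<in>B. (norm (F n))\<^sup>2) <= (1 / 4) ^ k"
  by metis
 define A where "A k = (\<Union>i\<le>k. A0 i)" for k
 have Af: "finite (A k)" for k unfolding A_def using A0(1) by simp
 have Am: "A k <= A l" if "k <= l" for k l using that unfolding A_def by fastforce
 have At: "(\<Sum>n\<in>B. (norm (F n))\<^sup>2) <= (1 / 4) ^ k" if "finite B" "B \<inter> A k = {}" for k B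
  by (rule A0(2)[OF that(1)]) (use that(2) in \<open>auto simp: A_def\<close>)
 define S where "S B \<xi> = (\<Sum>n\<in>B. F n * chr n \<xi>)" for B and \<xi> :: "real^'n"
 have Sm: "S B : borel_measurable borel" for B unfolding S_def[abs_def] by measurable
 define D where "D k \<xi> = S (A (Suc k)) \<xi> - S (A k) \<xi>" for k and \<xi> :: "real^'n"
 have Dm: "D k : borel_measurable TM" for k unfolding D_def[abs_def] by (intro TM_borel borel_measurable_diff Sm)
 have D2: "(\<integral>\<^sup>+\<xi>. ennreal ((norm (D k \<xi>))\<^sup>2) \<partial>TM) <= ennreal (?c * (1 / 4) ^ k)" for k
 proof -
  have D: "D k \<xi> = (\<Sum>n\<in>A (Suc k) - A k. F n * chr n \<xi>)" for \<xi>
   unfolding D_def S_def using sum_diff[OF Af Am[of k "Suc k"], of "%n. F n * chr n \<xi>"] by simp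
  have "(\<integral>\<^sup>+\<xi>. ennreal ((norm (D k \<xi>))\<^sup>2) \<partial>TM) = ennreal (?c * (\<Sum>n\<in>A (Suc k) - A k. (norm (F n))\<^sup>2))"
   unfolding D by (rule trig_nn(1)) (use Af in auto)
  also have "... <= ennreal (?c * (1 / 4) ^ k)"
   using c by (intro ennreal_leI mult_left_mono At) (auto simp: Af)
  finally show ?thesis .
 qed
 have D1: "(\<integral>\<^sup>+\<xi>. ennreal (norm (D k \<xi>)) \<partial>TM) <= ennreal ((enn2real (emeasure TM (pbox :: (real^'n) set)) + ?c) * (1 / 2) ^ k)" for k
 proof -
  let ?v = "enn2real (emeasure TM (pbox :: (real^'n) set))"
  have v: "emeasure TM (pbox :: (real^'n) set) = ennreal ?v" using emeasure_TM[where 'n = 'n] by (cases "emeasure TM (pbox :: (real^'n) set)") auto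
  have pt: "x <= (1 / 2) ^ k + 2 ^ k * x\<^sup>2" if "0 <= x" for x :: real
  proof (cases "x <= (1 / 2) ^ k")
   case True then show ?thesis by (simp add: add_increasing2)
  next
   case False
   then have "1 <= 2 ^ k * x" by (simp add: power_one_over field_simps)
   then have "x * 1 <= x * (2 ^ k * x)" using that by (rule mult_left_mono)
   then show ?thesis by (simp add: power2_eq_square mult_ac add_increasing)
  qed
  have "(\<integral>\<^sup>+\<xi>. ennreal (norm (D k \<xi>)) \<partial>TM) <= (\<integral>\<^sup>+\<xi>. ennreal ((1 / 2) ^ k) + ennreal (2 ^ k) * ennreal ((norm (D k \<xi>))\<^sup>2) \<partial>TM)"
  proof (rule nn_integral_mono)
   fix \<xi>
   have "ennreal (norm (D k \<xi>)) <= ennreal ((1 / 2) ^ k * 1 + 2 ^ k * (norm (D k \<xi>))\<^sup>2)" using pt[of "norm (D k \<xi>)"] by (intro ennreal_leI) simp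
   also have "... = ennreal ((1 / 2) ^ k) * ennreal 1 + ennreal (2 ^ k) * ennreal ((norm (D k \<xi>))\<^sup>2)" by (rule ennreal_comb) auto
   finally show "ennreal (norm (D k \<xi>)) <= ennreal ((1 / 2) ^ k) + ennreal (2 ^ k) * ennreal ((norm (D k \<xi>))\<^sup>2)" by simp
  qed
  also have "... = ennreal ((1 / 2) ^ k) * emeasure TM (pbox :: (real^'n) set) + ennreal (2 ^ k) * (\<integral>\<^sup>+\<xi>. ennreal ((norm (D k \<xi>))\<^sup>2) \<partial>TM)"
   using Dm[of k] by (subst nn_integral_add) (auto simp: nn_integral_cmult)
  also have "... <= ennreal ((1 / 2) ^ k) * ennreal ?v + ennreal (2 ^ k) * ennreal (?c * (1 / 4) ^ k)"
   unfolding v[symmetric] by (intro add_left_mono mult_left_mono D2) simp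
  also have "... = ennreal ((1 / 2) ^ k * ?v + 2 ^ k * (?c * (1 / 4) ^ k))" by (rule ennreal_comb[symmetric]) (use c in auto)
  also have "(1 / 2) ^ k * ?v + 2 ^ k * (?c * (1 / 4) ^ k) = (?v + ?c) * (1 / 2) ^ k"
  proof -
   have e: "2 ^ k * (1 / 4) ^ k = ((1 / 2) ^ k :: real)" by (simp flip: power_mult_distrib)
   have "2 ^ k * (?c * (1 / 4) ^ k) = ?c * (2 ^ k * (1 / 4) ^ k)" by (rule mult.left_commute)
   then have e2: "2 ^ k * (?c * (1 / 4) ^ k) = ?c * (1 / 2) ^ k" unfolding e .
   show ?thesis unfolding e2 distrib_right by (simp only: mult.commute)
  qed
  finally show ?thesis .
 qed
 have "(\<integral>\<^sup>+\<xi>. (\<Sum>k. ennreal (norm (D k \<xi>))) \<partial>TM) = (\<Sum>k. \<integral>\<^sup>+\<xi>. ennreal (norm (D k \<xi>)) \<partial>TM)"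
  using Dm by (intro nn_integral_suminf) auto
 also have "... <= (\<Sum>k. ennreal ((enn2real (emeasure TM (pbox :: (real^'n) set)) + ?c) * (1 / 2) ^ k))"
  by (intro suminf_le D1) auto
 also have "... < \<infinity>"
  using c by (subst suminf_ennreal2) (auto intro!: summable_mult summable_geometric add_nonneg_nonneg)
 finally have fin: "(\<integral>\<^sup>+\<xi>. (\<Sum>k. ennreal (norm (D k \<xi>))) \<partial>TM) ~= \<infinity>" by simp
 have meas: "(%\<xi>. \<Sum>k. ennreal (norm (D k \<xi>))) : borel_measurable TM" using Dm by measurable
 define g where "g \<xi> = lim (%k. S (A k) \<xi>)" for \<xi>
 have gm: "g : borel_measurable borel" unfolding g_def[abs_def] by (rule borel_measurable_lim_metric) (rule Sm)
 have AEl: "AE \<xi> in TM. (%k. S (A k) \<xi>) \<longlonglongrightarrow> g \<xi>"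
  using nn_integral_noteq_infinite[OF meas fin]
 proof eventually_elim
  fix \<xi> assume "(\<Sum>k. ennreal (norm (D k \<xi>))) ~= \<infinity>"
  then have "summable (%k. norm (D k \<xi>))" by (intro summable_suminf_not_top) auto
  then have "summable (%k. D k \<xi>)" by (rule summable_norm_cancel)
  then have "convergent (%k. \<Sum>i<k. D i \<xi>)" by (simp add: summable_iff_convergent)
  then obtain l where "(%k. \<Sum>i<k. D i \<xi>) \<longlonglongrightarrow> l" by (auto simp: convergent_def)
  then have "(%k. S (A 0) \<xi> + (\<Sum>i<k. D i \<xi>)) \<longlonglongrightarrow> S (A 0) \<xi> + l" by (intro tendsto_intros)
  moreover have "S (A 0) \<xi> + (\<Sum>i<k. D i \<xi>) = S (A k) \<xi>" for k
   unfolding D_def sum_lessThan_telescope[of "%i. S (A i) \<xi>"] by simp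
  ultimately have "convergent (%k. S (A k) \<xi>)" by (auto simp: convergent_def)
  then show "(%k. S (A k) \<xi>) \<longlonglongrightarrow> g \<xi>" unfolding g_def by (simp add: convergent_LIMSEQ_iff)
 qed
 have main: "(\<integral>\<^sup>+\<xi>. ennreal ((norm (g \<xi> - S B \<xi>))\<^sup>2) \<partial>TM) <= ennreal (?c * (1 / 4) ^ j)" if B: "finite B" "A j <= B" for B j
 proof -
  let ?q = "%k \<xi>. ennreal ((norm (S (A k) \<xi> - S B \<xi>))\<^sup>2)"
  have ev: "\<forall>\<^sub>F k in sequentially. (\<integral>\<^sup>+\<xi>. ?q k \<xi> \<partial>TM) <= ennreal (?c * (1 / 4) ^ j)"
   using eventually_ge_at_top[of j]
  proof eventually_elim
   fix k assume k: "j <= k"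
   define a where "a n = (if n : A k then F n else 0) - (if n : B then F n else 0)" for n
   let ?U = "A k \<union> B"
   have U: "finite ?U" using Af B by simp
   have 1: "S (A k) \<xi> = (\<Sum>n\<in>?U. (if n : A k then F n else 0) * chr n \<xi>)" for \<xi>
    unfolding S_def by (rule sum.mono_neutral_cong_left[OF U]) auto
   have 2: "S B \<xi> = (\<Sum>n\<in>?U. (if n : B then F n else 0) * chr n \<xi>)" for \<xi>
    unfolding S_def by (rule sum.mono_neutral_cong_left[OF U]) auto
   have "S (A k) \<xi> - S B \<xi> = (\<Sum>n\<in>?U. a n * chr n \<xi>)" for \<xi>
    unfolding 1 2 a_def by (simp only: left_diff_distrib sum_subtractf)
   then have "(\<integral>\<^sup>+\<xi>. ?q k \<xi> \<partial>TM) = ennreal (?c * (\<Sum>n\<in>?U. (norm (a n))\<^sup>2))" by (simp only: trig_nn(1)[OF U])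
   also have "(\<Sum>n\<in>?U. (norm (a n))\<^sup>2) = (\<Sum>n\<in>?U - A j. (norm (a n))\<^sup>2)"
    by (rule sum.mono_neutral_right[OF U]) (use Am[OF k] B in \<open>auto simp: a_def\<close>)
   also have "ennreal (?c * (\<Sum>n\<in>?U - A j. (norm (a n))\<^sup>2)) <= ennreal (?c * (1 / 4) ^ j)"
   proof (intro ennreal_leI mult_left_mono)
    have "(\<Sum>n\<in>?U - A j. (norm (a n))\<^sup>2) <= (\<Sum>n\<in>?U - A j. (norm (F n))\<^sup>2)" by (rule sum_mono) (auto simp: a_def)
    also have "... <= (1 / 4) ^ j" by (rule At) (use U in auto)
    finally show "(\<Sum>n\<in>?U - A j. (norm (a n))\<^sup>2) <= (1 / 4) ^ j" .
   qed (use c in simp)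
   finally show "(\<integral>\<^sup>+\<xi>. ?q k \<xi> \<partial>TM) <= ennreal (?c * (1 / 4) ^ j)" .
  qed
  have "(\<integral>\<^sup>+\<xi>. ennreal ((norm (g \<xi> - S B \<xi>))\<^sup>2) \<partial>TM) = (\<integral>\<^sup>+\<xi>. liminf (%k. ?q k \<xi>) \<partial>TM)"
  proof (rule nn_integral_cong_AE)
   show "AE \<xi> in TM. ennreal ((norm (g \<xi> - S B \<xi>))\<^sup>2) = liminf (%k. ?q k \<xi>)"
    using AEl
   proof eventually_elim
    fix \<xi> assume "(%k. S (A k) \<xi>) \<longlonglongrightarrow> g \<xi>"
    then have "(%k. ?q k \<xi>) \<longlonglongrightarrow> ennreal ((norm (g \<xi> - S B \<xi>))\<^sup>2)" by (intro tendsto_intros)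
    then show "ennreal ((norm (g \<xi> - S B \<xi>))\<^sup>2) = liminf (%k. ?q k \<xi>)" by (intro lim_imp_Liminf[symmetric]) auto
   qed
  qed
  also have "... <= liminf (%k. \<integral>\<^sup>+\<xi>. ?q k \<xi> \<partial>TM)"
   using TM_borel[OF Sm] by (intro nn_integral_liminf) measurable
  also have "... <= limsup (%k. \<integral>\<^sup>+\<xi>. ?q k \<xi> \<partial>TM)" by (rule Liminf_le_Limsup) simp
  also have "... <= ennreal (?c * (1 / 4) ^ j)" by (rule Limsup_bounded[OF ev])
  finally show ?thesis .
 qed
 show ?thesis
 proof (intro bexI[of _ g] allI impI)
  fix e :: real assume e: "0 < e"
  obtain j where "(1 / 4) ^ j < e / ?c" using real_arch_pow_inv[of "e / ?c" "1 / 4"] e c by auto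
  then have "?c * (1 / 4) ^ j <= e" using c by (simp add: pos_less_divide_eq mult.commute less_imp_le)
  then have j: "ennreal (?c * (1 / 4) ^ j) <= ennreal e" by (rule ennreal_leI)
  show "EX A. finite A & (ALL B. finite B --> A <= B -->
    (\<integral>\<^sup>+\<xi>. ennreal ((norm (g \<xi> - (\<Sum>n\<in>B. F n * chr n \<xi>)))\<^sup>2) \<partial>TM) <= ennreal e)"
   using Af[of j] order_trans[OF main j] unfolding S_def by blast
 qed (rule gm)
qed

lemma TM_torus:
 fixes V :: "real^'n => real"
 assumes h: "0 < h" and V: "V : borel_measurable borel" "integrable TM V"
 shows "set_integrable lborel (torus h) (%\<xi>. V (h *\<^sub>R \<xi>))"
  "(LINT \<xi>:torus h|lborel. V (h *\<^sub>R \<xi>)) = (1 / h ^ CARD('n)) * (\<integral>\<eta>. V \<eta> \<partial>TM)"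
proof -
 have "integrable lborel (%\<eta>. indicator pbox \<eta> *\<^sub>R V \<eta>)" using V(2) unfolding TM_def by (subst (asm) integrable_restrict_space) auto
 moreover have "AE \<eta> in lborel. indicator pbox \<eta> *\<^sub>R V \<eta> = indicator (torus 1) \<eta> *\<^sub>R V \<eta>"
  using AE_not_in[OF torus_null] by eventually_elim (use pbox_subset in \<open>auto simp: indicator_def\<close>)
 ultimately have "integrable lborel (%\<eta>. indicator (torus 1) \<eta> *\<^sub>R V \<eta>)"
  using V(1) by (subst (asm) integrable_cong_AE[where g = "%\<eta>. indicator (torus 1) \<eta> *\<^sub>R V \<eta>"]) auto
 from lborel_scale(1)[OF h this]
 have i: "integrable lborel (%\<xi>. indicator (torus 1) (h *\<^sub>R \<xi>) *\<^sub>R V (h *\<^sub>R \<xi>))" .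
 have "indicator (torus 1) (h *\<^sub>R \<xi>) = (indicator (torus h) \<xi> :: real)" for \<xi> :: "real^'n" using h by (simp add: indicator_def mem_torus)
 then show s: "set_integrable lborel (torus h) (%\<xi>. V (h *\<^sub>R \<xi>))" using i by (simp add: set_integrable_def)
 show "(LINT \<xi>:torus h|lborel. V (h *\<^sub>R \<xi>)) = (1 / h ^ CARD('n)) * (\<integral>\<eta>. V \<eta> \<partial>TM)"
  using torus_TM(2)[OF h s] h by simp
qed

lemma grid_trig:
 fixes f :: "real^'n => complex"
 assumes h: "0 < h"
 shows "(\<Sum>x\<in>(%n. h *\<^sub>R emb n) ` N. f x * exp (- (\<i> * of_real (x \<bullet> \<xi>)))) = (\<Sum>n\<in>N. f (h *\<^sub>R emb n) * chr n (h *\<^sub>R \<xi>))"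
proof -
 have "exp (- (\<i> * of_real ((h *\<^sub>R emb n) \<bullet> \<xi>))) = chr n (h *\<^sub>R \<xi>)" for n :: "int^'n" by (simp add: chr_def cis_conv_exp)
 then show ?thesis by (subst sum.reindex[OF inj_on_subset[OF grid_inj[OF h] subset_UNIV]]) simp
qed

lemma norm_diff_square: "(norm (a - b))\<^sup>2 <= 2 * (norm a)\<^sup>2 + 2 * (norm b)\<^sup>2" for a b :: complex
proof -
 have "(norm (a - b))\<^sup>2 <= (norm a + norm b)\<^sup>2" by (intro power_mono norm_triangle_ineq4) auto
 also have "... <= 2 * (norm a)\<^sup>2 + 2 * (norm b)\<^sup>2" using sum_squares_bound[of "norm a" "norm b"] by (simp add: power2_sum)
 finally show ?thesis .
qed

lemma fourier_exists:
 fixes f :: "real^'n => complex"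
 assumes h: "0 < h" and f: "f : Lp_space h 2" shows "EX g. is_L2_fourier h f g"
proof -
 define F where "F n = f (h *\<^sub>R emb n)" for n
 have "Np 2 F < \<infinity>" using f Lp_space_lattice[OF h, of 2 f] by (simp add: F_def[abs_def])
 then obtain g where gm: "g : borel_measurable borel"
  and g: "!!e. 0 < e ==> EX A. finite A & (ALL B. finite B --> A <= B -->
   (\<integral>\<^sup>+\<xi>. ennreal ((norm (g \<xi> - (\<Sum>n\<in>B. F n * chr n \<xi>)))\<^sup>2) \<partial>TM) <= ennreal e)"
  using riesz_fischer by blast
 define S where "S B \<xi> = (\<Sum>n\<in>B. F n * chr n \<xi>)" for B and \<xi> :: "real^'n"
 have Sm: "S B : borel_measurable borel" for B unfolding S_def[abs_def] by measurable
 define V where "V B \<xi> = (norm (g \<xi> - S B \<xi>))\<^sup>2" for B \<xi>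
 have Vm: "V B : borel_measurable borel" for B unfolding V_def[abs_def] using gm Sm by measurable
 have VI: "integrable TM (V B) & (\<integral>\<xi>. V B \<xi> \<partial>TM) <= e" if "(\<integral>\<^sup>+\<xi>. ennreal (V B \<xi>) \<partial>TM) <= ennreal e" "0 <= e" for B e
 proof
  have "(\<integral>\<^sup>+\<xi>. ennreal (V B \<xi>) \<partial>TM) < \<infinity>" using that(1) by (rule le_less_trans) simp
  then show i: "integrable TM (V B)" by (intro integrableI_nonneg TM_borel[OF Vm]) (auto simp: V_def)
  show "(\<integral>\<xi>. V B \<xi> \<partial>TM) <= e" using that nn_integral_eq_integral[OF i] by (simp add: V_def[abs_def])
 qed
 obtain A where "finite A" "(\<integral>\<^sup>+\<xi>. ennreal (V A \<xi>) \<partial>TM) <= ennreal 1" using g[of 1] unfolding V_def S_def by fastforce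
 then have VA: "integrable TM (V A)" and A: "finite A" using VI[of A 1] by auto
 have g2: "integrable TM (%\<xi>. (norm (g \<xi>))\<^sup>2)"
 proof (rule Bochner_Integration.integrable_bound)
  show "integrable TM (%\<xi>. 2 * V A \<xi> + 2 * (norm (S A \<xi>))\<^sup>2)"
   using VA trig_nn(2)[OF A, of F] unfolding S_def by auto
  show "(%\<xi>. (norm (g \<xi>))\<^sup>2) : borel_measurable TM" using TM_borel[OF gm] by measurable
  have "(norm (g \<xi>))\<^sup>2 <= 2 * V A \<xi> + 2 * (norm (S A \<xi>))\<^sup>2" for \<xi>
   using norm_diff_square[of "g \<xi> - S A \<xi>" "- S A \<xi>"] by (simp add: V_def)
  then show "AE \<xi> in TM. norm ((norm (g \<xi>))\<^sup>2) <= norm (2 * V A \<xi> + 2 * (norm (S A \<xi>))\<^sup>2)"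
   by (intro AE_I2) (simp add: V_def)
 qed
 let ?H = "h ^ CARD('n)"
 have H: "0 < ?H" using h by simp
 define u where "u \<xi> = of_real ?H * g (h *\<^sub>R \<xi>)" for \<xi>
 show ?thesis
 proof (intro exI[of _ u], unfold is_L2_fourier_def, intro conjI)
  show "set_borel_measurable lborel (torus h) u" unfolding set_borel_measurable_def u_def using gm by measurable
  have nu: "(norm (u \<xi>))\<^sup>2 = ?H\<^sup>2 * (norm (g (h *\<^sub>R \<xi>)))\<^sup>2" for \<xi>
   unfolding u_def norm_mult norm_of_real abs_of_pos[OF H] by (rule power_mult_distrib)
  have su: "set_integrable lborel (torus h) (%\<xi>. (norm (g (h *\<^sub>R \<xi>)))\<^sup>2)" by (rule TM_torus(1)[OF h _ g2]) (use gm in measurable)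
  show "set_integrable lborel (torus h) (%\<xi>. (norm (u \<xi>))\<^sup>2)"
   unfolding nu by (rule set_integrable_mult_right) (rule su)
  show "((%X. LINT \<xi>:torus h|lborel. (norm (u \<xi> - of_real ?H * (\<Sum>x\<in>X. f x * exp (- (\<i> * of_real (x \<bullet> \<xi>))))))\<^sup>2) \<longlongrightarrow> 0)
   (finite_subsets_at_top (grid h))"
  proof (rule tendstoI)
   fix e :: real assume e: "0 < e"
   have e': "0 < e / (2 * ?H)" using e H by simp
   then obtain B where B: "finite B" "!!N. finite N ==> B <= N ==> (\<integral>\<^sup>+\<xi>. ennreal (V N \<xi>) \<partial>TM) <= ennreal (e / (2 * ?H))"
    using g[OF e'] unfolding V_def S_def by blast
   let ?i = "%n::int^'n. h *\<^sub>R emb n"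
   have "dist (LINT \<xi>:torus h|lborel. (norm (u \<xi> - of_real ?H * (\<Sum>x\<in>X. f x * exp (- (\<i> * of_real (x \<bullet> \<xi>))))))\<^sup>2) 0 < e"
    if X: "finite X" "?i ` B <= X" "X <= grid h" for X
   proof -
    define N where "N = ?i -` X"
    have XN: "X = ?i ` N" using X(3) unfolding N_def grid_eq[OF h] by blast
    have N: "finite N" "B <= N" unfolding N_def using X finite_vimageI[OF X(1) grid_inj[OF h]] by auto
    have vi: "integrable TM (V N)" "(\<integral>\<xi>. V N \<xi> \<partial>TM) <= e / (2 * ?H)" using VI[OF B(2)[OF N]] e' by auto
    have q: "(norm (u \<xi> - of_real ?H * (\<Sum>x\<in>X. f x * exp (- (\<i> * of_real (x \<bullet> \<xi>))))))\<^sup>2 = ?H\<^sup>2 * V N (h *\<^sub>R \<xi>)" for \<xi>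
     unfolding XN grid_trig[OF h] u_def right_diff_distrib[symmetric] norm_mult norm_of_real abs_of_pos[OF H] V_def S_def F_def
     by (rule power_mult_distrib)
    have "(LINT \<xi>:torus h|lborel. (norm (u \<xi> - of_real ?H * (\<Sum>x\<in>X. f x * exp (- (\<i> * of_real (x \<bullet> \<xi>))))))\<^sup>2) = ?H\<^sup>2 * ((1 / ?H) * (\<integral>\<xi>. V N \<xi> \<partial>TM))"
     unfolding q set_integral_mult_right TM_torus(2)[OF h Vm vi(1)] ..
    also have "... = ?H * (\<integral>\<xi>. V N \<xi> \<partial>TM)" using H by (simp add: power2_eq_square)
    finally have eq: "(LINT \<xi>:torus h|lborel. (norm (u \<xi> - of_real ?H * (\<Sum>x\<in>X. f x * exp (- (\<i> * of_real (x \<bullet> \<xi>))))))\<^sup>2) = ?H * (\<integral>\<xi>. V N \<xi> \<partial>TM)" .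
    have "?H * (\<integral>\<xi>. V N \<xi> \<partial>TM) <= ?H * (e / (2 * ?H))" using vi(2) H by (intro mult_left_mono) auto
    also have "?H * (e / (2 * ?H)) = e / 2" using h by simp
    finally have "?H * (\<integral>\<xi>. V N \<xi> \<partial>TM) < e" using e by linarith
    moreover have "0 <= ?H * (\<integral>\<xi>. V N \<xi> \<partial>TM)" using H by (intro mult_nonneg_nonneg integral_nonneg_AE) (auto simp: V_def)
    ultimately show ?thesis unfolding eq dist_real_def by simp
   qed
   then show "\<forall>\<^sub>F X in finite_subsets_at_top (grid h). dist (LINT \<xi>:torus h|lborel. (norm (u \<xi> - of_real ?H * (\<Sum>x\<in>X. f x * exp (- (\<i> * of_real (x \<bullet> \<xi>))))))\<^sup>2) 0 < e"
    unfolding eventually_finite_subsets_at_top using B(1) grid_eq[OF h] by (intro exI[of _ "?i ` B"]) auto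
  qed
 qed
qed

text \<open>
  The coefficients of \<open>\<mu> * (G - S N)\<close> are bounded by the integral of \<open>\<bar>G - S N\<bar>\<close>, which is at most
  \<open>\<delta> v + I N / \<delta>\<close> for every positive \<open>\<delta>\<close>, where \<open>v\<close> is the volume of the cube and \<open>I N\<close> the squared
  distance in the mean.
\<close>

lemma L2_fourier_multiplier:
 fixes f :: "real^'n => complex"
 assumes h: "0 < h" and g: "is_L2_fourier h f g" and M: "W (%\<eta>. m ((1 / h) *\<^sub>R \<eta>))"
  and mg: "set_integrable lborel (torus h) (%\<xi>. m \<xi> * g \<xi>)" and bd: "!!n. norm (f (h *\<^sub>R emb n)) <= R"
 shows "of_real (1 / h ^ CARD('n)) * ker (%\<eta>. m ((1 / h) *\<^sub>R \<eta>) * g ((1 / h) *\<^sub>R \<eta>)) n = conv (ker (%\<eta>. m ((1 / h) *\<^sub>R \<eta>))) (%k. f (h *\<^sub>R emb k)) n"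
proof -
 let ?H = "h ^ CARD('n)" and ?i = "%n::int^'n. h *\<^sub>R emb n" and ?c = "(2 * pi) ^ CARD('n) :: real"
 have H: "0 < ?H" and c: "0 < ?c" using h by auto
 define G where "G \<eta> = g ((1 / h) *\<^sub>R \<eta>)" for \<eta>
 define \<mu> where "\<mu> \<eta> = m ((1 / h) *\<^sub>R \<eta>)" for \<eta>
 define F where "F n = f (?i n)" for n
 define S where "S N \<eta> = (\<Sum>n\<in>N. F n * chr n \<eta>)" for N and \<eta> :: "real^'n"
 define K where "K = enn2real (an1 \<mu>)"
 have W\<mu>: "W \<mu>" using M by (simp add: \<mu>_def[abs_def])
 have K: "norm (\<mu> \<eta>) <= K" if "\<eta> : pbox" for \<eta>
  using W_norm_le[OF W\<mu> that] W_an1[OF W\<mu>] unfolding K_def by (cases "an1 \<mu>") auto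
 have K0: "0 <= K" by (simp add: K_def)
 define E where "E X \<xi> = (norm (g \<xi> - of_real ?H * (\<Sum>x\<in>X. f x * exp (- (\<i> * of_real (x \<bullet> \<xi>))))))\<^sup>2" for X \<xi>
 define I where "I N = (\<integral>\<eta>. (norm (G \<eta> - of_real ?H * S N \<eta>))\<^sup>2 \<partial>TM)" for N
 have Ei: "set_integrable lborel (torus h) (E X)" for X
  unfolding set_integrable_def
 proof (rule Bochner_Integration.integrable_bound)
  let ?P = "%\<xi>. of_real ?H * (\<Sum>x\<in>X. f x * exp (- (\<i> * of_real (x \<bullet> \<xi>))))"
  define b where "b = ?H * (\<Sum>x\<in>X. norm (f x))"
  have s: "norm (\<Sum>x\<in>X. f x * exp (- (\<i> * of_real (x \<bullet> \<xi>)))) <= (\<Sum>x\<in>X. norm (f x))" for \<xi>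
   by (rule order_trans[OF norm_sum]) (simp add: norm_mult)
  have b: "norm (?P \<xi>) <= b" for \<xi>
   unfolding b_def norm_mult norm_of_real abs_of_pos[OF H] by (rule mult_left_mono[OF s]) (use H in simp)
  have i1: "integrable lborel (indicator (torus h) :: real^'n => real)"
   by (intro integrable_real_indicator) (auto simp: torus_def emeasure_lborel_cbox_eq)
  have i2: "integrable lborel (%\<xi>. indicator (torus h) \<xi> *\<^sub>R (norm (g \<xi>))\<^sup>2)" using g by (simp add: is_L2_fourier_def set_integrable_def)
  have "integrable lborel (%\<xi>. 2 * (indicator (torus h) \<xi> *\<^sub>R (norm (g \<xi>))\<^sup>2) + indicator (torus h) \<xi> * (2 * b\<^sup>2))"
   by (intro Bochner_Integration.integrable_add integrable_mult_right integrable_mult_left i1 i2)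
  then show "integrable lborel (%\<xi>. indicator (torus h) \<xi> *\<^sub>R (2 * (norm (g \<xi>))\<^sup>2 + 2 * b\<^sup>2))" by (simp add: algebra_simps)
  have gm: "(%\<xi>. indicator (torus h) \<xi> *\<^sub>R g \<xi>) : borel_measurable lborel" using g by (simp add: is_L2_fourier_def set_borel_measurable_def)
  have eE: "indicator (torus h) \<xi> *\<^sub>R E X \<xi> = indicator (torus h) \<xi> *\<^sub>R (norm (indicator (torus h) \<xi> *\<^sub>R g \<xi> - ?P \<xi>))\<^sup>2" for \<xi>
   by (cases "\<xi> : torus h") (auto simp: E_def)
  show "(%\<xi>. indicator (torus h) \<xi> *\<^sub>R E X \<xi>) : borel_measurable lborel" unfolding eE using gm by measurable
  have Eb: "E X \<xi> <= 2 * (norm (g \<xi>))\<^sup>2 + 2 * b\<^sup>2" for \<xi>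
   using norm_diff_square[of "g \<xi>" "?P \<xi>"] power_mono[OF b[of \<xi>] norm_ge_zero, of 2] unfolding E_def by linarith
  show "AE \<xi> in lborel. norm (indicator (torus h) \<xi> *\<^sub>R E X \<xi>) <= norm (indicator (torus h) \<xi> *\<^sub>R (2 * (norm (g \<xi>))\<^sup>2 + 2 * b\<^sup>2))"
  proof (rule AE_I2)
   fix \<xi>
   have "0 <= E X \<xi>" by (simp add: E_def)
   then have "norm (E X \<xi>) <= norm (2 * (norm (g \<xi>))\<^sup>2 + 2 * b\<^sup>2)" unfolding real_norm_def using Eb[of \<xi>] by linarith
   then show "norm (indicator (torus h) \<xi> *\<^sub>R E X \<xi>) <= norm (indicator (torus h) \<xi> *\<^sub>R (2 * (norm (g \<xi>))\<^sup>2 + 2 * b\<^sup>2))"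
    unfolding norm_scaleR by (rule mult_left_mono) simp
  qed
 qed
 have EN: "E (?i ` N) ((1 / h) *\<^sub>R \<eta>) = (norm (G \<eta> - of_real ?H * S N \<eta>))\<^sup>2" for N \<eta>
  using h unfolding E_def grid_trig[OF h] G_def S_def F_def by simp
 have EI: "(LINT \<xi>:torus h|lborel. E (?i ` N) \<xi>) = (1 / ?H) * I N" "integrable TM (%\<eta>. (norm (G \<eta> - of_real ?H * S N \<eta>))\<^sup>2)" for N
  using torus_TM[OF h Ei[of "?i ` N"]] unfolding EN I_def by auto
 have "((%X. LINT \<xi>:torus h|lborel. E X \<xi>) \<longlongrightarrow> 0) (finite_subsets_at_top (grid h))" using g by (simp add: is_L2_fourier_def E_def)
 then have "((%N. LINT \<xi>:torus h|lborel. E (?i ` N) \<xi>) \<longlongrightarrow> 0) (finite_subsets_at_top UNIV)"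
  unfolding grid_eq[OF h] filtermap_image_finite_subsets_at_top[OF grid_inj[OF h], symmetric] by (simp add: filterlim_filtermap)
 then have "((%N. ?H * ((1 / ?H) * I N)) \<longlongrightarrow> ?H * 0) (finite_subsets_at_top UNIV)" unfolding EI(1) by (rule tendsto_mult_left)
 then have I0: "(I \<longlongrightarrow> 0) (finite_subsets_at_top UNIV)" using h by simp
 define L where "L = ker (%\<eta>. \<mu> \<eta> * G \<eta>) n"
 define T where "T N = of_real ?H * (\<Sum>y\<in>N. ker \<mu> (n - y) * F y)" for N
 have GI: "integrable TM (%\<eta>. \<mu> \<eta> * G \<eta>)" using torus_TM(1)[OF h mg] by (simp add: \<mu>_def G_def)
 define v where "v = measure TM (space TM :: (real^'n) set)"
 have v0: "0 <= v" by (simp add: v_def)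
 have bound: "norm (L - T N) <= (K / ?c) * (\<delta> * v + I N / \<delta>)" if N: "finite N" and d: "0 < \<delta>" for N \<delta>
 proof -
  define FN where "FN k = (if k : N then F k else 0)" for k
  have FN: "!!k. k \<notin> N ==> FN k = 0" by (simp add: FN_def)
  have "wien (%\<eta>. \<Sum>k\<in>N. FN k * chr k \<eta>) FN" by (rule wien_fsupp[OF N FN])
  moreover have "(%\<eta>. \<Sum>k\<in>N. FN k * chr k \<eta>) = S N" by (simp add: S_def fun_eq_iff FN_def)
  ultimately have wS: "wien (S N) FN" by simp
  have w: "wien (%\<eta>. of_real ?H * (\<mu> \<eta> * S N \<eta>)) (%k. of_real ?H * conv (ker \<mu>) FN k)" by (rule wien_cmult[OF wien_mult[OF W\<mu> wS]])
  have "conv (ker \<mu>) FN n = (\<Sum>y\<in>N. ker \<mu> (n - y) * F y)"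
   by (subst conv_fsupp[OF N FN]) (auto simp: FN_def)
  then have TN: "ker (%\<eta>. of_real ?H * (\<mu> \<eta> * S N \<eta>)) n = T N" using wien_coeff[OF w] by (simp add: T_def)
  have SI: "integrable TM (%\<eta>. of_real ?H * (\<mu> \<eta> * S N \<eta>))" by (rule W_integrable[OF wien_imp_W[OF w]])
  have "of_real ?c * (L - T N) = (\<integral>\<eta>. \<mu> \<eta> * G \<eta> * chr (- n) \<eta> \<partial>TM) - (\<integral>\<eta>. of_real ?H * (\<mu> \<eta> * S N \<eta>) * chr (- n) \<eta> \<partial>TM)"
  proof -
   have cc: "complex_of_real ?c ~= 0" using less_imp_neq[OF c] by (simp only: of_real_eq_0_iff not_sym)
   show ?thesis unfolding L_def TN[symmetric] ker_def
    by (simp only: diff_divide_distrib[symmetric] times_divide_eq_right nonzero_mult_div_cancel_left[OF cc])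
  qed
  also have "... = (\<integral>\<eta>. \<mu> \<eta> * (G \<eta> - of_real ?H * S N \<eta>) * chr (- n) \<eta> \<partial>TM)"
   by (subst Bochner_Integration.integral_diff[symmetric, OF integrable_TM_chr[OF GI] integrable_TM_chr[OF SI]])
    (rule Bochner_Integration.integral_cong, simp_all add: algebra_simps)
  finally have e: "of_real ?c * (L - T N) = (\<integral>\<eta>. \<mu> \<eta> * (G \<eta> - of_real ?H * S N \<eta>) * chr (- n) \<eta> \<partial>TM)" .
  have "norm (of_real ?c * (L - T N)) <= (\<integral>\<eta>. K * (\<delta> + (1 / \<delta>) * (norm (G \<eta> - of_real ?H * S N \<eta>))\<^sup>2) \<partial>TM)"
   unfolding e
  proof (rule order_trans[OF Bochner_Integration.integral_norm_bound], rule Bochner_Integration.integral_mono)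
   have "integrable TM (%\<eta>. \<mu> \<eta> * G \<eta> * chr (- n) \<eta> - of_real ?H * (\<mu> \<eta> * S N \<eta>) * chr (- n) \<eta>)"
    by (intro Bochner_Integration.integrable_diff integrable_TM_chr GI SI)
   then have "integrable TM (%\<eta>. \<mu> \<eta> * (G \<eta> - of_real ?H * S N \<eta>) * chr (- n) \<eta>)" by (simp add: algebra_simps)
   then show "integrable TM (%\<eta>. norm (\<mu> \<eta> * (G \<eta> - of_real ?H * S N \<eta>) * chr (- n) \<eta>))" by (rule integrable_norm)
   show "integrable TM (%\<eta>. K * (\<delta> + (1 / \<delta>) * (norm (G \<eta> - of_real ?H * S N \<eta>))\<^sup>2))"
    by (intro integrable_mult_right Bochner_Integration.integrable_add EI(2)) simp
   fix \<eta> :: "real^'n" assume \<eta>: "\<eta> : space TM"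
   have pt: "x <= \<delta> + (1 / \<delta>) * x\<^sup>2" if "0 <= x" for x
   proof (cases "x <= \<delta>")
    case True then show ?thesis using d by (simp add: add_increasing2)
   next
    case False
    then have "x * \<delta> <= x * x" using that by (intro mult_left_mono) auto
    then have "x <= (1 / \<delta>) * x\<^sup>2" using d by (simp add: field_simps power2_eq_square)
    then show ?thesis using d by simp
   qed
   show "norm (\<mu> \<eta> * (G \<eta> - of_real ?H * S N \<eta>) * chr (- n) \<eta>) <= K * (\<delta> + (1 / \<delta>) * (norm (G \<eta> - of_real ?H * S N \<eta>))\<^sup>2)"
    unfolding norm_mult chr_simps(2) mult_1_right using \<eta> K0 by (intro mult_mono K pt) auto
  qed
  also have "... = K * (\<delta> * v + I N / \<delta>)"
  proof -
   have "(\<integral>\<eta>. \<delta> + (1 / \<delta>) * (norm (G \<eta> - of_real ?H * S N \<eta>))\<^sup>2 \<partial>TM) = (\<integral>\<eta>. \<delta> \<partial>(TM :: (real^'n) measure)) + (1 / \<delta>) * I N"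
   proof -
    have i1: "integrable TM (%\<eta>::real^'n. \<delta>)" by simp
    have i2: "integrable TM (%\<eta>. (1 / \<delta>) * (norm (G \<eta> - of_real ?H * S N \<eta>))\<^sup>2)"
     by (rule integrable_mult_right) (rule EI(2))
    show ?thesis unfolding I_def Bochner_Integration.integral_add[OF i1 i2] by (simp only: integral_mult_right_zero)
   qed
   also have "(\<integral>\<eta>. \<delta> \<partial>(TM :: (real^'n) measure)) = \<delta> * v" by (simp add: v_def)
   finally show ?thesis by (simp only: integral_mult_right_zero) simp
  qed
  finally have "norm (of_real ?c * (L - T N)) <= K * (\<delta> * v + I N / \<delta>)" .
  then have "?c * norm (L - T N) <= K * (\<delta> * v + I N / \<delta>)" unfolding norm_mult norm_of_real abs_of_pos[OF c] .
  then show ?thesis using c by (simp add: pos_le_divide_eq mult.commute)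
 qed
 have "(T \<longlongrightarrow> L) (finite_subsets_at_top UNIV)"
 proof (rule tendstoI)
  fix e :: real assume e: "0 < e"
  define \<kappa> where "\<kappa> = K / ?c + 1"
  have \<kappa>: "0 < \<kappa>" "K / ?c <= \<kappa>" using K0 c by (auto simp: \<kappa>_def add_nonneg_pos)
  define \<delta> where "\<delta> = e / (2 * \<kappa> * (v + 1))"
  have d: "0 < \<delta>" using e \<kappa> v0 by (simp add: \<delta>_def)
  have dv: "\<kappa> * (\<delta> * v) <= e / 2"
  proof -
   have "\<kappa> * (\<delta> * v) <= \<kappa> * (\<delta> * (v + 1))" using \<kappa> d by simp
   also have "... = e / 2"
   proof -
    have "\<kappa> * (e / (2 * \<kappa> * w) * w) = e / 2" if "0 < w" for w using that \<kappa>(1) by (simp add: field_simps)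
    moreover have "0 < v + 1" using v0 by simp
    ultimately show ?thesis unfolding \<delta>_def by blast
   qed
   finally show ?thesis .
  qed
  have "0 < e * \<delta> / (2 * \<kappa>)" using e d \<kappa> by simp
  then have ev: "\<forall>\<^sub>F N in finite_subsets_at_top UNIV. I N < e * \<delta> / (2 * \<kappa>)" using I0 by (intro order_tendstoD(2)) auto
  have fin: "\<forall>\<^sub>F N in finite_subsets_at_top (UNIV :: (int^'n) set). finite N"
   by (rule eventually_finite_subsets_at_top_weakI)
  show "\<forall>\<^sub>F N in finite_subsets_at_top UNIV. dist (T N) L < e"
   using ev fin
  proof eventually_elim
   case (elim N)
   note N = elim
   have I0: "0 <= I N" unfolding I_def by (rule integral_nonneg_AE) simp
   have "norm (L - T N) <= (K / ?c) * (\<delta> * v + I N / \<delta>)" by (rule bound[OF N(2) d])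
   also have "... <= \<kappa> * (\<delta> * v + I N / \<delta>)" using \<kappa> d v0 I0 by (intro mult_right_mono) auto
   also have "... = \<kappa> * (\<delta> * v) + \<kappa> * (I N / \<delta>)" by (rule distrib_left)
   also have "\<kappa> * (I N / \<delta>) < e / 2" using N(1) \<kappa> d by (simp add: field_simps)
   finally show "dist (T N) L < e" using dv by (simp add: dist_norm norm_minus_commute)
  qed
 qed
 note T1 = this
 have T2: "(T \<longlongrightarrow> of_real ?H * conv (ker \<mu>) F n) (finite_subsets_at_top UNIV)"
 proof -
  let ?a = "%y. ker \<mu> (n - y) * F y"
  have "integrable cs ?a" by (rule conv_integrand[OF wienD(1)[OF W\<mu>]]) (use bd in \<open>simp add: F_def\<close>)
  then have "?a summable_on UNIV" by (simp add: cs_summable)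
  then have "(sum ?a \<longlongrightarrow> infsum ?a UNIV) (finite_subsets_at_top UNIV)" using has_sum_infsum has_sum_def by blast
  moreover have "infsum ?a UNIV = conv (ker \<mu>) F n" unfolding conv_def by (rule cs_infsum)
  ultimately have "(sum ?a \<longlongrightarrow> conv (ker \<mu>) F n) (finite_subsets_at_top UNIV)" by (simp only:)
  then show ?thesis unfolding T_def[abs_def] by (rule tendsto_mult_left)
 qed
 have "L = of_real ?H * conv (ker \<mu>) F n" by (rule tendsto_unique[OF _ T1 T2]) simp
 then show ?thesis using h by (simp add: L_def \<mu>_def[abs_def] G_def[abs_def] F_def[abs_def])
qed

section \<open>First order operators\<close>

lemma conv_cmult_left: "conv (%n. c * K n) f n = c * conv K f n"
 unfolding conv_def by (simp add: mult.assoc)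

text \<open>
  Convolution with the kernel of \<open>\<bar>\<xi>\<bar>\<close> describes the operator in every case: by definition, through
  an absolutely convergent transform, or through the transform in the mean.
\<close>

lemma nabla_one:
 fixes f :: "real^'n => complex"
 assumes h: "0 < h" and bd: "!!n. norm (f (h *\<^sub>R emb n)) <= R"
 shows "nabla_pow h 1 f (h *\<^sub>R emb n) = conv (ker (%\<xi>. of_real (norm \<xi>))) (%n. of_real (1 / h) * f (h *\<^sub>R emb n)) n"
proof -
 let ?m = "psym (%\<eta>. (norm \<eta>)\<^sup>2) (1 / 2) h :: real^'n => complex"
 define F where "F n = f (h *\<^sub>R emb n)" for n
 let ?M = "%\<eta>. ?m ((1 / h) *\<^sub>R \<eta>)"
 have M: "W ?M" by (rule sym_W(2)[OF h]) simp
 have mi: "set_integrable lborel (torus h) ?m" by (rule sym_integrable[OF h]) auto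
 have Meq: "?M = (%\<eta>. of_real (1 / h) * of_real (norm \<eta>))"
  using h by (simp add: psym_def fun_eq_iff powr_half_sqrt real_sqrt_divide)
 have "ker ?M = (%n. of_real (1 / h) * ker (%\<xi>. of_real (norm \<xi>)) n)" unfolding Meq by (rule wien_coeff[OF wien_cmult[OF W_norm]])
 then have res: "conv (ker ?M) F n = conv (ker (%\<xi>. of_real (norm \<xi>))) (%n. of_real (1 / h) * F n) n"
  by (simp only: conv_cmult conv_cmult_left)
 have "fourier_multiplier h ?m f (h *\<^sub>R emb n) = conv (ker ?M) F n"
 proof (cases "f : Lp_space h 2 & set_integrable lborel (torus h) (%\<xi>. ?m \<xi> * lattice_fourier h f \<xi>)")
  case False
  show ?thesis unfolding F_def by (rule multiplier_convolution[OF h False mi])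
 next
  case True
  note T = multiplier_transform[OF h conjunct1[OF True] conjunct2[OF True], of n]
  show ?thesis
  proof (cases "f : Lp_space h 1")
   case False
   then have "lattice_fourier h f = (SOME g. is_L2_fourier h f g)" by (simp add: lattice_fourier_def)
   then have "is_L2_fourier h f (lattice_fourier h f)" using someI_ex[OF fourier_exists[OF h conjunct1[OF True]]] by simp
   from L2_fourier_multiplier[OF h this M conjunct2[OF True] bd, of n] T show ?thesis unfolding F_def by simp
  next
   case f1: True
   have "Np 1 F < \<infinity>" using f1 Lp_space_lattice[OF h, of 1 f] by (simp add: F_def[abs_def])
   then have Fi: "integrable cs F" by (simp add: integrable_cs_iff Np_def)
   define Fh where "Fh \<eta> = (\<integral>n. F n * chr n \<eta> \<partial>cs)" for \<eta> :: "real^'n"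
   have wF: "wien Fh F" using Fi by (simp add: wien_def Fh_def)
   have "lattice_fourier h f ((1 / h) *\<^sub>R \<eta>) = of_real (h ^ CARD('n)) * Fh \<eta>" for \<eta>
   proof -
    let ?u = "%x. f x * exp (- (\<i> * of_real (x \<bullet> ((1 / h) *\<^sub>R \<eta>))))"
    have "exp (- (\<i> * of_real ((h *\<^sub>R emb n) \<bullet> ((1 / h) *\<^sub>R \<eta>)))) = chr n \<eta>" for n :: "int^'n" using h by (simp add: chr_def cis_conv_exp)
    then have "?u \<circ> (%n. h *\<^sub>R emb n) = (%n. F n * chr n \<eta>)" by (simp only: o_def F_def)
    then have "infsum ?u (grid h) = Fh \<eta>" unfolding grid_eq[OF h] infsum_reindex[OF grid_inj[OF h]] Fh_def by (simp only: cs_infsum)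
    then show ?thesis using f1 by (simp add: lattice_fourier_def)
   qed
   then have "(%\<eta>. ?m ((1 / h) *\<^sub>R \<eta>) * lattice_fourier h f ((1 / h) *\<^sub>R \<eta>)) = (%\<eta>. of_real (h ^ CARD('n)) * (?M \<eta> * Fh \<eta>))"
    by (simp only: mult.left_commute)
   then have "ker (%\<eta>. ?m ((1 / h) *\<^sub>R \<eta>) * lattice_fourier h f ((1 / h) *\<^sub>R \<eta>)) n = of_real (h ^ CARD('n)) * conv (ker ?M) F n"
    by (simp only: wien_coeff[OF wien_cmult[OF wien_mult[OF M wF]]])
   then show ?thesis unfolding T using h by simp
  qed
 qed
 then show ?thesis unfolding nabla_pow_sym[OF h] res F_def .
qed

lemma conv_fd: "conv (ker (fd j)) F n = F (n + axis j 1) - F n" for F :: "int^'n => complex"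
proof -
 have "fd j = (%\<xi>::real^'n. chr (axis j (- 1)) \<xi> + (- 1) * chr 0 \<xi>)" by (simp add: fd_chr)
 then have k: "ker (fd j :: real^'n => complex) = (%n. (if n = axis j (- 1) then 1 else 0) + (- 1) * (if n = 0 then 1 else 0))"
  by (simp only: wien_coeff[OF wien_add[OF wien_chr wien_cmult[OF wien_chr]]])
 have "conv (ker (fd j)) F n = (\<integral>y. (if y = n + axis j 1 then F (n + axis j 1) else 0) - (if y = n then F n else 0) \<partial>cs)"
  unfolding conv_def k
 proof (intro Bochner_Integration.integral_cong refl)
  fix y
  have "n - y = axis j (- 1) \<longleftrightarrow> y = n + axis j 1" by (auto simp: vec_eq_iff axis_def algebra_simps)
  moreover have "n - y = 0 \<longleftrightarrow> y = n" by auto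
  ultimately show "((if n - y = axis j (- 1) then 1 else 0) + - 1 * (if n - y = 0 then 1 else 0)) * F y
   = (if y = n + axis j 1 then F (n + axis j 1) else 0) - (if y = n then F n else 0)" by simp
 qed
 also have "... = F (n + axis j 1) - F n"
  by (subst Bochner_Integration.integral_diff) (simp_all add: integral_cs_single)
 finally show ?thesis .
qed

lemma fwd_diff_lattice:
 assumes "0 < h"
 shows "fwd_diff h j f (h *\<^sub>R emb n) = conv (ker (fd j)) (%n. of_real (1 / h) * f (h *\<^sub>R emb n)) n"
proof -
 have "emb (axis j 1) = axis j (1 :: real)" by (simp add: vec_eq_iff axis_def)
 then have "h *\<^sub>R emb n + h *\<^sub>R axis j 1 = h *\<^sub>R emb (n + axis j 1)" by (simp add: scaleR_add_right)
 then show ?thesis by (simp add: fwd_diff_def conv_fd diff_divide_distrib)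
qed

lemma inverse_bound:
 assumes "X <= ennreal c * Y" "0 < c" "c <= C" shows "ennreal (inverse C) * X <= Y"
proof -
 have "ennreal (inverse C) * X <= ennreal (inverse C) * (ennreal C * Y)"
  using assms by (intro mult_left_mono order_trans[OF assms(1)] mult_right_mono ennreal_leI) auto
 also have "... = Y" using assms by (simp add: mult.assoc[symmetric] ennreal_mult[symmetric])
 finally show ?thesis .
qed

theorem proposition1p2:
  fixes p :: real
  assumes "1 < p"
  shows "(\<forall>s::real. \<exists>C::real. C \<ge> 1 \<and>
            (\<forall>h::real. 0 < h \<and> h \<le> 1 \<longrightarrow>
              (\<forall>f \<in> (admissible h s p :: (real ^ 'n \<Rightarrow> complex) set).
                 ennreal (inverse C) * Lp_norm h p (neg_laplacian_pow h (s / 2) f)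
                   \<le> sobolev_norm h s p f \<and>
                 sobolev_norm h s p f
                   \<le> ennreal C * Lp_norm h p (neg_laplacian_pow h (s / 2) f))))
       \<and> (\<exists>C::real. C \<ge> 1 \<and>
            (\<forall>h::real. 0 < h \<and> h \<le> 1 \<longrightarrow>
              (\<forall>f \<in> (Lp_space h p :: (real ^ 'n \<Rightarrow> complex) set).
                 ennreal (inverse C) * (\<Sum>j\<in>UNIV. Lp_norm h p (fwd_diff h j f))
                   \<le> sobolev_norm h 1 p f \<and>
                 sobolev_norm h 1 p f
                   \<le> ennreal C * (\<Sum>j\<in>UNIV. Lp_norm h p (fwd_diff h j f)))))"
proof (intro conjI allI)
  have p: "0 < p" using assms by simp
  have scale: "ennreal H * X \<le> ennreal c * (ennreal H * Y)" if "X \<le> ennreal c * Y" for H c X Y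
    using mult_left_mono[OF that, of "ennreal H"] by (simp add: mult.left_commute)
  have up: "X \<le> ennreal C * Y" if "X \<le> ennreal c * Y" "c \<le> C" for X Y c C
    using that by (meson ennreal_leI mult_right_mono order_trans zero_le)
  {
    fix s :: real
    obtain a where a: "0 < a" "\<And>g. lpn p (conv (ker (ratio (s / 2) :: real^'n \<Rightarrow> complex)) g) \<le> ennreal a * lpn p g"
      using W_mult_lp[of "ratio (s / 2) :: real^'n \<Rightarrow> complex", OF W_ratio] assms by blast
    obtain b where b: "0 < b" "\<And>g. lpn p (conv (ker (ratio (- (s / 2)) :: real^'n \<Rightarrow> complex)) g) \<le> ennreal b * lpn p g"
      using W_mult_lp[of "ratio (- (s / 2)) :: real^'n \<Rightarrow> complex", OF W_ratio] assms by blast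
    define C where "C = 1 + a + b"
    have C: "1 \<le> C" "a \<le> C" "b \<le> C" using a b by (auto simp: C_def)
    show "\<exists>C::real. C \<ge> 1 \<and>
            (\<forall>h::real. 0 < h \<and> h \<le> 1 \<longrightarrow>
              (\<forall>f \<in> (admissible h s p :: (real ^ 'n \<Rightarrow> complex) set).
                 ennreal (inverse C) * Lp_norm h p (neg_laplacian_pow h (s / 2) f)
                   \<le> sobolev_norm h s p f \<and>
                 sobolev_norm h s p f
                   \<le> ennreal C * Lp_norm h p (neg_laplacian_pow h (s / 2) f)))"
    proof (intro exI[of _ C] conjI[OF C(1)] allI impI ballI)
      fix h :: real and f :: "real^'n \<Rightarrow> complex" assume h: "0 < h \<and> h \<le> 1" and f: "f \<in> admissible h s p"
      then have h0: "0 < h" by simp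
      note P = powers_comparable[OF h0 assms f]
      have "lpn p (\<lambda>n. nabla_pow h s f (h *\<^sub>R emb n)) \<le> ennreal a * lpn p (\<lambda>n. neg_laplacian_pow h (s / 2) f (h *\<^sub>R emb n))"
        by (subst P(1)) (rule a(2))
      then have 1: "sobolev_norm h s p f \<le> ennreal a * Lp_norm h p (neg_laplacian_pow h (s / 2) f)"
        unfolding sobolev_norm_def Lp_norm_lattice[OF h0 p] by (rule scale)
      have "lpn p (\<lambda>n. neg_laplacian_pow h (s / 2) f (h *\<^sub>R emb n)) \<le> ennreal b * lpn p (\<lambda>n. nabla_pow h s f (h *\<^sub>R emb n))"
        by (subst P(2)) (rule b(2))
      then have 2: "Lp_norm h p (neg_laplacian_pow h (s / 2) f) \<le> ennreal b * sobolev_norm h s p f"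
        unfolding sobolev_norm_def Lp_norm_lattice[OF h0 p] by (rule scale)
      show "ennreal (inverse C) * Lp_norm h p (neg_laplacian_pow h (s / 2) f) \<le> sobolev_norm h s p f \<and>
        sobolev_norm h s p f \<le> ennreal C * Lp_norm h p (neg_laplacian_pow h (s / 2) f)"
        using inverse_bound[OF 2 b(1) C(3)] up[OF 1 C(2)] by blast
    qed
  }
  obtain c where c: "0 < c" "\<And>g :: int^'n \<Rightarrow> complex. Np p g < \<infinity> \<Longrightarrow>
    (\<Sum>j\<in>UNIV. lpn p (conv (ker (fd j)) g)) \<le> ennreal c * lpn p (conv (ker (\<lambda>\<xi>. of_real (norm \<xi>))) g) \<and>
    lpn p (conv (ker (\<lambda>\<xi>. of_real (norm \<xi>))) g) \<le> ennreal c * (\<Sum>j\<in>UNIV. lpn p (conv (ker (fd j)) g))"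
    using gradient_vs_norm[OF assms, where 'n = 'n] by blast
  define C where "C = 1 + c"
  have C: "1 \<le> C" "c \<le> C" using c by (auto simp: C_def)
  show "\<exists>C::real. C \<ge> 1 \<and>
            (\<forall>h::real. 0 < h \<and> h \<le> 1 \<longrightarrow>
              (\<forall>f \<in> (Lp_space h p :: (real ^ 'n \<Rightarrow> complex) set).
                 ennreal (inverse C) * (\<Sum>j\<in>UNIV. Lp_norm h p (fwd_diff h j f))
                   \<le> sobolev_norm h 1 p f \<and>
                 sobolev_norm h 1 p f
                   \<le> ennreal C * (\<Sum>j\<in>UNIV. Lp_norm h p (fwd_diff h j f))))"
  proof (intro exI[of _ C] conjI[OF C(1)] allI impI ballI)
    fix h :: real and f :: "real^'n \<Rightarrow> complex" assume "0 < h \<and> h \<le> 1" and f: "f \<in> Lp_space h p"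
    then have h: "0 < h" by simp
    define g where "g n = of_real (1 / h) * f (h *\<^sub>R emb n)" for n
    have F: "Np p (\<lambda>n. f (h *\<^sub>R emb n)) < \<infinity>" using f Lp_space_lattice[OF h p, of f] by simp
    then obtain R where R: "\<And>n. norm (f (h *\<^sub>R emb n)) \<le> R" using lp_imp_bounded[of "\<lambda>n. f (h *\<^sub>R emb n)" p] p unfolding Np_def by auto
    have gp: "ennreal (norm (g n) powr p) = ennreal ((1 / h) powr p) * ennreal (norm (f (h *\<^sub>R emb n)) powr p)" for n
    proof -
      have m: "norm (g n) = (1 / h) * norm (f (h *\<^sub>R emb n))" using h by (simp add: g_def norm_mult norm_divide)
      have q: "norm (g n) powr p = (1 / h) powr p * norm (f (h *\<^sub>R emb n)) powr p" unfolding m by (rule powr_mult)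
      show ?thesis unfolding q by (rule ennreal_mult) auto
    qed
    have "Np p g = ennreal ((1 / h) powr p) * Np p (\<lambda>n. f (h *\<^sub>R emb n))"
      unfolding Np_def gp by (rule nn_integral_cmult) simp
    then have "Np p g < \<infinity>" using F by (simp add: ennreal_mult_less_top)
    note G = c(2)[OF this]
    let ?H = "ennreal (h powr (CARD('n) / p))"
    have n: "(\<lambda>n. nabla_pow h 1 f (h *\<^sub>R emb n)) = conv (ker (\<lambda>\<xi>. of_real (norm \<xi>))) g"
      unfolding g_def[abs_def] by (rule ext, rule nabla_one[where f = f and R = R], rule h, rule R)
    have 1: "sobolev_norm h 1 p f = ?H * lpn p (conv (ker (\<lambda>\<xi>. of_real (norm \<xi>))) g)"
      unfolding sobolev_norm_def Lp_norm_lattice[OF h p] n ..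
    have fw: "(\<lambda>n. fwd_diff h j f (h *\<^sub>R emb n)) = conv (ker (fd j)) g" for j
      unfolding g_def[abs_def] by (rule ext) (rule fwd_diff_lattice[OF h])
    have 2: "(\<Sum>j\<in>UNIV. Lp_norm h p (fwd_diff h j f)) = ?H * (\<Sum>j\<in>UNIV. lpn p (conv (ker (fd j)) g))"
      unfolding Lp_norm_lattice[OF h p] fw by (rule sum_distrib_left[symmetric])
    have 3: "(\<Sum>j\<in>UNIV. Lp_norm h p (fwd_diff h j f)) \<le> ennreal c * sobolev_norm h 1 p f"
      unfolding 1 2 by (rule scale) (use G in blast)
    have 4: "sobolev_norm h 1 p f \<le> ennreal c * (\<Sum>j\<in>UNIV. Lp_norm h p (fwd_diff h j f))"
      unfolding 1 2 by (rule scale) (use G in blast)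
    show "ennreal (inverse C) * (\<Sum>j\<in>UNIV. Lp_norm h p (fwd_diff h j f)) \<le> sobolev_norm h 1 p f \<and>
      sobolev_norm h 1 p f \<le> ennreal C * (\<Sum>j\<in>UNIV. Lp_norm h p (fwd_diff h j f))"
      using inverse_bound[OF 3 c(1) C(2)] up[OF 4 C(2)] by blast
  qed
qed

end
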